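(* Assume the following. (1) The rows of $\mathbf{Z}$ are i.i.d. real or complex random vectors, either standard normal distributed, or distributed as $\sqrt{M}\,\mathbf{u}$ where $\mathbf{u}$ is uniformly (Haar) distributed on the unit sphere in $\mathbb{R}^M$ or $\mathbb{C}^M$. (2) $\mathbf{C}_N=\mathrm{diag}(c_1,\dots,c_N)$ with $c_n\ge0$ (the $c_n$ may depend on $N$), and there exist constants $C>0$, $\kappa>0$ such that $\frac1N\mathrm{tr}\,\mathbf{C}_N^2\le C$ and $\|\mathbf{C}_N\|\le\kappa\log M$. (3) The spectral density $f\in L^1(-\pi,\pi)$ of $\mathbf{R}_M$ is positive and is bounded on $[-\pi,\pi]\setminus(-\delta,\delta)$ for every $\delta>0$. (4) $\operatorname{ess\,inf}_{\theta\in(-\pi,\pi)}f(\theta)>0$. (5) $f$ is even and $f(x)=L(|x|^{-1})/|x|^a$ for $x\in[-\pi,\pi]\setminus\{0\}$, where $a\in(0,1)$ and $L$, defined on $[\pi^{-1},\infty)$, is slowly varying at $\infty$. Assume moreover that $\xi_N$ is bounded below by a positive constant. Then as $M,N\to\infty$ with $N\asymp M$, almost surely $$\left\|\hat{\mathbf{R}}_M^{1/2}\mathbf{R}_M^{-1/2}-\sqrt{\xi_N}\,\mathbf{I}\right\|\to0.$$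
   Context: For integers $M,N\ge1$, let $\mathbf{X}=\mathbf{C}_N^{1/2}\mathbf{Z}\mathbf{R}_M^{1/2}$, where $\mathbf{C}_N$ is an $N\times N$ deterministic matrix, $\mathbf{Z}$ is an $N\times M$ random matrix (all random matrices being defined on a common probability space), and $\mathbf{R}_M=(r_{i-j})_{i,j=1}^M$ is the Toeplitz matrix with spectral density $f$, i.e. $r_k=\frac{1}{2\pi}\int_{-\pi}^{\pi}f(x)e^{-\mathbf{i}kx}\,dx$. Put $\xi_N=\frac1N\mathrm{tr}\,\mathbf{C}_N$. Let $S_{i,j}$ denote the entries of the $M\times M$ matrix $\frac1N\mathbf{X}^*\mathbf{X}$, and define $$\hat r_k=\frac{1}{M-|k|}\sum_i S_{i+k,i}\,\mathbf{1}_{\{1\le i,\ i+k\le M\}}\quad(|k|\le M-1),$$ where the sum is over $i$ with both $1\le i\le M$ and $1\le i+k\le M$, and $\hat{\mathbf{R}}_M=(\hat r_{i-j})_{1\le i,j\le M}$, a Hermitian matrix. $\hat{\mathbf{R}}_M^{1/2}$ is the positive semi-definite square root of $\hat{\mathbf{R}}_M$; the assertion is understood to include that almost surely it is defined (i.e. $\hat{\mathbf{R}}_M$ is positive semi-definite) for all large enough $M$. $\|\cdot\|$ is the operator (spectral) norm. $N\asymp M$ means that $K_1M\le N\le K_2M$ for some constants $0<K_1<K_2$. *)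

theory Defs
  imports "HOL-Probability.Probability" "Jordan_Normal_Form.Schur_Decomposition"
begin

section \<open>Matrices\<close>

text \<open>Matrices are complex throughout; rows and columns are numbered from 0.\<close>

definition mtrace :: "complex Matrix.mat \<Rightarrow> complex" where
  "mtrace A = (\<Sum>i<dim_row A. A $$ (i, i))"

definition vec_l2 :: "complex Matrix.vec \<Rightarrow> real" where
  "vec_l2 v = L2_set (\<lambda>i. cmod (vec_index v i)) {..<dim_vec v}"

definition op_norm :: "complex Matrix.mat \<Rightarrow> real" where
  "op_norm A = (SUP v \<in> {v \<in> carrier_vec (dim_col A). vec_l2 v \<le> 1}. vec_l2 (A *\<^sub>v v))"

definition psd :: "complex Matrix.mat \<Rightarrow> bool" where
  "psd A \<longleftrightarrow> square_mat A \<and> mat_adjoint A = A \<and>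
     (\<forall>v \<in> carrier_vec (dim_row A). 0 \<le> Re ((A *\<^sub>v v) \<bullet>c v))"

text \<open>Unspecified unless \<open>A\<close> is positive semi-definite.\<close>

definition psd_sqrt :: "complex Matrix.mat \<Rightarrow> complex Matrix.mat" where
  "psd_sqrt A = (THE B. psd B \<and> B * B = A)"

text \<open>\<open>A\<^sup>-\<^sup>1\<^sup>/\<^sup>2\<close>, for a positive definite \<open>A\<close>.\<close>

definition psd_inv_sqrt :: "complex Matrix.mat \<Rightarrow> complex Matrix.mat" where
  "psd_inv_sqrt A = the (mat_inverse (psd_sqrt A))"

definition toeplitz_mat :: "nat \<Rightarrow> (int \<Rightarrow> complex) \<Rightarrow> complex Matrix.mat" where
  "toeplitz_mat M r = Matrix.mat M M (\<lambda>(i, j). r (int i - int j))"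


section \<open>Spectral density\<close>

definition fourier_coeff :: "(real \<Rightarrow> real) \<Rightarrow> int \<Rightarrow> complex" where
  "fourier_coeff f k = 1 / (2 * of_real pi) *
     (LINT x:{-pi..pi}|lebesgue. of_real (f x) * exp (- \<i> * of_int k * of_real x))"

definition toeplitz_cov :: "(real \<Rightarrow> real) \<Rightarrow> nat \<Rightarrow> complex Matrix.mat" where
  "toeplitz_cov f M = toeplitz_mat M (fourier_coeff f)"

definition essinf :: "'a measure \<Rightarrow> ('a \<Rightarrow> ereal) \<Rightarrow> ereal" where
  "essinf M g = - esssup M (\<lambda>x. - g x)"

definition slowly_varying_on :: "real \<Rightarrow> (real \<Rightarrow> real) \<Rightarrow> bool" where
  "slowly_varying_on A L \<longleftrightarrow>
     L \<in> borel_measurable (lebesgue_on {A..}) \<and> (\<forall>x\<ge>A. 0 < L x) \<and>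
     (\<forall>t>0. ((\<lambda>x. L (t * x) / L x) \<longlongrightarrow> 1) at_top)"


section \<open>Random matrices with i.i.d. rows\<close>

text \<open>A random vector of length \<open>M\<close> takes its values in the following product space.\<close>

abbreviation vec_space :: "nat \<Rightarrow> (nat \<Rightarrow> complex) measure" where
  "vec_space M \<equiv> PiM {..<M} (\<lambda>_. borel)"

definition real_std_normal :: "complex measure" where
  "real_std_normal = distr std_normal_distribution borel complex_of_real"

text \<open>Normalised so that the expectation of the squared modulus is 1.\<close>

definition complex_std_normal :: "complex measure" where
  "complex_std_normal = distr (std_normal_distribution \<Otimes>\<^sub>M std_normal_distribution) borel
     (\<lambda>(x, y). Complex (x / sqrt 2) (y / sqrt 2))"

definition normal_law :: "complex measure \<Rightarrow> nat \<Rightarrow> (nat \<Rightarrow> complex) measure \<Rightarrow> bool" where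
  "normal_law \<nu> M \<mu> \<longleftrightarrow> \<mu> = PiM {..<M} (\<lambda>_. \<nu>)"

text \<open>The uniform (Haar) law on the unit sphere of \<open>K\<^sup>M\<close>, where \<open>K\<close> is \<open>\<real>\<close> or \<open>UNIV\<close>: the
  probability measure on the sphere that is invariant under the orthogonal (\<open>K = \<real>\<close>),
  respectively unitary (\<open>K = UNIV\<close>), group.\<close>

definition haar_sphere :: "complex set \<Rightarrow> nat \<Rightarrow> (nat \<Rightarrow> complex) measure \<Rightarrow> bool" where
  "haar_sphere K M \<mu> \<longleftrightarrow>
     prob_space \<mu> \<and> sets \<mu> = sets (vec_space M) \<and>
     (AE u in \<mu>. (\<forall>j<M. u j \<in> K) \<and> (\<Sum>j<M. (cmod (u j))\<^sup>2) = 1) \<and>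
     (\<forall>U \<in> carrier_mat M M. elements_mat U \<subseteq> K \<and> U * mat_adjoint U = 1\<^sub>m M \<longrightarrow>
        distr \<mu> (vec_space M) (\<lambda>u. \<lambda>i\<in>{..<M}. \<Sum>j<M. U $$ (i, j) * u j) = \<mu>)"

text \<open>The law of \<open>\<surd>M u\<close> with \<open>u\<close> uniform on the unit sphere.\<close>

definition sphere_law :: "complex set \<Rightarrow> nat \<Rightarrow> (nat \<Rightarrow> complex) measure \<Rightarrow> bool" where
  "sphere_law K M \<mu> \<longleftrightarrow> (\<exists>\<nu>. haar_sphere K M \<nu> \<and>
     \<mu> = distr \<nu> (vec_space M) (\<lambda>u. \<lambda>j\<in>{..<M}. of_real (sqrt (real M)) * u j))"

definition iid_rows ::
    "'w measure \<Rightarrow> nat \<Rightarrow> nat \<Rightarrow> ('w \<Rightarrow> complex Matrix.mat) \<Rightarrow> (nat \<Rightarrow> complex) measure \<Rightarrow> bool" where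
  "iid_rows \<Omega> N M Z \<mu> \<longleftrightarrow>
     (\<forall>\<omega> \<in> space \<Omega>. Z \<omega> \<in> carrier_mat N M) \<and>
     prob_space.indep_vars \<Omega> (\<lambda>_. vec_space M) (\<lambda>i \<omega>. \<lambda>j\<in>{..<M}. Z \<omega> $$ (i, j)) {..<N} \<and>
     (\<forall>i<N. distr \<Omega> (vec_space M) (\<lambda>\<omega>. \<lambda>j\<in>{..<M}. Z \<omega> $$ (i, j)) = \<mu>)"


section \<open>The unbiased Toeplitz estimator\<close>

definition real_diag :: "nat \<Rightarrow> (nat \<Rightarrow> real) \<Rightarrow> complex Matrix.mat" where
  "real_diag N c = mat_diag N (\<lambda>n. complex_of_real (c n))"

text \<open>\<open>\<xi>\<^sub>N\<close>; the trace is real for Hermitian \<open>C\<close>.\<close>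

definition mean_trace :: "complex Matrix.mat \<Rightarrow> real" where
  "mean_trace C = Re (mtrace C) / real (dim_row C)"

definition data_mat ::
    "complex Matrix.mat \<Rightarrow> complex Matrix.mat \<Rightarrow> complex Matrix.mat \<Rightarrow> complex Matrix.mat" where
  "data_mat C Z R = psd_sqrt C * Z * psd_sqrt R"

definition sample_cov :: "complex Matrix.mat \<Rightarrow> complex Matrix.mat" where
  "sample_cov X = (1 / of_nat (dim_row X)) \<cdot>\<^sub>m (mat_adjoint X * X)"

definition diag_average :: "complex Matrix.mat \<Rightarrow> int \<Rightarrow> complex" where
  "diag_average S k =
     (\<Sum>i | 0 \<le> i \<and> i < int (dim_row S) \<and> 0 \<le> i + k \<and> i + k < int (dim_row S).
        S $$ (nat (i + k), nat i)) / of_int (int (dim_row S) - \<bar>k\<bar>)"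

definition toeplitz_est :: "complex Matrix.mat \<Rightarrow> complex Matrix.mat" where
  "toeplitz_est X = toeplitz_mat (dim_col X) (diag_average (sample_cov X))"

end

theory Submission
  imports Defs "Jordan_Normal_Form.Spectral_Radius" "HOL-Real_Asymp.Real_Asymp"
begin

text \<open>
  Write \<open>R\<close> for the covariance and \<open>E\<close> for its estimator, \<open>\<xi>\<close> for the mean trace. The proof rests on a bound of the error
  relative to the covariance: almost surely, for large \<open>M\<close>, the form of \<open>E - \<xi> R\<close> is at most \<open>\<epsilon> M\<close> times the form of \<open>R\<close>, where
  \<open>\<epsilon> M\<close> is a negative power of \<open>M\<close>. An absolute bound would be useless, as \<open>R\<close> has condition number up to about \<open>M\<^sup>a\<close>.

  From the relative bound to the theorem one has to take square roots, which do not commute. With \<open>X = E\<^sup>1\<^sup>/\<^sup>2\<close>,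
  \<open>Y = R\<^sup>1\<^sup>/\<^sup>2\<close>, \<open>s = \<surd>\<xi>\<close> the matrix \<open>P = X Y\<^sup>-\<^sup>1 - s\<close> solves the Sylvester equation \<open>X P + s P Y = (E - \<xi> R) Y\<^sup>-\<^sup>1\<close>.
  On a block of the spectrum of \<open>Y\<close> in which the eigenvalues are comparable the solution is of the size of the relative
  error, and there are of the order of \<open>ln M\<close> dyadic blocks (\<open>relative_sqrt_perturbation\<close>). The logarithm is harmless against
  the negative power.

  For the relative bound, the form of \<open>E - \<xi> R\<close> at \<open>v\<close> is written as an average, over
  \<open>2 M\<close> equidistant points \<open>\<theta>\<close>, of \<open>D \<theta>\<close> times the squared modulus of the trigonometric polynomial of \<open>v\<close>
  (\<open>diag_mean_form\<close>), and each \<open>D \<theta>\<close> is a weighted mean of independent centred quadratic forms in the rows with the matrix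
  \<open>R\<^sup>1\<^sup>/\<^sup>2 \<tau> R\<^sup>1\<^sup>/\<^sup>2\<close>, where \<open>\<tau>\<close> has the entries \<open>exp (\<i> (i - j) \<theta>) / (M - \<bar>i - j\<bar>)\<close>
  (\<open>tau_sum_sample_deviation\<close>). All moments of such forms are controlled by the Frobenius norm, with constants independent of
  the dimension: for normal rows by a martingale argument in the coordinates, for rows on the sphere by integration by parts
  along plane rotations (\<open>row_law_concentrated\<close>). The same martingale inequality sums over the rows, and with high moments a
  union bound and Borel--Cantelli make all \<open>D \<theta>\<close> small at once (\<open>row_forms_eventually_small\<close>).

  The Frobenius norm depends on \<open>\<theta>\<close>. Its square is of order \<open>M\<^sup>a\<close>, up to small powers, if \<open>\<theta>\<close> keeps a distance
  \<open>M\<^sup>-\<^sup>1\<^sup>/\<^sup>2\<close> from the singularity of the density (\<open>gram_int_far_bound\<close>), and of order \<open>M\<close> to the power \<open>2 a\<close> otherwise. The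
  near points are the critical ones for \<open>a \<ge> 1 / 2\<close>, where the bound on \<open>D \<theta>\<close> is not even small. But there a bump of width
  \<open>M\<^sup>-\<^sup>1\<^sup>/\<^sup>2\<close> dominates the indicator, and the bump is smaller than the density by a factor \<open>M\<close> to the power \<open>- a / 2\<close>
  (\<open>qf_bump_le\<close>). This compensates the larger error exactly: both regions contribute a relative error of order \<open>M\<close> to
  the power \<open>(a - 1) / 2\<close>. The power bounds on the density come from Potter-type bounds on slowly varying functions
  (\<open>slowly_varying_power_bounds\<close>).
\<close>

section \<open>Quadratic forms and the spectral theorem\<close>

abbreviation qform :: "complex Matrix.mat \<Rightarrow> complex Matrix.vec \<Rightarrow> real" where
  "qform A v \<equiv> Re ((A *\<^sub>v v) \<bullet>c v)"

lemma times_cnj: "z * cnj z = (of_real (cmod z))\<^sup>2"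
  by (simp add: complex_norm_square flip: of_real_power)

lemma adjoint_carrier: "A \<in> carrier_mat n m \<Longrightarrow> mat_adjoint A \<in> carrier_mat m n"
  for A :: "complex Matrix.mat"
  by (auto simp: mat_adjoint_def)

lemma adjoint_index:
  "A \<in> carrier_mat n m \<Longrightarrow> i < m \<Longrightarrow> j < n \<Longrightarrow> mat_adjoint A $$ (i, j) = cnj (A $$ (j, i))"
  for A :: "complex Matrix.mat"
  by (auto simp: mat_adjoint_def mat_of_rows_def)

lemma mat_mult_index:
  "A \<in> carrier_mat n m \<Longrightarrow> B \<in> carrier_mat m k \<Longrightarrow> i < n \<Longrightarrow> j < k \<Longrightarrow>
    (A * B) $$ (i, j) = (\<Sum>l<m. A $$ (i, l) * B $$ (l, j))"
  for A B :: "complex Matrix.mat"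
  by (simp add: scalar_prod_def atLeast0LessThan)

lemma mat_vec_index:
  "A \<in> carrier_mat n m \<Longrightarrow> v \<in> carrier_vec m \<Longrightarrow> i < n \<Longrightarrow>
    vec_index (A *\<^sub>v v) i = (\<Sum>l<m. A $$ (i, l) * vec_index v l)"
  for A :: "complex Matrix.mat"
  by (simp add: scalar_prod_def atLeast0LessThan)

lemma adjoint_adjoint [simp]: "mat_adjoint (mat_adjoint A) = A" for A :: "complex Matrix.mat"
  by (rule eq_matI) (auto simp: mat_adjoint_def mat_of_rows_def)

lemma adjoint_mult:
  fixes A B :: "complex Matrix.mat"
  assumes "A \<in> carrier_mat n m" "B \<in> carrier_mat m k"
  shows "mat_adjoint (A * B) = mat_adjoint B * mat_adjoint A"
proof (rule eq_matI)
  have c: "mat_adjoint A \<in> carrier_mat m n" "mat_adjoint B \<in> carrier_mat k m" "A * B \<in> carrier_mat n k"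
   using assms by (auto intro: adjoint_carrier)
  fix i j assume "i < dim_row (mat_adjoint B * mat_adjoint A)" "j < dim_col (mat_adjoint B * mat_adjoint A)"
  then have ij: "i < k" "j < n" using c by auto
  then show "mat_adjoint (A * B) $$ (i, j) = (mat_adjoint B * mat_adjoint A) $$ (i, j)"
   using assms c
   by (simp only: adjoint_index[OF c(3)] mat_mult_index[OF c(2,1)] mat_mult_index[OF assms] cnj_sum complex_cnj_mult)
     (auto intro!: sum.cong simp: adjoint_index[OF assms(1)] adjoint_index[OF assms(2)] mult.commute)
qed (use assms in \<open>auto simp: mat_adjoint_def\<close>)

lemma adjoint_one [simp]: "mat_adjoint (1\<^sub>m n :: complex Matrix.mat) = 1\<^sub>m n"
  by (rule eq_matI) (auto simp: mat_adjoint_def mat_of_rows_def)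

lemma cscalar_sum:
  "v \<in> carrier_vec n \<Longrightarrow> w \<in> carrier_vec n \<Longrightarrow>
    v \<bullet>c w = (\<Sum>i<n. vec_index v i * cnj (vec_index w i))"
  for v w :: "complex Matrix.vec"
  by (simp add: scalar_prod_def atLeast0LessThan)

lemma adjoint_swap:
  fixes A :: "complex Matrix.mat"
  assumes A: "A \<in> carrier_mat n m" and v: "v \<in> carrier_vec m" and w: "w \<in> carrier_vec n"
  shows "(A *\<^sub>v v) \<bullet>c w = v \<bullet>c (mat_adjoint A *\<^sub>v w)"
proof -
  have "(A *\<^sub>v v) \<bullet>c w = (\<Sum>i<n. \<Sum>l<m. A $$ (i, l) * vec_index v l * cnj (vec_index w i))"
   using assms by (subst cscalar_sum[OF mult_mat_vec_carrier[OF A v] w]) (auto simp: mat_vec_index[OF A v] sum_distrib_right simp del: index_mult_mat_vec)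
  also have "... = (\<Sum>l<m. \<Sum>i<n. vec_index v l * cnj (cnj (A $$ (i, l)) * vec_index w i))"
   by (subst sum.swap) (simp add: mult_ac)
  also have "... = v \<bullet>c (mat_adjoint A *\<^sub>v w)"
   using assms by (subst cscalar_sum[OF v mult_mat_vec_carrier[OF adjoint_carrier[OF A] w]])
    (auto simp: mat_vec_index[OF adjoint_carrier[OF A] w] adjoint_index[OF A] sum_distrib_left simp del: index_mult_mat_vec)
  finally show ?thesis .
qed

lemma vec_l2_nonneg [simp]: "0 \<le> vec_l2 v" by (simp add: vec_l2_def L2_set_nonneg)

lemma vec_l2_sq: "v \<in> carrier_vec n \<Longrightarrow> (vec_l2 v)\<^sup>2 = (\<Sum>i<n. (cmod (vec_index v i))\<^sup>2)"
  by (simp add: vec_l2_def L2_set_def sum_nonneg)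

lemma cscalar_self: "v \<in> carrier_vec n \<Longrightarrow> v \<bullet>c v = of_real ((vec_l2 v)\<^sup>2)"
  for v :: "complex Matrix.vec"
  by (simp add: cscalar_sum[of _ n] vec_l2_sq times_cnj)

lemma vec_l2_zero [simp]: "vec_l2 (0\<^sub>v n) = 0"
  by (simp add: vec_l2_def L2_set_def)

lemma vec_l2_eq_0: "v \<in> carrier_vec n \<Longrightarrow> vec_l2 v = 0 \<longleftrightarrow> v = 0\<^sub>v n"
proof
  assume v: "v \<in> carrier_vec n" and "vec_l2 v = 0"
  then have "(\<Sum>i<n. (cmod (vec_index v i))\<^sup>2) = 0" using vec_l2_sq[OF v] by simp
  then show "v = 0\<^sub>v n" using v by (auto simp: sum_nonneg_eq_0_iff)
qed simp

lemma vec_l2_triangle: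
  "v \<in> carrier_vec n \<Longrightarrow> w \<in> carrier_vec n \<Longrightarrow> vec_l2 (v + w) \<le> vec_l2 v + vec_l2 w"
proof -
  assume a: "v \<in> carrier_vec n" "w \<in> carrier_vec n"
  have "vec_l2 (v + w) \<le> L2_set (\<lambda>i. cmod (vec_index v i) + cmod (vec_index w i)) {..<n}"
   unfolding vec_l2_def using a by (auto intro!: L2_set_mono simp: norm_triangle_ineq)
  also have "... \<le> vec_l2 v + vec_l2 w"
   using L2_set_triangle_ineq[of "\<lambda>i. cmod (vec_index v i)" "\<lambda>i. cmod (vec_index w i)" "{..<n}"] a
   by (simp add: vec_l2_def)
  finally show ?thesis .
qed

lemma vec_l2_smult: "vec_l2 (a \<cdot>\<^sub>v v) = cmod a * vec_l2 v"
proof -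
  have "vec_l2 (a \<cdot>\<^sub>v v) = L2_set (\<lambda>i. cmod a * cmod (vec_index v i)) {..<dim_vec v}"
   unfolding vec_l2_def by (rule L2_set_cong) (auto simp: norm_mult)
  then show ?thesis by (simp add: vec_l2_def L2_set_right_distrib)
qed

lemma cauchy_schwarz_vec:
  fixes v w :: "complex Matrix.vec"
  assumes "v \<in> carrier_vec n" "w \<in> carrier_vec n"
  shows "cmod (v \<bullet>c w) \<le> vec_l2 v * vec_l2 w"
proof -
  have "cmod (v \<bullet>c w) \<le> (\<Sum>i<n. \<bar>cmod (vec_index v i)\<bar> * \<bar>cmod (vec_index w i)\<bar>)"
   unfolding cscalar_sum[OF assms] by (rule order_trans[OF norm_sum]) (simp add: norm_mult)
  also have "... \<le> vec_l2 v * vec_l2 w"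
   using L2_set_mult_ineq[of "\<lambda>i. cmod (vec_index v i)" "\<lambda>i. cmod (vec_index w i)" "{..<n}"] assms
   by (simp add: vec_l2_def)
  finally show ?thesis .
qed

lemma hermitian_eigenvalue_real:
  fixes A :: "complex Matrix.mat"
  assumes A: "A \<in> carrier_mat n n" and h: "mat_adjoint A = A"
   and v: "v \<in> carrier_vec n" "v \<noteq> 0\<^sub>v n" and ev: "A *\<^sub>v v = e \<cdot>\<^sub>v v"
  shows "e = of_real (Re e)"
proof -
  have "(e \<cdot>\<^sub>v v) \<bullet>c v = v \<bullet>c (e \<cdot>\<^sub>v v)"
   using adjoint_swap[OF A v(1) v(1)] ev h by simp
  then have "e * (v \<bullet>c v) = cnj e * (v \<bullet>c v)"
   using v by (simp add: conjugate_smult_vec)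
  moreover have "v \<bullet>c v \<noteq> 0" using v by (simp add: cscalar_self[of _ n] vec_l2_eq_0)
  ultimately have "e = cnj e" by simp
  then show ?thesis by (simp add: complex_eq_iff)
qed

text \<open>A Householder reflection: it exchanges the first basis vector and a given unit vector with
  real first entry.\<close>

lemma householder:
  fixes u :: "complex Matrix.vec"
  assumes u: "u \<in> carrier_vec (Suc m)" "vec_l2 u = 1" and r: "vec_index u 0 \<in> \<real>"
  shows "\<exists>W \<in> carrier_mat (Suc m) (Suc m). mat_adjoint W = W \<and> W * W = 1\<^sub>m (Suc m) \<and>
       (\<forall>i<Suc m. W $$ (i, 0) = vec_index u i)"
proof (cases "vec_index u 0 = 1")
  case True
  have "(cmod (vec_index u 0))\<^sup>2 + (\<Sum>i<m. (cmod (vec_index u (Suc i)))\<^sup>2) = 1"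
   using vec_l2_sq[OF u(1)] u(2) by (simp only: sum.lessThan_Suc_shift) simp
  then have "(\<Sum>i<m. (cmod (vec_index u (Suc i)))\<^sup>2) = 0" using True by simp
  then have "vec_index u (Suc i) = 0" if "i < m" for i using that by (auto simp: sum_nonneg_eq_0_iff)
  then have "(1\<^sub>m (Suc m)) $$ (i, 0) = vec_index u i" if "i < Suc m" for i
   using that True by (cases i) auto
  then show ?thesis by (intro bexI[of _ "1\<^sub>m (Suc m)"]) auto
next
  case False
  define t where "t = Re (vec_index u 0)"
  have t: "vec_index u 0 = of_real t" using r by (auto simp: t_def Reals_def)
  have t1: "t \<noteq> 1" using False t by auto
  define w where "w i = (if i = 0 then 1 else 0) - vec_index u i" for i
  define b where "b = complex_of_real (1 - t)"
  have b0: "b \<noteq> 0" using t1 by (auto simp: b_def)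
  define W where "W = Matrix.mat (Suc m) (Suc m) (\<lambda>(i, j). (if i = j then 1 else 0) - w i * cnj (w j) / b)"
  have W: "W \<in> carrier_mat (Suc m) (Suc m)" by (simp add: W_def)
  have s1: "(cmod (vec_index u 0))\<^sup>2 + (\<Sum>i<m. (cmod (vec_index u (Suc i)))\<^sup>2) = 1"
   using vec_l2_sq[OF u(1)] u(2) by (simp only: sum.lessThan_Suc_shift) simp
  have "(\<Sum>k<Suc m. w k * cnj (w k)) = (1 - of_real t) * (1 - of_real t) + (\<Sum>i<m. of_real ((cmod (vec_index u (Suc i)))\<^sup>2))"
   by (simp only: sum.lessThan_Suc_shift) (simp add: w_def t times_cnj)
  also have "... = of_real ((1 - t)^2 + (\<Sum>i<m. (cmod (vec_index u (Suc i)))\<^sup>2))"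
   by (simp add: power2_eq_square)
  also have "(\<Sum>i<m. (cmod (vec_index u (Suc i)))\<^sup>2) = 1 - t^2" using s1 t by simp
  also have "of_real ((1 - t)^2 + (1 - t^2)) = 2 * b" by (simp add: b_def power2_eq_square algebra_simps)
  finally have ww: "(\<Sum>k<Suc m. w k * cnj (w k)) = 2 * b" .
  have cb: "cnj b = b" by (simp add: b_def)
  have "mat_adjoint W = W"
   by (rule eq_matI) (use W in \<open>auto simp: adjoint_index[OF W], auto simp: W_def cb mult.commute mat_adjoint_def\<close>)
  moreover have "W * W = 1\<^sub>m (Suc m)"
  proof (rule eq_matI)
   fix i j assume "i < dim_row (1\<^sub>m (Suc m) :: complex Matrix.mat)" "j < dim_col (1\<^sub>m (Suc m) :: complex Matrix.mat)"
   then have ij: "i < Suc m" "j < Suc m" by auto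
   have "(W * W) $$ (i, j) = (\<Sum>k<Suc m. W $$ (i, k) * W $$ (k, j))" by (rule mat_mult_index[OF W W ij])
   also have "... = (\<Sum>k<Suc m. ((if i = k then 1 else 0) - w i * cnj (w k) / b) * ((if k = j then 1 else 0) - w k * cnj (w j) / b))"
    using ij by (intro sum.cong) (auto simp: W_def)
   also have "... = (\<Sum>k<Suc m. (if k = i then (if k = j then 1 else 0) else 0)
      - (if k = i then w k * cnj (w j) / b else 0) - (if k = j then w i * cnj (w k) / b else 0)
      + w i * cnj (w j) / b / b * (w k * cnj (w k)))"
    by (intro sum.cong) (auto simp: algebra_simps)
   also have "... = (if i = j then 1 else 0) - w i * cnj (w j) / b - w i * cnj (w j) / b
      + w i * cnj (w j) / b / b * (2 * b)"
    using ij unfolding sum.distrib sum_subtractf sum_distrib_left[symmetric] ww by (auto simp: sum.delta)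
   also have "... = (if i = j then 1 else 0)" using b0 by (simp add: field_simps)
   finally show "(W * W) $$ (i, j) = 1\<^sub>m (Suc m) $$ (i, j)" using ij by simp
  qed (use W in auto)
  moreover have "W $$ (i, 0) = vec_index u i" if "i < Suc m" for i
  proof -
   have "cnj (w 0) = b" by (simp add: w_def b_def t)
   then have "W $$ (i, 0) = (if i = 0 then 1 else 0) - w i" using that b0 by (simp add: W_def)
   then show ?thesis by (simp add: w_def)
  qed
  ultimately show ?thesis using W by blast
qed

text \<open>The spectral theorem, by deflation: a Householder reflection moves an eigenvector to the first
  basis vector, and the first row and column then split off.\<close>

theorem spectral_theorem:
  fixes A :: "complex Matrix.mat"
  assumes "A \<in> carrier_mat n n" "mat_adjoint A = A"
  shows "\<exists>U d. U \<in> carrier_mat n n \<and> mat_adjoint U * U = 1\<^sub>m n \<and>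
       A = U * real_diag n d * mat_adjoint U"
  using assms
proof (induction n arbitrary: A)
  case 0
  show ?case by (rule exI[of _ "1\<^sub>m 0"], rule exI[of _ "\<lambda>_. 0"])
    (use 0 in \<open>auto intro!: eq_matI simp: mat_adjoint_def real_diag_def\<close>)
next
  case (Suc m)
  note A = Suc.prems(1) and h = Suc.prems(2)
  obtain e where "eigenvalue A e"
   using spectrum_non_empty[OF A] by (auto simp: spectrum_def)
  then obtain v0 where v0: "v0 \<in> carrier_vec (Suc m)" "v0 \<noteq> 0\<^sub>v (Suc m)" "A *\<^sub>v v0 = e \<cdot>\<^sub>v v0"
   using A by (auto simp: eigenvalue_def eigenvector_def)
  have er: "e = of_real (Re e)" by (rule hermitian_eigenvalue_real[OF A h v0])
  define s where "s = (if vec_index v0 0 = 0 then 1 else cnj (sgn (vec_index v0 0))) / of_real (vec_l2 v0)"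
  have l0: "vec_l2 v0 \<noteq> 0" using v0 vec_l2_eq_0 by blast
  define u where "u = s \<cdot>\<^sub>v v0"
  have uc: "u \<in> carrier_vec (Suc m)" using v0 by (simp add: u_def)
  have cs: "cmod s = 1 / vec_l2 v0"
   by (simp add: s_def norm_divide norm_sgn)
  have u1: "vec_l2 u = 1" using l0 by (simp add: u_def vec_l2_smult cs)
  have "cnj (sgn z) * z = of_real (cmod z)" for z
   by (cases "z = 0") (simp_all add: sgn_eq field_simps times_cnj power2_eq_square mult.commute[of "cnj z" z])
  then have "vec_index u 0 \<in> \<real>"
   using v0 by (auto simp: u_def s_def)
  then obtain W where W: "W \<in> carrier_mat (Suc m) (Suc m)" "mat_adjoint W = W" "W * W = 1\<^sub>m (Suc m)"
    "\<And>i. i < Suc m \<Longrightarrow> W $$ (i, 0) = vec_index u i"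
   using householder[OF uc u1] by blast
  have Au: "A *\<^sub>v u = e \<cdot>\<^sub>v u"
   using v0 A by (simp add: u_def mult_mat_vec[OF A] smult_smult_assoc mult.commute)
  define A' where "A' = W * A * W"
  have A': "A' \<in> carrier_mat (Suc m) (Suc m)" using W A by (simp add: A'_def)
  have hA': "mat_adjoint A' = A'"
   unfolding A'_def using W A h
   by (simp add: adjoint_mult[of _ "Suc m" "Suc m" _ "Suc m"] assoc_mult_mat[of _ "Suc m" "Suc m" _ "Suc m" _ "Suc m"])
  have AW: "A = W * A' * W"
  proof -
   have "W * A' * W = (W * W) * A * (W * W)"
    unfolding A'_def using W(1) A by (simp add: assoc_mult_mat[of _ "Suc m" "Suc m" _ "Suc m" _ "Suc m"])
   then show ?thesis using W A by simp
  qed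
  have col0: "A' $$ (i, 0) = (if i = 0 then e else 0)" if i: "i < Suc m" for i
  proof -
   have "A' $$ (i, 0) = (\<Sum>k<Suc m. W $$ (i, k) * (A * W) $$ (k, 0))"
    unfolding A'_def using mat_mult_index[of W "Suc m" "Suc m" "A * W" "Suc m" i 0] W A i
    by (simp add: assoc_mult_mat[of _ "Suc m" "Suc m" _ "Suc m" _ "Suc m"])
   also have "... = (\<Sum>k<Suc m. W $$ (i, k) * (e * W $$ (k, 0)))"
   proof (rule sum.cong, goal_cases)
    case (2 k)
    then have k: "k < Suc m" by simp
    have "(A * W) $$ (k, 0) = (\<Sum>l<Suc m. A $$ (k, l) * W $$ (l, 0))"
     by (rule mat_mult_index[OF A W(1) k]) simp
    also have "... = (\<Sum>l<Suc m. A $$ (k, l) * vec_index u l)" by (intro sum.cong) (auto simp: W(4))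
    also have "... = vec_index (A *\<^sub>v u) k" using mat_vec_index[OF A uc k] by simp
    also have "... = e * W $$ (k, 0)" unfolding Au using uc k by (simp add: W(4))
    finally show ?case by simp
   qed simp
   also have "... = e * (W * W) $$ (i, 0)"
    by (subst mat_mult_index[OF W(1) W(1) i]) (auto simp: sum_distrib_left distrib_left mult_ac)
   also have "... = (if i = 0 then e else 0)" using W(3) i by simp
   finally show ?thesis .
  qed
  have row0: "A' $$ (0, i) = (if i = 0 then e else 0)" if i: "i < Suc m" for i
  proof -
   have "A' $$ (0, i) = cnj (A' $$ (i, 0))" using adjoint_index[OF A', of 0 i] hA' i by simp
   then show ?thesis using col0[OF i] er by (metis complex_cnj_complex_of_real complex_cnj_zero)
  qed
  define B where "B = Matrix.mat m m (\<lambda>(i, j). A' $$ (Suc i, Suc j))"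
  have B: "B \<in> carrier_mat m m" by (simp add: B_def)
  have hB: "mat_adjoint B = B"
  proof (rule eq_matI)
   fix i j assume "i < dim_row B" "j < dim_col B"
   then have ij: "i < m" "j < m" by (auto simp: B_def)
   have "A' $$ (Suc i, Suc j) = cnj (A' $$ (Suc j, Suc i))"
    using adjoint_index[OF A', of "Suc i" "Suc j"] hA' ij by simp
   then show "mat_adjoint B $$ (i, j) = B $$ (i, j)" using ij by (simp add: adjoint_index[OF B], simp add: B_def)
  qed (auto simp: B_def mat_adjoint_def)
  obtain U d where U: "U \<in> carrier_mat m m" "mat_adjoint U * U = 1\<^sub>m m" "B = U * real_diag m d * mat_adjoint U"
   using Suc.IH[OF B hB] by blast
  define V where "V = Matrix.mat (Suc m) (Suc m) (\<lambda>(i, j). case (i, j) of (0, 0) \<Rightarrow> 1 | (Suc i, Suc j) \<Rightarrow> U $$ (i, j) | _ \<Rightarrow> 0)"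
  have V: "V \<in> carrier_mat (Suc m) (Suc m)" by (simp add: V_def)
  have V00: "V $$ (0, 0) = 1" and V0: "\<And>j. j < m \<Longrightarrow> V $$ (0, Suc j) = 0" "\<And>j. j < m \<Longrightarrow> V $$ (Suc j, 0) = 0"
   and VS: "\<And>i j. i < m \<Longrightarrow> j < m \<Longrightarrow> V $$ (Suc i, Suc j) = U $$ (i, j)"
   by (auto simp: V_def)
  define D where "D k = (case k of 0 \<Rightarrow> Re e | Suc k \<Rightarrow> d k)" for k
  have VV: "mat_adjoint V * V = 1\<^sub>m (Suc m)"
  proof (rule eq_matI)
   fix i j assume "i < dim_row (1\<^sub>m (Suc m) :: complex Matrix.mat)" "j < dim_col (1\<^sub>m (Suc m) :: complex Matrix.mat)"
   then have ij: "i < Suc m" "j < Suc m" by auto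
   have "(mat_adjoint V * V) $$ (i, j) = (\<Sum>k<Suc m. cnj (V $$ (k, i)) * V $$ (k, j))"
    using ij by (simp add: mat_mult_index[OF adjoint_carrier[OF V] V] adjoint_index[OF V])
   also have "... = cnj (V $$ (0, i)) * V $$ (0, j) + (\<Sum>k<m. cnj (V $$ (Suc k, i)) * V $$ (Suc k, j))"
    by (rule sum.lessThan_Suc_shift)
   also have "... = 1\<^sub>m (Suc m) $$ (i, j)"
   proof (cases i; cases j)
    fix i' j' assume [simp]: "i = Suc i'" "j = Suc j'"
    have "(\<Sum>k<m. cnj (U $$ (k, i')) * U $$ (k, j')) = (mat_adjoint U * U) $$ (i', j')"
     using ij by (simp add: mat_mult_index[OF adjoint_carrier[OF U(1)] U(1)] adjoint_index[OF U(1)])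
    then show ?thesis using ij U(2) by (simp add: V0 VS)
   qed (use ij in \<open>auto simp: V00 V0\<close>)
   finally show "(mat_adjoint V * V) $$ (i, j) = 1\<^sub>m (Suc m) $$ (i, j)" .
  qed (use V in \<open>auto simp: mat_adjoint_def\<close>)
  have diag_index: "(X * real_diag n f * mat_adjoint X) $$ (i, j) = (\<Sum>k<n. X $$ (i, k) * of_real (f k) * cnj (X $$ (j, k)))"
   if X: "X \<in> carrier_mat n n" and ij: "i < n" "j < n" for X n f i j
  proof -
   have dc: "real_diag n f \<in> carrier_mat n n" by (simp add: real_diag_def)
   have "(X * real_diag n f) $$ (i, k) = X $$ (i, k) * of_real (f k)" if "k < n" for k
   proof -
    have "(X * real_diag n f) $$ (i, k) = (\<Sum>l<n. if l = k then X $$ (i, l) * of_real (f l) else 0)"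
     unfolding mat_mult_index[OF X dc ij(1) that]
     by (rule sum.cong) (use that in \<open>auto simp: real_diag_def mat_diag_def\<close>)
    then show ?thesis using that by simp
   qed
   then show ?thesis
    unfolding mat_mult_index[OF mult_carrier_mat[OF X dc] adjoint_carrier[OF X] ij]
    using ij by (intro sum.cong) (auto simp: adjoint_index[OF X])
  qed
  have A'V: "A' = V * real_diag (Suc m) D * mat_adjoint V"
  proof (rule eq_matI)
   fix i j assume "i < dim_row (V * real_diag (Suc m) D * mat_adjoint V)" "j < dim_col (V * real_diag (Suc m) D * mat_adjoint V)"
   then have ij: "i < Suc m" "j < Suc m" using V by (auto simp: mat_adjoint_def)
   have "(V * real_diag (Suc m) D * mat_adjoint V) $$ (i, j)
    = (\<Sum>k<Suc m. V $$ (i, k) * of_real (D k) * cnj (V $$ (j, k)))" by (rule diag_index[OF V ij])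
   also have "... = V $$ (i, 0) * e * cnj (V $$ (j, 0)) + (\<Sum>k<m. V $$ (i, Suc k) * of_real (d k) * cnj (V $$ (j, Suc k)))"
    using er by (simp only: sum.lessThan_Suc_shift) (simp add: D_def)
   also have "... = A' $$ (i, j)"
   proof (cases i; cases j)
    fix i' j' assume [simp]: "i = Suc i'" "j = Suc j'"
    have "A' $$ (i, j) = B $$ (i', j')" using ij by (simp add: B_def)
    also have "... = (\<Sum>k<m. U $$ (i', k) * of_real (d k) * cnj (U $$ (j', k)))"
     unfolding U(3) using ij by (intro diag_index U) auto
    finally show ?thesis using ij by (simp add: V0 VS)
   qed (use ij in \<open>auto simp: V00 V0 col0 row0\<close>)
   finally show "A' $$ (i, j) = (V * real_diag (Suc m) D * mat_adjoint V) $$ (i, j)" by simp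
  qed (use A' V in \<open>auto simp: mat_adjoint_def\<close>)
  have aU: "mat_adjoint (W * V) = mat_adjoint V * W" using adjoint_mult[OF W(1) V] W(2) by simp
  have rd: "real_diag (Suc m) D \<in> carrier_mat (Suc m) (Suc m)" by (simp add: real_diag_def)
  note assoc = assoc_mult_mat[of _ "Suc m" "Suc m" _ "Suc m" _ "Suc m"]
  have aV: "mat_adjoint V \<in> carrier_mat (Suc m) (Suc m)" using V by (rule adjoint_carrier)
  have "mat_adjoint (W * V) * (W * V) = mat_adjoint V * ((W * W) * V)"
   unfolding aU using W(1) V aV by (simp add: assoc)
  also have "... = 1\<^sub>m (Suc m)" using W(3) V VV by simp
  finally have "mat_adjoint (W * V) * (W * V) = 1\<^sub>m (Suc m)" .
  moreover have "A = (W * V) * real_diag (Suc m) D * mat_adjoint (W * V)"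
   unfolding aU using AW A'V W(1) V aV rd by (simp add: assoc)
  ultimately show ?case using W(1) V by (intro exI[of _ "W * V"] exI[of _ D]) auto
qed

section \<open>Positive semi-definite square roots\<close>

lemma real_diag_carrier [simp]: "real_diag n d \<in> carrier_mat n n"
  by (simp add: real_diag_def)

lemma real_diag_index: "i < n \<Longrightarrow> j < n \<Longrightarrow> real_diag n d $$ (i, j) = (if i = j then of_real (d i) else 0)"
  by (simp add: real_diag_def mat_diag_def)

lemma real_diag_mult: "real_diag n d * real_diag n e = real_diag n (\<lambda>i. d i * e i)"
  by (simp add: real_diag_def mat_diag_diag)

lemma real_diag_mult_vec:
  "v \<in> carrier_vec n \<Longrightarrow> real_diag n d *\<^sub>v v = Matrix.vec n (\<lambda>i. of_real (d i) * vec_index v i)"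
proof (rule eq_vecI)
  fix i assume v: "v \<in> carrier_vec n" and "i < dim_vec (Matrix.vec n (\<lambda>i. of_real (d i) * vec_index v i))"
  then have i: "i < n" by simp
  have "vec_index (real_diag n d *\<^sub>v v) i = (\<Sum>l<n. if l = i then of_real (d i) * vec_index v l else 0)"
   unfolding mat_vec_index[OF real_diag_carrier v i]
   by (rule sum.cong) (use i in \<open>auto simp: real_diag_index\<close>)
  then show "vec_index (real_diag n d *\<^sub>v v) i = vec_index (Matrix.vec n (\<lambda>i. of_real (d i) * vec_index v i)) i"
   using i by simp
qed (auto simp: real_diag_def mat_diag_def)

lemma real_diag_cong: "(\<And>i. i < n \<Longrightarrow> d i = e i) \<Longrightarrow> real_diag n d = real_diag n e"
  by (rule eq_matI) (auto simp: real_diag_def mat_diag_def)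

lemma real_diag_adjoint: "mat_adjoint (real_diag n d) = real_diag n d"
proof (rule eq_matI)
  fix i j assume "i < dim_row (real_diag n d)" "j < dim_col (real_diag n d)"
  then have "i < n" "j < n" by (auto simp: real_diag_def mat_diag_def)
  then show "mat_adjoint (real_diag n d) $$ (i, j) = real_diag n d $$ (i, j)"
   by (simp add: adjoint_index[OF real_diag_carrier] real_diag_index)
qed (auto simp: real_diag_def mat_diag_def mat_adjoint_def)

lemma mult_mat_zero_vec: "A \<in> carrier_mat n m \<Longrightarrow> A *\<^sub>v 0\<^sub>v m = 0\<^sub>v n"
  for A :: "complex Matrix.mat"
  by (rule eq_vecI) (auto simp: scalar_prod_def)

lemma psdD:
  assumes "psd A" "A \<in> carrier_mat n n"
  shows "mat_adjoint A = A" "\<And>v. v \<in> carrier_vec n \<Longrightarrow> 0 \<le> qform A v"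
  using assms by (auto simp: psd_def)

lemma psd_real_diag:
  assumes "\<And>i. i < n \<Longrightarrow> 0 \<le> d i"
  shows "psd (real_diag n d)"
proof -
  have "0 \<le> qform (real_diag n d) v" if v: "v \<in> carrier_vec n" for v
  proof -
   have "(real_diag n d *\<^sub>v v) \<bullet>c v = (\<Sum>i<n. of_real (d i * (cmod (vec_index v i))\<^sup>2))"
    unfolding real_diag_mult_vec[OF v] using v
    by (subst cscalar_sum[of _ n]) (auto simp: times_cnj mult.assoc)
   moreover have "0 \<le> (\<Sum>i<n. d i * (cmod (vec_index v i))\<^sup>2)" using assms by (intro sum_nonneg) simp
   ultimately show ?thesis by (simp del: of_real_mult of_real_power)
  qed
  then show ?thesis
   by (auto simp: psd_def real_diag_adjoint) (simp_all add: real_diag_def mat_diag_def)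
qed

lemma psd_conj:
  fixes U :: "complex Matrix.mat"
  assumes B: "psd B" "B \<in> carrier_mat n n" and U: "U \<in> carrier_mat m n"
  shows "psd (U * B * mat_adjoint U)"
proof -
  have c: "mat_adjoint U \<in> carrier_mat n m" using U by (simp add: adjoint_carrier)
  have "mat_adjoint (U * B * mat_adjoint U) = U * B * mat_adjoint U"
   unfolding adjoint_mult[OF mult_carrier_mat[OF U B(2)] c] adjoint_mult[OF U B(2)] psdD(1)[OF B] adjoint_adjoint
   by (rule assoc_mult_mat[OF U B(2) c, symmetric])
  moreover have "0 \<le> qform (U * B * mat_adjoint U) v" if v: "v \<in> carrier_vec m" for v
  proof -
   have w: "mat_adjoint U *\<^sub>v v \<in> carrier_vec n" using c v by simp
   have "(U * B * mat_adjoint U) *\<^sub>v v = U *\<^sub>v (B *\<^sub>v (mat_adjoint U *\<^sub>v v))"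
    using U B c v by (simp add: assoc_mult_mat_vec[of _ m n _ m] assoc_mult_mat_vec[of _ m n _ n])
   then have "((U * B * mat_adjoint U) *\<^sub>v v) \<bullet>c v = (B *\<^sub>v (mat_adjoint U *\<^sub>v v)) \<bullet>c (mat_adjoint U *\<^sub>v v)"
    using adjoint_swap[OF U, of "B *\<^sub>v (mat_adjoint U *\<^sub>v v)" v] B w v by simp
   then show ?thesis using psdD(2)[OF B w] by simp
  qed
  ultimately show ?thesis using U c by (auto simp: psd_def)
qed

lemma unitary_other_side:
  fixes U :: "complex Matrix.mat"
  assumes "U \<in> carrier_mat n n" "mat_adjoint U * U = 1\<^sub>m n"
  shows "U * mat_adjoint U = 1\<^sub>m n"
  using mat_mult_left_right_inverse[of "mat_adjoint U" n U] assms by (simp add: adjoint_carrier)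

lemma unitary_norm:
  fixes U :: "complex Matrix.mat"
  assumes "U \<in> carrier_mat n n" "mat_adjoint U * U = 1\<^sub>m n" "v \<in> carrier_vec n"
  shows "vec_l2 (U *\<^sub>v v) = vec_l2 v"
proof -
  have "(U *\<^sub>v v) \<bullet>c (U *\<^sub>v v) = v \<bullet>c (mat_adjoint U *\<^sub>v (U *\<^sub>v v))"
   using assms by (intro adjoint_swap) auto
  also have "mat_adjoint U *\<^sub>v (U *\<^sub>v v) = v"
   using assms adjoint_carrier[OF assms(1)] by (simp flip: assoc_mult_mat_vec[of _ n n _ n])
  finally have "(vec_l2 (U *\<^sub>v v))\<^sup>2 = (vec_l2 v)\<^sup>2"
   using assms by (simp add: cscalar_self[of _ n] flip: of_real_power)
  then show ?thesis by (simp add: power2_eq_iff_nonneg)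
qed

lemma psd_sqrt_exists:
  assumes A: "psd A" "A \<in> carrier_mat n n"
  shows "\<exists>B \<in> carrier_mat n n. psd B \<and> B * B = A"
proof -
  obtain U d where U: "U \<in> carrier_mat n n" "mat_adjoint U * U = 1\<^sub>m n" "A = U * real_diag n d * mat_adjoint U"
   using spectral_theorem[OF A(2) psdD(1)[OF A]] by blast
  let ?D = "\<lambda>d. real_diag n d"
  have c: "mat_adjoint U \<in> carrier_mat n n" using U by (simp add: adjoint_carrier)
  have d: "0 \<le> d i" if i: "i < n" for i
  proof -
   have "0 \<le> qform A (U *\<^sub>v unit_vec n i)"
    using U i by (intro psdD(2)[OF A]) auto
   also have "A *\<^sub>v (U *\<^sub>v unit_vec n i) = U *\<^sub>v (?D d *\<^sub>v ((mat_adjoint U * U) *\<^sub>v unit_vec n i))"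
    unfolding U(3) using U(1) c by (simp add: assoc_mult_mat_vec[of _ n n _ n])
   also have "... = U *\<^sub>v (?D d *\<^sub>v unit_vec n i)" by (simp add: U(2))
   also have "(U *\<^sub>v (?D d *\<^sub>v unit_vec n i)) \<bullet>c (U *\<^sub>v unit_vec n i)
     = (?D d *\<^sub>v unit_vec n i) \<bullet>c ((mat_adjoint U * U) *\<^sub>v unit_vec n i)"
    using U(1) c adjoint_swap[OF U(1), of "?D d *\<^sub>v unit_vec n i" "U *\<^sub>v unit_vec n i"]
    by (simp add: assoc_mult_mat_vec[of _ n n _ n] mult_mat_vec_carrier[of _ n n])
   also have "... = (\<Sum>k<n. if k = i then of_real (d i) else 0)"
    unfolding U(2) real_diag_mult_vec[OF unit_vec_carrier]
    using i by (subst cscalar_sum[of _ n]) (auto simp: if_distrib cong: if_cong intro!: sum.cong)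
   finally show ?thesis using i by simp
  qed
  define S where "S = ?D (\<lambda>i. sqrt (d i))"
  have S: "S \<in> carrier_mat n n" by (simp add: S_def)
  define B where "B = U * S * mat_adjoint U"
  have "psd B" unfolding B_def S_def by (intro psd_conj[of _ n] psd_real_diag) (use d U in auto)
  moreover have "B * B = A"
  proof -
   have "B * B = U * (S * ((mat_adjoint U * U) * (S * mat_adjoint U)))"
    unfolding B_def using U(1) c S by (simp add: assoc_mult_mat[of _ n n _ n _ n])
   also have "... = U * ((S * S) * mat_adjoint U)"
    unfolding U(2) using U(1) c S by (simp add: assoc_mult_mat[of _ n n _ n _ n] left_mult_one_mat[of _ n n])
   also have "S * S = ?D d"
    unfolding S_def real_diag_mult by (rule real_diag_cong) (simp add: d)
   finally show ?thesis unfolding U(3) using U(1) c assoc_mult_mat[OF U(1) real_diag_carrier c] by simp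
  qed
  moreover have "B \<in> carrier_mat n n" unfolding B_def using U(1) S c by (meson mult_carrier_mat)
  ultimately show ?thesis by blast
qed

text \<open>With \<open>B = S * S\<close> and \<open>S\<close> positive semi-definite, the form at \<open>v\<close> is the squared length of \<open>S v\<close>.\<close>

lemma psd_form_zero:
  assumes B: "psd B" "B \<in> carrier_mat n n" and v: "v \<in> carrier_vec n" and z: "qform B v = 0"
  shows "B *\<^sub>v v = 0\<^sub>v n"
proof -
  obtain C where C: "C \<in> carrier_mat n n" "psd C" "C * C = B" using psd_sqrt_exists[OF B] by blast
  have h: "mat_adjoint C = C" using psdD C by blast
  have cv: "C *\<^sub>v v \<in> carrier_vec n" using C v by simp
  have "B *\<^sub>v v = C *\<^sub>v (C *\<^sub>v v)" using C v by (simp flip: assoc_mult_mat_vec[of _ n n _ n])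
  moreover from this have "(B *\<^sub>v v) \<bullet>c v = (C *\<^sub>v v) \<bullet>c (C *\<^sub>v v)"
   using adjoint_swap[OF C(1) cv v] h by simp
  ultimately show ?thesis using z cv C by (simp add: cscalar_self[of _ n] vec_l2_eq_0[of _ n] mult_mat_zero_vec)
qed

lemma mult_unit_vec:
  fixes A :: "complex Matrix.mat"
  assumes A: "A \<in> carrier_mat n m" and j: "j < m"
  shows "A *\<^sub>v unit_vec m j = Matrix.col A j"
proof (rule eq_vecI)
  fix i assume "i < dim_vec (Matrix.col A j)"
  then have i: "i < n" using A by simp
  have "vec_index (A *\<^sub>v unit_vec m j) i = (\<Sum>l<m. if l = j then A $$ (i, l) else 0)"
   unfolding mat_vec_index[OF A unit_vec_carrier i] by (rule sum.cong) (use j in auto)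
  then show "vec_index (A *\<^sub>v unit_vec m j) i = vec_index (Matrix.col A j) i" using i j A by simp
qed (use A in auto)

text \<open>Uniqueness of the square root: with \<open>D = B - C\<close> one has \<open>B D + D C = 0\<close>, so that
  \<open>D B D\<close> and \<open>D C D\<close> are positive semi-definite with traces of sum zero. Testing on a single vector
  needs the two cross terms \<open>D (B D + D C)\<close> and \<open>(B D + D C) D\<close>; the trace identifies them.\<close>

lemma psd_sqrt_unique:
  assumes B: "psd B" "B \<in> carrier_mat n n" and C: "psd C" "C \<in> carrier_mat n n" and eq: "B * B = C * C"
  shows "B = C"
proof -
  define D where "D = B - C"
  have D: "D \<in> carrier_mat n n" unfolding D_def using C(2) by (rule minus_carrier_mat)
  have hD: "mat_adjoint D = D"
  proof (rule eq_matI)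
   fix i j assume "i < dim_row D" "j < dim_col D"
   then have ij: "i < n" "j < n" using D by auto
   have "B $$ (i, j) = cnj (B $$ (j, i))" "C $$ (i, j) = cnj (C $$ (j, i))"
    using adjoint_index[OF B(2) ij] adjoint_index[OF C(2) ij] psdD(1)[OF B] psdD(1)[OF C] by auto
   then show "mat_adjoint D $$ (i, j) = D $$ (i, j)"
    using ij B C by (simp add: adjoint_index[OF D], simp add: D_def)
  qed (use D in \<open>auto simp: mat_adjoint_def\<close>)
  have sumz: "B * D + D * C = 0\<^sub>m n n"
  proof -
   have "B * D + D * C = (B * B - B * C) + (B * C - C * C)"
    unfolding D_def using B C by (simp add: mult_minus_distrib_mat[of _ n n _ n] minus_mult_distrib_mat[of _ n n _ _ n])
   also have "... = 0\<^sub>m n n" unfolding eq by (rule eq_matI) (use B C in auto)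
   finally show ?thesis .
  qed
  define Dc where "Dc j = Matrix.col D j" for j
  have Dc: "Dc j \<in> carrier_vec n" for j unfolding Dc_def using D by (metis carrier_matD(1) col_dim)
  have key: "(\<Sum>j<n. (M *\<^sub>v Dc j) \<bullet>c Dc j) = mtrace (D * M * D)" if M: "M \<in> carrier_mat n n" for M
  proof -
   have "mtrace (D * M * D) = (\<Sum>j<n. (D * (M * D)) $$ (j, j))"
    unfolding mtrace_def using D M by (simp add: assoc_mult_mat[of _ n n _ n _ n])
   also have "... = (\<Sum>j<n. (M *\<^sub>v Dc j) \<bullet>c Dc j)"
   proof (rule sum.cong, goal_cases)
    case (2 j)
    then have j: "j < n" by simp
    have "(D * (M * D)) $$ (j, j) = (\<Sum>l<n. D $$ (j, l) * (M * D) $$ (l, j))"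
     by (rule mat_mult_index[OF D mult_carrier_mat[OF M D] j j])
    also have "... = (\<Sum>l<n. vec_index (M *\<^sub>v Dc j) l * cnj (vec_index (Dc j) l))"
    proof (rule sum.cong, goal_cases)
     case (2 l)
     then have l: "l < n" by simp
     have "D $$ (j, l) = cnj (vec_index (Dc j) l)"
      using adjoint_index[OF D j l] hD D l j by (simp add: Dc_def)
     moreover have "(M * D) $$ (l, j) = vec_index (M *\<^sub>v Dc j) l"
      using M D l j by (simp add: Dc_def)
     ultimately show ?case by simp
    qed simp
    also have "... = (M *\<^sub>v Dc j) \<bullet>c Dc j"
     by (rule cscalar_sum[symmetric]) (use M Dc in \<open>auto intro: mult_mat_vec_carrier\<close>)
    finally show ?case .
   qed simp
   finally show ?thesis by simp
  qed
  have comm: "mtrace (S * T) = mtrace (T * S)" if S: "S \<in> carrier_mat n n" and T: "T \<in> carrier_mat n n" for S T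
  proof -
   have "mtrace (S * T) = (\<Sum>i<n. \<Sum>l<n. S $$ (i, l) * T $$ (l, i))"
    unfolding mtrace_def using S mat_mult_index[OF S T] by (auto intro: sum.cong simp del: index_mult_mat(1))
   also have "... = (\<Sum>l<n. \<Sum>i<n. T $$ (l, i) * S $$ (i, l))" by (subst sum.swap) (simp add: mult.commute)
   also have "... = mtrace (T * S)"
    unfolding mtrace_def using T mat_mult_index[OF T S] by (auto intro: sum.cong simp del: index_mult_mat(1))
   finally show ?thesis .
  qed
  have add: "mtrace (S + T) = mtrace S + mtrace T" if "S \<in> carrier_mat n n" "T \<in> carrier_mat n n" for S T
   using that by (simp add: mtrace_def sum.distrib)
  have "mtrace (D * C * D) = mtrace (D * (D * C))"
   using comm[OF mult_carrier_mat[OF D C(2)] D] by simp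
  then have "mtrace (D * B * D) + mtrace (D * C * D) = mtrace (D * (B * D + D * C))"
   using add[of "D * (B * D)" "D * (D * C)"] B C D
   by (simp add: mult_add_distrib_mat[of _ n n _ n] assoc_mult_mat[of _ n n _ n _ n])
  also have "... = 0" unfolding sumz using D by (simp add: mtrace_def)
  finally have tr0: "(\<Sum>j<n. qform B (Dc j) + qform C (Dc j)) = 0"
   using key[OF B(2)] key[OF C(2)] by (simp add: sum.distrib flip: Re_sum plus_complex.sel(1))
  have pos: "0 \<le> qform B (Dc j)" "0 \<le> qform C (Dc j)" for j
   using psdD(2)[OF B Dc] psdD(2)[OF C Dc] by auto
  have "D *\<^sub>v Dc j = 0\<^sub>v n" if j: "j < n" for j
  proof -
   have "qform B (Dc j) + qform C (Dc j) = 0"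
    using tr0 pos j by (subst (asm) sum_nonneg_eq_0_iff) (auto intro: add_nonneg_nonneg)
   then have "qform B (Dc j) = 0" "qform C (Dc j) = 0"
    using pos[of j] by linarith+
   from psd_form_zero[OF B Dc this(1)] psd_form_zero[OF C Dc this(2)]
   have "B *\<^sub>v Dc j = 0\<^sub>v n" "C *\<^sub>v Dc j = 0\<^sub>v n" .
   then show ?thesis unfolding D_def using B C Dc[of j]
    by (simp add: minus_mult_distrib_mat_vec[of _ n n])
  qed
  then have "Dc j = 0\<^sub>v n" if j: "j < n" for j
  proof -
   have "(D *\<^sub>v Dc j) \<bullet>c unit_vec n j = Dc j \<bullet>c Dc j"
   proof -
    have "D *\<^sub>v unit_vec n j = Dc j" unfolding Dc_def by (rule mult_unit_vec[OF D j])
    then show ?thesis using adjoint_swap[OF D Dc unit_vec_carrier] hD by simp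
   qed
   moreover assume "\<And>j. j < n \<Longrightarrow> D *\<^sub>v Dc j = 0\<^sub>v n"
   ultimately show ?thesis using j Dc[of j] by (simp add: cscalar_self[of _ n] vec_l2_eq_0[of _ n])
  qed
  then have "D $$ (i, j) = 0" if "i < n" "j < n" for i j
   using that D by (metis Dc_def index_col index_zero_vec(1) carrier_matD)
  then show ?thesis using B C by (intro eq_matI) (auto simp: D_def)
qed

lemma psd_sqrt_props:
  assumes A: "psd A" "A \<in> carrier_mat n n"
  shows "psd_sqrt A \<in> carrier_mat n n" "psd (psd_sqrt A)" "psd_sqrt A * psd_sqrt A = A"
proof -
  obtain B where B: "B \<in> carrier_mat n n" "psd B" "B * B = A" using psd_sqrt_exists[OF A] by blast
  have "psd_sqrt A = B" unfolding psd_sqrt_def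
  proof (rule the_equality)
   fix C assume C: "psd C \<and> C * C = A"
   then have "square_mat C" "dim_row (C * C) = n" using A by (auto simp: psd_def)
   then have "C \<in> carrier_mat n n" by (intro carrier_matI) auto
   then show "C = B" using psd_sqrt_unique[of C n B] C B by simp
  qed (use B in auto)
  then show "psd_sqrt A \<in> carrier_mat n n" "psd (psd_sqrt A)" "psd_sqrt A * psd_sqrt A = A" using B by auto
qed

lemma psd_sqrt_eqI:
  assumes "B \<in> carrier_mat n n" "psd B" "B * B = A" "psd A"
  shows "psd_sqrt A = B"
proof -
  have A: "A \<in> carrier_mat n n" using assms by auto
  show ?thesis using psd_sqrt_unique[of "psd_sqrt A" n B] psd_sqrt_props[OF assms(4) A] assms by simp
qed

lemma psd_sqrt_real_diag:
  assumes "\<And>i. i < n \<Longrightarrow> 0 \<le> d i"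
  shows "psd_sqrt (real_diag n d) = real_diag n (\<lambda>i. sqrt (d i))"
proof (rule psd_sqrt_eqI)
  show "real_diag n (\<lambda>i. sqrt (d i)) * real_diag n (\<lambda>i. sqrt (d i)) = real_diag n d"
   unfolding real_diag_mult by (rule real_diag_cong) (simp add: assms)
qed (use assms in \<open>auto intro!: psd_real_diag real_diag_carrier\<close>)

section \<open>Relative perturbation of the square root\<close>

lemma mat_vec_bounded:
  fixes A :: "complex Matrix.mat"
  assumes A: "A \<in> carrier_mat n m"
  shows "\<exists>C\<ge>0. \<forall>v \<in> carrier_vec m. vec_l2 (A *\<^sub>v v) \<le> C * vec_l2 v"
proof -
  define r where "r i = L2_set (\<lambda>l. cmod (A $$ (i, l))) {..<m}" for i
  have "vec_l2 (A *\<^sub>v v) \<le> (\<Sum>i<n. r i) * vec_l2 v" if v: "v \<in> carrier_vec m" for v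
  proof -
   have e: "cmod (vec_index (A *\<^sub>v v) i) \<le> r i * vec_l2 v" if i: "i < n" for i
   proof -
    have "cmod (vec_index (A *\<^sub>v v) i) \<le> (\<Sum>l<m. \<bar>cmod (A $$ (i, l))\<bar> * \<bar>cmod (vec_index v l)\<bar>)"
     unfolding mat_vec_index[OF A v i] by (rule order_trans[OF norm_sum]) (simp add: norm_mult)
    also have "... \<le> r i * vec_l2 v"
     using L2_set_mult_ineq[of "\<lambda>l. cmod (A $$ (i, l))" "\<lambda>l. cmod (vec_index v l)" "{..<m}"] v
     by (simp add: vec_l2_def r_def)
    finally show ?thesis .
   qed
   have "vec_l2 (A *\<^sub>v v) \<le> (\<Sum>i<n. cmod (vec_index (A *\<^sub>v v) i))"
    unfolding vec_l2_def using A L2_set_le_sum[of "{..<n}" "\<lambda>i. cmod (vec_index (A *\<^sub>v v) i)"]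
    by (simp del: index_mult_mat_vec)
   also have "... \<le> (\<Sum>i<n. r i * vec_l2 v)" by (intro sum_mono e) auto
   finally show ?thesis by (simp add: sum_distrib_right)
  qed
  moreover have "0 \<le> (\<Sum>i<n. r i)" by (intro sum_nonneg) (simp add: r_def L2_set_nonneg)
  ultimately show ?thesis by blast
qed

text \<open>On a spectral block \<open>V\<close> of \<open>Y\<close> in which all eigenvalues are within a factor \<open>1/3\<close> of \<open>y\<close>, the
  Sylvester equation \<open>X P + s P Y = X G\<close> behaves like one with \<open>Y = y\<close>, whose solution is
  \<open>(X + s y)\<^sup>-\<^sup>1 X G\<close>; the remainder is absorbed because it is a contraction by \<open>1/3\<close>.\<close>

lemma sylvester_block:
  fixes X P Y G :: "complex Matrix.mat"
  assumes X: "psd X" "X \<in> carrier_mat n n" and P: "P \<in> carrier_mat n n"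
   and Y: "Y \<in> carrier_mat n n" and G: "G \<in> carrier_mat n n"
   and sy: "0 < s" "0 < y" and V: "V \<subseteq> carrier_vec n"
   and eq: "\<And>w. w \<in> V \<Longrightarrow> X *\<^sub>v (P *\<^sub>v w) + of_real s \<cdot>\<^sub>v (P *\<^sub>v (Y *\<^sub>v w)) = X *\<^sub>v (G *\<^sub>v w)"
   and blk: "\<And>w. w \<in> V \<Longrightarrow> Y *\<^sub>v w - of_real y \<cdot>\<^sub>v w \<in> V"
    "\<And>w. w \<in> V \<Longrightarrow> vec_l2 (Y *\<^sub>v w - of_real y \<cdot>\<^sub>v w) \<le> y / 3 * vec_l2 w"
   and g: "0 \<le> g" "\<And>w. w \<in> V \<Longrightarrow> vec_l2 (G *\<^sub>v w) \<le> g * vec_l2 w"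
   and w: "w \<in> V"
  shows "vec_l2 (P *\<^sub>v w) \<le> 3 * g * vec_l2 w"
proof -
  have step: "vec_l2 (P *\<^sub>v w) \<le> (2 * g + c / 3) * vec_l2 w"
   if c: "0 \<le> c" "\<And>w. w \<in> V \<Longrightarrow> vec_l2 (P *\<^sub>v w) \<le> c * vec_l2 w" and w: "w \<in> V" for c w
  proof -
   have wc: "w \<in> carrier_vec n" using w V by auto
   define u where "u = P *\<^sub>v w - G *\<^sub>v w"
   define z where "z = Y *\<^sub>v w - of_real y \<cdot>\<^sub>v w"
   have zc: "z \<in> carrier_vec n" using Y wc by (auto simp: z_def)
   have Pw: "P *\<^sub>v w \<in> carrier_vec n" and Gw: "G *\<^sub>v w \<in> carrier_vec n" and Pz: "P *\<^sub>v z \<in> carrier_vec n"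
    using P G wc zc by auto
   have uc: "u \<in> carrier_vec n" using Pw Gw by (simp add: u_def)
   have Xu: "X *\<^sub>v u \<in> carrier_vec n" using X uc by auto
   have Yw: "Y *\<^sub>v w = z + of_real y \<cdot>\<^sub>v w" using Y wc by (auto simp: z_def)
   have PYw: "P *\<^sub>v (Y *\<^sub>v w) = P *\<^sub>v z + of_real y \<cdot>\<^sub>v (P *\<^sub>v w)"
    unfolding Yw using P zc wc by (simp add: mult_add_distrib_mat_vec[of _ n n] mult_mat_vec[of _ n n])
   have XPw: "X *\<^sub>v (P *\<^sub>v w) = X *\<^sub>v u + X *\<^sub>v (G *\<^sub>v w)"
    unfolding u_def mult_minus_distrib_mat_vec[OF X(2) Pw Gw] using X Pw Gw
    by (intro eq_vecI) (auto simp del: index_mult_mat_vec)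
   define r where "r = of_real s \<cdot>\<^sub>v (P *\<^sub>v z) + of_real (s * y) \<cdot>\<^sub>v (G *\<^sub>v w)"
   have rc: "r \<in> carrier_vec n" using Pz Gw by (simp add: r_def)
   have main: "X *\<^sub>v u + of_real (s * y) \<cdot>\<^sub>v u = - r"
   proof (rule eq_vecI)
    fix i assume "i < dim_vec (- r)"
    then have i: "i < n" using rc by simp
    have "vec_index (X *\<^sub>v (P *\<^sub>v w)) i + of_real s * vec_index (P *\<^sub>v (Y *\<^sub>v w)) i = vec_index (X *\<^sub>v (G *\<^sub>v w)) i"
     using arg_cong[OF eq[OF w], of "\<lambda>v. vec_index v i"] i X P Y G wc by (simp del: index_mult_mat_vec)
    then have "vec_index (X *\<^sub>v u) i + of_real s * (vec_index (P *\<^sub>v z) i + of_real y * vec_index (P *\<^sub>v w) i) = 0"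
     unfolding PYw XPw using i X P Pw Pz Gw Xu by (simp del: index_mult_mat_vec)
    moreover have "vec_index (P *\<^sub>v w) i = vec_index u i + vec_index (G *\<^sub>v w) i"
     unfolding u_def using i P G by (simp del: index_mult_mat_vec)
    ultimately have "vec_index (X *\<^sub>v u) i + of_real s * (of_real y * vec_index u i)
      = - (of_real s * vec_index (P *\<^sub>v z) i + of_real s * of_real y * vec_index (G *\<^sub>v w) i)"
     by (simp add: algebra_simps eq_neg_iff_add_eq_0)
    moreover have "vec_index (- r) i = - (of_real s * vec_index (P *\<^sub>v z) i + of_real s * of_real y * vec_index (G *\<^sub>v w) i)"
     unfolding r_def using i P G by (simp del: index_mult_mat_vec)
    ultimately show "vec_index (X *\<^sub>v u + of_real (s * y) \<cdot>\<^sub>v u) i = vec_index (- r) i"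
     using i uc X by (simp add: mult.assoc del: index_mult_mat_vec)
   qed (use rc uc Xu in auto)
   have "s * y * (vec_l2 u)\<^sup>2 \<le> qform X u + s * y * (vec_l2 u)\<^sup>2"
    using psdD(2)[OF X uc] by simp
   also have "... = Re ((X *\<^sub>v u + of_real (s * y) \<cdot>\<^sub>v u) \<bullet>c u)"
    using uc Xu by (simp add: add_scalar_prod_distrib[of _ n] cscalar_self[of _ n])
   also have "... \<le> cmod ((- r) \<bullet>c u)" unfolding main by (rule complex_Re_le_cmod)
   also have "... \<le> vec_l2 (- r) * vec_l2 u" using rc uc by (intro cauchy_schwarz_vec[of _ n]) auto
   also have "vec_l2 (- r) = vec_l2 r" unfolding vec_l2_def using rc by (auto intro!: L2_set_cong)
   finally have "s * y * vec_l2 u \<le> vec_l2 r"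
    by (cases "vec_l2 u = 0") (auto simp: power2_eq_square order_less_le mult.assoc[symmetric])
   also have "... \<le> s * vec_l2 (P *\<^sub>v z) + s * y * vec_l2 (G *\<^sub>v w)"
    unfolding r_def using vec_l2_triangle[of "of_real s \<cdot>\<^sub>v (P *\<^sub>v z)" n "of_real (s * y) \<cdot>\<^sub>v (G *\<^sub>v w)"] Pz Gw sy
    by (simp add: vec_l2_smult abs_mult del: of_real_mult)
   also have "... \<le> s * (c * (y / 3 * vec_l2 w)) + s * y * (g * vec_l2 w)"
    using order_trans[OF c(2)[OF blk(1)[OF w]] mult_left_mono[OF blk(2)[OF w] c(1)]] g(2)[OF w] sy
    unfolding z_def by (intro add_mono mult_left_mono) auto
   also have "... = s * y * ((c / 3 + g) * vec_l2 w)" by (simp add: algebra_simps)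
   finally have u: "vec_l2 u \<le> (c / 3 + g) * vec_l2 w" using sy by simp
   have "P *\<^sub>v w = u + G *\<^sub>v w" unfolding u_def using P G
    by (intro eq_vecI) (auto simp del: index_mult_mat_vec)
   then have "vec_l2 (P *\<^sub>v w) \<le> vec_l2 u + vec_l2 (G *\<^sub>v w)" using vec_l2_triangle[OF uc Gw] by simp
   then show ?thesis using u g(2)[OF w] by (simp add: algebra_simps)
  qed
  obtain c0 where c0: "0 \<le> c0" "\<And>w. w \<in> carrier_vec n \<Longrightarrow> vec_l2 (P *\<^sub>v w) \<le> c0 * vec_l2 w"
   using mat_vec_bounded[OF P] by blast
  have it: "\<forall>w\<in>V. vec_l2 (P *\<^sub>v w) \<le> (3 * g + c0 * (1 / 3) ^ k) * vec_l2 w" for k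
  proof (induction k)
   case 0
   have "vec_l2 (P *\<^sub>v w) \<le> (3 * g + c0) * vec_l2 w" if "w \<in> V" for w
   proof -
    have "vec_l2 (P *\<^sub>v w) \<le> c0 * vec_l2 w" using c0(2) that V by auto
    moreover have "0 \<le> 3 * g * vec_l2 w" using g(1) by simp
    ultimately show ?thesis by (simp add: distrib_right)
   qed
   then show ?case by simp
  next
   case (Suc k)
   show ?case
   proof
    fix w assume "w \<in> V"
    have "vec_l2 (P *\<^sub>v w) \<le> (2 * g + (3 * g + c0 * (1 / 3) ^ k) / 3) * vec_l2 w"
     by (rule step) (use Suc.IH c0(1) g(1) \<open>w \<in> V\<close> in auto)
    also have "2 * g + (3 * g + c0 * (1 / 3) ^ k) / 3 = 3 * g + c0 * (1 / 3) ^ Suc k" by simp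
    finally show "vec_l2 (P *\<^sub>v w) \<le> (3 * g + c0 * (1 / 3) ^ Suc k) * vec_l2 w" .
   qed
  qed
  have "(\<lambda>k. (3 * g + c0 * (1 / 3) ^ k) * vec_l2 w) \<longlonglongrightarrow> (3 * g + c0 * 0) * vec_l2 w"
   by (intro tendsto_intros LIMSEQ_power_zero) auto
  then show ?thesis using LIMSEQ_le_const it w by fastforce
qed

text \<open>Summing over the dyadic blocks of the spectrum of \<open>Y\<close> costs one factor per block, that is, a
  logarithm of the condition number.\<close>

lemma sylvester_bound:
  fixes X P Y G :: "complex Matrix.mat"
  assumes X: "psd X" "X \<in> carrier_mat n n" and P: "P \<in> carrier_mat n n"
   and Y: "psd Y" "Y \<in> carrier_mat n n" and G: "G \<in> carrier_mat n n"
   and s: "0 < s" and lo: "0 < lo"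
   and spec: "\<And>v. v \<in> carrier_vec n \<Longrightarrow> lo * vec_l2 v \<le> vec_l2 (Y *\<^sub>v v)"
    "\<And>v. v \<in> carrier_vec n \<Longrightarrow> vec_l2 (Y *\<^sub>v v) \<le> hi * vec_l2 v"
   and K: "hi < 2 ^ K * lo"
   and eq: "\<And>w. w \<in> carrier_vec n \<Longrightarrow>
         X *\<^sub>v (P *\<^sub>v w) + of_real s \<cdot>\<^sub>v (P *\<^sub>v (Y *\<^sub>v w)) = X *\<^sub>v (G *\<^sub>v w)"
   and g: "0 \<le> g" "\<And>w. w \<in> carrier_vec n \<Longrightarrow> vec_l2 (G *\<^sub>v w) \<le> g * vec_l2 w"
   and v: "v \<in> carrier_vec n"
  shows "vec_l2 (P *\<^sub>v v) \<le> 3 * g * real K * vec_l2 v"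
proof -
  obtain U d where U: "U \<in> carrier_mat n n" "mat_adjoint U * U = 1\<^sub>m n" "Y = U * real_diag n d * mat_adjoint U"
   using spectral_theorem[OF Y(2) psdD(1)[OF Y]] by blast
  note Un = unitary_norm[OF U(1,2)]
  have c: "mat_adjoint U \<in> carrier_mat n n" using U by (simp add: adjoint_carrier)
  have Y_U: "Y *\<^sub>v (U *\<^sub>v z) = U *\<^sub>v (Matrix.vec n (\<lambda>i. of_real (d i) * vec_index z i))" if z: "z \<in> carrier_vec n" for z
  proof -
   have "Y *\<^sub>v (U *\<^sub>v z) = U *\<^sub>v (real_diag n d *\<^sub>v ((mat_adjoint U * U) *\<^sub>v z))"
    unfolding U(3) using U(1) c z by (simp add: assoc_mult_mat_vec[of _ n n _ n])
   then show ?thesis using z by (simp add: U(2) real_diag_mult_vec)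
  qed
  have UYU: "qform Y (U *\<^sub>v unit_vec n i) = d i"
   and Yu: "vec_l2 (Y *\<^sub>v (U *\<^sub>v unit_vec n i)) = \<bar>d i\<bar>" if i: "i < n" for i
  proof -
   have e: "Y *\<^sub>v (U *\<^sub>v unit_vec n i) = of_real (d i) \<cdot>\<^sub>v (U *\<^sub>v unit_vec n i)"
   proof -
    have "Matrix.vec n (\<lambda>j. complex_of_real (d j) * vec_index (unit_vec n i) j) = complex_of_real (d i) \<cdot>\<^sub>v unit_vec n i"
     using i by (intro eq_vecI) auto
    then show ?thesis unfolding Y_U[OF unit_vec_carrier] by (simp only: mult_mat_vec[OF U(1) unit_vec_carrier])
   qed
   have c: "U *\<^sub>v unit_vec n i \<in> carrier_vec n" using U(1) i by auto
   have "(vec_l2 (unit_vec n i))\<^sup>2 = (\<Sum>j<n. if j = i then 1 else 0)"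
    unfolding vec_l2_sq[OF unit_vec_carrier] using i by (intro sum.cong) auto
   then have "(vec_l2 (unit_vec n i))\<^sup>2 = 1" using i by simp
   then have n1: "vec_l2 (U *\<^sub>v unit_vec n i) = 1"
    by (simp add: Un power2_eq_1_iff) (metis vec_l2_nonneg not_one_le_zero le_minus_one_simps(1,3) order_trans)
   then show "qform Y (U *\<^sub>v unit_vec n i) = d i"
    unfolding e using c by (simp add: cscalar_self[of _ n])
   show "vec_l2 (Y *\<^sub>v (U *\<^sub>v unit_vec n i)) = \<bar>d i\<bar>" unfolding e using n1 by (simp add: vec_l2_smult)
  qed
  have d: "lo \<le> d i" "d i \<le> hi" if i: "i < n" for i
  proof -
   have c: "U *\<^sub>v unit_vec n i \<in> carrier_vec n" using U(1) i by auto
   have "vec_l2 (unit_vec n i) = 1"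
   proof -
    have "(vec_l2 (unit_vec n i))\<^sup>2 = (\<Sum>j<n. if j = i then 1 else 0)"
     unfolding vec_l2_sq[OF unit_vec_carrier] using i by (intro sum.cong) auto
    then have "(vec_l2 (unit_vec n i))\<^sup>2 = 1\<^sup>2" using i by simp
    then show ?thesis by (rule power2_eq_imp_eq) simp_all
   qed
   moreover have "0 \<le> d i" using psdD(2)[OF Y c] UYU[OF i] by simp
   ultimately show "lo \<le> d i" "d i \<le> hi" using spec[OF c] Yu[OF i] by (auto simp: Un)
  qed
  have block: "vec_l2 (P *\<^sub>v (U *\<^sub>v z)) \<le> 3 * g * vec_l2 z"
   if z: "z \<in> carrier_vec n" "\<And>i. i < n \<Longrightarrow> vec_index z i \<noteq> 0 \<Longrightarrow> 2 ^ k * lo \<le> d i \<and> d i < 2 ^ Suc k * lo" for z k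
  proof -
   define V where "V = {U *\<^sub>v z | z. z \<in> carrier_vec n \<and> (\<forall>i<n. vec_index z i \<noteq> 0 \<longrightarrow> 2 ^ k * lo \<le> d i \<and> d i < 2 ^ Suc k * lo)}"
   define y where "y = 3 / 2 * 2 ^ k * lo"
   have y: "0 < y" using lo by (simp add: y_def)
   have diff: "Y *\<^sub>v (U *\<^sub>v z) - of_real y \<cdot>\<^sub>v (U *\<^sub>v z) = U *\<^sub>v (Matrix.vec n (\<lambda>i. of_real (d i - y) * vec_index z i))"
    if z: "z \<in> carrier_vec n" for z
   proof -
    have "Matrix.vec n (\<lambda>i. of_real (d i - y) * vec_index z i)
      = Matrix.vec n (\<lambda>i. of_real (d i) * vec_index z i) - of_real y \<cdot>\<^sub>v z"
     using z by (intro eq_vecI) (auto simp: algebra_simps)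
    then show ?thesis using U(1) z by (simp add: Y_U mult_minus_distrib_mat_vec[of _ n n] mult_mat_vec[of _ n n])
   qed
   have "vec_l2 (P *\<^sub>v (U *\<^sub>v z)) \<le> 3 * g * vec_l2 (U *\<^sub>v z)"
   proof (rule sylvester_block[OF X P Y(2) G s y])
    show "V \<subseteq> carrier_vec n" using U(1) by (auto simp: V_def)
    show "U *\<^sub>v z \<in> V" using z by (auto simp: V_def)
    fix w assume "w \<in> V"
    then obtain z where w: "w = U *\<^sub>v z" and z: "z \<in> carrier_vec n"
     "\<forall>i<n. vec_index z i \<noteq> 0 \<longrightarrow> 2 ^ k * lo \<le> d i \<and> d i < 2 ^ Suc k * lo" by (auto simp: V_def)
    have wc: "w \<in> carrier_vec n" using U(1) z w by auto
    show "X *\<^sub>v (P *\<^sub>v w) + of_real s \<cdot>\<^sub>v (P *\<^sub>v (Y *\<^sub>v w)) = X *\<^sub>v (G *\<^sub>v w)" using eq wc by simp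
    show "vec_l2 (G *\<^sub>v w) \<le> g * vec_l2 w" using g wc by simp
    show "Y *\<^sub>v w - of_real y \<cdot>\<^sub>v w \<in> V"
     unfolding w diff[OF z(1)] V_def using z
     by (intro CollectI exI[of _ "Matrix.vec n (\<lambda>i. of_real (d i - y) * vec_index z i)"]) auto
    have ineq: "cmod (of_real (d i - y) * vec_index z i) \<le> cmod (of_real (y / 3) * vec_index z i)" if i: "i < n" for i
    proof (cases "vec_index z i = 0")
     case False
     then have "2 ^ k * lo \<le> d i \<and> d i < 2 ^ Suc k * lo" using z i by blast
     moreover define t where "t = 2 ^ k * lo"
     moreover have "y = 3 / 2 * t" "2 ^ Suc k * lo = 2 * t" by (simp_all add: y_def t_def)
     ultimately have "\<bar>d i - y\<bar> \<le> y / 3" by (simp only: abs_le_iff) linarith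
     from mult_right_mono[OF this norm_ge_zero[of "vec_index z i"]] show ?thesis
      using y by (simp add: norm_mult flip: of_real_diff del: of_real_divide)
    qed simp
    have "vec_l2 (Matrix.vec n (\<lambda>i. of_real (d i - y) * vec_index z i)) \<le> vec_l2 (of_real (y / 3) \<cdot>\<^sub>v z)"
     unfolding vec_l2_def using z(1) ineq by (auto intro!: L2_set_mono simp del: of_real_diff of_real_divide)
    then show "vec_l2 (Y *\<^sub>v w - of_real y \<cdot>\<^sub>v w) \<le> y / 3 * vec_l2 w"
     unfolding w diff[OF z(1)] using z(1) y by (simp add: Un vec_l2_smult norm_divide)
   qed (rule g(1))
   then show ?thesis using z by (simp add: Un)
  qed
  have "vec_l2 (P *\<^sub>v (U *\<^sub>v z)) \<le> 3 * g * real k * vec_l2 z"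
   if "z \<in> carrier_vec n" "\<And>i. i < n \<Longrightarrow> vec_index z i \<noteq> 0 \<Longrightarrow> d i < 2 ^ k * lo" for z k
   using that
  proof (induction k arbitrary: z)
   case 0
   have "z = 0\<^sub>v n" using 0 d by (intro eq_vecI) force+
   then show ?case using U(1) P by (simp add: mult_mat_zero_vec[of _ n])
  next
   case (Suc k)
   define z1 where "z1 = Matrix.vec n (\<lambda>i. if d i < 2 ^ k * lo then vec_index z i else 0)"
   define z2 where "z2 = Matrix.vec n (\<lambda>i. if d i < 2 ^ k * lo then 0 else vec_index z i)"
   have zc: "z1 \<in> carrier_vec n" "z2 \<in> carrier_vec n" by (auto simp: z1_def z2_def)
   have z12: "z = z1 + z2" using Suc.prems(1) by (intro eq_vecI) (auto simp: z1_def z2_def)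
   have l: "vec_l2 z1 \<le> vec_l2 z" "vec_l2 z2 \<le> vec_l2 z"
    unfolding vec_l2_def z1_def z2_def using Suc.prems(1) by (auto intro!: L2_set_mono)
   have "vec_l2 (P *\<^sub>v (U *\<^sub>v z)) \<le> vec_l2 (P *\<^sub>v (U *\<^sub>v z1)) + vec_l2 (P *\<^sub>v (U *\<^sub>v z2))"
    unfolding z12 using U(1) P zc
    by (simp add: mult_add_distrib_mat_vec[of _ n n] vec_l2_triangle[of _ n] mult_mat_vec_carrier[of _ n n])
   also have "... \<le> 3 * g * real k * vec_l2 z1 + 3 * g * vec_l2 z2"
   proof (rule add_mono)
    show "vec_l2 (P *\<^sub>v (U *\<^sub>v z1)) \<le> 3 * g * real k * vec_l2 z1"
     by (rule Suc.IH) (auto simp: z1_def split: if_splits)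
    show "vec_l2 (P *\<^sub>v (U *\<^sub>v z2)) \<le> 3 * g * vec_l2 z2"
     by (rule block[of _ k]) (use Suc.prems(2) in \<open>auto simp: z2_def not_less split: if_splits\<close>)
   qed
   also have "... \<le> 3 * g * real k * vec_l2 z + 3 * g * vec_l2 z"
    using l g(1) by (intro add_mono mult_left_mono) auto
   finally show ?case by (simp add: algebra_simps)
  qed
  note * = this[of "mat_adjoint U *\<^sub>v v" K]
  have "U *\<^sub>v (mat_adjoint U *\<^sub>v v) = v"
   using unitary_other_side[OF U(1,2)] U(1) c v by (simp flip: assoc_mult_mat_vec[of _ n n _ n])
  moreover have "vec_l2 (mat_adjoint U *\<^sub>v v) = vec_l2 v"
   using unitary_norm[OF c, of v] unitary_other_side[OF U(1,2)] v by simp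
  moreover have "d i < 2 ^ K * lo" if "i < n" for i using d[OF that] K by simp
  ultimately show ?thesis using * c v by auto
qed

text \<open>A Hermitian form that is dominated by a positive semi-definite form satisfies the corresponding
  Cauchy--Schwarz inequality, by polarisation after rescaling the two arguments.\<close>

lemma dominated_form_cauchy_schwarz:
  fixes A B :: "complex Matrix.mat"
  assumes A: "A \<in> carrier_mat n n" "mat_adjoint A = A" and B: "psd B" "B \<in> carrier_mat n n" and e: "0 \<le> e"
   and dom: "\<And>v. v \<in> carrier_vec n \<Longrightarrow> \<bar>qform A v\<bar> \<le> e * qform B v"
   and v: "v \<in> carrier_vec n" and w: "w \<in> carrier_vec n"
   and bv: "qform B v \<le> a\<^sup>2" and bw: "qform B w \<le> b\<^sup>2"
   and ab: "0 < a" "0 < b"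
  shows "Re ((A *\<^sub>v v) \<bullet>c w) \<le> e * a * b"
proof -
  define x where "x = of_real b \<cdot>\<^sub>v v"
  define y where "y = of_real a \<cdot>\<^sub>v w"
  have c: "x \<in> carrier_vec n" "y \<in> carrier_vec n" using v w by (auto simp: x_def y_def)
  have expand: "qform M (x + y) = qform M x + 2 * Re ((M *\<^sub>v x) \<bullet>c y) + qform M y"
   "qform M (x - y) = qform M x - 2 * Re ((M *\<^sub>v x) \<bullet>c y) + qform M y"
   if M: "M \<in> carrier_mat n n" "mat_adjoint M = M" for M
  proof -
   have Mc: "M *\<^sub>v x \<in> carrier_vec n" "M *\<^sub>v y \<in> carrier_vec n" using M c by auto
   have "(M *\<^sub>v y) \<bullet>c x = y \<bullet>c (M *\<^sub>v x)" using adjoint_swap[OF M(1) c(2,1)] M(2) by simp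
   also have "... = cnj ((M *\<^sub>v x) \<bullet>c y)"
    unfolding cscalar_sum[OF c(2) Mc(1)] cscalar_sum[OF Mc(1) c(2)] by (simp add: mult.commute del: index_mult_mat_vec)
   finally have sw: "(M *\<^sub>v y) \<bullet>c x = cnj ((M *\<^sub>v x) \<bullet>c y)" .
   have p: "(p + q) \<bullet>c (x + y) = p \<bullet>c x + q \<bullet>c x + (p \<bullet>c y + q \<bullet>c y)"
    "(p - q) \<bullet>c (x - y) = p \<bullet>c x - q \<bullet>c x - (p \<bullet>c y - q \<bullet>c y)"
    if "p \<in> carrier_vec n" "q \<in> carrier_vec n" for p q
    using that c by (simp_all add: cscalar_sum[of _ n] sum.distrib sum_subtractf algebra_simps)
   show "qform M (x + y) = qform M x + 2 * Re ((M *\<^sub>v x) \<bullet>c y) + qform M y"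
    unfolding mult_add_distrib_mat_vec[OF M(1) c] p(1)[OF Mc] by (simp add: sw)
   show "qform M (x - y) = qform M x - 2 * Re ((M *\<^sub>v x) \<bullet>c y) + qform M y"
    unfolding mult_minus_distrib_mat_vec[OF M(1) c] p(2)[OF Mc] by (simp add: sw)
  qed
  have "4 * Re ((A *\<^sub>v x) \<bullet>c y) = qform A (x + y) - qform A (x - y)"
   unfolding expand[OF A] by simp
  also have "... \<le> e * qform B (x + y) + e * qform B (x - y)"
   using dom[of "x + y"] dom[of "x - y"] c by (auto simp: abs_le_iff)
  also have "... = 2 * (e * (qform B x + qform B y))"
   unfolding expand[OF B(2) psdD(1)[OF B]] by (simp add: algebra_simps)
  finally have 1: "2 * Re ((A *\<^sub>v x) \<bullet>c y) \<le> e * (qform B x + qform B y)" by simp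
  have sc: "((M *\<^sub>v (complex_of_real p \<cdot>\<^sub>v u)) \<bullet>c (complex_of_real q \<cdot>\<^sub>v z)) = complex_of_real (p * q) * ((M *\<^sub>v u) \<bullet>c z)"
   if "M \<in> carrier_mat n n" "u \<in> carrier_vec n" "z \<in> carrier_vec n" for M u z p q
  proof -
   have "M *\<^sub>v u \<in> carrier_vec n" using that by auto
   then show ?thesis unfolding mult_mat_vec[OF that(1,2)] using that
    by (simp add: cscalar_sum[of _ n] sum_distrib_left mult_ac del: index_mult_mat_vec)
  qed
  have "2 * (a * b * Re ((A *\<^sub>v v) \<bullet>c w)) \<le> e * (b * b * qform B v + a * a * qform B w)"
   using 1 unfolding x_def y_def sc[OF A(1) v w] sc[OF B(2) v v] sc[OF B(2) w w] by (simp add: mult_ac del: of_real_mult)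
  also have "... \<le> e * (b * b * a\<^sup>2 + a * a * b\<^sup>2)"
   using bv bw e by (intro mult_left_mono add_mono) auto
  also have "... = 2 * (a * b * (e * a * b))" by (simp add: power2_eq_square algebra_simps)
  finally show ?thesis using ab by simp
qed

lemma smult_mat_mult_vec:
  fixes A :: "complex Matrix.mat"
  assumes "A \<in> carrier_mat n m" "v \<in> carrier_vec m"
  shows "(a \<cdot>\<^sub>m A) *\<^sub>v v = a \<cdot>\<^sub>v (A *\<^sub>v v)"
  using assms by (intro eq_vecI) (auto simp: scalar_prod_def sum_distrib_left mult.assoc)

lemma psd_inv_sqrt_props:
  assumes B: "psd B" "B \<in> carrier_mat n n" and lo: "0 < lo"
   and pd: "\<And>v. v \<in> carrier_vec n \<Longrightarrow> lo * vec_l2 v \<le> vec_l2 (psd_sqrt B *\<^sub>v v)"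
  shows "psd_inv_sqrt B \<in> carrier_mat n n" "psd_sqrt B * psd_inv_sqrt B = 1\<^sub>m n" "psd_inv_sqrt B * psd_sqrt B = 1\<^sub>m n"
proof -
  note Y = psd_sqrt_props(1)[OF B]
  have "det (psd_sqrt B) \<noteq> 0"
  proof
   assume "det (psd_sqrt B) = 0"
   then obtain v where v: "v \<in> carrier_vec n" "v \<noteq> 0\<^sub>v n" "psd_sqrt B *\<^sub>v v = 0\<^sub>v n"
    using det_0_iff_vec_prod_zero_field[OF Y] by blast
   then have "lo * vec_l2 v \<le> 0" using pd[of v] by simp
   then have "vec_l2 v = 0" using lo by (simp add: mult_le_0_iff order_antisym)
   then show False using v vec_l2_eq_0 by blast
  qed
  then have "psd_sqrt B \<in> Units (ring_mat TYPE(complex) n ())" by (rule det_non_zero_imp_unit[OF Y])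
  then obtain K where K: "mat_inverse (psd_sqrt B) = Some K"
   using mat_inverse(1)[OF Y, of "()"] by (cases "mat_inverse (psd_sqrt B)") auto
  show "psd_inv_sqrt B \<in> carrier_mat n n" "psd_sqrt B * psd_inv_sqrt B = 1\<^sub>m n" "psd_inv_sqrt B * psd_sqrt B = 1\<^sub>m n"
   using mat_inverse(2)[OF Y K] by (auto simp: psd_inv_sqrt_def K)
qed

lemma psd_sqrt_norm:
  assumes B: "psd B" "B \<in> carrier_mat n n" and v: "v \<in> carrier_vec n"
  shows "(vec_l2 (psd_sqrt B *\<^sub>v v))\<^sup>2 = qform B v"
proof -
  note Y = psd_sqrt_props[OF B]
  have Yv: "psd_sqrt B *\<^sub>v v \<in> carrier_vec n" using Y(1) v by auto
  have "B *\<^sub>v v = psd_sqrt B *\<^sub>v (psd_sqrt B *\<^sub>v v)"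
   using Y v by (metis assoc_mult_mat_vec)
  then have "(B *\<^sub>v v) \<bullet>c v = (psd_sqrt B *\<^sub>v v) \<bullet>c (psd_sqrt B *\<^sub>v v)"
   using adjoint_swap[OF Y(1) Yv v] psdD(1)[OF Y(2,1)] by simp
  then show ?thesis using Yv by (simp add: cscalar_self[of _ n])
qed

text \<open>With \<open>X = A\<^sup>1\<^sup>/\<^sup>2\<close>, \<open>Y = B\<^sup>1\<^sup>/\<^sup>2\<close> and \<open>P = X Y\<^sup>-\<^sup>1 - s\<close> one has \<open>X P + s P Y = (A - s\<^sup>2 B) Y\<^sup>-\<^sup>1\<close>, and the relative
  bound on \<open>A - s\<^sup>2 B\<close> is exactly what bounds \<open>X\<^sup>-\<^sup>1 (A - s\<^sup>2 B) Y\<^sup>-\<^sup>1\<close>.\<close>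

theorem relative_sqrt_perturbation:
  assumes A: "psd A" "A \<in> carrier_mat n n" and B: "psd B" "B \<in> carrier_mat n n"
   and s: "0 < s" and e: "0 \<le> e" "e \<le> 1 / 2" and lo: "0 < lo"
   and rel: "\<And>v. v \<in> carrier_vec n \<Longrightarrow>
     \<bar>qform A v - s\<^sup>2 * qform B v\<bar> \<le> e * (s\<^sup>2 * qform B v)"
   and spec: "\<And>v. v \<in> carrier_vec n \<Longrightarrow> lo\<^sup>2 * (vec_l2 v)\<^sup>2 \<le> qform B v"
    "\<And>v. v \<in> carrier_vec n \<Longrightarrow> qform B v \<le> hi\<^sup>2 * (vec_l2 v)\<^sup>2"
   and K: "hi < 2 ^ K * lo" "0 \<le> hi"
  shows "op_norm (psd_sqrt A * psd_inv_sqrt B - of_real s \<cdot>\<^sub>m 1\<^sub>m n) \<in> {0..6 * s * e * real K}"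
proof -
  define X where "X = psd_sqrt A"
  define Y where "Y = psd_sqrt B"
  define W where "W = psd_inv_sqrt B"
  note X = psd_sqrt_props[OF A, folded X_def] and Y = psd_sqrt_props[OF B, folded Y_def]
  have Yn: "(vec_l2 (Y *\<^sub>v v))\<^sup>2 = qform B v" and Xn: "(vec_l2 (X *\<^sub>v v))\<^sup>2 = qform A v"
   if "v \<in> carrier_vec n" for v
   using psd_sqrt_norm[OF B that] psd_sqrt_norm[OF A that] by (auto simp: X_def Y_def)
  have Ylo: "lo * vec_l2 v \<le> vec_l2 (Y *\<^sub>v v)" and Yhi: "vec_l2 (Y *\<^sub>v v) \<le> hi * vec_l2 v"
   if v: "v \<in> carrier_vec n" for v
   using spec[OF v] K(2) unfolding Yn[OF v, symmetric] power_mult_distrib[symmetric]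
   by (auto intro: power2_le_imp_le)
  note W = psd_inv_sqrt_props[OF B lo Ylo[unfolded Y_def], folded Y_def W_def]
  have half: "s\<^sup>2 * qform B v \<le> 2 * qform A v" if v: "v \<in> carrier_vec n" for v
  proof -
   have "e * (s\<^sup>2 * qform B v) \<le> 1 / 2 * (s\<^sup>2 * qform B v)"
    using psdD(2)[OF B v] e by (intro mult_right_mono) auto
   then show ?thesis using rel[OF v] by (simp add: abs_le_iff)
  qed
  have Xlo: "lo * s / sqrt 2 * vec_l2 v \<le> vec_l2 (X *\<^sub>v v)" if v: "v \<in> carrier_vec n" for v
  proof (rule power2_le_imp_le)
   have "(lo * s / sqrt 2 * vec_l2 v)\<^sup>2 = s\<^sup>2 * (lo\<^sup>2 * (vec_l2 v)\<^sup>2) / 2"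
    by (simp add: power_mult_distrib power_divide)
   also have "... \<le> s\<^sup>2 * qform B v / 2"
    using spec(1)[OF v] by (intro divide_right_mono mult_left_mono) auto
   also have "... \<le> (vec_l2 (X *\<^sub>v v))\<^sup>2" using half[OF v] Xn[OF v] by simp
   finally show "(lo * s / sqrt 2 * vec_l2 v)\<^sup>2 \<le> (vec_l2 (X *\<^sub>v v))\<^sup>2" .
  qed simp
  define V where "V = psd_inv_sqrt A"
  have los: "0 < lo * s / sqrt 2" using lo s by simp
  note V = psd_inv_sqrt_props[OF A los Xlo[unfolded X_def], folded X_def V_def]
  have XV: "X *\<^sub>v (V *\<^sub>v u) = u" if u: "u \<in> carrier_vec n" for u
   using assoc_mult_mat_vec[OF X(1) V(1) u] V(2) u by simp
  define D where "D = A - of_real (s\<^sup>2) \<cdot>\<^sub>m B"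
  have D: "D \<in> carrier_mat n n" using A B by (auto simp: D_def)
  have Dv: "(D *\<^sub>v v) \<bullet>c w = (A *\<^sub>v v) \<bullet>c w - of_real (s\<^sup>2) * ((B *\<^sub>v v) \<bullet>c w)"
   if v: "v \<in> carrier_vec n" and w: "w \<in> carrier_vec n" for v w
  proof -
   have "D *\<^sub>v v = A *\<^sub>v v - of_real (s\<^sup>2) \<cdot>\<^sub>v (B *\<^sub>v v)"
    unfolding D_def using A B v
    by (subst minus_mult_distrib_mat_vec[of _ n n]) (auto simp: smult_mat_mult_vec[of _ n n])
   moreover have "A *\<^sub>v v \<in> carrier_vec n" "B *\<^sub>v v \<in> carrier_vec n" using A B v by auto
   ultimately show ?thesis using w A B
    by (simp add: cscalar_sum[of _ n] sum_subtractf sum_distrib_left algebra_simps del: index_mult_mat_vec)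
  qed
  have hD: "mat_adjoint D = D"
  proof (rule eq_matI)
   fix i j assume "i < dim_row D" "j < dim_col D"
   then have ij: "i < n" "j < n" using D by auto
   have "A $$ (i, j) = cnj (A $$ (j, i))" "B $$ (i, j) = cnj (B $$ (j, i))"
    using adjoint_index[OF A(2) ij] adjoint_index[OF B(2) ij] psdD(1)[OF A] psdD(1)[OF B] by auto
   then show "mat_adjoint D $$ (i, j) = D $$ (i, j)"
    using ij A B by (simp add: adjoint_index[OF D], simp add: D_def)
  qed (use D in \<open>auto simp: mat_adjoint_def\<close>)
  define G where "G = V * (D * W)"
  have G: "G \<in> carrier_mat n n" unfolding G_def using V W D by (meson mult_carrier_mat)
  have Gb: "vec_l2 (G *\<^sub>v v) \<le> 2 * s * e * vec_l2 v" if v: "v \<in> carrier_vec n" for v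
  proof (cases "vec_l2 v = 0 \<or> vec_l2 (G *\<^sub>v v) = 0")
   case True
   then show ?thesis
   proof
    assume "vec_l2 v = 0"
    then have "v = 0\<^sub>v n" using v vec_l2_eq_0 by blast
    then show ?thesis using G by (simp add: mult_mat_zero_vec)
   qed (use s e in auto)
  next
   case False
   define g where "g = G *\<^sub>v v"
   have gc: "g \<in> carrier_vec n" using G v by (auto simp: g_def)
   have Wv: "W *\<^sub>v v \<in> carrier_vec n" and Vg: "V *\<^sub>v g \<in> carrier_vec n" using W V v gc by auto
   have pos: "0 < vec_l2 v" "0 < vec_l2 g" using False by (auto simp: g_def order_less_le)
   have hX: "mat_adjoint X = X" using psdD X by blast
   have "X *\<^sub>v (V *\<^sub>v g) = g" using V X gc by (simp flip: assoc_mult_mat_vec[of _ n n _ n])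
   moreover have "X *\<^sub>v g = D *\<^sub>v (W *\<^sub>v v)"
   proof -
    have "X *\<^sub>v g = X *\<^sub>v (V *\<^sub>v (D *\<^sub>v (W *\<^sub>v v)))"
     unfolding g_def G_def using V D W v
     by (simp add: assoc_mult_mat_vec[of _ n n _ n] mult_mat_vec_carrier[of _ n n])
    then show ?thesis using XV D Wv by simp
   qed
   ultimately have "g \<bullet>c g = (D *\<^sub>v (W *\<^sub>v v)) \<bullet>c (V *\<^sub>v g)"
    using adjoint_swap[OF X(1) gc Vg] hX by simp
   moreover have "Re ((D *\<^sub>v (W *\<^sub>v v)) \<bullet>c (V *\<^sub>v g)) \<le> e * (s * vec_l2 v) * (sqrt 2 * vec_l2 g)"
   proof (rule dominated_form_cauchy_schwarz[where B = "of_real (s\<^sup>2) \<cdot>\<^sub>m B" and n = n])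
    have sB: "((of_real (s\<^sup>2) \<cdot>\<^sub>m B) *\<^sub>v v) \<bullet>c w = of_real (s\<^sup>2) * ((B *\<^sub>v v) \<bullet>c w)"
     if v: "v \<in> carrier_vec n" and w: "w \<in> carrier_vec n" for v w
    proof -
     have "B *\<^sub>v v \<in> carrier_vec n" using B v by auto
     then show ?thesis using B v w by (simp add: smult_mat_mult_vec[of _ n n])
    qed
    show "of_real (s\<^sup>2) \<cdot>\<^sub>m B \<in> carrier_mat n n" using B by simp
    show "psd (of_real (s\<^sup>2) \<cdot>\<^sub>m B)"
    proof -
     have "mat_adjoint (of_real (s\<^sup>2) \<cdot>\<^sub>m B) = of_real (s\<^sup>2) \<cdot>\<^sub>m B"
     proof (rule eq_matI)
      fix i j assume "i < dim_row (complex_of_real (s\<^sup>2) \<cdot>\<^sub>m B)" "j < dim_col (complex_of_real (s\<^sup>2) \<cdot>\<^sub>m B)"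
      then have ij: "i < n" "j < n" using B by auto
      have sBc: "complex_of_real (s\<^sup>2) \<cdot>\<^sub>m B \<in> carrier_mat n n" using B by simp
      have "B $$ (i, j) = cnj (B $$ (j, i))"
       using adjoint_index[OF B(2) ij] psdD(1)[OF B] by auto
      then show "mat_adjoint (complex_of_real (s\<^sup>2) \<cdot>\<^sub>m B) $$ (i, j) = (complex_of_real (s\<^sup>2) \<cdot>\<^sub>m B) $$ (i, j)"
       unfolding adjoint_index[OF sBc ij] using ij B by simp
     qed (use B in \<open>auto simp: mat_adjoint_def\<close>)
     moreover have "0 \<le> qform ((of_real (s\<^sup>2) \<cdot>\<^sub>m B)) v" if "v \<in> carrier_vec n" for v
      using sB[OF that that] psdD(2)[OF B that] by (simp del: of_real_power)
     ultimately show ?thesis using B by (auto simp: psd_def)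
    qed
    show "\<bar>qform D v\<bar> \<le> e * qform (of_real (s\<^sup>2) \<cdot>\<^sub>m B) v" if "v \<in> carrier_vec n" for v
     unfolding sB[OF that that] Dv[OF that that] using rel[OF that] by (simp del: of_real_power)
    have "Y *\<^sub>v (W *\<^sub>v v) = v" using W Y v by (simp flip: assoc_mult_mat_vec[of _ n n _ n])
    then show "qform (of_real (s\<^sup>2) \<cdot>\<^sub>m B) (W *\<^sub>v v) \<le> (s * vec_l2 v)\<^sup>2"
     unfolding sB[OF Wv Wv] using Yn[OF Wv] by (simp add: power_mult_distrib del: of_real_power)
    show "qform (of_real (s\<^sup>2) \<cdot>\<^sub>m B) (V *\<^sub>v g) \<le> (sqrt 2 * vec_l2 g)\<^sup>2"
     unfolding sB[OF Vg Vg] using half[OF Vg] Xn[OF Vg] \<open>X *\<^sub>v (V *\<^sub>v g) = g\<close>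
     by (simp add: power_mult_distrib del: of_real_power)
   qed (use D hD e Wv Vg pos s in auto)
   ultimately have "(vec_l2 g)\<^sup>2 \<le> e * (s * vec_l2 v) * (sqrt 2 * vec_l2 g)"
    using arg_cong[OF cscalar_self[OF gc], of Re] by (simp del: of_real_power)
   then have "vec_l2 g \<le> sqrt 2 * (e * s * vec_l2 v)"
    using pos by (simp add: power2_eq_square mult_ac)
   also have "... \<le> 2 * (e * s * vec_l2 v)"
    using e s by (intro mult_right_mono) (auto intro: real_le_lsqrt)
   finally show ?thesis by (simp add: g_def mult_ac)
  qed
  define P where "P = X * W - of_real s \<cdot>\<^sub>m 1\<^sub>m n"
  have XW: "X * W \<in> carrier_mat n n" using X W by (meson mult_carrier_mat)
  have P: "P \<in> carrier_mat n n" unfolding P_def by (intro minus_carrier_mat) simp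
  have Pv: "P *\<^sub>v v = X *\<^sub>v (W *\<^sub>v v) - of_real s \<cdot>\<^sub>v v" if v: "v \<in> carrier_vec n" for v
   unfolding P_def using X W XW v
   by (simp add: minus_mult_distrib_mat_vec[of _ n n] smult_mat_mult_vec[of _ n n] assoc_mult_mat_vec[of _ n n _ n])
  have syl: "X *\<^sub>v (P *\<^sub>v w) + of_real s \<cdot>\<^sub>v (P *\<^sub>v (Y *\<^sub>v w)) = X *\<^sub>v (G *\<^sub>v w)" if w: "w \<in> carrier_vec n" for w
  proof -
   have Ww: "W *\<^sub>v w \<in> carrier_vec n" and Yw: "Y *\<^sub>v w \<in> carrier_vec n" using W Y w by auto
   have c1: "X *\<^sub>v (W *\<^sub>v w) \<in> carrier_vec n" "X *\<^sub>v w \<in> carrier_vec n" "A *\<^sub>v (W *\<^sub>v w) \<in> carrier_vec n"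
    using X A Ww w by auto
   have WY: "W *\<^sub>v (Y *\<^sub>v w) = w" using W Y w by (simp flip: assoc_mult_mat_vec[of _ n n _ n])
   have XX: "X *\<^sub>v (X *\<^sub>v (W *\<^sub>v w)) = A *\<^sub>v (W *\<^sub>v w)" using X Ww by (simp flip: assoc_mult_mat_vec[of _ n n _ n])
   have YW: "Y *\<^sub>v w = B *\<^sub>v (W *\<^sub>v w)"
   proof -
    have "B *\<^sub>v (W *\<^sub>v w) = Y *\<^sub>v (Y *\<^sub>v (W *\<^sub>v w))"
     unfolding Y(3)[symmetric] by (rule assoc_mult_mat_vec[OF Y(1) Y(1) Ww])
    also have "Y *\<^sub>v (W *\<^sub>v w) = w"
     using assoc_mult_mat_vec[OF Y(1) W(1) w] W(2) w by simp
    finally show ?thesis by simp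
   qed
   have XG: "X *\<^sub>v (G *\<^sub>v w) = D *\<^sub>v (W *\<^sub>v w)"
   proof -
    have "X *\<^sub>v (G *\<^sub>v w) = X *\<^sub>v (V *\<^sub>v (D *\<^sub>v (W *\<^sub>v w)))"
     unfolding G_def using V D W w
     by (simp add: assoc_mult_mat_vec[of _ n n _ n] mult_mat_vec_carrier[of _ n n])
    then show ?thesis using XV D Ww by simp
   qed
   have Dw: "D *\<^sub>v (W *\<^sub>v w) = A *\<^sub>v (W *\<^sub>v w) - of_real (s\<^sup>2) \<cdot>\<^sub>v (B *\<^sub>v (W *\<^sub>v w))"
    unfolding D_def using A B Ww
    by (subst minus_mult_distrib_mat_vec[of _ n n]) (auto simp: smult_mat_mult_vec[of _ n n])
   have XP: "X *\<^sub>v (P *\<^sub>v w) = A *\<^sub>v (W *\<^sub>v w) - of_real s \<cdot>\<^sub>v (X *\<^sub>v w)"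
    unfolding Pv[OF w] using X(1) c1 w
    by (simp add: mult_minus_distrib_mat_vec[of _ n n] mult_mat_vec[of _ n n] XX)
   have PY: "P *\<^sub>v (Y *\<^sub>v w) = X *\<^sub>v w - of_real s \<cdot>\<^sub>v (Y *\<^sub>v w)" unfolding Pv[OF Yw] WY ..
   show ?thesis unfolding XG Dw XP PY YW[symmetric]
    using c1 Yw X(1) Y(1) A(2) by (intro eq_vecI) (auto simp: algebra_simps power2_eq_square simp del: index_mult_mat_vec)
  qed
  have bound: "vec_l2 (P *\<^sub>v v) \<le> 6 * s * e * real K" if v: "v \<in> carrier_vec n" "vec_l2 v \<le> 1" for v
  proof -
   have "vec_l2 (P *\<^sub>v v) \<le> 3 * (2 * s * e) * real K * vec_l2 v"
    by (rule sylvester_bound[OF X(2,1) P Y(2,1) G s lo Ylo Yhi K(1) syl _ Gb v(1)]) (use s e in auto)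
   also have "... \<le> 3 * (2 * s * e) * real K * 1" using v(2) s e by (intro mult_left_mono) auto
   finally show ?thesis by simp
  qed
  have "op_norm P \<le> 6 * s * e * real K"
   unfolding op_norm_def using P bound
   by (intro cSUP_least) (auto intro!: exI[of _ "0\<^sub>v n"])
  moreover have "0 \<le> op_norm P"
  proof -
   have "vec_l2 (P *\<^sub>v 0\<^sub>v n) \<le> op_norm P"
    unfolding op_norm_def
   proof (rule cSUP_upper)
    show "bdd_above ((\<lambda>v. vec_l2 (P *\<^sub>v v)) ` {v \<in> carrier_vec (dim_col P). vec_l2 v \<le> 1})"
     using P bound by (intro bdd_aboveI2[of _ _ "6 * s * e * real K"]) auto
   qed (use P in auto)
   then show ?thesis by (meson order_trans vec_l2_nonneg)
  qed
  ultimately show ?thesis by (auto simp: P_def X_def W_def)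
qed

section \<open>Even moments of martingale sums\<close>

lemma mixed_power_le:
  fixes s d :: real
  assumes "k \<le> p"
  shows "\<bar>s\<bar> ^ (p - k) * \<bar>d\<bar> ^ k \<le> \<bar>s\<bar> ^ p + \<bar>d\<bar> ^ p"
proof -
  have p: "\<bar>x\<bar> ^ (p - k) * \<bar>x\<bar> ^ k = \<bar>x\<bar> ^ p" for x :: real
   using assms by (simp flip: power_add)
  show ?thesis
  proof (cases "\<bar>s\<bar> \<le> \<bar>d\<bar>")
   case True
   then have "\<bar>s\<bar> ^ (p - k) * \<bar>d\<bar> ^ k \<le> \<bar>d\<bar> ^ (p - k) * \<bar>d\<bar> ^ k"
    by (intro mult_right_mono power_mono) auto
   then show ?thesis unfolding p by (rule order_trans) simp
  next
   case False
   then have "\<bar>s\<bar> ^ (p - k) * \<bar>d\<bar> ^ k \<le> \<bar>s\<bar> ^ (p - k) * \<bar>s\<bar> ^ k"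
    by (intro mult_left_mono power_mono) auto
   then show ?thesis unfolding p by (rule order_trans) simp
  qed
qed

lemma power_add_le_max:
  fixes x y :: real
  assumes "0 \<le> x" "0 \<le> y"
  shows "(x + y) ^ p \<le> 2 ^ p * (x ^ p + y ^ p)"
proof -
  have "(x + y) ^ p \<le> (2 * max x y) ^ p" using assms by (intro power_mono) auto
  also have "... = 2 ^ p * max x y ^ p" by (rule power_mult_distrib)
  also have "max x y ^ p \<le> x ^ p + y ^ p" using assms by (auto simp: max_def)
  finally show ?thesis by simp
qed

text \<open>Taylor's formula of second order for an even power, with a remainder in which the two
  extreme terms dominate all others.\<close>

lemma even_power_add_le:
  fixes s d :: real
  assumes q: "1 \<le> q"
  shows "(s + d) ^ (2 * q) \<le> s ^ (2 * q) + 2 * real q * (s ^ (2 * q - 1) * d)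
       + 4 ^ q * (s ^ (2 * q - 2) * d\<^sup>2 + d ^ (2 * q))"
proof -
  define t where "t k = real (2 * q choose k) * d ^ k * s ^ (2 * q - k)" for k
  define p where "p = 2 * q - 2"
  have p: "2 * q = Suc (Suc p)" using q by (simp add: p_def)
  have "even p" by (simp add: p_def)
  have ev: "s ^ p = \<bar>s\<bar> ^ p" "d ^ p = \<bar>d\<bar> ^ p" using \<open>even p\<close> by (simp_all add: power_even_abs)
  have "(d + s) ^ (2 * q) = (\<Sum>k\<le>2 * q. t k)" unfolding t_def by (rule binomial_ring)
  also have "... = t 0 + t 1 + (\<Sum>k\<le>p. t (Suc (Suc k)))"
   unfolding p by (simp only: sum.atMost_Suc_shift) simp
  also have "(\<Sum>k\<le>p. t (Suc (Suc k))) \<le> (\<Sum>k\<le>p. real (2 * q choose Suc (Suc k)) * (s ^ p * d\<^sup>2 + d ^ (2 * q)))"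
  proof (rule sum_mono)
   fix k assume "k \<in> {..p}"
   then have k: "k \<le> p" by simp
   have "d ^ Suc (Suc k) * s ^ (2 * q - Suc (Suc k)) \<le> \<bar>d ^ Suc (Suc k) * s ^ (2 * q - Suc (Suc k))\<bar>" by simp
   also have "... = (\<bar>s\<bar> ^ (p - k) * \<bar>d\<bar> ^ k) * d\<^sup>2"
   proof -
    have "2 * q - Suc (Suc k) = p - k" unfolding p by simp
    then have "\<bar>d ^ Suc (Suc k) * s ^ (2 * q - Suc (Suc k))\<bar> = (\<bar>s\<bar> ^ (p - k) * \<bar>d\<bar> ^ k) * (\<bar>d\<bar> * \<bar>d\<bar>)"
     by (simp add: abs_mult power_abs)
    then show ?thesis by (simp only: abs_mult_self_eq power2_eq_square)
   qed
   also have "... \<le> (\<bar>s\<bar> ^ p + \<bar>d\<bar> ^ p) * d\<^sup>2" by (intro mult_right_mono mixed_power_le k) auto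
   also have "... = s ^ p * d\<^sup>2 + d ^ (2 * q)"
    unfolding p ev[symmetric] by (simp add: algebra_simps power2_eq_square)
   finally have "d ^ Suc (Suc k) * s ^ (2 * q - Suc (Suc k)) \<le> s ^ p * d\<^sup>2 + d ^ (2 * q)" .
   then show "t (Suc (Suc k)) \<le> real (2 * q choose Suc (Suc k)) * (s ^ p * d\<^sup>2 + d ^ (2 * q))"
    unfolding t_def mult.assoc by (intro mult_left_mono) auto
  qed
  also have "... = (\<Sum>k\<le>p. real (2 * q choose Suc (Suc k))) * (s ^ p * d\<^sup>2 + d ^ (2 * q))"
   by (simp add: sum_distrib_right)
  also have "... \<le> 4 ^ q * (s ^ p * d\<^sup>2 + d ^ (2 * q))"
  proof (rule mult_right_mono)
   have "(\<Sum>k\<le>p. (2 * q choose Suc (Suc k))) \<le> (\<Sum>k\<le>2 * q. (2 * q choose k))"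
    unfolding p by (simp only: sum.atMost_Suc_shift)
   also have "... = 4 ^ q" by (simp add: choose_row_sum power_mult)
   finally have "real (\<Sum>k\<le>p. (2 * q choose Suc (Suc k))) \<le> real (4 ^ q)" by (rule of_nat_mono)
   then show "(\<Sum>k\<le>p. real (2 * q choose Suc (Suc k))) \<le> 4 ^ q" by simp
   have "0 \<le> s ^ p" "0 \<le> d ^ (2 * q)" using \<open>even p\<close> by (auto simp: zero_le_even_power)
   then show "0 \<le> s ^ p * d\<^sup>2 + d ^ (2 * q)" by simp
  qed
  also have "t 0 = s ^ (2 * q)" by (simp add: t_def)
  also have "t 1 = 2 * real q * (s ^ (2 * q - 1) * d)" by (simp add: t_def)
  finally show ?thesis unfolding p_def add.commute[of d s] by simp
qed

context prob_space
begin

lemma even_power_of_sum_integrable: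
  fixes D :: "nat \<Rightarrow> 'a \<Rightarrow> real"
  assumes "\<And>k. k < N \<Longrightarrow> D k \<in> borel_measurable M" "\<And>k. k < N \<Longrightarrow> integrable M (\<lambda>\<omega>. D k \<omega> ^ (2 * q))"
  shows "integrable M (\<lambda>\<omega>. (\<Sum>k<N. D k \<omega>) ^ (2 * q))"
  using assms
proof (induction N)
  case 0
  then show ?case by (simp add: power_0_left)
next
  case (Suc n)
  have [measurable]: "(\<lambda>\<omega>. \<Sum>k<n. D k \<omega>) \<in> borel_measurable M" "D n \<in> borel_measurable M"
   using Suc.prems(1) by (auto intro!: borel_measurable_sum)
  show ?case
  proof (rule Bochner_Integration.integrable_bound)
   show "integrable M (\<lambda>\<omega>. 2 ^ (2 * q) * ((\<Sum>k<n. D k \<omega>) ^ (2 * q) + D n \<omega> ^ (2 * q)))"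
    using Suc by auto
   show "(\<lambda>\<omega>. (\<Sum>k<Suc n. D k \<omega>) ^ (2 * q)) \<in> borel_measurable M" by simp
   show "AE \<omega> in M. norm ((\<Sum>k<Suc n. D k \<omega>) ^ (2 * q)) \<le> norm (2 ^ (2 * q) * ((\<Sum>k<n. D k \<omega>) ^ (2 * q) + D n \<omega> ^ (2 * q)))"
   proof (rule AE_I2)
    fix \<omega>
    define s where "s = (\<Sum>k<n. D k \<omega>)"
    have "\<bar>s + D n \<omega>\<bar> ^ (2 * q) \<le> (\<bar>s\<bar> + \<bar>D n \<omega>\<bar>) ^ (2 * q)" by (intro power_mono) auto
    also have "... \<le> 2 ^ (2 * q) * (\<bar>s\<bar> ^ (2 * q) + \<bar>D n \<omega>\<bar> ^ (2 * q))" by (rule power_add_le_max) auto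
    finally show "norm ((\<Sum>k<Suc n. D k \<omega>) ^ (2 * q)) \<le> norm (2 ^ (2 * q) * ((\<Sum>k<n. D k \<omega>) ^ (2 * q) + D n \<omega> ^ (2 * q)))"
     unfolding sum.lessThan_Suc s_def[symmetric] by (simp add: power_even_abs abs_mult)
   qed
  qed
qed

text \<open>A Marcinkiewicz--Zygmund inequality: the moments of a sum grow like those of a Gaussian of the
  same variance proxy, provided that each increment is orthogonal to the odd power of the preceding
  partial sum that appears in Taylor's formula. Martingale differences have this property.\<close>

lemma even_moment_of_sum_le:
  fixes D :: "nat \<Rightarrow> 'a \<Rightarrow> real"
  assumes q: "1 \<le> q" and m: "0 \<le> m"
   and D: "\<And>k. k < N \<Longrightarrow> D k \<in> borel_measurable M"
   and int: "\<And>k. k < N \<Longrightarrow> integrable M (\<lambda>\<omega>. D k \<omega> ^ (2 * q))"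
   and mom: "\<And>k. k < N \<Longrightarrow> expectation (\<lambda>\<omega>. D k \<omega> ^ (2 * q)) \<le> m * v k ^ q"
   and v: "\<And>k. k < N \<Longrightarrow> 0 \<le> v k"
   and orth: "\<And>k. k < N \<Longrightarrow> expectation (\<lambda>\<omega>. (\<Sum>j<k. D j \<omega>) ^ (2 * q - 1) * D k \<omega>) = 0"
  shows "expectation (\<lambda>\<omega>. (\<Sum>k<N. D k \<omega>) ^ (2 * q)) \<le> 2 * exp (4 ^ q) * m * (\<Sum>k<N. v k) ^ q"
proof -
  define S where "S n \<omega> = (\<Sum>k<n. D k \<omega>)" for n \<omega>
  have meas [measurable]: "S n \<in> borel_measurable M" if "n \<le> N" for n
   unfolding S_def using D that by (intro borel_measurable_sum) auto
  have S_int: "n \<le> N \<Longrightarrow> integrable M (\<lambda>\<omega>. S n \<omega> ^ (2 * q))" for n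
   unfolding S_def using D int by (intro even_power_of_sum_integrable) auto
  have step: "expectation (\<lambda>\<omega>. S (Suc n) \<omega> ^ (2 * q))
     \<le> expectation (\<lambda>\<omega>. S n \<omega> ^ (2 * q)) * (1 + 4 ^ q * (u n / V)) + 2 * 4 ^ q * (u n / V) * (m * V ^ q)"
   if n: "n < N" and u: "\<And>k. k < N \<Longrightarrow> 0 < u k" "\<And>k. k < N \<Longrightarrow> v k \<le> u k" "V = (\<Sum>k<N. u k)" for n u V
  proof -
   have V: "0 < V" "u n \<le> V"
   proof -
    show "u n \<le> V" unfolding u(3) using n u(1) by (intro member_le_sum) (auto intro: less_imp_le)
    then show "0 < V" using u(1)[OF n] by simp
   qed
   have dom: "integrable M (\<lambda>\<omega>. S n \<omega> ^ (2 * q) + D n \<omega> ^ (2 * q))" using S_int[of n] int[OF n] n by auto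
   have mixed: "integrable M (\<lambda>\<omega>. S n \<omega> ^ (2 * q - k) * D n \<omega> ^ k)" if "k \<le> 2 * q" for k
   proof (rule Bochner_Integration.integrable_bound[OF dom])
    show "AE \<omega> in M. norm (S n \<omega> ^ (2 * q - k) * D n \<omega> ^ k) \<le> norm (S n \<omega> ^ (2 * q) + D n \<omega> ^ (2 * q))"
     using mixed_power_le[OF that] by (intro AE_I2) (simp add: abs_mult power_abs power_even_abs)
   qed (use n meas[of n] D[OF n] in \<open>auto intro!: borel_measurable_times borel_measurable_power\<close>)
   have m1: "integrable M (\<lambda>\<omega>. S n \<omega> ^ (2 * q - 1) * D n \<omega>)" using mixed[of 1] q by simp
   have m2: "integrable M (\<lambda>\<omega>. S n \<omega> ^ (2 * q - 2) * (D n \<omega>)\<^sup>2)" using mixed[of 2] q by simp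
   note ints = S_int[of n] int[OF n] m1 m2
   have "expectation (\<lambda>\<omega>. S (Suc n) \<omega> ^ (2 * q)) \<le> expectation (\<lambda>\<omega>. S n \<omega> ^ (2 * q)
     + 2 * real q * (S n \<omega> ^ (2 * q - 1) * D n \<omega>)
     + 4 ^ q * (S n \<omega> ^ (2 * q - 2) * (D n \<omega>)\<^sup>2 + D n \<omega> ^ (2 * q)))"
   proof (rule integral_mono)
    show "integrable M (\<lambda>\<omega>. S (Suc n) \<omega> ^ (2 * q))" using S_int[of "Suc n"] n by simp
    show "S (Suc n) \<omega> ^ (2 * q) \<le> S n \<omega> ^ (2 * q) + 2 * real q * (S n \<omega> ^ (2 * q - 1) * D n \<omega>)
     + 4 ^ q * (S n \<omega> ^ (2 * q - 2) * (D n \<omega>)\<^sup>2 + D n \<omega> ^ (2 * q))" for \<omega>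
     using even_power_add_le[OF q] by (simp add: S_def)
   qed (use ints n in auto)
   also have "... = expectation (\<lambda>\<omega>. S n \<omega> ^ (2 * q))
     + 4 ^ q * (expectation (\<lambda>\<omega>. S n \<omega> ^ (2 * q - 2) * (D n \<omega>)\<^sup>2) + expectation (\<lambda>\<omega>. D n \<omega> ^ (2 * q)))"
    using ints n orth[OF n] by (simp add: S_def)
   also have "... \<le> expectation (\<lambda>\<omega>. S n \<omega> ^ (2 * q))
     + 4 ^ q * (u n / V * (expectation (\<lambda>\<omega>. S n \<omega> ^ (2 * q)) + m * V ^ q) + u n / V * (m * V ^ q))"
   proof (intro add_left_mono mult_left_mono add_mono)
    \<comment> \<open>Young's inequality, scaled so that both terms carry the share \<open>u n / V\<close> of the total variance\<close>
    have young: "S n \<omega> ^ (2 * q - 2) * (D n \<omega>)\<^sup>2 \<le> u n / V * (S n \<omega> ^ (2 * q) + (V / u n) ^ q * D n \<omega> ^ (2 * q))" for \<omega>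
    proof -
     define r where "r = sqrt (V / u n)"
     have r: "r\<^sup>2 = V / u n" using V u(1)[OF n] by (simp add: r_def)
     have "\<bar>S n \<omega>\<bar> ^ (2 * q - 2) * \<bar>r * D n \<omega>\<bar> ^ 2 \<le> \<bar>S n \<omega>\<bar> ^ (2 * q) + \<bar>r * D n \<omega>\<bar> ^ (2 * q)"
      by (rule mixed_power_le) (use q in simp)
     moreover have "\<bar>S n \<omega>\<bar> ^ (2 * q - 2) = S n \<omega> ^ (2 * q - 2)"
      by (rule power_even_abs) (use q in simp)
     moreover have "\<bar>r * D n \<omega>\<bar> ^ (2 * q) = (V / u n) ^ q * D n \<omega> ^ (2 * q)"
      by (simp add: power_even_abs power_mult_distrib power_mult r power_divide)
     ultimately have "S n \<omega> ^ (2 * q - 2) * (V / u n * (D n \<omega>)\<^sup>2) \<le> S n \<omega> ^ (2 * q) + (V / u n) ^ q * D n \<omega> ^ (2 * q)"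
      by (simp add: power_even_abs power_mult_distrib r)
     from mult_left_mono[OF this, of "u n / V"] show ?thesis using V u(1)[OF n] by (simp add: field_simps)
    qed
    have "expectation (\<lambda>\<omega>. S n \<omega> ^ (2 * q - 2) * (D n \<omega>)\<^sup>2)
      \<le> expectation (\<lambda>\<omega>. u n / V * (S n \<omega> ^ (2 * q) + (V / u n) ^ q * D n \<omega> ^ (2 * q)))"
     by (rule integral_mono) (use ints n young in auto)
    also have "... = u n / V * (expectation (\<lambda>\<omega>. S n \<omega> ^ (2 * q)) + (V / u n) ^ q * expectation (\<lambda>\<omega>. D n \<omega> ^ (2 * q)))"
     using ints n by simp
    also have "... \<le> u n / V * (expectation (\<lambda>\<omega>. S n \<omega> ^ (2 * q)) + (V / u n) ^ q * (m * u n ^ q))"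
    proof -
     have "expectation (\<lambda>\<omega>. D n \<omega> ^ (2 * q)) \<le> m * u n ^ q"
      using mom[OF n] mult_left_mono[OF power_mono[OF u(2)[OF n] v[OF n]] m] by (rule order_trans)
     then show ?thesis using V u(1)[OF n] by (intro mult_left_mono add_mono) (auto intro: less_imp_le)
    qed
    also have "(V / u n) ^ q * (m * u n ^ q) = m * V ^ q"
     using u(1)[OF n] by (simp add: power_divide)
    finally show "expectation (\<lambda>\<omega>. S n \<omega> ^ (2 * q - 2) * (D n \<omega>)\<^sup>2)
      \<le> u n / V * (expectation (\<lambda>\<omega>. S n \<omega> ^ (2 * q)) + m * V ^ q)" .
    have "expectation (\<lambda>\<omega>. D n \<omega> ^ (2 * q)) \<le> m * u n ^ q"
     using mom[OF n] mult_left_mono[OF power_mono[OF u(2)[OF n] v[OF n]] m] by (rule order_trans)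
    also have "u n ^ q = u n * u n ^ (q - 1)" using q by (cases q) auto
    also have "m * (u n * u n ^ (q - 1)) \<le> m * (u n * V ^ (q - 1))"
     using u(1)[OF n] V m by (intro mult_left_mono power_mono) auto
    also have "... = u n / V * (m * V ^ q)" using q V by (cases q) auto
    finally show "expectation (\<lambda>\<omega>. D n \<omega> ^ (2 * q)) \<le> u n / V * (m * V ^ q)" .
   qed auto
   finally show ?thesis by (simp add: algebra_simps)
  qed
  have bound: "expectation (\<lambda>\<omega>. S N \<omega> ^ (2 * q)) \<le> 2 * exp (4 ^ q) * m * (\<Sum>k<N. u k) ^ q"
   if u: "\<And>k. k < N \<Longrightarrow> 0 < u k" "\<And>k. k < N \<Longrightarrow> v k \<le> u k" for u
  proof (cases "N = 0")
   case True
   then show ?thesis using q m by (simp add: S_def power_0_left)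
  next
   case False
   define V where "V = (\<Sum>k<N. u k)"
   have V: "0 < V" unfolding V_def using u(1) False by (intro sum_pos) auto
   have mV: "0 \<le> m * V ^ q" using m V by simp
   have "n \<le> N \<Longrightarrow> expectation (\<lambda>\<omega>. S n \<omega> ^ (2 * q)) \<le> 2 * (m * V ^ q) * (exp (4 ^ q * (\<Sum>k<n. u k / V)) - 1)" for n
   proof (induction n)
    case 0
    then show ?case using q by (simp add: S_def power_0_left)
   next
    case (Suc n)
    define w where "w = 4 ^ q * (u n / V)"
    define E where "E = exp (4 ^ q * (\<Sum>k<n. u k / V))"
    have w: "0 \<le> w" using u(1)[of n] Suc.prems V by (auto simp: w_def intro: less_imp_le)
    have "expectation (\<lambda>\<omega>. S (Suc n) \<omega> ^ (2 * q)) \<le> expectation (\<lambda>\<omega>. S n \<omega> ^ (2 * q)) * (1 + w) + 2 * w * (m * V ^ q)"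
     using step[OF _ u V_def, of n] Suc.prems by (simp add: w_def mult_ac)
    also have "... \<le> 2 * (m * V ^ q) * (E - 1) * (1 + w) + 2 * w * (m * V ^ q)"
     using Suc w by (intro add_right_mono mult_right_mono) (auto simp: E_def)
    also have "... = 2 * (m * V ^ q) * (E * (1 + w) - 1)" by (simp add: algebra_simps)
    also have "... \<le> 2 * (m * V ^ q) * (E * exp w - 1)"
     using mV by (intro mult_left_mono diff_right_mono) (auto simp: E_def exp_ge_add_one_self)
    also have "E * exp w = exp (4 ^ q * (\<Sum>k<Suc n. u k / V))"
     by (simp add: E_def w_def distrib_left exp_add)
    finally show ?case .
   qed
   from this[of N] have "expectation (\<lambda>\<omega>. S N \<omega> ^ (2 * q)) \<le> 2 * (m * V ^ q) * (exp (4 ^ q * (\<Sum>k<N. u k / V)) - 1)" by simp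
   also have "(\<Sum>k<N. u k / V) = 1" using V by (simp add: V_def flip: sum_divide_distrib)
   also have "2 * (m * V ^ q) * (exp (4 ^ q * 1) - 1) \<le> 2 * (m * V ^ q) * exp (4 ^ q)"
    using mV by (intro mult_left_mono) auto
   finally show ?thesis by (simp add: V_def mult_ac)
  qed
  have "((\<lambda>e. 2 * exp (4 ^ q) * m * (\<Sum>k<N. v k + e) ^ q) \<longlongrightarrow> 2 * exp (4 ^ q) * m * (\<Sum>k<N. v k + 0) ^ q) (at_right 0)"
   by (intro tendsto_intros)
  moreover have "\<forall>\<^sub>F e in at_right 0. expectation (\<lambda>\<omega>. S N \<omega> ^ (2 * q)) \<le> 2 * exp (4 ^ q) * m * (\<Sum>k<N. v k + e) ^ q"
   unfolding eventually_at_right_field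
   by (intro exI[of _ 1] conjI allI impI bound) (auto intro!: add_nonneg_pos v)
  ultimately have "expectation (\<lambda>\<omega>. S N \<omega> ^ (2 * q)) \<le> 2 * exp (4 ^ q) * m * (\<Sum>k<N. v k + 0) ^ q"
   by (rule tendsto_lowerbound) simp
  then show "expectation (\<lambda>\<omega>. (\<Sum>k<N. D k \<omega>) ^ (2 * q)) \<le> 2 * exp (4 ^ q) * m * (\<Sum>k<N. v k) ^ q"
   by (simp add: S_def)
qed

lemma integrable_lower_power:
  fixes S :: "'a \<Rightarrow> real"
  assumes [measurable]: "S \<in> borel_measurable M" and "integrable M (\<lambda>\<omega>. S \<omega> ^ (2 * q))" and "k \<le> 2 * q"
  shows "integrable M (\<lambda>\<omega>. \<bar>S \<omega>\<bar> ^ k)" "integrable M (\<lambda>\<omega>. S \<omega> ^ k)"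
proof -
  have dom: "integrable M (\<lambda>\<omega>. S \<omega> ^ (2 * q) + 1)" using assms by simp
  have le: "\<bar>S \<omega>\<bar> ^ k \<le> S \<omega> ^ (2 * q) + 1" for \<omega>
   using mixed_power_le[of "2 * q - k" "2 * q" "S \<omega>" 1] assms(3) by (simp add: power_even_abs)
  show "integrable M (\<lambda>\<omega>. \<bar>S \<omega>\<bar> ^ k)"
   by (rule Bochner_Integration.integrable_bound[OF dom]) (use le in \<open>auto intro!: AE_I2 simp: abs_le_iff intro: order_trans\<close>)
  show "integrable M (\<lambda>\<omega>. S \<omega> ^ k)"
   by (rule Bochner_Integration.integrable_bound[OF dom]) (use le in \<open>auto intro!: AE_I2 simp: power_abs intro: order_trans\<close>)
qed

lemma indep_past_present:
  fixes g :: "('i \<Rightarrow> 'b) \<Rightarrow> 'c :: {real_normed_field, banach, second_countable_topology}"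
  assumes ind: "indep_vars M' X I" and A: "A \<subseteq> I" "n \<in> I" "n \<notin> A"
   and g: "g \<in> borel_measurable (PiM A M')" and h: "h \<in> borel_measurable (M' n)"
   and gi: "integrable M (\<lambda>\<omega>. g (\<lambda>i\<in>A. X i \<omega>))" and hi: "integrable M (\<lambda>\<omega>. h (X n \<omega>))"
  shows "integrable M (\<lambda>\<omega>. g (\<lambda>i\<in>A. X i \<omega>) * h (X n \<omega>))"
   and "expectation (\<lambda>\<omega>. g (\<lambda>i\<in>A. X i \<omega>) * h (X n \<omega>)) =
    expectation (\<lambda>\<omega>. g (\<lambda>i\<in>A. X i \<omega>)) * expectation (\<lambda>\<omega>. h (X n \<omega>))"
proof -
  have "indep_var (PiM A M') (\<lambda>\<omega>. \<lambda>i\<in>A. X i \<omega>) (PiM {n} M') (\<lambda>\<omega>. \<lambda>i\<in>{n}. X i \<omega>)"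
   using ind A by (intro indep_var_restrict[where I = I]) auto
  then have "indep_var borel (g \<circ> (\<lambda>\<omega>. \<lambda>i\<in>A. X i \<omega>)) borel ((\<lambda>f. h (f n)) \<circ> (\<lambda>\<omega>. \<lambda>i\<in>{n}. X i \<omega>))"
  proof (rule indep_var_compose[OF _ g])
   show "(\<lambda>f. h (f n)) \<in> borel_measurable (Pi\<^sub>M {n} M')"
    using measurable_compose[OF measurable_component_singleton[of n "{n}" M'] h] by simp
  qed
  then have iv: "indep_var borel (\<lambda>\<omega>. g (\<lambda>i\<in>A. X i \<omega>)) borel (\<lambda>\<omega>. h (X n \<omega>))"
   by (simp add: comp_def)
  show "integrable M (\<lambda>\<omega>. g (\<lambda>i\<in>A. X i \<omega>) * h (X n \<omega>))" by (rule indep_var_integrable[OF iv gi hi])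
  show "expectation (\<lambda>\<omega>. g (\<lambda>i\<in>A. X i \<omega>) * h (X n \<omega>)) =
    expectation (\<lambda>\<omega>. g (\<lambda>i\<in>A. X i \<omega>)) * expectation (\<lambda>\<omega>. h (X n \<omega>))"
   by (rule indep_var_lebesgue_integral[OF iv gi hi])
qed

end

section \<open>Quadratic forms in independent coordinates\<close>

definition centred_form :: "nat \<Rightarrow> (nat \<Rightarrow> nat \<Rightarrow> complex) \<Rightarrow> (nat \<Rightarrow> complex) \<Rightarrow> real" where
  "centred_form M A z = Re (\<Sum>k<M. \<Sum>l<M. cnj (z k) * z l * A k l) - Re (\<Sum>k<M. A k k)"

lemma cnj_measurable [measurable]: "cnj \<in> borel_measurable borel"
  by (intro borel_measurable_continuous_onI continuous_intros)

lemma cmod_power_le_Re_Im: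
  "cmod z ^ (2 * q) \<le> 2 ^ q * (Re z ^ (2 * q) + Im z ^ (2 * q))"
proof -
  have "cmod z ^ (2 * q) = ((Re z)\<^sup>2 + (Im z)\<^sup>2) ^ q" by (simp add: power_mult cmod_power2)
  also have "... \<le> 2 ^ q * (((Re z)\<^sup>2) ^ q + ((Im z)\<^sup>2) ^ q)" by (rule power_add_le_max) auto
  finally show ?thesis by (simp add: power_mult)
qed

context prob_space
begin

lemma indep_past_present_lessThan:
  fixes g :: "(nat \<Rightarrow> 'b :: topological_space) \<Rightarrow> 'c :: {real_normed_field, banach, second_countable_topology}"
  assumes ind: "indep_vars (\<lambda>_. borel) X {..<N}" and n: "n < N"
   and g: "g \<in> borel_measurable (PiM {..<n} (\<lambda>_. borel))" and h: "h \<in> borel_measurable borel"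
   and G: "\<And>\<omega>. g (\<lambda>i\<in>{..<n}. X i \<omega>) = G \<omega>"
   and gi: "integrable M G" and hi: "integrable M (\<lambda>\<omega>. h (X n \<omega>))"
  shows "integrable M (\<lambda>\<omega>. G \<omega> * h (X n \<omega>))"
   and "expectation (\<lambda>\<omega>. G \<omega> * h (X n \<omega>)) = expectation G * expectation (\<lambda>\<omega>. h (X n \<omega>))"
proof -
  note * = indep_past_present[OF ind _ _ _ g h, unfolded G]
  show "integrable M (\<lambda>\<omega>. G \<omega> * h (X n \<omega>))" by (rule *(1)) (use n gi hi in auto)
  show "expectation (\<lambda>\<omega>. G \<omega> * h (X n \<omega>)) = expectation G * expectation (\<lambda>\<omega>. h (X n \<omega>))"
   by (rule *(2)) (use n gi hi in auto)
qed

lemma independent_linear_form_moments: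
  fixes X :: "nat \<Rightarrow> 'a \<Rightarrow> complex" and a :: "nat \<Rightarrow> complex"
  assumes ind: "indep_vars (\<lambda>_. borel) X {..<N}" and q: "1 \<le> q"
   and X0: "\<And>k. k < N \<Longrightarrow> expectation (X k) = 0"
   and Xi: "\<And>k. k < N \<Longrightarrow> integrable M (X k)"
   and Xq: "\<And>k. k < N \<Longrightarrow> integrable M (\<lambda>\<omega>. cmod (X k \<omega>) ^ (2 * q))"
   and Xm: "\<And>k. k < N \<Longrightarrow> expectation (\<lambda>\<omega>. cmod (X k \<omega>) ^ (2 * q)) \<le> m"
   and m: "0 \<le> m"
  shows "integrable M (\<lambda>\<omega>. cmod (\<Sum>k<N. a k * X k \<omega>) ^ (2 * q))"
   and "expectation (\<lambda>\<omega>. cmod (\<Sum>k<N. a k * X k \<omega>) ^ (2 * q))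
    \<le> 2 ^ q * (4 * exp (4 ^ q)) * m * (\<Sum>k<N. (cmod (a k))\<^sup>2) ^ q"
proof -
  have Xmeas [measurable]: "X k \<in> borel_measurable M" if "k < N" for k
   using ind that by (auto simp: indep_vars_def)
  have part: "integrable M (\<lambda>\<omega>. (\<Sum>k<N. r (a k * X k \<omega>)) ^ (2 * q)) \<and>
    expectation (\<lambda>\<omega>. (\<Sum>k<N. r (a k * X k \<omega>)) ^ (2 * q)) \<le> 2 * exp (4 ^ q) * m * (\<Sum>k<N. (cmod (a k))\<^sup>2) ^ q"
   if r: "bounded_linear r" "\<And>z. \<bar>r z\<bar> \<le> cmod z" for r :: "complex \<Rightarrow> real"
  proof -
   have [measurable]: "r \<in> borel_measurable borel"
    using bounded_linear.continuous_on[OF r(1) continuous_on_id] by (intro borel_measurable_continuous_onI) auto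
   have D_meas: "(\<lambda>\<omega>. r (a k * X k \<omega>)) \<in> borel_measurable M" if "k < N" for k
    using Xmeas[OF that] by measurable
   have le: "r (a k * X k \<omega>) ^ (2 * q) \<le> cmod (a k) ^ (2 * q) * cmod (X k \<omega>) ^ (2 * q)" for k \<omega>
   proof -
    have "\<bar>r (a k * X k \<omega>)\<bar> ^ (2 * q) \<le> cmod (a k * X k \<omega>) ^ (2 * q)" by (intro power_mono r(2)) auto
    then show ?thesis by (simp add: power_even_abs norm_mult power_mult_distrib)
   qed
   have D_int: "integrable M (\<lambda>\<omega>. r (a k * X k \<omega>) ^ (2 * q))" if k: "k < N" for k
   proof (rule Bochner_Integration.integrable_bound)
    show "integrable M (\<lambda>\<omega>. cmod (a k) ^ (2 * q) * cmod (X k \<omega>) ^ (2 * q))" using Xq[OF k] by simp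
   qed (use le[of k] D_meas[OF k] in \<open>auto simp: power_even_abs\<close>)
   have "integrable M (\<lambda>\<omega>. (\<Sum>k<N. r (a k * X k \<omega>)) ^ (2 * q))"
    using D_int D_meas by (intro even_power_of_sum_integrable) auto
   moreover have "expectation (\<lambda>\<omega>. (\<Sum>k<N. r (a k * X k \<omega>)) ^ (2 * q)) \<le> 2 * exp (4 ^ q) * m * (\<Sum>k<N. (cmod (a k))\<^sup>2) ^ q"
   proof (rule even_moment_of_sum_le[OF q m])
   fix k assume k: "k < N"
   have "expectation (\<lambda>\<omega>. r (a k * X k \<omega>) ^ (2 * q)) \<le> expectation (\<lambda>\<omega>. cmod (a k) ^ (2 * q) * cmod (X k \<omega>) ^ (2 * q))"
    using D_int[OF k] Xq[OF k] le by (intro integral_mono) auto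
   also have "... \<le> cmod (a k) ^ (2 * q) * m" using Xm[OF k] by (simp add: mult_left_mono)
   finally show "expectation (\<lambda>\<omega>. r (a k * X k \<omega>) ^ (2 * q)) \<le> m * (cmod (a k))\<^sup>2 ^ q"
    by (simp add: mult.commute flip: power_mult)
   show "0 \<le> (cmod (a k))\<^sup>2" by simp
   define g where "g z = (\<Sum>j<k. r (a j * z j)) ^ (2 * q - 1)" for z :: "nat \<Rightarrow> complex"
   have g: "g \<in> borel_measurable (PiM {..<k} (\<lambda>_. borel))" unfolding g_def by measurable
   have gX: "g (\<lambda>i\<in>{..<k}. X i \<omega>) = (\<Sum>j<k. r (a j * X j \<omega>)) ^ (2 * q - 1)" for \<omega> by (simp add: g_def)
   have "integrable M (\<lambda>\<omega>. (\<Sum>j<k. r (a j * X j \<omega>)) ^ (2 * q))"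
    using D_int D_meas k by (intro even_power_of_sum_integrable) auto
   then have gi: "integrable M (\<lambda>\<omega>. g (\<lambda>i\<in>{..<k}. X i \<omega>))"
    unfolding gX by (rule integrable_lower_power(2)[rotated]) (use D_meas k in \<open>auto intro!: borel_measurable_sum\<close>)
   have "expectation (\<lambda>\<omega>. r (a k * X k \<omega>)) = r (expectation (\<lambda>\<omega>. a k * X k \<omega>))"
    using Xi[OF k] by (intro integral_bounded_linear[OF r(1)]) simp
   also have "... = 0" using X0[OF k] Xi[OF k] linear_0[OF bounded_linear.linear[OF r(1)]] by simp
   finally have h0: "expectation (\<lambda>\<omega>. r (a k * X k \<omega>)) = 0" .
   have hi: "integrable M (\<lambda>\<omega>. r (a k * X k \<omega>))"
    using Xi[OF k] by (intro integrable_bounded_linear[OF r(1)]) simp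
   show "expectation (\<lambda>\<omega>. (\<Sum>j<k. r (a j * X j \<omega>)) ^ (2 * q - 1) * r (a k * X k \<omega>)) = 0"
   proof -
    have "expectation (\<lambda>\<omega>. g (\<lambda>i\<in>{..<k}. X i \<omega>) * r (a k * X k \<omega>))
     = expectation (\<lambda>\<omega>. g (\<lambda>i\<in>{..<k}. X i \<omega>)) * expectation (\<lambda>\<omega>. r (a k * X k \<omega>))"
     by (rule indep_past_present(2)[OF ind _ _ _ g _ gi hi]) (use k in auto)
    then show ?thesis unfolding gX h0 by simp
   qed
   qed (use D_int D_meas in auto)
   ultimately show ?thesis ..
  qed
  have le: "cmod (\<Sum>k<N. a k * X k \<omega>) ^ (2 * q)
    \<le> 2 ^ q * ((\<Sum>k<N. Re (a k * X k \<omega>)) ^ (2 * q) + (\<Sum>k<N. Im (a k * X k \<omega>)) ^ (2 * q))" for \<omega>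
   using cmod_power_le_Re_Im[of "\<Sum>k<N. a k * X k \<omega>" q] by (simp only: Re_sum Im_sum)
  note re = part[OF bounded_linear_Re abs_Re_le_cmod] and im = part[OF bounded_linear_Im abs_Im_le_cmod]
  have dom: "integrable M (\<lambda>\<omega>. 2 ^ q * ((\<Sum>k<N. Re (a k * X k \<omega>)) ^ (2 * q) + (\<Sum>k<N. Im (a k * X k \<omega>)) ^ (2 * q)))"
   using re im by auto
  show int: "integrable M (\<lambda>\<omega>. cmod (\<Sum>k<N. a k * X k \<omega>) ^ (2 * q))"
   by (rule Bochner_Integration.integrable_bound[OF dom]) (use le in \<open>auto intro: order_trans\<close>)
  have "expectation (\<lambda>\<omega>. cmod (\<Sum>k<N. a k * X k \<omega>) ^ (2 * q)) \<le>
    expectation (\<lambda>\<omega>. 2 ^ q * ((\<Sum>k<N. Re (a k * X k \<omega>)) ^ (2 * q) + (\<Sum>k<N. Im (a k * X k \<omega>)) ^ (2 * q)))"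
   by (rule integral_mono[OF int dom le])
  also have "... = 2 ^ q * (expectation (\<lambda>\<omega>. (\<Sum>k<N. Re (a k * X k \<omega>)) ^ (2 * q)) + expectation (\<lambda>\<omega>. (\<Sum>k<N. Im (a k * X k \<omega>)) ^ (2 * q)))"
   using re im by simp
  also have "... \<le> 2 ^ q * (2 * exp (4 ^ q) * m * (\<Sum>k<N. (cmod (a k))\<^sup>2) ^ q + 2 * exp (4 ^ q) * m * (\<Sum>k<N. (cmod (a k))\<^sup>2) ^ q)"
   using re im by (intro mult_left_mono add_mono) auto
  finally show "expectation (\<lambda>\<omega>. cmod (\<Sum>k<N. a k * X k \<omega>) ^ (2 * q))
    \<le> 2 ^ q * (4 * exp (4 ^ q)) * m * (\<Sum>k<N. (cmod (a k))\<^sup>2) ^ q" by (simp add: algebra_simps)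
qed

text \<open>Adding the coordinate \<open>n\<close> changes the form by \<open>2 * Re (l * cnj (X n))\<close>, with \<open>l\<close> a linear form in the preceding
  coordinates, and by a multiple of the centred square of \<open>X n\<close>. These increments are orthogonal to the past, and their
  moments are governed by the squared norm of the \<open>n\<close>-th row up to the diagonal.\<close>

lemma independent_quadratic_form_moments:
  fixes X :: "nat \<Rightarrow> 'a \<Rightarrow> complex" and A :: "nat \<Rightarrow> nat \<Rightarrow> complex" and m :: "nat \<Rightarrow> real"
  assumes ind: "indep_vars (\<lambda>_. borel) X {..<N}" and q: "1 \<le> q"
   and X0: "\<And>k. k < N \<Longrightarrow> expectation (X k) = 0"
   and X1: "\<And>k. k < N \<Longrightarrow> expectation (\<lambda>\<omega>. (cmod (X k \<omega>))\<^sup>2) = 1"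
   and Xi: "\<And>k p. k < N \<Longrightarrow> integrable M (\<lambda>\<omega>. cmod (X k \<omega>) ^ p)"
   and Xm: "\<And>k p. k < N \<Longrightarrow> expectation (\<lambda>\<omega>. cmod (X k \<omega>) ^ p) \<le> m p"
   and m: "\<And>p. 0 \<le> m p"
   and A: "\<And>k l. k < N \<Longrightarrow> l < N \<Longrightarrow> A l k = cnj (A k l)"
  shows "integrable M (\<lambda>\<omega>. centred_form N A (\<lambda>k. X k \<omega>) ^ (2 * q))"
   and "expectation (\<lambda>\<omega>. centred_form N A (\<lambda>k. X k \<omega>) ^ (2 * q)) \<le>
    2 * exp (4 ^ q) * (16 ^ q * (2 ^ q * (4 * exp (4 ^ q)) * m (2 * q) * m (2 * q) + m (4 * q) + 1))
     * (\<Sum>k<N. \<Sum>l<N. (cmod (A k l))\<^sup>2) ^ q"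
   and "expectation (\<lambda>\<omega>. centred_form N A (\<lambda>k. X k \<omega>)) = 0"
proof -
  have Xmeas: "X k \<in> borel_measurable M" if "k < N" for k
   using ind that by (auto simp: indep_vars_def)
  define lf where "lf n z = (\<Sum>l<n. A n l * z l)" for n and z :: "nat \<Rightarrow> complex"
  define dd where "dd n z = Re (A n n) * ((cmod z)\<^sup>2 - 1)" for n z
  define D where "D n z = 2 * Re (lf n z * cnj (z n)) + dd n (z n)" for n z
  let ?X = "\<lambda>\<omega> k. X k \<omega>"
  have form_sum: "n \<le> N \<Longrightarrow> centred_form n A z = (\<Sum>k<n. D k z)" for n z
  proof (induction n)
   case 0
   then show ?case by (simp add: centred_form_def)
  next
   case (Suc n)
   define T where "T = (\<Sum>k<n. \<Sum>l<n. cnj (z k) * z l * A k l)"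
   have "(\<Sum>k<Suc n. \<Sum>l<Suc n. cnj (z k) * z l * A k l)
     = T + (\<Sum>k<n. cnj (z k) * z n * A k n) + (\<Sum>l<n. cnj (z n) * z l * A n l) + cnj (z n) * z n * A n n"
    by (simp add: T_def sum.distrib)
   moreover have "(\<Sum>k<n. cnj (z k) * z n * A k n) = cnj (lf n z * cnj (z n))"
    using A[of n] Suc.prems by (auto simp: lf_def sum_distrib_left sum_distrib_right mult_ac intro!: sum.cong)
   moreover have "(\<Sum>l<n. cnj (z n) * z l * A n l) = lf n z * cnj (z n)"
    by (auto simp: lf_def sum_distrib_left sum_distrib_right mult_ac intro!: sum.cong)
   moreover have "cnj (z n) * z n = of_real ((cmod (z n))\<^sup>2)"
    by (simp add: complex_norm_square mult.commute del: of_real_power)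
   ultimately have "Re (\<Sum>k<Suc n. \<Sum>l<Suc n. cnj (z k) * z l * A k l)
     = Re T + 2 * Re (lf n z * cnj (z n)) + (cmod (z n))\<^sup>2 * Re (A n n)" by (simp del: sum.lessThan_Suc of_real_power)
   then have "centred_form (Suc n) A z = centred_form n A z + D n z"
    unfolding centred_form_def T_def D_def dd_def by (simp add: algebra_simps del: sum.lessThan_Suc) simp
   then show ?case using Suc by simp
  qed
  have lf_meas: "lf n \<in> borel_measurable (PiM {..<n} (\<lambda>_. borel))" for n
   unfolding lf_def by measurable
  have lf_X: "lf n (\<lambda>i\<in>{..<n}. X i \<omega>) = lf n (?X \<omega>)" for n \<omega> by (simp add: lf_def)
  have lf_meas_X: "(\<lambda>\<omega>. lf n (?X \<omega>)) \<in> borel_measurable M" if "n < N" for n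
   unfolding lf_def using Xmeas that by (intro borel_measurable_sum borel_measurable_times) auto
  have D_meas: "(\<lambda>\<omega>. D n (?X \<omega>)) \<in> borel_measurable M" if n: "n < N" for n
  proof -
   have [measurable]: "(\<lambda>\<omega>. X n \<omega>) \<in> borel_measurable M" "(\<lambda>\<omega>. lf n (?X \<omega>)) \<in> borel_measurable M"
    using lf_meas_X[OF n] Xmeas[OF n] by auto
   show ?thesis unfolding D_def dd_def by measurable
  qed
  have X_int: "integrable M (X k)" if "k < N" for k
   using Xi[OF that, of 1] Xmeas[OF that] by (simp add: integrable_norm_iff)
  have lfq: "integrable M (\<lambda>\<omega>. cmod (lf n (?X \<omega>)) ^ (2 * q)) \<and>
    expectation (\<lambda>\<omega>. cmod (lf n (?X \<omega>)) ^ (2 * q))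
     \<le> 2 ^ q * (4 * exp (4 ^ q)) * m (2 * q) * (\<Sum>l<n. (cmod (A n l))\<^sup>2) ^ q" if n: "n < N" for n
  proof -
   have ind_n: "indep_vars (\<lambda>_. borel) X {..<n}" by (rule indep_vars_subset[OF ind]) (use n in auto)
   have k: "k < N" if "k < n" for k using that n by simp
   show ?thesis unfolding lf_def
    using independent_linear_form_moments[OF ind_n q X0[OF k] X_int[OF k] Xi[OF k] Xm[OF k] m] by blast
  qed
  have lf_int: "integrable M (\<lambda>\<omega>. lf n (?X \<omega>))" if "n < N" for n
   unfolding lf_def using X_int that by (auto intro!: Bochner_Integration.integrable_sum)
  define w where "w n = (\<Sum>l<Suc n. (cmod (A n l))\<^sup>2)" for n
  have w: "0 \<le> w n" for n unfolding w_def by (intro sum_nonneg) auto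
  define c where "c = 16 ^ q * (2 ^ q * (4 * exp (4 ^ q)) * m (2 * q) * m (2 * q) + m (4 * q) + 1)"
  have c: "0 \<le> c" unfolding c_def using m by (intro mult_nonneg_nonneg add_nonneg_nonneg) auto
  have dd_int: "integrable M (\<lambda>\<omega>. dd n (X n \<omega>)) \<and> expectation (\<lambda>\<omega>. dd n (X n \<omega>)) = 0" if n: "n < N" for n
   using Xi[OF n, of 2] X1[OF n] by (simp add: dd_def prob_space)
  have D_moment: "integrable M (\<lambda>\<omega>. D n (?X \<omega>) ^ (2 * q)) \<and> expectation (\<lambda>\<omega>. D n (?X \<omega>) ^ (2 * q)) \<le> c * w n ^ q"
   if n: "n < N" for n
  proof -
   define b where "b \<omega> = 16 ^ q * (cmod (lf n (?X \<omega>)) ^ (2 * q) * cmod (X n \<omega>) ^ (2 * q)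
     + (cmod (A n n))\<^sup>2 ^ q * (cmod (X n \<omega>) ^ (4 * q) + 1))" for \<omega>
   have le: "D n (?X \<omega>) ^ (2 * q) \<le> b \<omega>" for \<omega>
   proof -
    define l where "l = cmod (lf n (?X \<omega>))"
    define x where "x = cmod (X n \<omega>)"
    define a where "a = cmod (A n n)"
    have nn: "0 \<le> l" "0 \<le> x" "0 \<le> a" by (auto simp: l_def x_def a_def)
    have "\<bar>Re (lf n (?X \<omega>) * cnj (X n \<omega>))\<bar> \<le> l * x"
     unfolding l_def x_def by (metis abs_Re_le_cmod norm_mult complex_mod_cnj)
    moreover have "\<bar>dd n (X n \<omega>)\<bar> \<le> a * (x\<^sup>2 + 1)"
     unfolding dd_def abs_mult a_def x_def by (intro mult_mono abs_Re_le_cmod) (auto simp: abs_le_iff add_increasing)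
    ultimately have "\<bar>D n (?X \<omega>)\<bar> \<le> 2 * (l * x) + a * (x\<^sup>2 + 1)" unfolding D_def by linarith
    then have "\<bar>D n (?X \<omega>)\<bar> ^ (2 * q) \<le> (2 * (l * x) + a * (x\<^sup>2 + 1)) ^ (2 * q)" by (intro power_mono) auto
    also have "... \<le> 2 ^ (2 * q) * ((2 * (l * x)) ^ (2 * q) + (a * (x\<^sup>2 + 1)) ^ (2 * q))"
     using nn by (intro power_add_le_max) auto
    also have "... \<le> 2 ^ (2 * q) * ((2 * (l * x)) ^ (2 * q) + a ^ (2 * q) * (2 ^ (2 * q) * ((x\<^sup>2) ^ (2 * q) + 1 ^ (2 * q))))"
     unfolding power_mult_distrib[of a]
     using nn by (intro mult_left_mono add_left_mono power_add_le_max) auto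
    also have "... = b \<omega>"
    proof -
     define t where "t = (2::real) ^ (2 * q)"
     have "(4::real) ^ q * 4 ^ q = 16 ^ q" by (simp flip: power_mult_distrib)
     then have t: "t * t = 16 ^ q" by (simp add: t_def power_mult)
     have e: "(x\<^sup>2) ^ (2 * q) = x ^ (4 * q)" "a ^ (2 * q) = a\<^sup>2 ^ q" by (simp_all flip: power_mult)
     have "t * ((2 * (l * x)) ^ (2 * q) + a\<^sup>2 ^ q * (t * (x ^ (4 * q) + 1)))
      = t * (t * (l ^ (2 * q) * x ^ (2 * q)) + a\<^sup>2 ^ q * (t * (x ^ (4 * q) + 1)))"
      by (simp only: power_mult_distrib t_def)
     also have "... = (t * t) * (l ^ (2 * q) * x ^ (2 * q) + a\<^sup>2 ^ q * (x ^ (4 * q) + 1))"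
      by (simp only: distrib_left mult.left_commute mult.assoc)
     finally show ?thesis
      unfolding b_def l_def[symmetric] x_def[symmetric] a_def[symmetric] e t t_def[symmetric] power_one .
    qed
    finally show ?thesis by (simp add: power_even_abs)
   qed
   have pp: "integrable M (\<lambda>\<omega>. cmod (lf n (?X \<omega>)) ^ (2 * q) * cmod (X n \<omega>) ^ (2 * q))"
    "expectation (\<lambda>\<omega>. cmod (lf n (?X \<omega>)) ^ (2 * q) * cmod (X n \<omega>) ^ (2 * q))
     = expectation (\<lambda>\<omega>. cmod (lf n (?X \<omega>)) ^ (2 * q)) * expectation (\<lambda>\<omega>. cmod (X n \<omega>) ^ (2 * q))"
   proof -
    note [measurable] = lf_meas[of n]
    have g: "(\<lambda>z. cmod (lf n z) ^ (2 * q)) \<in> borel_measurable (PiM {..<n} (\<lambda>_. borel))" by measurable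
    have h: "(\<lambda>x::complex. cmod x ^ (2 * q)) \<in> borel_measurable borel" by measurable
    have G: "cmod (lf n (\<lambda>i\<in>{..<n}. X i \<omega>)) ^ (2 * q) = cmod (lf n (?X \<omega>)) ^ (2 * q)" for \<omega> by (simp only: lf_X)
    note * = indep_past_present_lessThan[OF ind n g h G conjunct1[OF lfq[OF n]] Xi[OF n]]
    show "integrable M (\<lambda>\<omega>. cmod (lf n (?X \<omega>)) ^ (2 * q) * cmod (X n \<omega>) ^ (2 * q))" by (rule *(1))
    show "expectation (\<lambda>\<omega>. cmod (lf n (?X \<omega>)) ^ (2 * q) * cmod (X n \<omega>) ^ (2 * q))
     = expectation (\<lambda>\<omega>. cmod (lf n (?X \<omega>)) ^ (2 * q)) * expectation (\<lambda>\<omega>. cmod (X n \<omega>) ^ (2 * q))" by (rule *(2))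
   qed
   have b_int: "integrable M b" unfolding b_def using pp Xi[OF n] by auto
   have int: "integrable M (\<lambda>\<omega>. D n (?X \<omega>) ^ (2 * q))"
    by (rule Bochner_Integration.integrable_bound[OF b_int])
     (use D_meas[OF n] order_trans[OF le abs_ge_self] in \<open>auto intro!: AE_I2 simp: power_even_abs\<close>)
   have "expectation (\<lambda>\<omega>. D n (?X \<omega>) ^ (2 * q)) \<le> expectation b" by (rule integral_mono[OF int b_int le])
   also have "... = 16 ^ q * (expectation (\<lambda>\<omega>. cmod (lf n (?X \<omega>)) ^ (2 * q)) * expectation (\<lambda>\<omega>. cmod (X n \<omega>) ^ (2 * q))
     + (cmod (A n n))\<^sup>2 ^ q * (expectation (\<lambda>\<omega>. cmod (X n \<omega>) ^ (4 * q)) + 1))"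
    unfolding b_def using pp Xi[OF n] by (simp add: prob_space)
   also have "... \<le> 16 ^ q * ((2 ^ q * (4 * exp (4 ^ q)) * m (2 * q) * w n ^ q) * m (2 * q)
     + w n ^ q * (m (4 * q) + 1))"
   proof (intro mult_left_mono add_mono mult_mono)
    have "(\<Sum>l<n. (cmod (A n l))\<^sup>2) ^ q \<le> w n ^ q" unfolding w_def by (intro power_mono sum_nonneg) auto
    then show "expectation (\<lambda>\<omega>. cmod (lf n (?X \<omega>)) ^ (2 * q)) \<le> 2 ^ q * (4 * exp (4 ^ q)) * m (2 * q) * w n ^ q"
     using lfq[OF n] m by (meson order_trans mult_left_mono mult_nonneg_nonneg zero_le_power exp_ge_zero zero_le_numeral)
    show "(cmod (A n n))\<^sup>2 ^ q \<le> w n ^ q" unfolding w_def by (intro power_mono) (auto intro: sum_nonneg)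
   qed (use Xm[OF n] m w[of n] in \<open>auto intro!: mult_nonneg_nonneg zero_le_power\<close>)
   also have "... = c * w n ^ q" by (simp add: c_def algebra_simps)
   finally show ?thesis using int by blast
  qed
  have orth: "expectation (\<lambda>\<omega>. (\<Sum>k<n. D k (?X \<omega>)) ^ (2 * q - 1) * D n (?X \<omega>)) = 0" if n: "n < N" for n
  proof -
   define S where "S z = centred_form n A z" for z
   have S_meas [measurable]: "S \<in> borel_measurable (PiM {..<n} (\<lambda>_. borel))"
    unfolding S_def centred_form_def by measurable
   have S_X: "S (\<lambda>i\<in>{..<n}. X i \<omega>) = (\<Sum>k<n. D k (?X \<omega>))" for \<omega>
   proof -
    have "S (\<lambda>i\<in>{..<n}. X i \<omega>) = S (?X \<omega>)" by (simp add: S_def centred_form_def)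
    then show ?thesis using form_sum[of n "?X \<omega>"] n by (simp add: S_def)
   qed
   have SM: "(\<lambda>\<omega>. \<Sum>k<n. D k (?X \<omega>)) \<in> borel_measurable M" using D_meas n by (intro borel_measurable_sum) auto
   have Sq: "integrable M (\<lambda>\<omega>. (\<Sum>k<n. D k (?X \<omega>)) ^ (2 * q))"
    using D_meas D_moment n by (intro even_power_of_sum_integrable) auto
   have S1: "integrable M (\<lambda>\<omega>. (\<Sum>k<n. D k (?X \<omega>)) ^ (2 * q - 1))"
    by (rule integrable_lower_power(2)[OF SM Sq]) simp
   define s where "s \<omega> = (\<Sum>k<n. D k (?X \<omega>)) ^ (2 * q - 1)" for \<omega>
   have [measurable]: "s \<in> borel_measurable M" unfolding s_def using SM by (intro borel_measurable_power)
   note lf_meas[of n, measurable]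
   have g: "(\<lambda>z. complex_of_real (S z ^ (2 * q - 1)) * lf n z) \<in> borel_measurable (PiM {..<n} (\<lambda>_. borel))" by measurable
   have G: "complex_of_real (S (\<lambda>i\<in>{..<n}. X i \<omega>) ^ (2 * q - 1)) * lf n (\<lambda>i\<in>{..<n}. X i \<omega>) = of_real (s \<omega>) * lf n (?X \<omega>)" for \<omega>
    by (simp only: S_X lf_X s_def)
   have gi: "integrable M (\<lambda>\<omega>. of_real (s \<omega>) * lf n (?X \<omega>))"
   proof (rule Bochner_Integration.integrable_bound)
    show "integrable M (\<lambda>\<omega>. (\<Sum>k<n. D k (?X \<omega>)) ^ (2 * q) + cmod (lf n (?X \<omega>)) ^ (2 * q))" using Sq lfq[OF n] by simp
    show "(\<lambda>\<omega>. of_real (s \<omega>) * lf n (?X \<omega>)) \<in> borel_measurable M"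
     using lf_meas_X[OF n] by (intro borel_measurable_times) auto
    show "AE \<omega> in M. norm (of_real (s \<omega>) * lf n (?X \<omega>)) \<le> norm ((\<Sum>k<n. D k (?X \<omega>)) ^ (2 * q) + cmod (lf n (?X \<omega>)) ^ (2 * q))"
    proof (rule AE_I2)
     fix \<omega>
     have "\<bar>\<Sum>k<n. D k (?X \<omega>)\<bar> ^ (2 * q - 1) * \<bar>cmod (lf n (?X \<omega>))\<bar> ^ 1
       \<le> \<bar>\<Sum>k<n. D k (?X \<omega>)\<bar> ^ (2 * q) + \<bar>cmod (lf n (?X \<omega>))\<bar> ^ (2 * q)"
      by (rule mixed_power_le) (use q in simp)
     then show "norm (of_real (s \<omega>) * lf n (?X \<omega>)) \<le> norm ((\<Sum>k<n. D k (?X \<omega>)) ^ (2 * q) + cmod (lf n (?X \<omega>)) ^ (2 * q))"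
      by (simp add: s_def norm_mult power_abs power_even_abs del: of_real_sum of_real_power)
    qed
   qed
   have cnjX: "integrable M (\<lambda>\<omega>. cnj (X n \<omega>))" "expectation (\<lambda>\<omega>. cnj (X n \<omega>)) = 0"
    using X_int[OF n] X0[OF n] by (simp_all add: integrable_cnj)
   note p1 = indep_past_present_lessThan[OF ind n g cnj_measurable G gi cnjX(1)]
   have dd_meas: "dd n \<in> borel_measurable borel" unfolding dd_def by measurable
   have Sg: "(\<lambda>z. S z ^ (2 * q - 1)) \<in> borel_measurable (PiM {..<n} (\<lambda>_. borel))" by measurable
   have SG: "S (\<lambda>i\<in>{..<n}. X i \<omega>) ^ (2 * q - 1) = s \<omega>" for \<omega> by (simp only: S_X s_def)
   have S1': "integrable M s" using S1 by (simp add: s_def[abs_def])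
   note p2 = indep_past_present_lessThan[OF ind n Sg dd_meas SG S1' conjunct1[OF dd_int[OF n]]]
   have "(\<Sum>k<n. D k (?X \<omega>)) ^ (2 * q - 1) * D n (?X \<omega>)
     = 2 * Re (of_real (s \<omega>) * lf n (?X \<omega>) * cnj (X n \<omega>)) + s \<omega> * dd n (X n \<omega>)" for \<omega>
   proof -
    have "Re (complex_of_real s * l * x) = s * Re (l * x)" for s l x by (simp add: algebra_simps)
    then show ?thesis unfolding s_def D_def[of n] by (simp only: distrib_left mult.left_commute)
   qed
   then have "expectation (\<lambda>\<omega>. (\<Sum>k<n. D k (?X \<omega>)) ^ (2 * q - 1) * D n (?X \<omega>))
     = 2 * Re (expectation (\<lambda>\<omega>. of_real (s \<omega>) * lf n (?X \<omega>) * cnj (X n \<omega>)))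
      + expectation (\<lambda>\<omega>. s \<omega> * dd n (X n \<omega>))"
    using p1(1) p2(1) by (simp only: integral_add integrable_mult_right integrable_Re integral_mult_right_zero integral_Re Bochner_Integration.integral_add)
   then show ?thesis using p1(2) p2(2) cnjX(2) dd_int[OF n] by simp
  qed
  show "integrable M (\<lambda>\<omega>. centred_form N A (\<lambda>k. X k \<omega>) ^ (2 * q))"
   unfolding form_sum[OF order_refl] using D_meas D_moment by (intro even_power_of_sum_integrable) auto
  have "expectation (\<lambda>\<omega>. (\<Sum>n<N. D n (?X \<omega>)) ^ (2 * q)) \<le> 2 * exp (4 ^ q) * c * (\<Sum>n<N. w n) ^ q"
   using D_moment by (intro even_moment_of_sum_le q c D_meas w orth) auto
  also have "... \<le> 2 * exp (4 ^ q) * c * (\<Sum>k<N. \<Sum>l<N. (cmod (A k l))\<^sup>2) ^ q"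
  proof (intro mult_left_mono power_mono sum_mono sum_nonneg w)
   fix n assume "n \<in> {..<N}"
   then show "w n \<le> (\<Sum>l<N. (cmod (A n l))\<^sup>2)" unfolding w_def by (intro sum_mono2) auto
  qed (use c in auto)
  finally show "expectation (\<lambda>\<omega>. centred_form N A (\<lambda>k. X k \<omega>) ^ (2 * q)) \<le>
    2 * exp (4 ^ q) * (16 ^ q * (2 ^ q * (4 * exp (4 ^ q)) * m (2 * q) * m (2 * q) + m (4 * q) + 1))
     * (\<Sum>k<N. \<Sum>l<N. (cmod (A k l))\<^sup>2) ^ q"
   unfolding form_sum[OF order_refl] c_def .
  have "integrable M (\<lambda>\<omega>. D n (?X \<omega>)) \<and> expectation (\<lambda>\<omega>. D n (?X \<omega>)) = 0" if n: "n < N" for n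
  proof -
   have cnjX: "integrable M (\<lambda>\<omega>. cnj (X n \<omega>))" "expectation (\<lambda>\<omega>. cnj (X n \<omega>)) = 0"
    using X_int[OF n] X0[OF n] by (simp_all add: integrable_cnj)
   note p = indep_past_present_lessThan[OF ind n lf_meas cnj_measurable lf_X lf_int[OF n] cnjX(1)]
   have i: "integrable M (\<lambda>\<omega>. Re (lf n (?X \<omega>) * cnj (X n \<omega>)))" by (rule integrable_Re[OF p(1)])
   have "expectation (\<lambda>\<omega>. Re (lf n (?X \<omega>) * cnj (X n \<omega>))) = Re (expectation (\<lambda>\<omega>. lf n (?X \<omega>) * cnj (X n \<omega>)))"
    by (rule integral_Re[OF p(1)])
   also have "... = 0" unfolding p(2) cnjX(2) by simp
   finally show ?thesis unfolding D_def using dd_int[OF n] i by (simp del: times_complex.sel)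
  qed
  then show "expectation (\<lambda>\<omega>. centred_form N A (\<lambda>k. X k \<omega>)) = 0"
   unfolding form_sum[OF order_refl] by simp
qed

end

section \<open>Normal rows\<close>

text \<open>What counts is that, for a fixed kind of rows, \<open>K\<close> can be chosen independently of the dimension \<open>M\<close>.\<close>

definition concentrated_forms :: "nat \<Rightarrow> real \<Rightarrow> nat \<Rightarrow> (nat \<Rightarrow> complex) measure \<Rightarrow> bool" where
  "concentrated_forms q K M \<mu> \<longleftrightarrow>
    (\<forall>A. (\<forall>k<M. \<forall>l<M. A l k = cnj (A k l)) \<longrightarrow>
     integrable \<mu> (\<lambda>z. centred_form M A z ^ (2 * q)) \<and>
     (LINT z|\<mu>. centred_form M A z ^ (2 * q)) \<le> K * (\<Sum>k<M. \<Sum>l<M. (cmod (A k l))\<^sup>2) ^ q \<and>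
     (LINT z|\<mu>. centred_form M A z) = 0)"

text \<open>In a product law the coordinates are independent, so the martingale bound applies, with constants that depend on the
  moments of a single coordinate only.\<close>

lemma concentrated_forms_PiM:
  fixes \<nu> :: "complex measure"
  assumes \<nu>: "prob_space \<nu>" "sets \<nu> = sets borel" and q: "1 \<le> q"
   and mean: "(LINT z|\<nu>. z) = 0" and var: "(LINT z|\<nu>. (cmod z)\<^sup>2) = 1"
   and mom: "\<And>p. integrable \<nu> (\<lambda>z. cmod z ^ p)"
  shows "\<exists>K\<ge>0. \<forall>M\<ge>1. concentrated_forms q K M (PiM {..<M} (\<lambda>_. \<nu>))"
proof -
  define m where "m p = (LINT z|\<nu>. cmod z ^ p)" for p
  have m: "0 \<le> m p" for p unfolding m_def by (intro Bochner_Integration.integral_nonneg) auto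
  define K where "K = 2 * exp (4 ^ q) * (16 ^ q * (2 ^ q * (4 * exp (4 ^ q)) * m (2 * q) * m (2 * q) + m (4 * q) + 1))"
  have "concentrated_forms q K M (PiM {..<M} (\<lambda>_. \<nu>))" if M: "1 \<le> M" for M
  proof -
   let ?P = "PiM {..<M} (\<lambda>_. \<nu>)"
   interpret P: prob_space ?P by (rule prob_space_PiM) (rule \<nu>(1))
   have s: "sets ?P = sets (PiM {..<M} (\<lambda>_. borel))" by (rule sets_PiM_cong) (auto simp: \<nu>(2))
   have meas: "(\<lambda>z. z k) \<in> borel_measurable ?P" if "k < M" for k
    using measurable_component_singleton[of k "{..<M}" "\<lambda>_. borel"] that
    unfolding measurable_cong_sets[OF s refl] by simp
   have coord: "distr ?P \<nu> (\<lambda>z. z k) = \<nu>" if "k < M" for k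
    by (rule distr_PiM_component) (use \<nu>(1) that in auto)
   have mc: "(\<lambda>z. z k) \<in> measurable ?P \<nu>" if "k < M" for k
    using meas[OF that] measurable_cong_sets[OF refl \<nu>(2)] by blast
   have int: "integrable ?P (\<lambda>z. f (z k)) \<and> (LINT z|?P. f (z k)) = (LINT x|\<nu>. f x)"
    if "k < M" "integrable \<nu> f" for k and f :: "complex \<Rightarrow> 'b :: {banach, second_countable_topology}"
   proof -
    have fm: "f \<in> borel_measurable \<nu>" using that(2) by simp
    show ?thesis
     using integrable_distr_eq[OF mc[OF that(1)] fm] integral_distr[OF mc[OF that(1)] fm] that coord[OF that(1)]
     by simp
   qed
   have ind: "P.indep_vars (\<lambda>_. borel) (\<lambda>k z. z k) {..<M}"
   proof (subst P.indep_vars_iff_distr_eq_PiM')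
    show "{..<M} \<noteq> {}" using M by (auto simp: lessThan_empty_iff)
    have "distr ?P (PiM {..<M} (\<lambda>_. borel)) (\<lambda>z. \<lambda>k\<in>{..<M}. z k) = distr ?P ?P (\<lambda>z. z)"
     by (rule distr_cong) (auto simp: s space_PiM PiE_def extensional_restrict)
    also have "... = ?P" by simp
    also have "... = PiM {..<M} (\<lambda>k. distr ?P borel (\<lambda>z. z k))"
    proof (rule PiM_cong)
     fix k assume "k \<in> {..<M}"
     then have "distr ?P borel (\<lambda>z. z k) = distr ?P \<nu> (\<lambda>z. z k)" by (intro distr_cong) (auto simp: \<nu>(2))
     then show "\<nu> = distr ?P borel (\<lambda>z. z k)" using coord \<open>k \<in> {..<M}\<close> by simp
    qed simp
    finally show "distr ?P (PiM {..<M} (\<lambda>_. borel)) (\<lambda>z. \<lambda>k\<in>{..<M}. z k) = PiM {..<M} (\<lambda>k. distr ?P borel (\<lambda>z. z k))" .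
   qed (use meas in auto)
   have i1: "integrable \<nu> (\<lambda>z. z)"
   proof -
    have "(\<lambda>z. z) \<in> borel_measurable \<nu>" using measurable_ident_sets[OF \<nu>(2)] by simp
    then show ?thesis using mom[of 1] by (simp add: integrable_norm_iff)
   qed
   show ?thesis unfolding concentrated_forms_def
   proof (intro allI impI)
    fix A :: "nat \<Rightarrow> nat \<Rightarrow> complex" assume A: "\<forall>k<M. \<forall>l<M. A l k = cnj (A k l)"
    have E0: "P.expectation (\<lambda>z. z k) = 0" if "k < M" for k using int[OF that i1] mean by simp
    have E2: "P.expectation (\<lambda>z. (cmod (z k))\<^sup>2) = 1" if "k < M" for k using int[OF that mom[of 2]] var by simp
    have Ei: "integrable ?P (\<lambda>z. cmod (z k) ^ p)" if "k < M" for k p using int[OF that mom[of p]] by simp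
    have Em: "P.expectation (\<lambda>z. cmod (z k) ^ p) \<le> m p" if "k < M" for k p using int[OF that mom[of p]] by (simp add: m_def)
    note * = P.independent_quadratic_form_moments[OF ind q E0 E2 Ei Em m, of A]
    show "integrable ?P (\<lambda>z. centred_form M A z ^ (2 * q)) \<and>
     (LINT z|?P. centred_form M A z ^ (2 * q)) \<le> K * (\<Sum>k<M. \<Sum>l<M. (cmod (A k l))\<^sup>2) ^ q \<and>
     (LINT z|?P. centred_form M A z) = 0"
     unfolding K_def using * A by blast
   qed
  qed
  moreover have "0 \<le> K" unfolding K_def using m by (intro mult_nonneg_nonneg add_nonneg_nonneg) auto
  ultimately show ?thesis by blast
qed

lemma std_normal_abs_moment: "integrable std_normal_distribution (\<lambda>x. \<bar>x\<bar> ^ p)"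
  using integrable_std_normal_moment_abs[of p]
  by (simp add: integrable_density normal_density_nonneg)

lemma std_normal_mean: "integrable std_normal_distribution (\<lambda>x::real. x)" "(LINT x|std_normal_distribution. x) = 0"
proof -
  have "integrable std_normal_distribution (\<lambda>x::real. x ^ 1)" by (rule integrable_std_normal_distribution_moment)
  then show "integrable std_normal_distribution (\<lambda>x::real. x)" unfolding power_one_right .
  have "(LINT x|std_normal_distribution. x ^ 1) = 0" by (rule integral_std_normal_distribution_moment_odd) simp
  then show "(LINT x|std_normal_distribution. x) = 0" by (simp only: power_one_right)
qed

lemma real_std_normal_moments:
  "prob_space real_std_normal" "sets real_std_normal = sets borel"
  "(LINT z|real_std_normal. z) = 0" "(LINT z|real_std_normal. (cmod z)\<^sup>2) = 1"
  "integrable real_std_normal (\<lambda>z. cmod z ^ p)"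
proof -
  interpret prob_space std_normal_distribution by (rule prob_space_normal_density) simp
  have c [measurable]: "complex_of_real \<in> measurable std_normal_distribution borel" by simp
  show "prob_space real_std_normal" unfolding real_std_normal_def by (rule prob_space_distr[OF c])
  show "sets real_std_normal = sets borel" by (simp add: real_std_normal_def)
  have x: "integrable std_normal_distribution (\<lambda>x::real. x)" by (rule std_normal_mean)
  have "(LINT z|real_std_normal. z) = (LINT x|std_normal_distribution. complex_of_real x)"
   unfolding real_std_normal_def by (subst integral_distr) auto
  also have "... = complex_of_real (LINT x|std_normal_distribution. x)" by (rule integral_of_real[OF x])
  also have "(LINT x|std_normal_distribution. x) = 0" by (rule std_normal_mean)
  finally show "(LINT z|real_std_normal. z) = 0" by simp
  show "(LINT z|real_std_normal. (cmod z)\<^sup>2) = 1"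
   unfolding real_std_normal_def using std_normal_distribution_even_moments(1)[of 1]
   by (subst integral_distr) auto
  show "integrable real_std_normal (\<lambda>z. cmod z ^ p)"
   unfolding real_std_normal_def by (subst integrable_distr_eq) (auto simp: std_normal_abs_moment)
qed

lemma complex_std_normal_moments:
  "prob_space complex_std_normal" "sets complex_std_normal = sets borel"
  "(LINT z|complex_std_normal. z) = 0" "(LINT z|complex_std_normal. (cmod z)\<^sup>2) = 1"
  "integrable complex_std_normal (\<lambda>z. cmod z ^ p)"
proof -
  let ?\<rho> = "std_normal_distribution"
  let ?P = "?\<rho> \<Otimes>\<^sub>M ?\<rho>"
  interpret \<rho>: prob_space ?\<rho> by (rule prob_space_normal_density) simp
  interpret P: pair_prob_space ?\<rho> ?\<rho> ..
  have sP: "sets ?P = sets (borel \<Otimes>\<^sub>M borel)" by (rule sets_pair_measure_cong) auto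
  define g where "g = (\<lambda>(x, y). Complex (x / sqrt 2) (y / sqrt 2))"
  have g_eq: "g = (\<lambda>p. complex_of_real (fst p / sqrt 2) + \<i> * complex_of_real (snd p / sqrt 2))"
   by (auto simp: g_def complex_eq_iff fun_eq_iff)
  have g [measurable]: "g \<in> measurable ?P borel"
   unfolding g_eq measurable_cong_sets[OF sP refl] by measurable
  have CN: "complex_std_normal = distr ?P borel g" by (simp add: complex_std_normal_def g_def)
  show "prob_space complex_std_normal" unfolding CN by (rule P.P.prob_space_distr[OF g])
  show "sets complex_std_normal = sets borel" by (simp add: CN)
  have dfst: "distr ?P ?\<rho> fst = ?\<rho>" by (rule \<rho>.distr_pair_fst)
  have dsnd: "distr ?P ?\<rho> snd = ?\<rho>"
  proof -
   have "distr ?P ?\<rho> snd = distr (distr ?P ?P (\<lambda>(x, y). (y, x))) ?\<rho> snd"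
    using P.distr_pair_swap by simp
   also have "... = distr ?P ?\<rho> fst" by (subst distr_distr) (auto simp: comp_def case_prod_unfold)
   finally show ?thesis using dfst by simp
  qed
  have F: "integrable ?P (\<lambda>p. f (fst p)) \<and> (LINT p|?P. f (fst p)) = (LINT x|?\<rho>. f x)"
   and S: "integrable ?P (\<lambda>p. f (snd p)) \<and> (LINT p|?P. f (snd p)) = (LINT x|?\<rho>. f x)"
   if "integrable ?\<rho> f" for f :: "real \<Rightarrow> real"
  proof -
   have fm: "f \<in> borel_measurable ?\<rho>" using that by (rule borel_measurable_integrable)
   have m1: "fst \<in> measurable ?P ?\<rho>" and m2: "snd \<in> measurable ?P ?\<rho>" by (rule measurable_fst measurable_snd)+
   show "integrable ?P (\<lambda>p. f (fst p)) \<and> (LINT p|?P. f (fst p)) = (LINT x|?\<rho>. f x)"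
    using integrable_distr_eq[OF m1 fm] integral_distr[OF m1 fm] that unfolding dfst by simp
   show "integrable ?P (\<lambda>p. f (snd p)) \<and> (LINT p|?P. f (snd p)) = (LINT x|?\<rho>. f x)"
    using integrable_distr_eq[OF m2 fm] integral_distr[OF m2 fm] that unfolding dsnd by simp
  qed
  have x: "integrable ?\<rho> (\<lambda>x. x)" by (rule std_normal_mean)
  have x2: "integrable ?\<rho> (\<lambda>x. x\<^sup>2)" by (rule integrable_std_normal_distribution_moment)
  have Ex: "(LINT x|?\<rho>. x) = 0" by (rule std_normal_mean)
  have Ex2: "(LINT x|?\<rho>. x\<^sup>2) = 1" using std_normal_distribution_even_moments(1)[of 1] by simp
  have "(LINT z|complex_std_normal. z) = (LINT p|?P. g p)" unfolding CN by (subst integral_distr) auto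
  also have "... = (LINT p|?P. complex_of_real (fst p / sqrt 2)) + (LINT p|?P. \<i> * complex_of_real (snd p / sqrt 2))"
   unfolding g_eq using F[OF x] S[OF x]
   by (intro Bochner_Integration.integral_add integrable_mult_right integrable_of_real integrable_divide) auto
  also have "(LINT p|?P. complex_of_real (fst p / sqrt 2)) = 0"
   using F[OF x] Ex by (subst integral_of_real) auto
  also have "(LINT p|?P. \<i> * complex_of_real (snd p / sqrt 2)) = 0"
   using S[OF x] Ex by (subst integral_mult_right_zero, subst integral_of_real) auto
  finally show "(LINT z|complex_std_normal. z) = 0" by simp
  have g2: "(cmod (g p))\<^sup>2 = (fst p)\<^sup>2 / 2 + (snd p)\<^sup>2 / 2" for p
   by (simp add: g_def case_prod_unfold cmod_power2 power_divide)
  have "(LINT z|complex_std_normal. (cmod z)\<^sup>2) = (LINT p|?P. (fst p)\<^sup>2 / 2 + (snd p)\<^sup>2 / 2)"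
   unfolding CN g2[symmetric] by (subst integral_distr) auto
  also have "... = 1" using F[OF x2] S[OF x2] Ex2 by simp
  finally show "(LINT z|complex_std_normal. (cmod z)\<^sup>2) = 1" .
  have "integrable ?P (\<lambda>p. cmod (g p) ^ p')" for p'
  proof (rule Bochner_Integration.integrable_bound)
   show "integrable ?P (\<lambda>p. 2 ^ p' * (\<bar>fst p\<bar> ^ p' + \<bar>snd p\<bar> ^ p'))"
    using F[OF std_normal_abs_moment[of p']] S[OF std_normal_abs_moment[of p']] by simp
   show "AE p in ?P. norm (cmod (g p) ^ p') \<le> norm (2 ^ p' * (\<bar>fst p\<bar> ^ p' + \<bar>snd p\<bar> ^ p'))"
   proof (rule AE_I2)
    fix p
    have "cmod (g p) \<le> \<bar>fst p\<bar> / sqrt 2 + \<bar>snd p\<bar> / sqrt 2"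
     using cmod_le[of "g p"] by (simp add: g_def case_prod_unfold)
    also have "... \<le> \<bar>fst p\<bar> + \<bar>snd p\<bar>" by (intro add_mono) (auto simp: divide_le_eq_1 mult_le_cancel_left1 divide_le_eq)
    finally have "cmod (g p) ^ p' \<le> (\<bar>fst p\<bar> + \<bar>snd p\<bar>) ^ p'" by (intro power_mono) auto
    also have "... \<le> 2 ^ p' * (\<bar>fst p\<bar> ^ p' + \<bar>snd p\<bar> ^ p')" by (rule power_add_le_max) auto
    finally show "norm (cmod (g p) ^ p') \<le> norm (2 ^ p' * (\<bar>fst p\<bar> ^ p' + \<bar>snd p\<bar> ^ p'))" by simp
   qed
  qed simp
  then show "integrable complex_std_normal (\<lambda>z. cmod z ^ p)"
   unfolding CN by (subst integrable_distr_eq) auto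
qed

lemma normal_law_concentrated:
  assumes "1 \<le> q" "\<nu> = real_std_normal \<or> \<nu> = complex_std_normal"
  shows "\<exists>K\<ge>0. \<forall>M\<ge>1. \<forall>\<mu>. normal_law \<nu> M \<mu> \<longrightarrow> concentrated_forms q K M \<mu>"
proof -
  have "\<exists>K\<ge>0. \<forall>M\<ge>1. concentrated_forms q K M (PiM {..<M} (\<lambda>_. \<nu>))"
   using assms(2)
  proof
   assume "\<nu> = real_std_normal"
   then show ?thesis using concentrated_forms_PiM[OF real_std_normal_moments(1,2) assms(1) real_std_normal_moments(3-5)] by simp
  next
   assume "\<nu> = complex_std_normal"
   then show ?thesis using concentrated_forms_PiM[OF complex_std_normal_moments(1,2) assms(1) complex_std_normal_moments(3-5)] by simp
  qed
  then show ?thesis by (simp add: normal_law_def)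
qed

section \<open>Forms on the sphere\<close>

definition plane_rotation :: "nat \<Rightarrow> nat \<Rightarrow> nat \<Rightarrow> real \<Rightarrow> (nat \<Rightarrow> complex) \<Rightarrow> nat \<Rightarrow> complex" where
  "plane_rotation M i j t z = (\<lambda>k\<in>{..<M}.
    if k = i then of_real (cos t) * z i - of_real (sin t) * z j
    else if k = j then of_real (sin t) * z i + of_real (cos t) * z j else z k)"

lemma plane_rotation_orthogonal:
  assumes ij: "i < M" "j < M" "i \<noteq> j"
  shows "\<exists>U \<in> carrier_mat M M. elements_mat U \<subseteq> \<real> \<and> U * mat_adjoint U = 1\<^sub>m M \<and>
   (\<forall>z. (\<lambda>k\<in>{..<M}. \<Sum>l<M. U $$ (k, l) * z l) = plane_rotation M i j t z)"
proof -
  define d where "d k = (if k = i \<or> k = j then complex_of_real (cos t) else 1)" for k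
  define e where "e k = (if k = i then - complex_of_real (sin t) else if k = j then complex_of_real (sin t) else 0)" for k
  define s where "s k = (if k = i then j else if k = j then i else k)" for k
  define u where "u k l = (if l = k then d k else 0) + (if l = s k then e k else 0)" for k l
  define U where "U = Matrix.mat M M (\<lambda>(k, l). u k l)"
  have U: "U \<in> carrier_mat M M" by (simp add: U_def)
  have sM: "s k < M" if "k < M" for k using that ij by (simp add: s_def)
  have sum_u: "(\<Sum>l<M. u k l * w l) = d k * w k + e k * w (s k)" if "k < M" for k w
  proof -
   have "(\<Sum>l<M. u k l * w l) = (\<Sum>l<M. (if l = k then d k * w l else 0) + (if l = s k then e k * w l else 0))"
    by (intro sum.cong) (auto simp: u_def distrib_right)
   then show ?thesis using that sM[OF that] by (simp add: sum.distrib)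
  qed
  have sc: "complex_of_real (cos t) * complex_of_real (cos t) + complex_of_real (sin t) * complex_of_real (sin t) = 1"
   by (simp flip: of_real_mult of_real_add add: sin_cos_squared_add3)
  have cnj_u: "cnj (u k l) = u k l" for k l by (simp add: u_def d_def e_def)
  have "U * mat_adjoint U = 1\<^sub>m M"
  proof (rule eq_matI)
   fix a b assume "a < dim_row (1\<^sub>m M :: complex Matrix.mat)" "b < dim_col (1\<^sub>m M :: complex Matrix.mat)"
   then have ab: "a < M" "b < M" by auto
   have "(U * mat_adjoint U) $$ (a, b) = (\<Sum>l<M. u a l * u b l)"
    unfolding mat_mult_index[OF U adjoint_carrier[OF U] ab]
    by (intro sum.cong) (use ab in \<open>auto simp: adjoint_index[OF U] cnj_u, auto simp: U_def cnj_u\<close>)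
   also have "... = d a * u b a + e a * u b (s a)" by (rule sum_u[OF ab(1)])
   also have "... = (if a = b then 1 else 0)"
    using ij sc by (auto simp: u_def d_def e_def s_def add.commute)
   finally show "(U * mat_adjoint U) $$ (a, b) = 1\<^sub>m M $$ (a, b)" using ab by simp
  qed (use U in \<open>auto simp: mat_adjoint_def\<close>)
  moreover have "elements_mat U \<subseteq> \<real>"
   by (auto simp: elements_mat_def U_def u_def d_def e_def)
  moreover have "(\<lambda>k\<in>{..<M}. \<Sum>l<M. U $$ (k, l) * z l) = plane_rotation M i j t z" for z
  proof (rule ext)
   fix k
   show "(\<lambda>k\<in>{..<M}. \<Sum>l<M. U $$ (k, l) * z l) k = plane_rotation M i j t z k"
   proof (cases "k < M")
    case True
    have "(\<Sum>l<M. U $$ (k, l) * z l) = (\<Sum>l<M. u k l * z l)" using True by (intro sum.cong) (auto simp: U_def)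
    also have "... = d k * z k + e k * z (s k)" by (rule sum_u[OF True])
    finally show ?thesis using True ij by (auto simp: plane_rotation_def d_def e_def s_def)
   qed (simp add: plane_rotation_def)
  qed
  ultimately show ?thesis using U by blast
qed

locale invariant_sphere_law = prob_space \<nu> for \<nu> :: "(nat \<Rightarrow> complex) measure" +
  fixes M :: nat
  assumes sets_law: "sets \<nu> = sets (vec_space M)"
   and on_sphere: "AE u in \<nu>. (\<Sum>k<M. (cmod (u k))\<^sup>2) = 1"
   and invariant: "\<And>i j t. i < M \<Longrightarrow> j < M \<Longrightarrow> i \<noteq> j \<Longrightarrow>
     distr \<nu> (vec_space M) (plane_rotation M i j t) = \<nu>"
begin

definition sphere :: "(nat \<Rightarrow> complex) set" where
  "sphere = {z. (\<Sum>k<M. (cmod (z k))\<^sup>2) = 1}"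

text \<open>\<open>flow_derivative i j h h'\<close>: along every rotation in the plane \<open>(i, j)\<close> the derivative of \<open>h\<close> is
  \<open>h'\<close>, with the measurability and boundedness that integration needs. Polynomials in the coordinates
  and their conjugates have flow derivatives, computed by the product rule.\<close>

definition flow_derivative ::
   "nat \<Rightarrow> nat \<Rightarrow> ((nat \<Rightarrow> complex) \<Rightarrow> complex) \<Rightarrow> ((nat \<Rightarrow> complex) \<Rightarrow> complex) \<Rightarrow> bool" where
  "flow_derivative i j h h' \<longleftrightarrow>
    h \<in> borel_measurable (vec_space M) \<and> h' \<in> borel_measurable (vec_space M) \<and>
    (\<exists>B. \<forall>z\<in>sphere. cmod (h z) \<le> B \<and> cmod (h' z) \<le> B) \<and>
    (\<forall>z t. ((\<lambda>t. h (plane_rotation M i j t z)) has_vector_derivative h' (plane_rotation M i j t z)) (at t))"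

lemma measurable_law: "f \<in> borel_measurable (vec_space M) \<Longrightarrow> f \<in> borel_measurable \<nu>"
  using measurable_cong_sets[OF sets_law refl] by blast

lemma space_law: "space \<nu> = extensional {..<M}"
  using sets_eq_imp_space_eq[OF sets_law] by (simp add: space_PiM PiE_def)

lemma AE_sphere: "AE z in \<nu>. z \<in> sphere"
  using on_sphere by (simp add: sphere_def)

lemma coord_le_1:
  assumes "z \<in> sphere" "k < M"
  shows "cmod (z k) \<le> 1"
proof -
  have "(cmod (z k))\<^sup>2 \<le> (\<Sum>k<M. (cmod (z k))\<^sup>2)" using assms(2) by (intro member_le_sum) auto
  then have "(cmod (z k))\<^sup>2 \<le> 1\<^sup>2" using assms(1) by (simp add: sphere_def)
  then show ?thesis by (rule power2_le_imp_le) simp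
qed

lemma integrable_bounded:
  assumes "h \<in> borel_measurable (vec_space M)" "\<And>z. z \<in> sphere \<Longrightarrow> norm (h z) \<le> B"
  shows "integrable \<nu> (h :: _ \<Rightarrow> 'b :: {banach, second_countable_topology})"
  using AE_sphere by (intro integrable_const_bound[of _ B] measurable_law assms) (auto elim!: eventually_mono intro: assms)

lemma rotation_sphere:
  assumes ij: "i < M" "j < M" "i \<noteq> j" and z: "z \<in> sphere"
  shows "plane_rotation M i j t z \<in> sphere"
proof -
  let ?r = "plane_rotation M i j t z"
  have split: "(\<Sum>k<M. f k) = f i + f j + (\<Sum>k\<in>{..<M} - {i, j}. f k)" for f :: "nat \<Rightarrow> real"
  proof -
   have "(\<Sum>k<M. f k) = (\<Sum>k\<in>{i, j}. f k) + (\<Sum>k\<in>{..<M} - {i, j}. f k)"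
    using ij by (subst sum.subset_diff[of "{i, j}"]) auto
   then show ?thesis using ij by simp
  qed
  have sc: "(cos t)\<^sup>2 + (sin t)\<^sup>2 = 1" by simp
  have "(cmod (?r i))\<^sup>2 + (cmod (?r j))\<^sup>2 = ((cos t)\<^sup>2 + (sin t)\<^sup>2) * ((cmod (z i))\<^sup>2 + (cmod (z j))\<^sup>2)"
  proof -
   have "(cmod (?r i))\<^sup>2 = (cos t * Re (z i) - sin t * Re (z j))\<^sup>2 + (cos t * Im (z i) - sin t * Im (z j))\<^sup>2"
    "(cmod (?r j))\<^sup>2 = (sin t * Re (z i) + cos t * Re (z j))\<^sup>2 + (sin t * Im (z i) + cos t * Im (z j))\<^sup>2"
    using ij by (simp_all add: plane_rotation_def cmod_power2)
   moreover have "(c * a - s * b)\<^sup>2 + (c * a' - s * b')\<^sup>2 + ((s * a + c * b)\<^sup>2 + (s * a' + c * b')\<^sup>2)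
     = (c\<^sup>2 + s\<^sup>2) * (a\<^sup>2 + a'\<^sup>2 + (b\<^sup>2 + b'\<^sup>2))" for c s a b a' b' :: real
    by (simp add: power2_eq_square algebra_simps)
   ultimately show ?thesis unfolding cmod_power2[of "z i"] cmod_power2[of "z j"] by presburger
  qed
  then have "(cmod (?r i))\<^sup>2 + (cmod (?r j))\<^sup>2 = (cmod (z i))\<^sup>2 + (cmod (z j))\<^sup>2" using sc by simp
  moreover have "(\<Sum>k\<in>{..<M} - {i, j}. (cmod (?r k))\<^sup>2) = (\<Sum>k\<in>{..<M} - {i, j}. (cmod (z k))\<^sup>2)"
   by (intro sum.cong) (auto simp: plane_rotation_def)
  ultimately have "(\<Sum>k<M. (cmod (?r k))\<^sup>2) = (\<Sum>k<M. (cmod (z k))\<^sup>2)"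
   unfolding split[of "\<lambda>k. (cmod (?r k))\<^sup>2"] split[of "\<lambda>k. (cmod (z k))\<^sup>2"] by simp
  then show ?thesis using z by (simp add: sphere_def)
qed

lemma rotation_measurable: "i < M \<Longrightarrow> j < M \<Longrightarrow> plane_rotation M i j t \<in> measurable (vec_space M) (vec_space M)"
  unfolding plane_rotation_def by measurable

text \<open>The infinitesimal form of invariance: the mean of \<open>h\<close> along the rotation by \<open>t\<close> is constant in \<open>t\<close>, so
  differentiation under the integral at \<open>t = 0\<close> makes the mean of the flow derivative vanish.\<close>

lemma flow_derivative_mean_zero:
  assumes ij: "i < M" "j < M" "i \<noteq> j" and h: "flow_derivative i j h h'"
  shows "integrable \<nu> h'" "(LINT z|\<nu>. h' z) = 0"
proof -
  let ?r = "plane_rotation M i j"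
  obtain B where B: "\<And>z. z \<in> sphere \<Longrightarrow> cmod (h z) \<le> B" "\<And>z. z \<in> sphere \<Longrightarrow> cmod (h' z) \<le> B"
   using h by (auto simp: flow_derivative_def)
  have meas: "h \<in> borel_measurable (vec_space M)" "h' \<in> borel_measurable (vec_space M)"
   and deriv: "\<And>z t. ((\<lambda>t. h (?r t z)) has_vector_derivative h' (?r t z)) (at t)"
   using h by (auto simp: flow_derivative_def)
  show "integrable \<nu> h'" by (rule integrable_bounded[OF meas(2) B(2)])
  have hi: "integrable \<nu> h" by (rule integrable_bounded[OF meas(1) B(1)])
  define f where "f n z = of_nat (Suc n) * (h (?r (1 / real (Suc n)) z) - h z)" for n z
  have rm: "?r t \<in> measurable \<nu> (vec_space M)" for t
   using rotation_measurable[OF ij(1,2)] measurable_cong_sets[OF sets_law refl] by blast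
  have hr: "integrable \<nu> (\<lambda>z. h (?r t z)) \<and> (LINT z|\<nu>. h (?r t z)) = (LINT z|\<nu>. h z)" for t
   using integrable_distr_eq[OF rm meas(1), of t] integral_distr[OF rm meas(1), of t] hi invariant[OF ij, of t] by simp
  have f0: "(LINT z|\<nu>. f n z) = 0" for n unfolding f_def using hr hi by simp
  have r0: "?r 0 z = z" if "z \<in> extensional {..<M}" for z
   using that ij by (auto simp: plane_rotation_def fun_eq_iff extensional_def)
  have "(\<lambda>n. LINT z|\<nu>. f n z) \<longlonglongrightarrow> (LINT z|\<nu>. h' z)"
  proof (rule integral_dominated_convergence[where w = "\<lambda>_. B"])
   show "h' \<in> borel_measurable \<nu>" by (rule measurable_law[OF meas(2)])
   show "f n \<in> borel_measurable \<nu>" for n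
    using measurable_compose[OF rm meas(1)] measurable_law[OF meas(1)] unfolding f_def by measurable
   show "AE z in \<nu>. (\<lambda>n. f n z) \<longlonglongrightarrow> h' z"
   proof (rule AE_I2)
    fix z assume "z \<in> space \<nu>"
    then have z: "?r 0 z = z" using r0 space_law by auto
    have "(\<lambda>x. norm (h (?r (0 + x) z) - h (?r 0 z) - x *\<^sub>R h' (?r 0 z)) / norm x) \<midarrow>0\<rightarrow> 0"
     using deriv[of z 0] unfolding has_vector_derivative_def has_derivative_at by blast
    moreover have "filterlim (\<lambda>n. 1 / real (Suc n)) (at 0) sequentially"
     using LIMSEQ_Suc[OF lim_inverse_n'] by (auto simp: filterlim_at simp del: of_nat_Suc)
    ultimately have "(\<lambda>n. norm (h (?r (0 + 1 / real (Suc n)) z) - h (?r 0 z) - (1 / real (Suc n)) *\<^sub>R h' (?r 0 z)) / norm (1 / real (Suc n))) \<longlonglongrightarrow> 0"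
     by (rule filterlim_compose)
    moreover have "norm (h (?r (0 + 1 / real (Suc n)) z) - h (?r 0 z) - (1 / real (Suc n)) *\<^sub>R h' (?r 0 z)) / norm (1 / real (Suc n))
      = norm (f n z - h' z)" for n
    proof -
     have "f n z - h' z = of_nat (Suc n) * (h (?r (0 + 1 / real (Suc n)) z) - h (?r 0 z) - (1 / real (Suc n)) *\<^sub>R h' (?r 0 z))"
      unfolding f_def z by (simp add: scaleR_conv_of_real right_diff_distrib del: of_nat_Suc)
     then have "norm (f n z - h' z) = real (Suc n) * norm (h (?r (0 + 1 / real (Suc n)) z) - h (?r 0 z) - (1 / real (Suc n)) *\<^sub>R h' (?r 0 z))"
      by (simp only: norm_mult norm_of_nat)
     then show ?thesis by (simp add: mult.commute del: of_nat_Suc)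
    qed
    ultimately have "(\<lambda>n. norm (f n z - h' z)) \<longlonglongrightarrow> 0" by simp
    then show "(\<lambda>n. f n z) \<longlonglongrightarrow> h' z" by (subst LIM_zero_iff[symmetric], subst tendsto_norm_zero_iff[symmetric])
   qed
   show "AE z in \<nu>. norm (f n z) \<le> B" for n
   proof (rule AE_mp[OF AE_sphere], rule AE_I2, rule impI)
    fix z assume "z \<in> space \<nu>" and zs: "z \<in> sphere"
    then have z: "?r 0 z = z" using r0 space_law by auto
    have "norm (h (?r (1 / real (Suc n)) z) - h (?r 0 z)) \<le> B * norm (1 / real (Suc n) - 0)"
    proof (rule differentiable_bound[where S = UNIV])
     show "((\<lambda>t. h (?r t z)) has_derivative (\<lambda>x. x *\<^sub>R h' (?r t z))) (at t within UNIV)" for t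
      using deriv[of z t] by (simp add: has_vector_derivative_def)
     show "onorm (\<lambda>x. x *\<^sub>R h' (?r t z)) \<le> B" for t
      using B(2)[OF rotation_sphere[OF ij zs, of t]] by (intro onorm_le) (simp add: mult.commute[of "\<bar>_\<bar>"] mult_right_mono)
    qed auto
    moreover have "norm (f n z) = real (Suc n) * norm (h (?r (1 / real (Suc n)) z) - h z)"
     unfolding f_def by (simp only: norm_mult norm_of_nat)
    ultimately show "norm (f n z) \<le> B" using z by (simp add: field_simps del: of_nat_Suc)
   qed
  qed simp
  then show "(LINT z|\<nu>. h' z) = 0" unfolding f0 by (simp add: LIMSEQ_const_iff)
qed

lemma flow_derivative_cong:
  "flow_derivative i j h h' \<Longrightarrow> (\<And>z. g z = h z) \<Longrightarrow> (\<And>z. g' z = h' z) \<Longrightarrow> flow_derivative i j g g'"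
  by (simp add: flow_derivative_def cong: measurable_cong)

lemma flow_derivative_const: "flow_derivative i j (\<lambda>_. c) (\<lambda>_. 0)"
  unfolding flow_derivative_def by (auto intro!: exI[of _ "cmod c"])

lemma flow_derivative_cnj:
  assumes "flow_derivative i j h h'"
  shows "flow_derivative i j (\<lambda>z. cnj (h z)) (\<lambda>z. cnj (h' z))"
  using assms unfolding flow_derivative_def
  by (auto intro!: measurable_compose[OF _ cnj_measurable] bounded_linear.has_vector_derivative[OF bounded_linear_cnj])

lemma flow_derivative_mult:
  assumes "flow_derivative i j h h'" "flow_derivative i j g g'"
  shows "flow_derivative i j (\<lambda>z. h z * g z) (\<lambda>z. h z * g' z + h' z * g z)"
proof -
  obtain B where B: "\<And>z. z \<in> sphere \<Longrightarrow> cmod (h z) \<le> B" "\<And>z. z \<in> sphere \<Longrightarrow> cmod (h' z) \<le> B"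
   using assms(1) unfolding flow_derivative_def by blast
  obtain C where C: "\<And>z. z \<in> sphere \<Longrightarrow> cmod (g z) \<le> C" "\<And>z. z \<in> sphere \<Longrightarrow> cmod (g' z) \<le> C"
   using assms(2) unfolding flow_derivative_def by blast
  note BC = B C
  have "cmod (h z * g z) \<le> 2 * (\<bar>B\<bar> * \<bar>C\<bar>) \<and> cmod (h z * g' z + h' z * g z) \<le> 2 * (\<bar>B\<bar> * \<bar>C\<bar>)" if z: "z \<in> sphere" for z
  proof -
   have l: "cmod (h z) \<le> \<bar>B\<bar>" "cmod (h' z) \<le> \<bar>B\<bar>" "cmod (g z) \<le> \<bar>C\<bar>" "cmod (g' z) \<le> \<bar>C\<bar>" using BC[OF z] by auto
   have "cmod (h z * g z) \<le> \<bar>B\<bar> * \<bar>C\<bar>" "cmod (h z * g' z) \<le> \<bar>B\<bar> * \<bar>C\<bar>" "cmod (h' z * g z) \<le> \<bar>B\<bar> * \<bar>C\<bar>"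
    unfolding norm_mult using l by (auto intro!: mult_mono)
   moreover have "0 \<le> \<bar>B\<bar> * \<bar>C\<bar>" by simp
   ultimately show ?thesis using norm_triangle_ineq[of "h z * g' z" "h' z * g z"] by linarith
  qed
  then show ?thesis using assms unfolding flow_derivative_def
   by (auto intro!: borel_measurable_times borel_measurable_add has_vector_derivative_mult)
qed

lemma flow_derivative_add:
  assumes "flow_derivative i j h h'" "flow_derivative i j g g'"
  shows "flow_derivative i j (\<lambda>z. h z + g z) (\<lambda>z. h' z + g' z)"
proof -
  obtain B where B: "\<And>z. z \<in> sphere \<Longrightarrow> cmod (h z) \<le> B" "\<And>z. z \<in> sphere \<Longrightarrow> cmod (h' z) \<le> B"
   using assms(1) unfolding flow_derivative_def by blast
  obtain C where C: "\<And>z. z \<in> sphere \<Longrightarrow> cmod (g z) \<le> C" "\<And>z. z \<in> sphere \<Longrightarrow> cmod (g' z) \<le> C"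
   using assms(2) unfolding flow_derivative_def by blast
  note BC = B C
  have "cmod (h z + g z) \<le> B + C \<and> cmod (h' z + g' z) \<le> B + C" if z: "z \<in> sphere" for z
   using BC[OF z] norm_triangle_mono by blast
  then show ?thesis using assms unfolding flow_derivative_def
   by (auto intro!: borel_measurable_add has_vector_derivative_add)
qed

lemma flow_derivative_sum:
  assumes "\<And>k. k \<in> S \<Longrightarrow> flow_derivative i j (h k) (h' k)"
  shows "flow_derivative i j (\<lambda>z. \<Sum>k\<in>S. h k z) (\<lambda>z. \<Sum>k\<in>S. h' k z)"
proof (cases "finite S")
  case True
  then show ?thesis using assms
   by (induction S) (auto intro: flow_derivative_const flow_derivative_add)
qed (simp add: flow_derivative_const)

lemma flow_derivative_power:
  assumes "flow_derivative i j h h'"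
  shows "flow_derivative i j (\<lambda>z. h z ^ n) (\<lambda>z. of_nat n * h z ^ (n - 1) * h' z)"
proof (induction n)
  case (Suc n)
  show ?case
   by (rule flow_derivative_cong[OF flow_derivative_mult[OF assms Suc]])
    (cases n; simp add: algebra_simps)+
qed (simp add: flow_derivative_const)

lemma flow_derivative_coord:
  assumes "i < M" "j < M" "i \<noteq> j" "k < M"
  shows "flow_derivative i j (\<lambda>z. z k) (\<lambda>z. if k = i then - z j else if k = j then z i else 0)"
proof -
  have "((\<lambda>t. plane_rotation M i j t z k) has_vector_derivative
    (if k = i then - plane_rotation M i j t z j else if k = j then plane_rotation M i j t z i else 0)) (at t)" for z t
  proof -
   have 1: "((\<lambda>t. of_real (cos t)) has_vector_derivative (- of_real (sin t) :: complex)) (at t)"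
    using has_vector_derivative_of_real[OF DERIV_cos[THEN has_field_derivative_at_within], of t UNIV] by simp
   have 2: "((\<lambda>t. of_real (sin t)) has_vector_derivative (of_real (cos t) :: complex)) (at t)"
    using has_vector_derivative_of_real[OF DERIV_sin[THEN has_field_derivative_at_within], of t UNIV] by simp
   show ?thesis using assms
    by (auto simp: plane_rotation_def intro!: derivative_eq_intros 1 2)
  qed
  moreover have "(\<lambda>z. if k = i then - z j else if k = j then z i else 0) \<in> borel_measurable (vec_space M)"
   using assms by simp
  moreover have "(\<lambda>z. z k) \<in> borel_measurable (vec_space M)" using assms by simp
  moreover have "\<forall>z\<in>sphere. cmod (z k) \<le> 1 \<and> cmod (if k = i then - z j else if k = j then z i else 0) \<le> 1"
   using assms by (auto simp: coord_le_1)
  ultimately show ?thesis unfolding flow_derivative_def by blast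
qed

definition lin :: "(nat \<Rightarrow> complex) \<Rightarrow> (nat \<Rightarrow> complex) \<Rightarrow> complex" where
  "lin a z = (\<Sum>k<M. a k * z k)"

lemma flow_derivative_lin:
  assumes ij: "i < M" "j < M" "i \<noteq> j"
  shows "flow_derivative i j (lin a) (\<lambda>z. a j * z i - a i * z j)"
proof (rule flow_derivative_cong)
  show "flow_derivative i j (\<lambda>z. \<Sum>k<M. a k * z k)
    (\<lambda>z. \<Sum>k<M. a k * (if k = i then - z j else if k = j then z i else 0) + 0 * z k)"
   by (intro flow_derivative_sum flow_derivative_mult flow_derivative_const flow_derivative_coord ij) auto
  fix z
  have "(\<Sum>k<M. a k * (if k = i then - z j else if k = j then z i else 0) + 0 * z k)
    = (\<Sum>k<M. (if k = i then - a k * z j else 0) + (if k = j then a k * z i else 0))"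
   using ij by (intro sum.cong) auto
  then show "a j * z i - a i * z j = (\<Sum>k<M. a k * (if k = i then - z j else if k = j then z i else 0) + 0 * z k)"
   using ij by (simp add: sum.distrib)
qed (simp add: lin_def)

lemma sum_off_diagonal:
  "(\<Sum>i<M. \<Sum>j\<in>{..<M} - {i}. F i j) = (\<Sum>i<M. \<Sum>j<M. F i j) - (\<Sum>i<M. F i i)"
  for F :: "nat \<Rightarrow> nat \<Rightarrow> complex"
  by (simp add: sum_diff1 sum_subtractf)

lemma off_diagonal_mean_zero:
  assumes "\<And>i j. i < M \<Longrightarrow> j < M \<Longrightarrow> i \<noteq> j \<Longrightarrow> flow_derivative i j (h i j) (F i j)"
  shows "(LINT z|\<nu>. (\<Sum>i<M. \<Sum>j\<in>{..<M} - {i}. F i j z)) = 0"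
   "integrable \<nu> (\<lambda>z. \<Sum>i<M. \<Sum>j\<in>{..<M} - {i}. F i j z)"
proof -
  have *: "integrable \<nu> (F i j)" "(LINT z|\<nu>. F i j z) = 0" if "i < M" "j \<in> {..<M} - {i}" for i j
   using flow_derivative_mean_zero[OF _ _ _ assms, of i j] that by auto
  show "(LINT z|\<nu>. (\<Sum>i<M. \<Sum>j\<in>{..<M} - {i}. F i j z)) = 0"
  proof -
   have "(LINT z|\<nu>. (\<Sum>i<M. \<Sum>j\<in>{..<M} - {i}. F i j z)) = (\<Sum>i<M. LINT z|\<nu>. (\<Sum>j\<in>{..<M} - {i}. F i j z))"
    using * by (intro Bochner_Integration.integral_sum Bochner_Integration.integrable_sum) auto
   also have "... = (\<Sum>i<M. \<Sum>j\<in>{..<M} - {i}. LINT z|\<nu>. F i j z)"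
    using * by (intro sum.cong refl Bochner_Integration.integral_sum) auto
   also have "... = 0" using * by (intro sum.neutral ballI) auto
   finally show ?thesis .
  qed
  show "integrable \<nu> (\<lambda>z. \<Sum>i<M. \<Sum>j\<in>{..<M} - {i}. F i j z)"
   using * by (intro Bochner_Integration.integrable_sum) auto
qed

text \<open>The lower power produced by integration by parts is absorbed into half of the moment to be bounded.\<close>

lemma young_absorb:
  fixes x w :: real
  assumes "0 \<le> x" "0 \<le> w" "1 \<le> q"
  shows "w * x ^ (q - 1) \<le> x ^ q / 2 + (2 * w) ^ q / 2"
proof -
  obtain p where p: "q = Suc p" using assms(3) by (cases q) auto
  show ?thesis
  proof (cases "2 * w \<le> x")
   case True
   then have "(2 * w) * x ^ p \<le> x * x ^ p" using assms by (intro mult_right_mono) auto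
   then show ?thesis using assms by (simp add: p add_increasing2)
  next
   case False
   then have "(2 * w) * x ^ p \<le> (2 * w) * (2 * w) ^ p" using assms by (intro mult_left_mono power_mono) auto
   moreover have "0 \<le> x * x ^ p" using assms by simp
   ultimately show ?thesis by (simp add: p)
  qed
qed

lemma off_diagonal_le:
  fixes x y :: "nat \<Rightarrow> real"
  assumes "\<And>i. 0 \<le> x i" "\<And>i. 0 \<le> y i"
  shows "(\<Sum>i<M. \<Sum>j\<in>{..<M} - {i}. x i * y j * (x i * y j + x j * y i)) \<le> 2 * ((\<Sum>i<M. (x i)\<^sup>2) * (\<Sum>i<M. (y i)\<^sup>2))"
proof -
  have "(\<Sum>i<M. \<Sum>j\<in>{..<M} - {i}. x i * y j * (x i * y j + x j * y i)) \<le> (\<Sum>i<M. \<Sum>j<M. x i * y j * (x i * y j + x j * y i))"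
   using assms by (intro sum_mono sum_mono2) auto
  also have "... = (\<Sum>i<M. \<Sum>j<M. (x i)\<^sup>2 * (y j)\<^sup>2) + (\<Sum>i<M. \<Sum>j<M. (x i * y i) * (x j * y j))"
   by (simp add: sum.distrib algebra_simps power2_eq_square)
  also have "... = (\<Sum>i<M. (x i)\<^sup>2) * (\<Sum>i<M. (y i)\<^sup>2) + (\<Sum>i<M. x i * y i)\<^sup>2"
   by (simp add: sum_product power2_eq_square)
  finally show ?thesis using Cauchy_Schwarz_ineq_sum[of x y "{..<M}"] by linarith
qed

text \<open>Integration by parts: the rotation derivative of \<open>a j * z i\<close>, summed over all planes \<open>(i, j)\<close>, is \<open>- (M - 1) * lin a z\<close>.
  Multiplied by the remaining powers of \<open>lin a z\<close> this is the moment itself up to a factor, while the derivatives of those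
  powers only yield the next lower moment. So each pair of factors gains \<open>1 / M\<close>.\<close>

lemma lin_moments:
  assumes q: "1 \<le> q" and M: "2 \<le> M"
  shows "integrable \<nu> (\<lambda>z. cmod (lin a z) ^ (2 * q))"
   and "expectation (\<lambda>z. cmod (lin a z) ^ (2 * q)) \<le> (4 * (2 * real q - 1) / (real M - 1) * (\<Sum>k<M. (cmod (a k))\<^sup>2)) ^ q"
proof -
  define s where "s = (\<Sum>k<M. (cmod (a k))\<^sup>2)"
  have s0: "0 \<le> s" by (simp add: s_def sum_nonneg)
  have lm: "lin a \<in> borel_measurable (vec_space M)" unfolding lin_def by measurable
  have lb: "cmod (lin a z) \<le> (\<Sum>k<M. cmod (a k))" if "z \<in> sphere" for z
   unfolding lin_def by (rule order_trans[OF norm_sum]) (auto intro!: sum_mono simp: norm_mult mult_left_le coord_le_1[OF that])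
  have int: "integrable \<nu> (\<lambda>z. cmod (lin a z) ^ n)" for n
   by (rule integrable_bounded[where B = "(\<Sum>k<M. cmod (a k)) ^ n"]) (use lm lb in \<open>auto intro!: power_mono\<close>)
  then show "integrable \<nu> (\<lambda>z. cmod (lin a z) ^ (2 * q))" .
  define G where "G z = cnj (lin a z) ^ q * lin a z ^ (q - 1)" for z
  define L where "L i j z = a j * z i - a i * z j" for i j and z :: "nat \<Rightarrow> complex"
  define G' where "G' i j z = cnj (lin a z) ^ q * (of_nat (q - 1) * lin a z ^ (q - 1 - 1) * L i j z)
    + (of_nat q * cnj (lin a z) ^ (q - 1) * cnj (L i j z)) * lin a z ^ (q - 1)" for i j z
  define F where "F i j z = a j * z i * G' i j z - a j * z j * G z" for i j z
  have fd: "flow_derivative i j (\<lambda>z. a j * z i * G z) (F i j)" if ij: "i < M" "j < M" "i \<noteq> j" for i j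
  proof (rule flow_derivative_cong)
   show "flow_derivative i j (\<lambda>z. (a j * z i) * G z)
    (\<lambda>z. (a j * z i) * G' i j z + (a j * (if i = i then - z j else if i = j then z i else 0) + 0 * z i) * G z)"
    unfolding G_def G'_def L_def
    by (intro flow_derivative_mult flow_derivative_power flow_derivative_cnj flow_derivative_lin
       flow_derivative_coord flow_derivative_const ij)
  qed (auto simp: F_def)
  have lG: "lin a z * G z = of_real (cmod (lin a z) ^ (2 * q))" for z
  proof -
   have "lin a z * G z = (lin a z * cnj (lin a z)) ^ q"
    using q by (cases q) (auto simp: G_def power_mult_distrib mult_ac)
   then show ?thesis by (simp add: complex_norm_square[symmetric] power_mult del: of_real_power) simp
  qed
  have sumF: "(\<Sum>i<M. \<Sum>j\<in>{..<M} - {i}. F i j z) = (\<Sum>i<M. \<Sum>j\<in>{..<M} - {i}. a j * z i * G' i j z)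
    - of_real ((real M - 1) * cmod (lin a z) ^ (2 * q))" for z
  proof -
   have "(\<Sum>i<M. \<Sum>j\<in>{..<M} - {i}. a j * z j * G z) = of_nat M * (lin a z * G z) - lin a z * G z"
    unfolding sum_off_diagonal by (simp add: lin_def sum_distrib_right)
   also have "... = of_real ((real M - 1) * cmod (lin a z) ^ (2 * q))"
    unfolding lG by (simp add: algebra_simps)
   finally show ?thesis unfolding F_def sum_subtractf by simp
  qed
  have G'_le: "cmod (G' i j z) \<le> (2 * real q - 1) * cmod (lin a z) ^ (2 * q - 2) * cmod (L i j z)" for i j z
  proof -
   define l where "l = cmod (lin a z)"
   have "cmod (G' i j z) \<le> l ^ q * (real (q - 1) * l ^ (q - 1 - 1) * cmod (L i j z)) + (real q * l ^ (q - 1) * cmod (L i j z)) * l ^ (q - 1)"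
    unfolding G'_def l_def by (rule order_trans[OF norm_triangle_ineq]) (simp add: norm_mult norm_power)
   also have "... = (2 * real q - 1) * l ^ (2 * q - 2) * cmod (L i j z)"
   proof -
    obtain p where p: "q = Suc p" using q by (cases q) auto
    show ?thesis
    proof (cases p)
     case (Suc r)
     have "q + (q - 1 - 1) = 2 * q - 2" "(q - 1) + (q - 1) = 2 * q - 2" using p Suc by simp_all
     then have e: "l ^ q * l ^ (q - 1 - 1) = l ^ (2 * q - 2)" "l ^ (q - 1) * l ^ (q - 1) = l ^ (2 * q - 2)"
      by (simp_all only: flip: power_add)
     have "l ^ q * (real (q - 1) * l ^ (q - 1 - 1) * cmod (L i j z)) + (real q * l ^ (q - 1) * cmod (L i j z)) * l ^ (q - 1)
      = real (q - 1) * (l ^ q * l ^ (q - 1 - 1)) * cmod (L i j z) + real q * (l ^ (q - 1) * l ^ (q - 1)) * cmod (L i j z)"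
      by (simp only: mult_ac)
     then show ?thesis unfolding e using q by (simp add: of_nat_diff algebra_simps)
    qed (simp add: p)
   qed
   finally show ?thesis by (simp add: l_def)
  qed
  have off: "cmod (\<Sum>i<M. \<Sum>j\<in>{..<M} - {i}. a j * z i * G' i j z) \<le> 2 * (2 * real q - 1) * s * cmod (lin a z) ^ (2 * q - 2)"
   if z: "z \<in> sphere" for z
  proof -
   define g where "g = (2 * real q - 1) * cmod (lin a z) ^ (2 * q - 2)"
   have g: "0 \<le> g" using q by (simp add: g_def)
   have "cmod (\<Sum>i<M. \<Sum>j\<in>{..<M} - {i}. a j * z i * G' i j z)
     \<le> (\<Sum>i<M. \<Sum>j\<in>{..<M} - {i}. g * (cmod (z i) * cmod (a j) * (cmod (z i) * cmod (a j) + cmod (z j) * cmod (a i))))"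
   proof (intro order_trans[OF norm_sum] sum_mono)
    fix i j
    have "cmod (L i j z) \<le> cmod (z i) * cmod (a j) + cmod (z j) * cmod (a i)"
     unfolding L_def by (rule order_trans[OF norm_triangle_ineq4]) (simp add: norm_mult mult.commute)
    then have "cmod (G' i j z) \<le> g * (cmod (z i) * cmod (a j) + cmod (z j) * cmod (a i))"
     using G'_le[of i j z] g unfolding g_def by (meson mult_left_mono order_trans)
    then have "cmod (z i) * cmod (a j) * cmod (G' i j z) \<le> cmod (z i) * cmod (a j) * (g * (cmod (z i) * cmod (a j) + cmod (z j) * cmod (a i)))"
     by (intro mult_left_mono) auto
    then show "cmod (a j * z i * G' i j z) \<le> g * (cmod (z i) * cmod (a j) * (cmod (z i) * cmod (a j) + cmod (z j) * cmod (a i)))"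
     by (simp add: norm_mult mult_ac)
   qed
   also have "... \<le> g * (2 * ((\<Sum>i<M. (cmod (z i))\<^sup>2) * s))"
    unfolding s_def sum_distrib_left[symmetric] by (intro mult_left_mono off_diagonal_le g) auto
   also have "... = 2 * (2 * real q - 1) * s * cmod (lin a z) ^ (2 * q - 2)"
    using z by (simp add: sphere_def g_def)
   finally show ?thesis .
  qed
  define R where "R z = (\<Sum>i<M. \<Sum>j\<in>{..<M} - {i}. a j * z i * G' i j z)" for z
  note F0 = off_diagonal_mean_zero[OF fd, unfolded sumF, folded R_def]
  have M1: "0 < real M - 1" using M by simp
  have Ri: "integrable \<nu> R"
  proof -
   have "integrable \<nu> (\<lambda>z. (R z - of_real ((real M - 1) * cmod (lin a z) ^ (2 * q))) + of_real ((real M - 1) * cmod (lin a z) ^ (2 * q)))"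
    by (intro Bochner_Integration.integrable_add F0(2) integrable_of_real integrable_mult_right int)
   then show ?thesis by simp
  qed
  have "complex_of_real ((real M - 1) * expectation (\<lambda>z. cmod (lin a z) ^ (2 * q))) = (LINT z|\<nu>. R z)"
  proof -
   have "(LINT z|\<nu>. R z - of_real ((real M - 1) * cmod (lin a z) ^ (2 * q)))
     = (LINT z|\<nu>. R z) - of_real (LINT z|\<nu>. (real M - 1) * cmod (lin a z) ^ (2 * q))"
    by (subst Bochner_Integration.integral_diff[OF Ri], intro integrable_of_real integrable_mult_right int)
     (subst integral_of_real, auto intro!: int)
   then show ?thesis using F0(1) by simp
  qed
  then have "(real M - 1) * expectation (\<lambda>z. cmod (lin a z) ^ (2 * q)) \<le> cmod (LINT z|\<nu>. R z)"
   by (metis abs_ge_self norm_of_real)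
  also have "... \<le> (LINT z|\<nu>. cmod (R z))" by (rule integral_norm_bound)
  also have "... \<le> (LINT z|\<nu>. 2 * (2 * real q - 1) * s * cmod (lin a z) ^ (2 * q - 2))"
   by (rule integral_mono_AE) (use Ri int AE_sphere off[folded R_def] in \<open>auto elim!: eventually_mono\<close>)
  also have "... \<le> (LINT z|\<nu>. (real M - 1) * (cmod (lin a z) ^ (2 * q) / 2 + (2 * (2 * (2 * real q - 1) * s / (real M - 1))) ^ q / 2))"
  proof (rule integral_mono)
   fix z
   define w where "w = 2 * (2 * real q - 1) * s / (real M - 1)"
   have "w * (cmod (lin a z))\<^sup>2 ^ (q - 1) \<le> (cmod (lin a z))\<^sup>2 ^ q / 2 + (2 * w) ^ q / 2"
    using s0 q M1 by (intro young_absorb) (auto simp: w_def)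
   moreover have "(cmod (lin a z))\<^sup>2 ^ (q - 1) = cmod (lin a z) ^ (2 * q - 2)" "(cmod (lin a z))\<^sup>2 ^ q = cmod (lin a z) ^ (2 * q)"
    by (simp_all add: diff_mult_distrib2 flip: power_mult)
   ultimately have "(real M - 1) * (w * cmod (lin a z) ^ (2 * q - 2)) \<le> (real M - 1) * (cmod (lin a z) ^ (2 * q) / 2 + (2 * w) ^ q / 2)"
    using M1 by (intro mult_left_mono) auto
   moreover have "(real M - 1) * w = 2 * (2 * real q - 1) * s" using M1 by (simp add: w_def)
   ultimately show "2 * (2 * real q - 1) * s * cmod (lin a z) ^ (2 * q - 2)
     \<le> (real M - 1) * (cmod (lin a z) ^ (2 * q) / 2 + (2 * (2 * (2 * real q - 1) * s / (real M - 1))) ^ q / 2)"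
    unfolding w_def[symmetric] by (metis mult.assoc)
  qed (use int in auto)
  also have "... = (real M - 1) * (expectation (\<lambda>z. cmod (lin a z) ^ (2 * q)) / 2 + (2 * (2 * (2 * real q - 1) * s / (real M - 1))) ^ q / 2)"
   using int by (simp add: prob_space)
  finally have "expectation (\<lambda>z. cmod (lin a z) ^ (2 * q)) \<le> (2 * (2 * (2 * real q - 1) * s / (real M - 1))) ^ q"
   using M1 by (simp only: mult_le_cancel_left_pos)
  then show "expectation (\<lambda>z. cmod (lin a z) ^ (2 * q)) \<le> (4 * (2 * real q - 1) / (real M - 1) * (\<Sum>k<M. (cmod (a k))\<^sup>2)) ^ q"
  proof -
   have "2 * (2 * (2 * real q - 1) * s / (real M - 1)) = 4 * (2 * real q - 1) / (real M - 1) * s"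
    by (simp add: field_simps)
   moreover assume "expectation (\<lambda>z. cmod (lin a z) ^ (2 * q)) \<le> (2 * (2 * (2 * real q - 1) * s / (real M - 1))) ^ q"
   ultimately show ?thesis unfolding s_def by (simp only:)
  qed
qed

lemma sum_power_le_weighted:
  fixes x b :: "nat \<Rightarrow> real"
  assumes "\<And>k. k < n \<Longrightarrow> 0 \<le> x k" "\<And>k. k < n \<Longrightarrow> 0 < b k" "0 < n" and s: "s = (\<Sum>k<n. b k)"
  shows "(\<Sum>k<n. x k) ^ q \<le> (\<Sum>k<n. b k / s * (x k * (s / b k)) ^ q)"
proof -
  have s0: "0 < s" unfolding s using assms(2,3) by (intro sum_pos) auto
  have cv: "convex_on {0::real..} (\<lambda>x. x ^ q)"
   using convex_power_odd convex_on_subset[OF convex_power_even subset_UNIV] by (cases "even q") auto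
  have "(\<Sum>k<n. (b k / s) *\<^sub>R (x k * (s / b k))) ^ q \<le> (\<Sum>k<n. b k / s * (x k * (s / b k)) ^ q)"
  proof (rule convex_on_sum[OF _ _ cv])
   show "(\<Sum>k<n. b k / s) = 1" using s0 by (simp add: s flip: sum_divide_distrib)
   fix k assume "k \<in> {..<n}"
   then have "0 \<le> x k" "0 < b k" using assms(1,2) by auto
   then show "0 \<le> b k / s" "x k * (s / b k) \<in> {0..}" using s0 by auto
  qed (use assms(3) in auto)
  moreover have "(\<Sum>k<n. (b k / s) *\<^sub>R (x k * (s / b k))) = (\<Sum>k<n. x k)"
  proof (rule sum.cong)
   fix k assume "k \<in> {..<n}"
   then have "b k \<noteq> 0" "s \<noteq> 0" using assms(2)[of k] s0 by auto
   then show "(b k / s) *\<^sub>R (x k * (s / b k)) = x k" by (simp add: field_simps)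
  qed simp
  ultimately show ?thesis by simp
qed

text \<open>Jensen's inequality reduces the length of a vector of linear forms to its entries.\<close>

lemma lin_vector_moments:
  assumes q: "1 \<le> q" and M: "2 \<le> M"
  shows "integrable \<nu> (\<lambda>z. (\<Sum>k<M. (cmod (lin (B k) z))\<^sup>2) ^ q)"
   and "expectation (\<lambda>z. (\<Sum>k<M. (cmod (lin (B k) z))\<^sup>2) ^ q)
     \<le> (4 * (2 * real q - 1) / (real M - 1) * (\<Sum>k<M. \<Sum>l<M. (cmod (B k l))\<^sup>2)) ^ q"
proof -
  define c where "c = 4 * (2 * real q - 1) / (real M - 1)"
  have c: "0 \<le> c" using q M by (simp add: c_def)
  have lm: "lin a \<in> borel_measurable (vec_space M)" for a unfolding lin_def by measurable
  have lb: "cmod (lin a z) \<le> (\<Sum>k<M. cmod (a k))" if "z \<in> sphere" for a z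
   unfolding lin_def by (rule order_trans[OF norm_sum]) (auto intro!: sum_mono simp: norm_mult mult_left_le coord_le_1[OF that])
  show int: "integrable \<nu> (\<lambda>z. (\<Sum>k<M. (cmod (lin (B k) z))\<^sup>2) ^ q)"
  proof (rule integrable_bounded[where B = "(\<Sum>k<M. (\<Sum>l<M. cmod (B k l))\<^sup>2) ^ q"])
   show "(\<lambda>z. (\<Sum>k<M. (cmod (lin (B k) z))\<^sup>2) ^ q) \<in> borel_measurable (vec_space M)" using lm by measurable
   fix z assume "z \<in> sphere"
   then have "(\<Sum>k<M. (cmod (lin (B k) z))\<^sup>2) ^ q \<le> (\<Sum>k<M. (\<Sum>l<M. cmod (B k l))\<^sup>2) ^ q"
    by (intro power_mono sum_mono lb sum_nonneg) auto
   then show "norm ((\<Sum>k<M. (cmod (lin (B k) z))\<^sup>2) ^ q) \<le> (\<Sum>k<M. (\<Sum>l<M. cmod (B k l))\<^sup>2) ^ q"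
    by (simp add: sum_nonneg)
  qed
  \<comment> \<open>The weights of Jensen's inequality are the squared row norms, made positive by \<open>e\<close>.\<close>
  define b where "b e k = (\<Sum>l<M. (cmod (B k l))\<^sup>2) + e" for e k
  have step: "expectation (\<lambda>z. (\<Sum>k<M. (cmod (lin (B k) z))\<^sup>2) ^ q) \<le> (c * (\<Sum>k<M. b e k)) ^ q" if e: "0 < e" for e
  proof -
   define s where "s = (\<Sum>k<M. b e k)"
   have b0: "0 < b e k" for k unfolding b_def using e by (intro add_nonneg_pos sum_nonneg) auto
   have s0: "0 < s" unfolding s_def using b0 M by (intro sum_pos) (auto simp: lessThan_empty_iff)
   have mi: "integrable \<nu> (\<lambda>z. cmod (lin (B k) z) ^ (2 * q))" for k by (rule lin_moments(1)[OF q M])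
   have ex: "b e k / s * ((cmod (lin (B k) z))\<^sup>2 * (s / b e k)) ^ q = b e k / s * (s / b e k) ^ q * cmod (lin (B k) z) ^ (2 * q)" for k z
    by (simp add: power_mult_distrib power_mult power_divide)
   have "expectation (\<lambda>z. (\<Sum>k<M. (cmod (lin (B k) z))\<^sup>2) ^ q)
     \<le> expectation (\<lambda>z. \<Sum>k<M. b e k / s * (s / b e k) ^ q * cmod (lin (B k) z) ^ (2 * q))"
   proof (rule integral_mono[OF int])
    show "integrable \<nu> (\<lambda>z. \<Sum>k<M. b e k / s * (s / b e k) ^ q * cmod (lin (B k) z) ^ (2 * q))"
     using mi by (intro Bochner_Integration.integrable_sum integrable_mult_right) auto
    show "(\<Sum>k<M. (cmod (lin (B k) z))\<^sup>2) ^ q \<le> (\<Sum>k<M. b e k / s * (s / b e k) ^ q * cmod (lin (B k) z) ^ (2 * q))" for z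
     using sum_power_le_weighted[of M "\<lambda>k. (cmod (lin (B k) z))\<^sup>2" "b e" s q] b0 M unfolding ex by (simp add: s_def)
   qed
   also have "... = (\<Sum>k<M. b e k / s * (s / b e k) ^ q * expectation (\<lambda>z. cmod (lin (B k) z) ^ (2 * q)))"
    using mi by (subst Bochner_Integration.integral_sum) auto
   also have "... \<le> (\<Sum>k<M. b e k / s * (s / b e k) ^ q * (c * b e k) ^ q)"
   proof (intro sum_mono mult_left_mono)
    fix k
    have "expectation (\<lambda>z. cmod (lin (B k) z) ^ (2 * q)) \<le> (c * (\<Sum>l<M. (cmod (B k l))\<^sup>2)) ^ q"
     unfolding c_def by (rule lin_moments(2)[OF q M])
    also have "... \<le> (c * b e k) ^ q"
     using c e by (intro power_mono mult_left_mono mult_nonneg_nonneg sum_nonneg) (auto simp: b_def)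
    finally show "expectation (\<lambda>z. cmod (lin (B k) z) ^ (2 * q)) \<le> (c * b e k) ^ q" .
   qed (use b0 s0 in \<open>auto intro!: mult_nonneg_nonneg divide_nonneg_nonneg zero_le_power less_imp_le\<close>)
   also have "... = (\<Sum>k<M. b e k / s * (c * s) ^ q)"
   proof (rule sum.cong)
    fix k
    have "(s / b e k) ^ q * (c * b e k) ^ q = (c * s) ^ q"
     using b0[of k] unfolding power_mult_distrib[symmetric] by (simp add: mult.commute)
    then show "b e k / s * (s / b e k) ^ q * (c * b e k) ^ q = b e k / s * (c * s) ^ q" by (simp only: mult.assoc)
   qed simp
   also have "... = (c * s) ^ q" using s0 by (simp add: s_def flip: sum_distrib_right sum_divide_distrib)
   finally show ?thesis by (simp add: s_def)
  qed
  have "((\<lambda>e. (c * (\<Sum>k<M. b e k)) ^ q) \<longlongrightarrow> (c * (\<Sum>k<M. b 0 k)) ^ q) (at_right 0)"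
   unfolding b_def by (intro tendsto_intros)
  moreover have "\<forall>\<^sub>F e in at_right 0. expectation (\<lambda>z. (\<Sum>k<M. (cmod (lin (B k) z))\<^sup>2) ^ q) \<le> (c * (\<Sum>k<M. b e k)) ^ q"
   unfolding eventually_at_right_field by (intro exI[of _ 1]) (auto intro!: step)
  ultimately have "expectation (\<lambda>z. (\<Sum>k<M. (cmod (lin (B k) z))\<^sup>2) ^ q) \<le> (c * (\<Sum>k<M. b 0 k)) ^ q"
   by (rule tendsto_lowerbound) simp
  then show "expectation (\<lambda>z. (\<Sum>k<M. (cmod (lin (B k) z))\<^sup>2) ^ q)
     \<le> (4 * (2 * real q - 1) / (real M - 1) * (\<Sum>k<M. \<Sum>l<M. (cmod (B k l))\<^sup>2)) ^ q"
   by (simp add: b_def c_def)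
qed

definition form :: "(nat \<Rightarrow> nat \<Rightarrow> complex) \<Rightarrow> (nat \<Rightarrow> complex) \<Rightarrow> complex" where
  "form B z = (\<Sum>k<M. cnj (z k) * lin (B k) z)"

text \<open>Hermitian forms whose matrix is also symmetric or antisymmetric, that is, a real or a purely
  imaginary matrix. For these the divergence of the field \<open>cnj (z i) (B z)\<^sub>j\<close> over all rotation planes
  is a multiple of the form itself.\<close>

context
  fixes B :: "nat \<Rightarrow> nat \<Rightarrow> complex" and \<sigma> :: real
  assumes herm: "\<And>k l. k < M \<Longrightarrow> l < M \<Longrightarrow> B l k = cnj (B k l)"
   and symm: "\<And>k l. k < M \<Longrightarrow> l < M \<Longrightarrow> B l k = of_real \<sigma> * B k l" and \<sigma>: "\<bar>\<sigma>\<bar> \<le> 1"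
   and traceless: "(\<Sum>k<M. B k k) = 0"
begin

lemma form_real: "form B z = of_real (Re (form B z))"
proof -
  have "cnj (form B z) = (\<Sum>k<M. \<Sum>l<M. z k * (cnj (B k l) * cnj (z l)))"
   by (simp add: form_def lin_def sum_distrib_left)
  also have "... = (\<Sum>k<M. \<Sum>l<M. z k * (B l k * cnj (z l)))"
  proof (intro sum.cong refl)
   fix k l assume "k \<in> {..<M}" "l \<in> {..<M}"
   then have "B l k = cnj (B k l)" by (intro herm) auto
   then show "z k * (cnj (B k l) * cnj (z l)) = z k * (B l k * cnj (z l))" by simp
  qed
  also have "... = form B z"
   unfolding form_def lin_def sum_distrib_left by (subst sum.swap) (simp add: mult_ac)
  finally show ?thesis by (simp add: complex_eq_iff)
qed

lemma cnj_lin: "j < M \<Longrightarrow> (\<Sum>k<M. cnj (z k) * B k j) = cnj (lin (B j) z)"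
  unfolding lin_def cnj_sum
proof (intro sum.cong refl)
  fix k assume "j < M" "k \<in> {..<M}"
  then have "B k j = cnj (B j k)" by (intro herm) auto
  then show "cnj (z k) * B k j = cnj (B j k * z k)" by simp
qed

lemma flow_derivative_form:
  assumes ij: "i < M" "j < M" "i \<noteq> j"
  shows "flow_derivative i j (form B) (\<lambda>z. cnj (z i) * lin (B j) z - cnj (z j) * lin (B i) z
    + z i * cnj (lin (B j) z) - z j * cnj (lin (B i) z))"
proof (rule flow_derivative_cong)
  show "flow_derivative i j (\<lambda>z. \<Sum>k<M. cnj (z k) * lin (B k) z)
    (\<lambda>z. \<Sum>k<M. cnj (z k) * (B k j * z i - B k i * z j)
     + cnj (if k = i then - z j else if k = j then z i else 0) * lin (B k) z)"
   by (intro flow_derivative_sum flow_derivative_mult flow_derivative_cnj flow_derivative_lin flow_derivative_coord ij) auto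
  fix z
  have "(\<Sum>k<M. cnj (z k) * (B k j * z i - B k i * z j)
     + cnj (if k = i then - z j else if k = j then z i else 0) * lin (B k) z)
    = (\<Sum>k<M. cnj (z k) * B k j * z i) - (\<Sum>k<M. cnj (z k) * B k i * z j)
     + (\<Sum>k<M. (if k = i then - cnj (z j) * lin (B k) z else 0) + (if k = j then cnj (z i) * lin (B k) z else 0))"
   unfolding sum.distrib[symmetric] sum_subtractf[symmetric]
   by (intro sum.cong refl) (use ij in \<open>auto simp: algebra_simps\<close>)
  also have "... = cnj (lin (B j) z) * z i - cnj (lin (B i) z) * z j + (cnj (z i) * lin (B j) z - cnj (z j) * lin (B i) z)"
   unfolding sum_distrib_right[symmetric] cnj_lin[OF ij(1)] cnj_lin[OF ij(2)] using ij by (simp add: sum.distrib)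
  finally show "cnj (z i) * lin (B j) z - cnj (z j) * lin (B i) z + z i * cnj (lin (B j) z) - z j * cnj (lin (B i) z)
   = (\<Sum>k<M. cnj (z k) * (B k j * z i - B k i * z j)
     + cnj (if k = i then - z j else if k = j then z i else 0) * lin (B k) z)"
   by (simp add: algebra_simps)
qed (simp add: form_def)

text \<open>The same integration by parts as for linear forms, with the field \<open>cnj (z i) * lin (B j) z\<close>. The derivative of the power
  of the form is bounded by the squared length of \<open>B z\<close>, which is of the order of the squared Frobenius norm divided
  by \<open>M\<close>; together with the factor \<open>M - 1\<close> on the other side this gives \<open>M\<^sup>-\<^sup>2\<close>. Tracelessness is what makes
  the diagonal part of the divergence vanish.\<close>

lemma form_moments:
  assumes q: "1 \<le> q" and M: "4 \<le> M"
  shows "integrable \<nu> (\<lambda>z. Re (form B z) ^ n)"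
   and "expectation (\<lambda>z. Re (form B z)) = 0"
   and "expectation (\<lambda>z. Re (form B z) ^ (2 * q))
     \<le> (128 * (2 * real q - 1)\<^sup>2 / (real M)\<^sup>2 * (\<Sum>k<M. \<Sum>l<M. (cmod (B k l))\<^sup>2)) ^ q"
proof -
  define L where "L i j z = cnj (z i) * lin (B j) z - cnj (z j) * lin (B i) z
    + z i * cnj (lin (B j) z) - z j * cnj (lin (B i) z)" for i j z
  define V where "V z = (\<Sum>k<M. (cmod (lin (B k) z))\<^sup>2)" for z
  have V0: "0 \<le> V z" for z by (simp add: V_def sum_nonneg)
  have lm: "lin a \<in> borel_measurable (vec_space M)" for a unfolding lin_def by measurable
  have lb: "cmod (lin a z) \<le> (\<Sum>k<M. cmod (a k))" if "z \<in> sphere" for a z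
   unfolding lin_def by (rule order_trans[OF norm_sum]) (auto intro!: sum_mono simp: norm_mult mult_left_le coord_le_1[OF that])
  have fm: "form B \<in> borel_measurable (vec_space M)" unfolding form_def using lm by measurable
  have fb: "cmod (form B z) \<le> (\<Sum>k<M. \<Sum>l<M. cmod (B k l))" if z: "z \<in> sphere" for z
   unfolding form_def
  proof (rule order_trans[OF norm_sum], rule sum_mono)
   fix k assume "k \<in> {..<M}"
   then have "cmod (z k) * cmod (lin (B k) z) \<le> 1 * (\<Sum>l<M. cmod (B k l))"
    using coord_le_1[OF z, of k] lb[OF z, of "B k"] by (intro mult_mono) auto
   then show "cmod (cnj (z k) * lin (B k) z) \<le> (\<Sum>l<M. cmod (B k l))" by (simp add: norm_mult)
  qed
  have intc: "integrable \<nu> (\<lambda>z. form B z ^ n)" for n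
   by (rule integrable_bounded[where B = "(\<Sum>k<M. \<Sum>l<M. cmod (B k l)) ^ n"])
    (use fm fb in \<open>auto simp: norm_power intro!: power_mono\<close>)
  have form_pow: "form B z ^ n = of_real (Re (form B z) ^ n)" for z n
   using form_real[of z] by (metis of_real_power)
  show int: "integrable \<nu> (\<lambda>z. Re (form B z) ^ n)" for n
   using integrable_Re[OF intc[of n]] unfolding form_pow by simp
  define F where "F p i j z = cnj (z i) * lin (B j) z * (of_nat p * form B z ^ (p - 1) * L i j z)
    + (cnj (z i) * (B j j * z i - B j i * z j) - cnj (z j) * lin (B j) z) * form B z ^ p" for p i j z
  have fd: "flow_derivative i j (\<lambda>z. cnj (z i) * lin (B j) z * form B z ^ p) (F p i j)"
   if ij: "i < M" "j < M" "i \<noteq> j" for p i j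
  proof (rule flow_derivative_cong)
   show "flow_derivative i j (\<lambda>z. cnj (z i) * lin (B j) z * form B z ^ p)
    (\<lambda>z. cnj (z i) * lin (B j) z * (of_nat p * form B z ^ (p - 1) * L i j z)
     + (cnj (z i) * (B j j * z i - B j i * z j) + cnj (if i = i then - z j else if i = j then z i else 0) * lin (B j) z) * form B z ^ p)"
    unfolding L_def
    by (intro flow_derivative_mult flow_derivative_power flow_derivative_cnj flow_derivative_lin
       flow_derivative_form flow_derivative_coord ij)
  qed (auto simp: F_def algebra_simps)
  define R where "R z = (\<Sum>i<M. \<Sum>j\<in>{..<M} - {i}. cnj (z i) * lin (B j) z * L i j z)" for z
  have sumF: "(\<Sum>i<M. \<Sum>j\<in>{..<M} - {i}. F p i j z)
    = of_nat p * form B z ^ (p - 1) * R z - of_real (real M - 1 + \<sigma>) * form B z ^ (p + 1)" for p z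
  proof -
   have t1: "(\<Sum>i<M. \<Sum>j\<in>{..<M} - {i}. cnj (z i) * lin (B j) z * (of_nat p * form B z ^ (p - 1) * L i j z))
    = of_nat p * form B z ^ (p - 1) * R z"
    unfolding R_def sum_distrib_left by (intro sum.cong refl) (simp add: mult_ac)
   have a1: "(\<Sum>i<M. \<Sum>j<M. cnj (z i) * (B j j * z i)) = 0"
   proof -
    have "(\<Sum>i<M. \<Sum>j<M. cnj (z i) * (B j j * z i)) = (\<Sum>i<M. cnj (z i) * z i * (\<Sum>j<M. B j j))"
     unfolding sum_distrib_left by (simp add: mult_ac)
    then show ?thesis by (simp add: traceless)
   qed
   have a2: "(\<Sum>i<M. \<Sum>j<M. cnj (z i) * (B j i * z j)) = of_real \<sigma> * form B z"
    unfolding form_def lin_def sum_distrib_left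
   proof (intro sum.cong refl)
    fix i j assume "i \<in> {..<M}" "j \<in> {..<M}"
    then have "B j i = of_real \<sigma> * B i j" by (intro symm) auto
    then show "cnj (z i) * (B j i * z j) = of_real \<sigma> * (cnj (z i) * (B i j * z j))" by simp
   qed
   have a3: "(\<Sum>i<M. \<Sum>j<M. cnj (z j) * lin (B j) z) = of_nat M * form B z" by (simp add: form_def)
   have "(\<Sum>i<M. \<Sum>j\<in>{..<M} - {i}. cnj (z i) * (B j j * z i - B j i * z j) - cnj (z j) * lin (B j) z)
    = (0 - of_real \<sigma> * form B z - of_nat M * form B z) - (\<Sum>i<M. - (cnj (z i) * lin (B i) z))"
    unfolding sum_off_diagonal right_diff_distrib sum_subtractf a1 a2 a3 by (simp add: sum_negf)
   also have "... = - of_real (real M - 1 + \<sigma>) * form B z"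
   proof -
    have "(\<Sum>i<M. - (cnj (z i) * lin (B i) z)) = - form B z" unfolding form_def by (rule sum_negf)
    then show ?thesis by (simp add: algebra_simps)
   qed
   finally have t2: "(\<Sum>i<M. \<Sum>j\<in>{..<M} - {i}. cnj (z i) * (B j j * z i - B j i * z j) - cnj (z j) * lin (B j) z)
    = - of_real (real M - 1 + \<sigma>) * form B z" .
   show ?thesis unfolding F_def sum.distrib t1 sum_distrib_right[symmetric] t2 by (simp add: algebra_simps)
  qed
  have R_le: "cmod (R z) \<le> 4 * V z" if z: "z \<in> sphere" for z
  proof -
   have "cmod (R z) \<le> (\<Sum>i<M. \<Sum>j\<in>{..<M} - {i}. 2 * (cmod (z i) * cmod (lin (B j) z) * (cmod (z i) * cmod (lin (B j) z) + cmod (z j) * cmod (lin (B i) z))))"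
    unfolding R_def
   proof (intro order_trans[OF norm_sum] sum_mono)
    fix i j
    have "cmod (L i j z) \<le> cmod (z i) * cmod (lin (B j) z) + cmod (z j) * cmod (lin (B i) z)
     + cmod (z i) * cmod (lin (B j) z) + cmod (z j) * cmod (lin (B i) z)"
     unfolding L_def
     using norm_triangle_ineq4[of "cnj (z i) * lin (B j) z - cnj (z j) * lin (B i) z + z i * cnj (lin (B j) z)" "z j * cnj (lin (B i) z)"]
      norm_triangle_ineq[of "cnj (z i) * lin (B j) z - cnj (z j) * lin (B i) z" "z i * cnj (lin (B j) z)"]
      norm_triangle_ineq4[of "cnj (z i) * lin (B j) z" "cnj (z j) * lin (B i) z"]
     unfolding norm_mult complex_mod_cnj by linarith
    then have "cmod (z i) * cmod (lin (B j) z) * cmod (L i j z)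
      \<le> cmod (z i) * cmod (lin (B j) z) * (2 * (cmod (z i) * cmod (lin (B j) z) + cmod (z j) * cmod (lin (B i) z)))"
     by (intro mult_left_mono) auto
    then show "cmod (cnj (z i) * lin (B j) z * L i j z)
      \<le> 2 * (cmod (z i) * cmod (lin (B j) z) * (cmod (z i) * cmod (lin (B j) z) + cmod (z j) * cmod (lin (B i) z)))"
     unfolding norm_mult complex_mod_cnj by (simp only: mult_ac)
   qed
   also have "... \<le> 2 * (2 * ((\<Sum>i<M. (cmod (z i))\<^sup>2) * V z))"
    unfolding V_def sum_distrib_left[symmetric] by (intro mult_left_mono off_diagonal_le) auto
   finally show ?thesis using z by (simp add: sphere_def)
  qed
  have m: "0 < real M - 1 + \<sigma>" "real M / 2 \<le> real M - 1 + \<sigma>" using M \<sigma> by (auto simp: abs_le_iff)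
  have identity: "of_real (real M - 1 + \<sigma>) * (LINT z|\<nu>. form B z ^ (p + 1)) = (LINT z|\<nu>. of_nat p * form B z ^ (p - 1) * R z)
    \<and> integrable \<nu> (\<lambda>z. of_nat p * form B z ^ (p - 1) * R z)" for p
  proof -
   note F0 = off_diagonal_mean_zero[OF fd[of _ _ p], unfolded sumF]
   have i2: "integrable \<nu> (\<lambda>z. of_real (real M - 1 + \<sigma>) * form B z ^ (p + 1))"
    by (intro integrable_mult_right intc)
   have i1: "integrable \<nu> (\<lambda>z. of_nat p * form B z ^ (p - 1) * R z)"
    using Bochner_Integration.integrable_add[OF F0(2) i2] by simp
   have "(LINT z|\<nu>. of_nat p * form B z ^ (p - 1) * R z) - (LINT z|\<nu>. of_real (real M - 1 + \<sigma>) * form B z ^ (p + 1)) = 0"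
    using F0(1) Bochner_Integration.integral_diff[OF i1 i2] by simp
   moreover have "(LINT z|\<nu>. of_real (real M - 1 + \<sigma>) * form B z ^ (p + 1)) = of_real (real M - 1 + \<sigma>) * (LINT z|\<nu>. form B z ^ (p + 1))"
    by (rule integral_mult_right_zero)
   ultimately show ?thesis using i1 by simp
  qed
  have "of_real (real M - 1 + \<sigma>) * (LINT z|\<nu>. form B z ^ 1) = 0" using identity[of 0] by simp
  then have "(LINT z|\<nu>. form B z) = 0"
   using m(1) by (simp del: of_real_add of_real_diff)
  then show "expectation (\<lambda>z. Re (form B z)) = 0" using integral_Re[OF intc[of 1]] by simp
  define p where "p = 2 * q - 1"
  have p: "p + 1 = 2 * q" "p - 1 = 2 * q - 2" "real p = 2 * real q - 1" using q by (auto simp: p_def of_nat_diff)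
  define E where "E = expectation (\<lambda>z. Re (form B z) ^ (2 * q))"
  note VI = lin_vector_moments[of q B, folded V_def]
  have "(real M - 1 + \<sigma>) * E = cmod (of_real (real M - 1 + \<sigma>) * (LINT z|\<nu>. form B z ^ (p + 1)))"
  proof -
   have "(LINT z|\<nu>. form B z ^ (p + 1)) = of_real E" unfolding p form_pow E_def by (rule integral_of_real[OF int])
   moreover have "0 \<le> E" unfolding E_def by (rule Bochner_Integration.integral_nonneg) (simp add: zero_le_even_power)
   ultimately show ?thesis using m(1) by (simp add: norm_mult del: of_real_add of_real_diff)
  qed
  also have "... = cmod (LINT z|\<nu>. of_nat p * form B z ^ (p - 1) * R z)" using identity[of p] by simp
  also have "... \<le> (LINT z|\<nu>. cmod (of_nat p * form B z ^ (p - 1) * R z))" by (rule integral_norm_bound)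
  also have "... \<le> (LINT z|\<nu>. (real M - 1 + \<sigma>) * (Re (form B z) ^ (2 * q) / 2
    + (16 * (2 * real q - 1) / real M) ^ q * V z ^ q / 2))"
  proof (rule integral_mono_AE)
   show "integrable \<nu> (\<lambda>z. cmod (of_nat p * form B z ^ (p - 1) * R z))"
    by (rule integrable_norm[OF conjunct2[OF identity]])
   show "integrable \<nu> (\<lambda>z. (real M - 1 + \<sigma>) * (Re (form B z) ^ (2 * q) / 2 + (16 * (2 * real q - 1) / real M) ^ q * V z ^ q / 2))"
    using int VI(1)[OF q] M by auto
   show "AE z in \<nu>. cmod (of_nat p * form B z ^ (p - 1) * R z)
     \<le> (real M - 1 + \<sigma>) * (Re (form B z) ^ (2 * q) / 2 + (16 * (2 * real q - 1) / real M) ^ q * V z ^ q / 2)"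
    using AE_sphere
   proof eventually_elim
    case (elim z)
    define x where "x = (Re (form B z))\<^sup>2"
    define w where "w = 8 * (2 * real q - 1) / real M * V z"
    have w0: "0 \<le> w" using q V0 by (simp add: w_def)
    have pows: "cmod (form B z ^ (p - 1)) = x ^ (q - 1)" "Re (form B z) ^ (2 * q) = x ^ q"
    proof -
     have "cmod (form B z ^ (p - 1)) = \<bar>Re (form B z)\<bar> ^ (2 * q - 2)" unfolding form_pow p by (simp add: power_abs norm_power)
     also have "... = \<bar>Re (form B z)\<bar> ^ (2 * (q - 1))" by (simp add: diff_mult_distrib2)
     also have "... = x ^ (q - 1)" unfolding x_def by (simp add: power_mult)
     finally show "cmod (form B z ^ (p - 1)) = x ^ (q - 1)" .
     show "Re (form B z) ^ (2 * q) = x ^ q" unfolding x_def by (simp add: power_mult)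
    qed
    have "cmod (of_nat p * form B z ^ (p - 1) * R z) = (2 * real q - 1) * x ^ (q - 1) * cmod (R z)"
     by (simp only: norm_mult norm_of_nat pows p(3))
    also have "... \<le> (2 * real q - 1) * x ^ (q - 1) * (4 * V z)"
     using R_le[OF elim] q by (intro mult_left_mono) (auto simp: x_def)
    also have "... = real M / 2 * (w * x ^ (q - 1))" using M by (simp add: w_def field_simps)
    also have "... \<le> (real M - 1 + \<sigma>) * (w * x ^ (q - 1))"
     using m(2) w0 by (intro mult_right_mono) (auto simp: x_def)
    also have "... \<le> (real M - 1 + \<sigma>) * (x ^ q / 2 + (2 * w) ^ q / 2)"
     using m(1) w0 q by (intro mult_left_mono young_absorb) (auto simp: x_def)
    also have "(2 * w) ^ q = (16 * (2 * real q - 1) / real M) ^ q * V z ^ q"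
    proof -
     have "2 * w = 16 * (2 * real q - 1) / real M * V z" by (simp add: w_def algebra_simps)
     then show ?thesis by (simp only: power_mult_distrib)
    qed
    finally show ?case unfolding pows .
   qed
  qed
  also have "... = (real M - 1 + \<sigma>) * (E / 2 + (16 * (2 * real q - 1) / real M) ^ q * expectation (\<lambda>z. V z ^ q) / 2)"
   unfolding E_def using int VI(1)[OF q] M by simp
  finally have "E \<le> E / 2 + (16 * (2 * real q - 1) / real M) ^ q * expectation (\<lambda>z. V z ^ q) / 2"
   using m(1) by (simp only: mult_le_cancel_left_pos)
  then have "E \<le> (16 * (2 * real q - 1) / real M) ^ q * expectation (\<lambda>z. V z ^ q)" by simp
  also have "... \<le> (16 * (2 * real q - 1) / real M) ^ q * (8 * (2 * real q - 1) / real M * (\<Sum>k<M. \<Sum>l<M. (cmod (B k l))\<^sup>2)) ^ q"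
  proof (rule mult_left_mono)
   define S where "S = (\<Sum>k<M. \<Sum>l<M. (cmod (B k l))\<^sup>2)"
   have S: "0 \<le> S" by (simp add: S_def sum_nonneg)
   have "expectation (\<lambda>z. V z ^ q) \<le> (4 * (2 * real q - 1) / (real M - 1) * S) ^ q"
    unfolding S_def using VI(2)[OF q] M by simp
   also have "... \<le> (8 * (2 * real q - 1) / real M * S) ^ q"
   proof (intro power_mono mult_right_mono S)
    have "4 / (real M - 1) \<le> 8 / real M" using M by (simp add: field_simps)
    from mult_right_mono[OF this, of "2 * real q - 1"] show "4 * (2 * real q - 1) / (real M - 1) \<le> 8 * (2 * real q - 1) / real M"
     using q by (simp add: mult.commute)
   qed (use q M S in auto)
   finally show "expectation (\<lambda>z. V z ^ q) \<le> (8 * (2 * real q - 1) / real M * (\<Sum>k<M. \<Sum>l<M. (cmod (B k l))\<^sup>2)) ^ q"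
    by (simp add: S_def)
  qed (use q in simp)
  also have "... = (128 * (2 * real q - 1)\<^sup>2 / (real M)\<^sup>2 * (\<Sum>k<M. \<Sum>l<M. (cmod (B k l))\<^sup>2)) ^ q"
  proof -
   have "16 * r / m * (8 * r / m * S) = 128 * r\<^sup>2 / m\<^sup>2 * S" for r m S :: real
    by (simp add: power2_eq_square)
   then show ?thesis unfolding power_mult_distrib[symmetric] by (simp only:)
  qed
  finally show "expectation (\<lambda>z. Re (form B z) ^ (2 * q))
     \<le> (128 * (2 * real q - 1)\<^sup>2 / (real M)\<^sup>2 * (\<Sum>k<M. \<Sum>l<M. (cmod (B k l))\<^sup>2)) ^ q"
   by (simp add: E_def)
qed

end

end

section \<open>Rows on the sphere\<close>

text \<open>Plane rotations are orthogonal matrices, so the real and the complex sphere law are invariant under the same one-parameter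
  groups and can be treated together.\<close>

lemma haar_sphere_invariant:
  assumes h: "haar_sphere K M \<nu>" and K: "\<real> \<subseteq> K"
  shows "invariant_sphere_law \<nu> M"
proof -
  interpret prob_space \<nu> using h by (simp add: haar_sphere_def)
  show ?thesis
  proof
   show "sets \<nu> = sets (vec_space M)" using h by (simp add: haar_sphere_def)
   show "AE u in \<nu>. (\<Sum>k<M. (cmod (u k))\<^sup>2) = 1"
    using h by (auto simp: haar_sphere_def elim!: eventually_mono)
   fix i j t assume ij: "i < M" "j < M" "i \<noteq> j"
   from plane_rotation_orthogonal[OF ij, of t] obtain U where U: "U \<in> carrier_mat M M" "elements_mat U \<subseteq> \<real>" "U * mat_adjoint U = 1\<^sub>m M"
    "\<And>z. (\<lambda>k\<in>{..<M}. \<Sum>l<M. U $$ (k, l) * z l) = plane_rotation M i j t z"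
    by blast
   have "elements_mat U \<subseteq> K" using U(2) K by blast
   then have "distr \<nu> (vec_space M) (\<lambda>u. \<lambda>i\<in>{..<M}. \<Sum>j<M. U $$ (i, j) * u j) = \<nu>"
    using h U(1,3) unfolding haar_sphere_def by blast
   then show "distr \<nu> (vec_space M) (plane_rotation M i j t) = \<nu>" unfolding U(4) .
  qed
qed

text \<open>A Hermitian matrix without its trace part splits into a real symmetric and a purely imaginary
  antisymmetric matrix, and the scaling by \<open>M\<close> exactly compensates the factor \<open>M\<^sup>-\<^sup>2\<close> of the moment
  bound.\<close>

lemma (in invariant_sphere_law) scaled_law_concentrated:
  assumes q: "1 \<le> q" and M: "4 \<le> M"
  shows "concentrated_forms q (2 * (512 * (2 * real q - 1)\<^sup>2) ^ q) M
    (distr \<nu> (vec_space M) (\<lambda>u. \<lambda>j\<in>{..<M}. of_real (sqrt (real M)) * u j))"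
  unfolding concentrated_forms_def
proof (intro allI impI)
  fix A :: "nat \<Rightarrow> nat \<Rightarrow> complex" assume A: "\<forall>k<M. \<forall>l<M. A l k = cnj (A k l)"
  let ?s = "\<lambda>u::nat\<Rightarrow>complex. \<lambda>j\<in>{..<M}. complex_of_real (sqrt (real M)) * u j"
  define \<tau> where "\<tau> = Re (\<Sum>k<M. A k k) / real M"
  define S where "S k l = complex_of_real (Re (A k l) - (if k = l then \<tau> else 0))" for k l
  define T where "T k l = \<i> * complex_of_real (Im (A k l))" for k l
  have M0: "real M \<noteq> 0" using M by simp
  have A': "A l k = cnj (A k l)" if "k < M" "l < M" for k l using A that by blast
  have ReA: "Re (A l k) = Re (A k l)" "Im (A l k) = - Im (A k l)" if "k < M" "l < M" for k l
   unfolding A'[OF that] by simp_all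
  have S: "S l k = cnj (S k l)" "S l k = of_real 1 * S k l" if "k < M" "l < M" for k l
   unfolding S_def ReA(1)[OF that] by simp_all
  have T: "T l k = cnj (T k l)" "T l k = of_real (- 1) * T k l" if "k < M" "l < M" for k l
   unfolding T_def ReA(2)[OF that] by simp_all
  have "(\<Sum>k<M. S k k) = of_real (Re (\<Sum>k<M. A k k) - real M * \<tau>)" by (simp add: S_def sum_subtractf)
  then have trS: "(\<Sum>k<M. S k k) = 0" using M0 by (simp add: \<tau>_def)
  have "Im (A k k) = 0" if "k < M" for k using ReA(2)[OF that that] by simp
  then have trT: "(\<Sum>k<M. T k k) = 0" by (simp add: T_def)
  have one: "\<bar>1 :: real\<bar> \<le> 1" "\<bar>- 1 :: real\<bar> \<le> 1" by simp_all
  note fS = form_moments[where B = S and \<sigma> = 1, OF S(1) S(2) one(1) trS q M] and fT = form_moments[where B = T and \<sigma> = "- 1", OF T(1) T(2) one(2) trT q M]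
  define F where "F = (\<Sum>k<M. \<Sum>l<M. (cmod (A k l))\<^sup>2)"
  have F0: "0 \<le> F" by (simp add: F_def sum_nonneg)
  have S_le: "(\<Sum>k<M. \<Sum>l<M. (cmod (S k l))\<^sup>2) \<le> F"
  proof -
   have "(cmod (S k l))\<^sup>2 = (Re (A k l))\<^sup>2 + (if l = k then \<tau>\<^sup>2 - 2 * \<tau> * Re (A k k) else 0)" for k l
    by (simp add: S_def power2_eq_square algebra_simps del: of_real_diff)
   then have "(\<Sum>k<M. \<Sum>l<M. (cmod (S k l))\<^sup>2) = (\<Sum>k<M. \<Sum>l<M. (Re (A k l))\<^sup>2) + (\<Sum>k<M. \<tau>\<^sup>2 - 2 * \<tau> * Re (A k k))"
    by (simp add: sum.distrib)
   also have "(\<Sum>k<M. \<tau>\<^sup>2 - 2 * \<tau> * Re (A k k)) = real M * \<tau>\<^sup>2 - 2 * \<tau> * (real M * \<tau>)"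
   proof -
    have "(\<Sum>k<M. Re (A k k)) = real M * \<tau>" using M0 by (simp add: \<tau>_def)
    moreover have "(\<Sum>k<M. 2 * \<tau> * Re (A k k)) = 2 * \<tau> * (\<Sum>k<M. Re (A k k))" by (simp only: sum_distrib_left)
    ultimately show ?thesis by (simp add: sum_subtractf)
   qed
   also have "... = - (real M * \<tau>\<^sup>2)" by (simp add: power2_eq_square)
   also have "... \<le> 0" by simp
   also have "(\<Sum>k<M. \<Sum>l<M. (Re (A k l))\<^sup>2) + 0 \<le> F"
    unfolding F_def by (simp add: sum_mono cmod_power2 sum_nonneg)
   finally show ?thesis by simp
  qed
  have T_le: "(\<Sum>k<M. \<Sum>l<M. (cmod (T k l))\<^sup>2) \<le> F"
   unfolding F_def T_def by (intro sum_mono) (simp add: norm_mult cmod_power2)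
  have decomp: "centred_form M A (?s u) = real M * (Re (form S u) + Re (form T u))" if u: "u \<in> sphere" for u
  proof -
   have "(\<Sum>k<M. \<Sum>l<M. cnj (?s u k) * ?s u l * A k l)
     = (\<Sum>k<M. \<Sum>l<M. of_real (real M) * (cnj (u k) * (S k l * u l) + cnj (u k) * (T k l * u l) + (if l = k then of_real (\<tau> * (cmod (u k))\<^sup>2) else 0)))"
   proof (intro sum.cong refl)
    fix k l assume kl: "k \<in> {..<M}" "l \<in> {..<M}"
    have Aeq: "A k l = S k l + T k l + (if l = k then of_real \<tau> else 0)"
     by (simp add: S_def T_def complex_eq_iff)
    have r: "complex_of_real (sqrt (real M)) * complex_of_real (sqrt (real M)) = of_real (real M)"
     by (simp flip: of_real_mult)
    have "cnj (?s u k) * ?s u l * A k l = (complex_of_real (sqrt (real M)) * complex_of_real (sqrt (real M))) * (cnj (u k) * u l * A k l)"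
     using kl by (simp add: mult_ac)
    also have "... = of_real (real M) * (cnj (u k) * u l * A k l)" unfolding r ..
    also have "cnj (u k) * u l * A k l = cnj (u k) * (S k l * u l) + cnj (u k) * (T k l * u l) + (if l = k then of_real (\<tau> * (cmod (u k))\<^sup>2) else 0)"
     unfolding Aeq by (auto simp: algebra_simps complex_norm_square simp del: of_real_power)
    finally show "cnj (?s u k) * ?s u l * A k l = of_real (real M) * (cnj (u k) * (S k l * u l) + cnj (u k) * (T k l * u l) + (if l = k then of_real (\<tau> * (cmod (u k))\<^sup>2) else 0))" .
   qed
   also have "... = of_real (real M) * (form S u + form T u + (\<Sum>k<M. of_real (\<tau> * (cmod (u k))\<^sup>2)))"
    by (simp add: form_def lin_def sum.distrib sum_distrib_left[symmetric])
   also have "(\<Sum>k<M. complex_of_real (\<tau> * (cmod (u k))\<^sup>2)) = of_real (\<tau> * (\<Sum>k<M. (cmod (u k))\<^sup>2))"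
    by (simp add: sum_distrib_left)
   also have "(\<Sum>k<M. (cmod (u k))\<^sup>2) = 1" using u by (simp add: sphere_def)
   finally have e: "(\<Sum>k<M. \<Sum>l<M. cnj (?s u k) * ?s u l * A k l) = of_real (real M) * (form S u + form T u + of_real (\<tau> * 1))" .
   have "Re (\<Sum>k<M. A k k) = real M * \<tau>" using M0 by (simp add: \<tau>_def)
   then show ?thesis unfolding centred_form_def e by (simp add: algebra_simps)
  qed
  define g where "g u = real M * (Re (form S u) + Re (form T u))" for u
  have sm: "?s \<in> measurable \<nu> (vec_space M)"
   unfolding measurable_cong_sets[OF sets_law refl] by measurable
  have cm: "centred_form M A \<in> borel_measurable (vec_space M)" unfolding centred_form_def by measurable
  have lm: "lin a \<in> borel_measurable (vec_space M)" for a unfolding lin_def by measurable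
  have gm: "g \<in> borel_measurable \<nu>"
   unfolding g_def form_def by (rule measurable_law) (use lm in measurable)
  have AEg: "AE u in \<nu>. centred_form M A (?s u) = g u" using AE_sphere decomp by (auto simp: g_def elim!: eventually_mono)
  have cs: "(\<lambda>u. centred_form M A (?s u)) \<in> borel_measurable \<nu>" by (rule measurable_compose[OF sm cm])
  have dom: "integrable \<nu> (\<lambda>u. real M ^ (2 * q) * (2 ^ (2 * q) * (Re (form S u) ^ (2 * q) + Re (form T u) ^ (2 * q))))"
   using fS(1) fT(1) by simp
  have g_le: "g u ^ (2 * q) \<le> real M ^ (2 * q) * (2 ^ (2 * q) * (Re (form S u) ^ (2 * q) + Re (form T u) ^ (2 * q)))" for u
  proof -
   have "\<bar>Re (form S u) + Re (form T u)\<bar> ^ (2 * q) \<le> (\<bar>Re (form S u)\<bar> + \<bar>Re (form T u)\<bar>) ^ (2 * q)" by (intro power_mono) auto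
   also have "... \<le> 2 ^ (2 * q) * (\<bar>Re (form S u)\<bar> ^ (2 * q) + \<bar>Re (form T u)\<bar> ^ (2 * q))" by (rule power_add_le_max) auto
   finally show ?thesis unfolding g_def power_mult_distrib by (intro mult_left_mono) (auto simp: power_even_abs)
  qed
  have gi: "integrable \<nu> (\<lambda>u. g u ^ (2 * q))"
   by (rule Bochner_Integration.integrable_bound[OF dom])
    (use gm order_trans[OF g_le abs_ge_self] in \<open>auto intro!: AE_I2 simp: zero_le_even_power\<close>)
  have i: "integrable (distr \<nu> (vec_space M) ?s) (\<lambda>z. centred_form M A z ^ (2 * q))"
  proof -
   have "integrable \<nu> (\<lambda>u. centred_form M A (?s u) ^ (2 * q)) \<longleftrightarrow> integrable \<nu> (\<lambda>u. g u ^ (2 * q))"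
   proof (rule integrable_cong_AE)
    show "AE u in \<nu>. centred_form M A (?s u) ^ (2 * q) = g u ^ (2 * q)" using AEg by eventually_elim simp
   qed (rule borel_measurable_power[OF cs] borel_measurable_power[OF gm])+
   then show ?thesis
    using integrable_distr_eq[OF sm borel_measurable_power[OF cm]] gi by blast
  qed
  have "(LINT z|distr \<nu> (vec_space M) ?s. centred_form M A z ^ (2 * q)) = (LINT u|\<nu>. centred_form M A (?s u) ^ (2 * q))"
   by (rule integral_distr[OF sm borel_measurable_power[OF cm]])
  also have "... = (LINT u|\<nu>. g u ^ (2 * q))"
  proof (rule integral_cong_AE)
   show "AE u in \<nu>. centred_form M A (?s u) ^ (2 * q) = g u ^ (2 * q)" using AEg by eventually_elim simp
  qed (rule borel_measurable_power[OF cs] borel_measurable_power[OF gm])+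
  also have "... \<le> (LINT u|\<nu>. real M ^ (2 * q) * (2 ^ (2 * q) * (Re (form S u) ^ (2 * q) + Re (form T u) ^ (2 * q))))"
   by (rule integral_mono[OF gi dom g_le])
  also have "... = real M ^ (2 * q) * (2 ^ (2 * q) * (expectation (\<lambda>u. Re (form S u) ^ (2 * q)) + expectation (\<lambda>u. Re (form T u) ^ (2 * q))))"
   using fS(1) fT(1) by simp
  also have "... \<le> real M ^ (2 * q) * (2 ^ (2 * q) * ((128 * (2 * real q - 1)\<^sup>2 / (real M)\<^sup>2 * F) ^ q + (128 * (2 * real q - 1)\<^sup>2 / (real M)\<^sup>2 * F) ^ q))"
  proof (intro mult_left_mono add_mono)
   have p: "(128 * (2 * real q - 1)\<^sup>2 / (real M)\<^sup>2 * G) ^ q \<le> (128 * (2 * real q - 1)\<^sup>2 / (real M)\<^sup>2 * F) ^ q" if "0 \<le> G" "G \<le> F" for G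
    using that by (intro power_mono mult_left_mono) auto
   show "expectation (\<lambda>u. Re (form S u) ^ (2 * q)) \<le> (128 * (2 * real q - 1)\<^sup>2 / (real M)\<^sup>2 * F) ^ q"
    by (rule order_trans[OF fS(3) p[OF _ S_le]]) (auto intro!: sum_nonneg)
   show "expectation (\<lambda>u. Re (form T u) ^ (2 * q)) \<le> (128 * (2 * real q - 1)\<^sup>2 / (real M)\<^sup>2 * F) ^ q"
    by (rule order_trans[OF fT(3) p[OF _ T_le]]) (auto intro!: sum_nonneg)
  qed auto
  also have "... = 2 * (512 * (2 * real q - 1)\<^sup>2) ^ q * F ^ q"
  proof -
   have "real M ^ (2 * q) = ((real M)\<^sup>2) ^ q" "(2::real) ^ (2 * q) = 4 ^ q" by (simp_all add: power_mult)
   then have "real M ^ (2 * q) * (2 ^ (2 * q) * (x ^ q + x ^ q)) = 2 * ((real M)\<^sup>2 * 4 * x) ^ q" for x :: real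
    by (simp add: power_mult_distrib)
   moreover have "(real M)\<^sup>2 * 4 * (128 * (2 * real q - 1)\<^sup>2 / (real M)\<^sup>2 * F) = 512 * (2 * real q - 1)\<^sup>2 * F"
    using M0 by simp
   ultimately have "real M ^ (2 * q) * (2 ^ (2 * q) * ((128 * (2 * real q - 1)\<^sup>2 / (real M)\<^sup>2 * F) ^ q + (128 * (2 * real q - 1)\<^sup>2 / (real M)\<^sup>2 * F) ^ q))
     = 2 * (512 * (2 * real q - 1)\<^sup>2 * F) ^ q" by presburger
   also have "... = 2 * (512 * (2 * real q - 1)\<^sup>2) ^ q * F ^ q" using power_mult_distrib[of "512 * (2 * real q - 1)\<^sup>2" F q] by (simp only: mult.assoc)
   finally show ?thesis .
  qed
  finally have b: "(LINT z|distr \<nu> (vec_space M) ?s. centred_form M A z ^ (2 * q)) \<le> 2 * (512 * (2 * real q - 1)\<^sup>2) ^ q * F ^ q" .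
  have "(LINT z|distr \<nu> (vec_space M) ?s. centred_form M A z) = (LINT u|\<nu>. centred_form M A (?s u))"
   by (rule integral_distr[OF sm cm])
  also have "... = (LINT u|\<nu>. g u)" by (rule integral_cong_AE[OF cs gm AEg])
  also have "... = 0"
   unfolding g_def using fS(1)[of 1] fT(1)[of 1] fS(2) fT(2) by simp
  finally have z: "(LINT z|distr \<nu> (vec_space M) ?s. centred_form M A z) = 0" .
  show "integrable (distr \<nu> (vec_space M) ?s) (\<lambda>z. centred_form M A z ^ (2 * q)) \<and>
   (LINT z|distr \<nu> (vec_space M) ?s. centred_form M A z ^ (2 * q))
    \<le> 2 * (512 * (2 * real q - 1)\<^sup>2) ^ q * (\<Sum>k<M. \<Sum>l<M. (cmod (A k l))\<^sup>2) ^ q \<and>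
   (LINT z|distr \<nu> (vec_space M) ?s. centred_form M A z) = 0"
   using i b z unfolding F_def by blast
qed

lemma row_law_concentrated:
  assumes q: "1 \<le> q"
   and law: "row_law \<in> {normal_law real_std_normal, normal_law complex_std_normal, sphere_law \<real>, sphere_law UNIV}"
  shows "\<exists>K\<ge>0. \<forall>M\<ge>4. \<forall>\<mu>. row_law M \<mu> \<longrightarrow> concentrated_forms q K M \<mu>"
proof -
  have sph: "\<exists>K\<ge>0. \<forall>M\<ge>4. \<forall>\<mu>. sphere_law S M \<mu> \<longrightarrow> concentrated_forms q K M \<mu>" if S: "\<real> \<subseteq> S" for S
  proof (intro exI[of _ "2 * (512 * (2 * real q - 1)\<^sup>2) ^ q"] conjI allI impI)
   fix M :: nat and \<mu> assume M: "4 \<le> M" and "sphere_law S M \<mu>"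
   then obtain \<nu> where \<nu>: "haar_sphere S M \<nu>"
    "\<mu> = distr \<nu> (vec_space M) (\<lambda>u. \<lambda>j\<in>{..<M}. of_real (sqrt (real M)) * u j)"
    by (auto simp: sphere_law_def)
   interpret invariant_sphere_law \<nu> M by (rule haar_sphere_invariant[OF \<nu>(1) S])
   show "concentrated_forms q (2 * (512 * (2 * real q - 1)\<^sup>2) ^ q) M \<mu>"
    unfolding \<nu>(2) by (rule scaled_law_concentrated[OF q M])
  qed simp
  have nrm: "\<exists>K\<ge>0. \<forall>M\<ge>4. \<forall>\<mu>. normal_law \<nu> M \<mu> \<longrightarrow> concentrated_forms q K M \<mu>"
   if "\<nu> = real_std_normal \<or> \<nu> = complex_std_normal" for \<nu>
   using normal_law_concentrated[OF q that] by (meson le_trans one_le_numeral)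
  show ?thesis using law sph[of \<real>] sph[of UNIV] nrm by auto
qed

section \<open>Slowly varying functions\<close>

text \<open>Continuity of the measure, in the form in which two sets of almost full measure are forced to meet.\<close>

lemma emeasure_limit_large:
  fixes A :: "nat \<Rightarrow> real set"
  assumes A: "\<And>n. A n \<in> sets lebesgue" and inc: "incseq A" and I: "(\<Union>n. A n) = {a..b}" and ab: "a \<le> b" and e: "0 < e"
  shows "\<exists>N. \<forall>n\<ge>N. b - a - e < measure lebesgue (A n)"
proof -
  have sub: "A n \<subseteq> {a..b}" for n using I by blast
  have lm: "A n \<in> lmeasurable" for n
   by (rule fmeasurableI2[of "{a..b}"]) (use sub A in auto)
  have "(\<lambda>n. measure lebesgue (A n)) \<longlonglongrightarrow> measure lebesgue (\<Union>n. A n)"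
  proof (rule Lim_measure_incseq)
   show "range A \<subseteq> sets lebesgue" using A by auto
   show "emeasure lebesgue (\<Union>n. A n) \<noteq> \<infinity>" unfolding I by (simp add: emeasure_lborel_Icc_eq)
  qed (rule inc)
  then have "(\<lambda>n. measure lebesgue (A n)) \<longlonglongrightarrow> b - a" unfolding I using ab by simp
  then have "\<forall>\<^sub>F n in sequentially. b - a - e < measure lebesgue (A n)"
   by (rule order_tendstoD) (use e in simp)
  then show ?thesis by (simp add: eventually_sequentially)
qed

text \<open>A slowly varying function oscillates boundedly over dyadic intervals: otherwise there are scales
  \<open>x n\<close> and ratios \<open>\<lambda> n \<in> [1, 2]\<close> violating the bound. The sets of \<open>s\<close> at which \<open>L (s x n) / L (x n)\<close>,
  respectively \<open>L (s \<lambda> n x n) / L (\<lambda> n x n)\<close>, stay close to 1 have almost full measure in \<open>[1, 4]\<close>, so that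
  the second, scaled by \<open>\<lambda> n\<close>, meets the first.\<close>

lemma slowly_varying_dyadic_bound:
  assumes L: "slowly_varying_on A L" and A: "0 < A"
  shows "\<exists>X\<ge>A. \<forall>x\<ge>X. \<forall>t\<in>{1..2}. L (t * x) \<le> 4 * L x \<and> L x \<le> 4 * L (t * x)"
proof (rule ccontr)
  assume neg: "\<not> ?thesis"
  have pos: "\<And>x. A \<le> x \<Longrightarrow> 0 < L x" and lim: "\<And>t. 0 < t \<Longrightarrow> ((\<lambda>x. L (t * x) / L x) \<longlongrightarrow> 1) at_top"
   and Lm: "L \<in> borel_measurable (lebesgue_on {A..})"
   using L by (auto simp: slowly_varying_on_def)
  have "\<forall>n. \<exists>x t. max A (real n) \<le> x \<and> t \<in> {1..2} \<and> \<not> (L (t * x) \<le> 4 * L x \<and> L x \<le> 4 * L (t * x))"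
   using neg by (meson max.cobounded1)
  then obtain x t where xt: "\<And>n. max A (real n) \<le> x n" "\<And>n. t n \<in> {1..2::real}"
   "\<And>n. \<not> (L (t n * x n) \<le> 4 * L (x n) \<and> L (x n) \<le> 4 * L (t n * x n))"
   by metis
  define y where "y n = t n * x n" for n
  have xA: "A \<le> x n" "real n \<le> x n" for n using xt(1)[of n] by auto
  have yA: "A \<le> y n" "real n \<le> y n" for n
  proof -
   have "x n \<le> y n" unfolding y_def using xt(2)[of n] xA(1)[of n] A by simp
   then show "A \<le> y n" "real n \<le> y n" using xA[of n] by auto
  qed
  define G where "G z n = {s \<in> {1..4::real}. \<forall>m\<ge>n. L (s * z m) \<le> 2 * L (z m) \<and> L (z m) \<le> 2 * L (s * z m)}" for z :: "nat \<Rightarrow> real" and n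
  have good: "\<exists>N. \<forall>n\<ge>N. 3 - 1 / 4 < measure lebesgue (G z n)" "\<And>n. G z n \<in> sets lebesgue"
   if z: "\<And>n. A \<le> z n" "\<And>n. real n \<le> z n" for z
  proof -
   have z0: "0 < z n" for n using z(1)[of n] A by linarith
   have m1: "{s \<in> {1..4}. L (s * z m) \<le> 2 * L (z m) \<and> L (z m) \<le> 2 * L (s * z m)} \<in> sets lebesgue" for m
   proof -
    define Q where "Q = {w \<in> {A..}. L w \<le> 2 * L (z m) \<and> L (z m) \<le> 2 * L w}"
    have "Q \<in> sets (lebesgue_on {A..})"
    proof -
     have "{w \<in> space (lebesgue_on {A..}). L w \<le> 2 * L (z m) \<and> L (z m) \<le> 2 * L w} \<in> sets (lebesgue_on {A..})"
      using Lm by measurable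
     then show ?thesis by (simp add: Q_def)
    qed
    then have Q: "Q \<in> sets lebesgue" by (simp add: sets_restrict_space_iff)
    have "(\<lambda>s. z m *\<^sub>R s) \<in> measurable lebesgue lebesgue" by (rule lebesgue_measurable_scaling)
    from measurable_sets[OF this Q] have "(\<lambda>s. z m * s) -` Q \<in> sets lebesgue" by simp
    then have "((\<lambda>s. z m * s) -` Q) \<inter> {1..4} \<in> sets lebesgue" by (intro sets.Int) auto
    moreover have "((\<lambda>s. z m * s) -` Q) \<inter> {1..4} = {s \<in> {1..4}. L (s * z m) \<le> 2 * L (z m) \<and> L (z m) \<le> 2 * L (s * z m)}"
    proof -
     have "A \<le> z m * s" if "1 \<le> s" for s
      using mult_left_mono[OF that, of "z m"] z0[of m] z(1)[of m] by (simp add: order_trans)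
     then show ?thesis unfolding Q_def by (auto simp: mult.commute)
    qed
    ultimately show ?thesis by simp
   qed
   have G_eq: "G z n = {1..4} \<inter> (\<Inter>m\<in>{n..}. {s \<in> {1..4}. L (s * z m) \<le> 2 * L (z m) \<and> L (z m) \<le> 2 * L (s * z m)})" for n
    unfolding G_def by auto
   show Gm: "G z n \<in> sets lebesgue" for n
    unfolding G_eq using m1 by (intro sets.Int sets.countable_INT'') auto
   have inc: "incseq (G z)" unfolding G_def incseq_def by auto
   have "(\<Union>n. G z n) = {1..4}"
   proof (intro equalityI subsetI)
    fix s :: real assume s: "s \<in> {1..4}"
    have zt: "filterlim z at_top sequentially"
     by (rule filterlim_at_top_mono[OF filterlim_real_sequentially]) (use z(2) in auto)
    have "((\<lambda>n. L (s * z n) / L (z n)) \<longlongrightarrow> 1) sequentially"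
     using filterlim_compose[OF lim zt] s by simp
    then have "\<forall>\<^sub>F n in sequentially. L (s * z n) / L (z n) \<in> {1 / 2<..<2}"
     by (intro topological_tendstoD) auto
    then obtain N where N: "\<And>n. N \<le> n \<Longrightarrow> L (s * z n) / L (z n) \<in> {1 / 2<..<2}"
     by (auto simp: eventually_sequentially)
    have "s \<in> G z N" unfolding G_def using s N pos[OF z(1)] by (fastforce simp: field_simps)
    then show "s \<in> (\<Union>n. G z n)" by blast
   qed (auto simp: G_def)
   then show "\<exists>N. \<forall>n\<ge>N. 3 - 1 / 4 < measure lebesgue (G z n)"
    using emeasure_limit_large[OF Gm inc, of 1 4 "1 / 4"] by simp
  qed
  obtain N1 N2 where N: "\<forall>n\<ge>N1. 3 - 1 / 4 < measure lebesgue (G x n)" "\<forall>n\<ge>N2. 3 - 1 / 4 < measure lebesgue (G y n)"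
   using good(1)[OF xA] good(1)[OF yA] by blast
  define n where "n = max N1 N2"
  have big: "3 - 1 / 4 < measure lebesgue (G x n)" "3 - 1 / 4 < measure lebesgue (G y n)" using N by (auto simp: n_def)
  define l where "l = t n"
  have l: "1 \<le> l" "l \<le> 2" using xt(2)[of n] by (auto simp: l_def)
  define H where "H = (\<lambda>s. l *\<^sub>R s) ` G y n"
  have Gsub: "G z m \<subseteq> {1..4}" for z m by (auto simp: G_def)
  have fin: "G x n \<in> lmeasurable" "G y n \<in> lmeasurable"
   using good(2)[OF xA, of n] good(2)[OF yA, of n] Gsub by (auto intro: fmeasurableI2[of "{1..4}"])
  have Hsub: "H \<subseteq> {1..8}"
  proof
   fix w assume "w \<in> H"
   then obtain s where s: "s \<in> G y n" "w = l * s" by (auto simp: H_def)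
   then have "1 \<le> s" "s \<le> 4" using Gsub[of y n] by auto
   then have "1 * 1 \<le> l * s" "l * s \<le> 2 * 4" using l by (intro mult_mono; simp)+
   then show "w \<in> {1..8}" using s by simp
  qed
  have H: "H \<in> lmeasurable" "measure lebesgue H = l * measure lebesgue (G y n)"
  proof -
   have Heq: "H = (*\<^sub>R) (1 / l) -` G y n \<inter> space lebesgue"
   proof (intro equalityI subsetI)
    fix w assume "w \<in> (*\<^sub>R) (1 / l) -` G y n \<inter> space lebesgue"
    then have "w / l \<in> G y n" by simp
    moreover have "w = l *\<^sub>R (w / l)" using l by simp
    ultimately show "w \<in> H" unfolding H_def by (rule rev_image_eqI)
   qed (use l in \<open>auto simp: H_def\<close>)
   have "H \<in> sets lebesgue"
    unfolding Heq by (rule measurable_sets[OF lebesgue_measurable_scaling good(2)[OF yA]])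
   moreover have "{1..8::real} \<in> lmeasurable" by simp
   ultimately show "H \<in> lmeasurable" using Hsub by (simp add: fmeasurableI2[of "{1..8}"])
   show "measure lebesgue H = l * measure lebesgue (G y n)"
    using measure_lebesgue_affine[of l 0 "G y n"] l by (simp add: H_def)
  qed
  have "G x n \<inter> H \<noteq> {}"
  proof
   assume disj: "G x n \<inter> H = {}"
   \<comment> \<open>both sets lie in \<open>[1, max 4 (4 l)]\<close>, which has length \<open>4 l - 1\<close>\<close>
   have "G x n \<union> H \<subseteq> {1..4 * l}"
   proof
    fix w assume "w \<in> G x n \<union> H"
    then show "w \<in> {1..4 * l}"
    proof
     assume "w \<in> G x n" then show ?thesis using Gsub[of x n] l by fastforce
    next
     assume "w \<in> H"
     then obtain s where s: "s \<in> G y n" "w = l * s" by (auto simp: H_def)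
     then have "1 \<le> s" "s \<le> 4" using Gsub[of y n] by auto
     then show ?thesis using Hsub \<open>w \<in> H\<close> s l by auto
    qed
   qed
   then have "measure lebesgue (G x n \<union> H) \<le> measure lebesgue {1..4 * l}"
    using fin H by (intro measure_mono_fmeasurable) auto
   moreover have "measure lebesgue (G x n \<union> H) = measure lebesgue (G x n) + measure lebesgue H"
    using fin H disj by (intro measure_Un3[THEN trans]) auto
   moreover have "measure lebesgue {1..4 * l} = 4 * l - 1" using l by simp
   ultimately have "measure lebesgue (G x n) + l * measure lebesgue (G y n) \<le> 4 * l - 1" using H by simp
   moreover have "l * (11 / 4) \<le> l * measure lebesgue (G y n)" using big l by (intro mult_left_mono) auto
   moreover have "11 / 4 < measure lebesgue (G x n)" using big by simp
   ultimately show False using l by linarith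
  qed
  then obtain w where w: "w \<in> G x n" "w \<in> H" by blast
  then obtain s where s: "s \<in> G y n" "w = l * s" by (auto simp: H_def)
  have "L (w * x n) \<le> 2 * L (x n)" "L (x n) \<le> 2 * L (w * x n)" using w by (auto simp: G_def)
  moreover have e: "s * y n = w * x n" by (simp add: s y_def l_def)
  have "L (s * y n) \<le> 2 * L (y n)" "L (y n) \<le> 2 * L (s * y n)" using s by (auto simp: G_def)
  then have "L (w * x n) \<le> 2 * L (y n)" "L (y n) \<le> 2 * L (w * x n)" unfolding e by auto
  ultimately have "L (y n) \<le> 4 * L (x n) \<and> L (x n) \<le> 4 * L (y n)" by linarith
  then show False using xt(3)[of n] unfolding y_def by blast
qed

text \<open>Potter's bounds up to constants. As \<open>L (2 * x) / L x\<close> tends to 1, each doubling of the argument costs at most a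
  factor \<open>2 powr d\<close>; the dyadic bound covers the arguments in between.\<close>

lemma slowly_varying_power_bounds:
  assumes L: "slowly_varying_on A L" and A: "0 < A" and d: "0 < d"
  shows "\<exists>c>0. \<exists>C>0. \<exists>X\<ge>max A 1. \<forall>x\<ge>X. c * x powr (- d) \<le> L x \<and> L x \<le> C * x powr d"
proof -
  have pos: "\<And>x. A \<le> x \<Longrightarrow> 0 < L x" and lim: "((\<lambda>x. L (2 * x) / L x) \<longlongrightarrow> 1) at_top"
   using L by (auto simp: slowly_varying_on_def)
  obtain X1 where X1: "A \<le> X1" "\<And>x t. X1 \<le> x \<Longrightarrow> t \<in> {1..2} \<Longrightarrow> L (t * x) \<le> 4 * L x \<and> L x \<le> 4 * L (t * x)"
   using slowly_varying_dyadic_bound[OF L A] by blast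
  have gt1: "1 < 2 powr d" using d by simp
  then have "\<forall>\<^sub>F x in at_top. L (2 * x) / L x \<in> {1 / 2 powr d<..<2 powr d}"
   by (intro topological_tendstoD[OF lim]) auto
  then obtain X2 where X2: "\<And>x. X2 \<le> x \<Longrightarrow> L (2 * x) / L x \<in> {1 / 2 powr d<..<2 powr d}"
   by (auto simp: eventually_at_top_linorder)
  define X where "X = Max {X1, X2, A, 1}"
  have X: "X1 \<le> X" "X2 \<le> X" "A \<le> X" "1 \<le> X" by (auto simp: X_def)
  have iter: "L (2 ^ k * X) \<le> (2 powr d) ^ k * L X \<and> L X \<le> (2 powr d) ^ k * L (2 ^ k * X)" for k
  proof (induction k)
   case (Suc k)
   define z where "z = 2 ^ k * X"
   have "1 * X \<le> 2 ^ k * X" using X by (intro mult_right_mono) auto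
   then have z: "X \<le> z" by (simp add: z_def)
   have Lz: "0 < L z" using pos z X by simp
   have r: "L (2 * z) \<le> 2 powr d * L z" "L z \<le> 2 powr d * L (2 * z)"
    using X2[of z] z X Lz gt1 by (auto simp: field_simps)
   have "L (2 * z) \<le> 2 powr d * ((2 powr d) ^ k * L X)"
    by (rule order_trans[OF r(1) mult_left_mono[OF conjunct1[OF Suc.IH, folded z_def]]]) simp
   moreover have "L X \<le> (2 powr d) ^ k * (2 powr d * L (2 * z))"
    by (rule order_trans[OF conjunct2[OF Suc.IH, folded z_def] mult_left_mono[OF r(2)]]) simp
   ultimately show ?case by (simp add: z_def mult_ac)
  qed simp
  have LX: "0 < L X" using pos X by simp
  have main: "(L X * X powr d / 4 / 2 powr d) * x powr (- d) \<le> L x \<and> L x \<le> (4 * L X) * x powr d" if x: "X \<le> x" for x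
  proof -
   define k where "k = nat \<lfloor>log 2 (x / X)\<rfloor>"
   have X0: "0 < X" "0 < x" using X x by auto
   have lg: "0 \<le> log 2 (x / X)" using x X0 by simp
   have k1: "real k \<le> log 2 (x / X)" "log 2 (x / X) < real k + 1"
    using lg by (auto simp: k_def)
   have "2 powr real k \<le> x / X" using k1(1) X0 by (simp add: le_log_iff)
   then have p1: "2 ^ k * X \<le> x" using X0 by (simp add: powr_realpow field_simps)
   have "x / X < 2 powr (real k + 1)" using k1(2) X0 by (simp add: log_less_iff)
   then have p2: "x \<le> 2 * (2 ^ k * X)" using X0 by (simp add: powr_add powr_realpow field_simps)
   define z where "z = 2 ^ k * X"
   have "1 * X \<le> 2 ^ k * X" using X by (intro mult_right_mono) auto
   then have z: "X \<le> z" "0 < z" using X0 by (auto simp: z_def)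
   have "x / z \<in> {1..2}" using p1[folded z_def] p2[folded z_def] z by (simp add: field_simps)
   from X1(2)[of z "x / z", OF _ this] have Lx: "L x \<le> 4 * L z" "L z \<le> 4 * L x" using z X by auto
   have dk: "(2 powr d) ^ k = (z / X) powr d"
    using X0 by (simp add: z_def powr_power powr_powr mult.commute flip: powr_realpow)
   have e: "(z / X) powr d * X powr d = z powr d" using X0 z by (simp add: powr_divide)
   have Xd: "1 \<le> X powr d" using X d by (simp add: ge_one_powr_ge_zero)
   have it: "L z \<le> (z / X) powr d * L X" "L X \<le> (z / X) powr d * L z" using iter[of k] by (auto simp: dk z_def)
   have up: "L x \<le> 4 * L X * x powr d"
   proof -
    have "(z / X) powr d \<le> x powr d"
    proof (rule powr_mono2)
     have "z / X \<le> z / 1" using X z by (intro divide_left_mono) auto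
     then show "z / X \<le> x" using p1 by (simp add: z_def)
    qed (use d z X0 in auto)
    then have "(z / X) powr d * L X \<le> x powr d * L X" using LX by (intro mult_right_mono) auto
    then have "L x \<le> 4 * (x powr d * L X)" using Lx(1) it(1) by linarith
    then show ?thesis by (simp add: mult_ac)
   qed
   have "L X * X powr d \<le> (z / X) powr d * L z * X powr d" using it(2) by (intro mult_right_mono) auto
   also have "... = z powr d * L z" using e by (metis mult.assoc mult.commute)
   also have "... \<le> x powr d * (4 * L x)"
   proof (rule mult_mono)
    show "z powr d \<le> x powr d" using p1 d z by (intro powr_mono2) (auto simp: z_def)
   qed (use Lx pos[of z] z X in auto)
   also have "... \<le> 2 powr d * (x powr d * (4 * L x))"
   proof -
    have "1 * (x powr d * (4 * L x)) \<le> 2 powr d * (x powr d * (4 * L x))"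
     using gt1 pos[of x] x X by (intro mult_right_mono) (auto intro: less_imp_le)
    then show ?thesis by simp
   qed
   finally have "L X * X powr d / 4 / 2 powr d \<le> x powr d * L x" by (simp add: field_simps)
   then have "L X * X powr d / 4 / 2 powr d * x powr (- d) \<le> x powr d * L x * x powr (- d)"
    by (intro mult_right_mono) auto
   also have "... = L x" using X0 by (simp add: powr_minus field_simps)
   finally show ?thesis using up by simp
  qed
  show ?thesis
   by (intro exI[of _ "L X * X powr d / 4 / 2 powr d"] exI[of _ "4 * L X"] exI[of _ X] conjI allI impI)
    (use LX X main in auto)
qed

section \<open>Toeplitz forms and their symbols\<close>

abbreviation circ :: "real measure" where
  "circ \<equiv> lebesgue_on {-pi..pi}"

definition trig :: "nat \<Rightarrow> (nat \<Rightarrow> complex) \<Rightarrow> real \<Rightarrow> complex" where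
  "trig M v x = (\<Sum>j<M. v j * cis (real j * x))"

definition toeplitz_qf :: "(real \<Rightarrow> real) \<Rightarrow> nat \<Rightarrow> (nat \<Rightarrow> complex) \<Rightarrow> real" where
  "toeplitz_qf f M v = (LINT x|circ. f x * (cmod (trig M v x))\<^sup>2) / (2 * pi)"

lemma continuous_measurable_circ:
  "continuous_on UNIV h \<Longrightarrow> h \<in> borel_measurable circ" for h :: "real \<Rightarrow> 'a :: {second_countable_topology, real_normed_vector}"
  by (rule continuous_imp_measurable_on_sets_lebesgue) (auto intro: continuous_on_subset)

lemma integrable_times_continuous:
  fixes h :: "real \<Rightarrow> 'a :: {second_countable_topology, banach}"
  assumes f: "integrable circ f" and h: "continuous_on UNIV h"
  shows "integrable circ (\<lambda>x. f x *\<^sub>R h x)"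
proof -
  have "compact (h ` {-pi..pi})"
   by (intro compact_continuous_image continuous_on_subset[OF h]) auto
  then obtain B where B: "\<And>x. x \<in> {-pi..pi} \<Longrightarrow> norm (h x) \<le> B"
   by (meson bounded_iff compact_imp_bounded image_eqI)
  show ?thesis
  proof (rule Bochner_Integration.integrable_bound)
   show "integrable circ (\<lambda>x. B * norm (f x))" using f by simp
   show "(\<lambda>x. f x *\<^sub>R h x) \<in> borel_measurable circ"
    using borel_measurable_integrable[OF f] continuous_measurable_circ[OF h] by measurable
   show "AE x in circ. norm (f x *\<^sub>R h x) \<le> norm (B * norm (f x))"
   proof (rule AE_I2)
    fix x assume "x \<in> space circ"
    then have "norm (h x) \<le> B" using B by simp
    then have "norm (f x) * norm (h x) \<le> norm (f x) * B" "0 \<le> B"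
     by (auto intro!: mult_left_mono intro: order_trans[OF norm_ge_zero])
    then show "norm (f x *\<^sub>R h x) \<le> norm (B * norm (f x))" by (simp add: abs_mult mult.commute)
   qed
  qed
qed

lemmas integrable_times_continuous_real = integrable_times_continuous[where ?'a = real, simplified]

lemma fourier_coeff_circ:
  "fourier_coeff f k = (LINT x|circ. f x *\<^sub>R cis (- (of_int k * x))) / (2 * pi)"
proof -
  have eq: "complex_of_real (f x) * exp (- \<i> * of_int k * of_real x) = f x *\<^sub>R cis (- (of_int k * x))" for x
   by (simp add: scaleR_conv_of_real cis_conv_exp mult_ac)
  show ?thesis unfolding fourier_coeff_def eq
   by (simp add: set_lebesgue_integral_def integral_restrict_space)
qed

lemma continuous_cis_lin: "continuous_on UNIV (\<lambda>x. cis (c * x))"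
  by (intro continuous_intros)

lemma continuous_trig: "continuous_on UNIV (trig M v)"
  unfolding trig_def by (intro continuous_intros)

lemma cnj_cis_diff: "cnj (cis (a * x)) * cis (b * x) = cis (- ((a - b) * x))"
  by (simp add: cis_cnj cis_mult algebra_simps)

lemma cmod_trig_sq:
  "of_real ((cmod (trig M v x))\<^sup>2) = (\<Sum>i<M. \<Sum>j<M. cnj (v i) * v j * cis (- (of_int (int i - int j) * x)))"
proof -
  have "of_real ((cmod (trig M v x))\<^sup>2) = cnj (trig M v x) * trig M v x"
   by (simp only: complex_norm_square mult.commute)
  also have "... = (\<Sum>i<M. \<Sum>j<M. cnj (v i * cis (real i * x)) * (v j * cis (real j * x)))"
   by (simp add: trig_def sum_product)
  also have "... = (\<Sum>i<M. \<Sum>j<M. cnj (v i) * v j * cis (- (of_int (int i - int j) * x)))"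
  proof (intro sum.cong refl)
   fix i j
   have "cnj (v i * cis (real i * x)) * (v j * cis (real j * x)) = cnj (v i) * v j * (cnj (cis (real i * x)) * cis (real j * x))"
    by simp
   then show "cnj (v i * cis (real i * x)) * (v j * cis (real j * x)) = cnj (v i) * v j * cis (- (of_int (int i - int j) * x))"
    unfolding cnj_cis_diff by simp
  qed
  finally show ?thesis .
qed

lemma integral_circ_sum2:
  fixes F :: "nat \<Rightarrow> nat \<Rightarrow> real \<Rightarrow> complex"
  assumes f: "integrable circ f" and F: "\<And>i j. continuous_on UNIV (F i j)"
  shows "(LINT x|circ. f x *\<^sub>R (\<Sum>i<M. \<Sum>j<M. c i j * F i j x)) = (\<Sum>i<M. \<Sum>j<M. c i j * (LINT x|circ. f x *\<^sub>R F i j x))"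
proof -
  have i: "integrable circ (\<lambda>x. c i j * (f x *\<^sub>R F i j x))" for i j
   by (rule integrable_mult_right[OF integrable_times_continuous[OF f F]])
  have "(LINT x|circ. f x *\<^sub>R (\<Sum>i<M. \<Sum>j<M. c i j * F i j x)) = (LINT x|circ. (\<Sum>i<M. \<Sum>j<M. c i j * (f x *\<^sub>R F i j x)))"
   by (simp only: scaleR_sum_right mult_scaleR_right)
  also have "... = (\<Sum>i<M. LINT x|circ. (\<Sum>j<M. c i j * (f x *\<^sub>R F i j x)))"
   using i by (intro Bochner_Integration.integral_sum Bochner_Integration.integrable_sum)
  also have "... = (\<Sum>i<M. \<Sum>j<M. LINT x|circ. c i j * (f x *\<^sub>R F i j x))"
   using i by (intro sum.cong refl Bochner_Integration.integral_sum)
  finally show ?thesis by (simp only: integral_mult_right_zero)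
qed

text \<open>Everything about the covariance matrix is read off from its symbol through this identity: it turns entrywise bounds
  on \<open>f\<close> into bounds on the form, monotonically.\<close>

lemma toeplitz_form:
  assumes f: "integrable circ f"
  shows "(\<Sum>i<M. \<Sum>j<M. cnj (v i) * v j * fourier_coeff f (int i - int j)) = of_real (toeplitz_qf f M v)"
proof -
  have i: "integrable circ (\<lambda>x. f x * (cmod (trig M v x))\<^sup>2)"
   using continuous_trig[of M v] by (intro integrable_times_continuous_real[OF f] continuous_intros) auto
  have "complex_of_real (toeplitz_qf f M v) = (LINT x|circ. complex_of_real (f x * (cmod (trig M v x))\<^sup>2)) / (2 * pi)"
   unfolding toeplitz_qf_def integral_of_real[OF i] by simp
  also have "(LINT x|circ. complex_of_real (f x * (cmod (trig M v x))\<^sup>2))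
    = (LINT x|circ. f x *\<^sub>R (\<Sum>i<M. \<Sum>j<M. cnj (v i) * v j * cis (- (of_int (int i - int j) * x))))"
   unfolding of_real_mult cmod_trig_sq by (simp add: scaleR_conv_of_real)
  also have "... = (\<Sum>i<M. \<Sum>j<M. cnj (v i) * v j * (LINT x|circ. f x *\<^sub>R cis (- (of_int (int i - int j) * x))))"
   by (intro integral_circ_sum2[OF f] continuous_intros)
  also have "... / (2 * pi) = (\<Sum>i<M. \<Sum>j<M. cnj (v i) * v j * fourier_coeff f (int i - int j))"
   unfolding fourier_coeff_circ sum_divide_distrib by (simp add: mult.assoc)
  finally show ?thesis by simp
qed

lemma measure_circ: "measure circ {-pi..pi} = 2 * pi"
  by (simp add: measure_restrict_space)

lemma integrable_const_circ: "integrable circ (\<lambda>_. c :: real)"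
  by (intro finite_measure.integrable_const finite_measure_lebesgue_on) auto

text \<open>The symbol 1 belongs to the identity matrix, so bounds of the symbol by constants are bounds by the Euclidean norm.\<close>

lemma fourier_coeff_one: "fourier_coeff (\<lambda>_. 1) k = (if k = 0 then 1 else 0)"
proof (cases "k = 0")
  case True
  then show ?thesis using measure_circ by (simp add: fourier_coeff_circ scaleR_conv_of_real)
next
  case False
  define F where "F x = exp (- \<i> * of_int k * complex_of_real x) / (- \<i> * of_int k)" for x
  have F_cis: "F x = cis (- (of_int k * x)) / (- \<i> * of_int k)" for x
   by (simp add: F_def cis_conv_exp mult_ac)
  have d: "(F has_vector_derivative cis (- (of_int k * x))) (at x within S)" for x S
  proof -
   have "((\<lambda>z. exp (- \<i> * of_int k * z) / (- \<i> * of_int k)) has_field_derivative exp (- \<i> * of_int k * complex_of_real x)) (at (complex_of_real x))"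
    using False by (auto intro!: derivative_eq_intros)
   from has_vector_derivative_real_field[OF this, of S] show ?thesis
    by (simp add: F_def[abs_def] cis_conv_exp mult_ac)
  qed
  have "((\<lambda>x. cis (- (of_int k * x))) has_integral F pi - F (- pi)) {-pi..pi}"
   by (intro fundamental_theorem_of_calculus d) auto
  moreover have "F pi = F (- pi)"
  proof -
   have "cis (- (of_int k * pi)) = cis (of_int k * pi)"
    by (simp add: complex_eq_iff mult.commute[of _ pi])
   then show ?thesis by (simp add: F_cis)
  qed
  ultimately have "integral {-pi..pi} (\<lambda>x. cis (- (of_int k * x))) = 0" by (simp add: has_integral_iff)
  moreover have "(LINT x|circ. cis (- (of_int k * x))) = integral {-pi..pi} (\<lambda>x. cis (- (of_int k * x)))"
  proof (rule lebesgue_integral_eq_integral)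
   have "continuous_on UNIV (\<lambda>x. cis (- (of_int k * x)))" by (intro continuous_intros)
   from integrable_times_continuous[OF integrable_const_circ[of 1] this]
   show "integrable circ (\<lambda>x. cis (- (of_int k * x)))" by simp
  qed simp
  ultimately show ?thesis using False by (simp add: fourier_coeff_circ)
qed

lemma toeplitz_qf_one: "toeplitz_qf (\<lambda>_. 1) M v = (\<Sum>j<M. (cmod (v j))\<^sup>2)"
proof -
  have "complex_of_real (toeplitz_qf (\<lambda>_. 1) M v) = (\<Sum>i<M. \<Sum>j<M. if i = j then cnj (v i) * v j else 0)"
   unfolding toeplitz_form[OF integrable_const_circ, symmetric]
   by (intro sum.cong refl) (auto simp: fourier_coeff_one)
  also have "... = of_real (\<Sum>j<M. (cmod (v j))\<^sup>2)"
   by (simp add: complex_norm_square mult.commute del: of_real_power)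
  finally show ?thesis by (simp only: of_real_eq_iff)
qed

lemma integrable_qf:
  assumes "integrable circ f"
  shows "integrable circ (\<lambda>x. f x * (cmod (trig M v x))\<^sup>2)"
  using continuous_trig[of M v] by (intro integrable_times_continuous_real[OF assms] continuous_intros) auto

lemma toeplitz_qf_mono:
  assumes "integrable circ f" "integrable circ g" "AE x in circ. f x \<le> g x"
  shows "toeplitz_qf f M v \<le> toeplitz_qf g M v"
  unfolding toeplitz_qf_def
  by (intro divide_right_mono integral_mono_AE integrable_qf assms)
   (use assms(3) in \<open>auto elim!: eventually_mono intro: mult_right_mono\<close>)

lemma toeplitz_qf_cmult: "toeplitz_qf (\<lambda>x. c * f x) M v = c * toeplitz_qf f M v"
  by (simp add: toeplitz_qf_def mult.assoc)

lemma toeplitz_qf_add: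
  assumes "integrable circ f" "integrable circ g"
  shows "toeplitz_qf (\<lambda>x. f x + g x) M v = toeplitz_qf f M v + toeplitz_qf g M v"
  unfolding toeplitz_qf_def distrib_right
  using integrable_qf[OF assms(1)] integrable_qf[OF assms(2)] by (simp add: add_divide_distrib)

lemma toeplitz_qf_nonneg:
  assumes "AE x in circ. 0 \<le> f x"
  shows "0 \<le> toeplitz_qf f M v"
  unfolding toeplitz_qf_def
  by (intro divide_nonneg_nonneg integral_nonneg_AE) (use assms in \<open>auto elim!: eventually_mono\<close>)

lemma toeplitz_qf_le_const:
  assumes "integrable circ f" "AE x in circ. f x \<le> B"
  shows "toeplitz_qf f M v \<le> B * (\<Sum>j<M. (cmod (v j))\<^sup>2)"
  using toeplitz_qf_mono[OF assms(1) integrable_const_circ[of B] assms(2), of M v]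
   toeplitz_qf_cmult[of B "\<lambda>_. 1" M v] by (simp add: toeplitz_qf_one)

lemma toeplitz_qf_ge_const:
  assumes "integrable circ f" "AE x in circ. B \<le> f x"
  shows "B * (\<Sum>j<M. (cmod (v j))\<^sup>2) \<le> toeplitz_qf f M v"
  using toeplitz_qf_mono[OF integrable_const_circ[of B] assms, of M v]
   toeplitz_qf_cmult[of B "\<lambda>_. 1" M v] by (simp add: toeplitz_qf_one)

section \<open>Frobenius norms of the weighted matrices\<close>

text \<open>The weights with which the entries of \<open>S\<close> enter the estimated spectral density at \<open>\<theta>\<close>.\<close>

definition tau :: "nat \<Rightarrow> real \<Rightarrow> nat \<Rightarrow> nat \<Rightarrow> complex" where
  "tau M \<theta> i j = cis ((real i - real j) * \<theta>) / of_real (real M - \<bar>real i - real j\<bar>)"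

definition tau_vec :: "nat \<Rightarrow> real \<Rightarrow> real \<Rightarrow> nat \<Rightarrow> complex" where
  "tau_vec M \<theta> \<phi> j = (\<Sum>i<M. tau M \<theta> i j * cis (- (real i * \<phi>)))"

definition gram_sum :: "nat \<Rightarrow> real \<Rightarrow> (real \<Rightarrow> real) \<Rightarrow> (real \<Rightarrow> real) \<Rightarrow> complex" where
  "gram_sum M \<theta> f g = (\<Sum>i<M. \<Sum>i'<M. (\<Sum>j'<M. \<Sum>j<M. fourier_coeff g (int j' - int j) * tau M \<theta> i j * cnj (tau M \<theta> i' j'))
    * fourier_coeff f (int i - int i'))"

definition gram_int :: "nat \<Rightarrow> real \<Rightarrow> (real \<Rightarrow> real) \<Rightarrow> (real \<Rightarrow> real) \<Rightarrow> real" where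
  "gram_int M \<theta> f g = (LINT \<phi>|circ. f \<phi> * toeplitz_qf g M (tau_vec M \<theta> \<phi>)) / (2 * pi)"

lemma tau_cnj: "cnj (tau M \<theta> i j) = tau M \<theta> j i"
  by (simp add: tau_def cis_cnj abs_minus_commute algebra_simps)

lemma sum_swap_pairs:
  "(\<Sum>a<M. \<Sum>b<M. \<Sum>c<M. \<Sum>d<M. F a b c d) = (\<Sum>c<M. \<Sum>d<M. \<Sum>a<M. \<Sum>b<M. F a b c d)"
  for F :: "nat \<Rightarrow> nat \<Rightarrow> nat \<Rightarrow> nat \<Rightarrow> complex"
proof -
  have "(\<Sum>a<M. \<Sum>b<M. \<Sum>c<M. \<Sum>d<M. F a b c d) = (\<Sum>a<M. \<Sum>c<M. \<Sum>b<M. \<Sum>d<M. F a b c d)"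
   by (rule sum.cong[OF refl], rule sum.swap)
  also have "... = (\<Sum>c<M. \<Sum>a<M. \<Sum>b<M. \<Sum>d<M. F a b c d)" by (rule sum.swap)
  also have "... = (\<Sum>c<M. \<Sum>a<M. \<Sum>d<M. \<Sum>b<M. F a b c d)"
   by (rule sum.cong[OF refl], rule sum.cong[OF refl], rule sum.swap)
  also have "... = (\<Sum>c<M. \<Sum>d<M. \<Sum>a<M. \<Sum>b<M. F a b c d)"
   by (rule sum.cong[OF refl], rule sum.swap)
  finally show ?thesis .
qed

lemma qf_tau_vec:
  assumes g: "integrable circ g"
  shows "of_real (toeplitz_qf g M (tau_vec M \<theta> \<phi>)) =
   (\<Sum>i<M. \<Sum>i'<M. (\<Sum>j'<M. \<Sum>j<M. fourier_coeff g (int j' - int j) * tau M \<theta> i j * cnj (tau M \<theta> i' j'))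
     * cis (- (of_int (int i - int i') * \<phi>)))"
proof -
  have "of_real (toeplitz_qf g M (tau_vec M \<theta> \<phi>))
    = (\<Sum>j'<M. \<Sum>j<M. cnj (tau_vec M \<theta> \<phi> j') * tau_vec M \<theta> \<phi> j * fourier_coeff g (int j' - int j))"
   by (rule toeplitz_form[OF g, symmetric])
  also have "... = (\<Sum>j'<M. \<Sum>j<M. \<Sum>i<M. \<Sum>i'<M. fourier_coeff g (int j' - int j) * tau M \<theta> i j * cnj (tau M \<theta> i' j')
     * cis (- (of_int (int i - int i') * \<phi>)))"
  proof (intro sum.cong refl)
   fix j' j
   have "cnj (tau_vec M \<theta> \<phi> j') * tau_vec M \<theta> \<phi> j
    = (\<Sum>i<M. \<Sum>i'<M. (tau M \<theta> i j * cis (- (real i * \<phi>))) * (cnj (tau M \<theta> i' j') * cis (real i' * \<phi>)))"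
    unfolding tau_vec_def cnj_sum complex_cnj_mult cis_cnj by (subst mult.commute) (simp add: sum_product)
   also have "... = (\<Sum>i<M. \<Sum>i'<M. tau M \<theta> i j * cnj (tau M \<theta> i' j') * cis (- (of_int (int i - int i') * \<phi>)))"
   proof (intro sum.cong refl)
    fix i i'
    have "(tau M \<theta> i j * cis (- (real i * \<phi>))) * (cnj (tau M \<theta> i' j') * cis (real i' * \<phi>))
     = tau M \<theta> i j * cnj (tau M \<theta> i' j') * (cis (- (real i * \<phi>)) * cis (real i' * \<phi>))" by simp
    also have "cis (- (real i * \<phi>)) * cis (real i' * \<phi>) = cis (- (of_int (int i - int i') * \<phi>))"
     unfolding cis_mult by (simp add: algebra_simps)
    finally show "(tau M \<theta> i j * cis (- (real i * \<phi>))) * (cnj (tau M \<theta> i' j') * cis (real i' * \<phi>))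
     = tau M \<theta> i j * cnj (tau M \<theta> i' j') * cis (- (of_int (int i - int i') * \<phi>))" .
   qed
   finally show "cnj (tau_vec M \<theta> \<phi> j') * tau_vec M \<theta> \<phi> j * fourier_coeff g (int j' - int j)
    = (\<Sum>i<M. \<Sum>i'<M. fourier_coeff g (int j' - int j) * tau M \<theta> i j * cnj (tau M \<theta> i' j') * cis (- (of_int (int i - int i') * \<phi>)))"
    by (simp add: sum_distrib_left sum_distrib_right mult_ac)
  qed
  also have "... = (\<Sum>i<M. \<Sum>i'<M. \<Sum>j'<M. \<Sum>j<M. fourier_coeff g (int j' - int j) * tau M \<theta> i j * cnj (tau M \<theta> i' j')
     * cis (- (of_int (int i - int i') * \<phi>)))"
   by (rule sum_swap_pairs)
  finally show ?thesis by (simp only: sum_distrib_right)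
qed

lemma continuous_qf_tau_vec:
  assumes g: "integrable circ g"
  shows "continuous_on UNIV (\<lambda>\<phi>. toeplitz_qf g M (tau_vec M \<theta> \<phi>))"
proof -
  have "(\<lambda>\<phi>. toeplitz_qf g M (tau_vec M \<theta> \<phi>)) = (\<lambda>\<phi>. Re (of_real (toeplitz_qf g M (tau_vec M \<theta> \<phi>))))" by simp
  then show ?thesis unfolding qf_tau_vec[OF g] by (simp only:) (intro continuous_intros)
qed

text \<open>The squared Frobenius norm of \<open>R\<^sup>1\<^sup>/\<^sup>2 \<tau> R\<^sup>1\<^sup>/\<^sup>2\<close>, for general symbols in the two places. As an iterated integral it is
  monotone and additive in each symbol, which the entries do not show.\<close>

lemma gram_sum_eq:
  assumes f: "integrable circ f" and g: "integrable circ g"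
  shows "gram_sum M \<theta> f g = of_real (gram_int M \<theta> f g)"
proof -
  have i: "integrable circ (\<lambda>\<phi>. f \<phi> * toeplitz_qf g M (tau_vec M \<theta> \<phi>))"
   by (rule integrable_times_continuous_real[OF f continuous_qf_tau_vec[OF g]])
  have "complex_of_real (gram_int M \<theta> f g) = (LINT \<phi>|circ. complex_of_real (f \<phi> * toeplitz_qf g M (tau_vec M \<theta> \<phi>))) / (2 * pi)"
   unfolding gram_int_def integral_of_real[OF i] by simp
  also have "(LINT \<phi>|circ. complex_of_real (f \<phi> * toeplitz_qf g M (tau_vec M \<theta> \<phi>)))
    = (LINT \<phi>|circ. f \<phi> *\<^sub>R (\<Sum>i<M. \<Sum>i'<M. (\<Sum>j'<M. \<Sum>j<M. fourier_coeff g (int j' - int j) * tau M \<theta> i j * cnj (tau M \<theta> i' j'))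
     * cis (- (of_int (int i - int i') * \<phi>))))"
   unfolding of_real_mult qf_tau_vec[OF g] by (simp add: scaleR_conv_of_real)
  also have "... = (\<Sum>i<M. \<Sum>i'<M. (\<Sum>j'<M. \<Sum>j<M. fourier_coeff g (int j' - int j) * tau M \<theta> i j * cnj (tau M \<theta> i' j'))
     * (LINT \<phi>|circ. f \<phi> *\<^sub>R cis (- (of_int (int i - int i') * \<phi>))))"
   by (intro integral_circ_sum2[OF f] continuous_intros)
  also have "... / (2 * pi) = gram_sum M \<theta> f g"
   unfolding gram_sum_def fourier_coeff_circ[of f] sum_divide_distrib by simp
  finally show ?thesis by simp
qed

lemma gram_int_commute:
  assumes f: "integrable circ f" and g: "integrable circ g"
  shows "gram_int M \<theta> f g = gram_int M \<theta> g f"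
proof -
  have "gram_sum M \<theta> f g = (\<Sum>i<M. \<Sum>i'<M. \<Sum>j'<M. \<Sum>j<M. fourier_coeff g (int j' - int j) * tau M \<theta> i j * cnj (tau M \<theta> i' j') * fourier_coeff f (int i - int i'))"
   by (simp add: gram_sum_def sum_distrib_right)
  also have "... = (\<Sum>j'<M. \<Sum>j<M. \<Sum>i<M. \<Sum>i'<M. fourier_coeff g (int j' - int j) * tau M \<theta> i j * cnj (tau M \<theta> i' j') * fourier_coeff f (int i - int i'))"
   by (rule sum_swap_pairs)
  also have "... = gram_sum M \<theta> g f"
   unfolding gram_sum_def sum_distrib_right
   by (intro sum.cong refl) (simp add: tau_cnj mult_ac)
  finally show ?thesis
   unfolding gram_sum_eq[OF f g] gram_sum_eq[OF g f] by (simp only: of_real_eq_iff)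
qed

lemma cmod_tau_vec: "cmod (tau_vec M \<theta> \<phi> j) = cmod (trig M (\<lambda>i. tau M \<theta> j i) \<phi>)"
proof -
  have "cnj (tau_vec M \<theta> \<phi> j) = trig M (\<lambda>i. tau M \<theta> j i) \<phi>"
   unfolding tau_vec_def trig_def cnj_sum by (simp add: tau_cnj cis_cnj)
  then show ?thesis by (metis complex_mod_cnj)
qed

definition tau_weight :: "nat \<Rightarrow> nat \<Rightarrow> nat \<Rightarrow> real" where
  "tau_weight M i j = 1 / (real M - \<bar>real i - real j\<bar>)"

lemma cmod_tau: "i < M \<Longrightarrow> j < M \<Longrightarrow> cmod (tau M \<theta> i j) = tau_weight M i j"
  by (auto simp: tau_def tau_weight_def norm_divide simp flip: of_real_diff)

lemma tau_weight_max:
  assumes "i < M" "j < M"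
  shows "tau_weight M i j = max (1 / (real M - real j + real i)) (1 / (real M - real i + real j))"
proof (cases "i \<le> j")
  case True
  then have "1 / (real M - real i + real j) \<le> 1 / (real M - real j + real i)"
   using assms by (intro divide_left_mono) auto
  then show ?thesis using True by (simp add: tau_weight_def)
next
  case False
  then have "1 / (real M - real j + real i) \<le> 1 / (real M - real i + real j)"
   using assms by (intro divide_left_mono) auto
  then show ?thesis using False by (simp add: tau_weight_def)
qed

lemma sum_inverse_harm: "(\<Sum>j<M. 1 / (real j + 1)) = harm M" "(\<Sum>j<M. 1 / (real M - real j)) = harm M"
proof -
  show 1: "(\<Sum>j<M. 1 / (real j + 1)) = harm M"
  proof (induction M)
   case 0
   show ?case by (simp add: harm_def)
  next
   case (Suc M)
   then show ?case by (simp add: harm_Suc inverse_eq_divide add.commute)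
  qed
  have "(\<Sum>j<M. 1 / (real M - real j)) = (\<Sum>j<M. 1 / (real (M - Suc j) + 1))"
   by (intro sum.cong refl) (auto simp: of_nat_diff)
  also have "... = (\<Sum>j<M. 1 / (real j + 1))"
   by (rule sum.nat_diff_reindex)
  finally show "(\<Sum>j<M. 1 / (real M - real j)) = harm M" using 1 by simp
qed

lemma sum_inverse_squares: "0 < m \<Longrightarrow> (\<Sum>i<n. 1 / (real m + real i)\<^sup>2) \<le> 2 / real m"
proof -
  assume m: "0 < m"
  have "(\<Sum>i<Suc n. 1 / (real m + real i)\<^sup>2) \<le> 2 / real m - 1 / (real m + real n)" for n
  proof (induction n)
   case 0
   have "1 / (real m)\<^sup>2 \<le> 1 / real m" using m by (simp add: field_simps power2_eq_square)
   then show ?case by simp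
  next
   case (Suc n)
   define x where "x = real m + real n"
   have x: "0 < x" using m by (simp add: x_def)
   have "1 / (x + 1)\<^sup>2 \<le> 1 / (x * (x + 1))" using x by (intro divide_left_mono) (auto simp: power2_eq_square)
   also have "... = 1 / x - 1 / (x + 1)" using x by (simp add: field_simps)
   finally have "1 / (real m + real (Suc n))\<^sup>2 \<le> 1 / (real m + real n) - 1 / (real m + real (Suc n))"
    by (simp add: x_def add_ac)
   then show ?case using Suc by simp
  qed
  note * = this
  show "(\<Sum>i<n. 1 / (real m + real i)\<^sup>2) \<le> 2 / real m"
  proof (cases n)
   case (Suc k)
   have "0 \<le> 1 / (real m + real k)" by simp
   then show ?thesis unfolding Suc using *[of k] by linarith
  qed simp
qed

text \<open>The squared weights in row \<open>j\<close> are summable from the two ends of the row; this gives \<open>1 / (j + 1)\<close> and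
  \<open>1 / (M - j)\<close> up to constants, hence a harmonic number in total.\<close>

lemma tau_frobenius: "(\<Sum>j<M. \<Sum>i<M. (cmod (tau M \<theta> j i))\<^sup>2) \<le> 4 * harm M"
proof -
  have "(\<Sum>i<M. (cmod (tau M \<theta> j i))\<^sup>2) \<le> 2 * (1 / (real M - real j)) + 2 * (1 / (real j + 1))" if j: "j < M" for j
  proof -
   have "(\<Sum>i<M. (cmod (tau M \<theta> j i))\<^sup>2) \<le> (\<Sum>i<M. 1 / (real (M - j) + real i)\<^sup>2 + 1 / (real (Suc j) + real (M - Suc i))\<^sup>2)"
   proof (rule sum_mono)
    fix i assume "i \<in> {..<M}"
    then have i: "i < M" by simp
    have e: "real M - real j + real i = real (M - j) + real i" "real M - real i + real j = real (Suc j) + real (M - Suc i)"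
     using i j by (auto simp: of_nat_diff)
    have "(tau_weight M i j)\<^sup>2 \<le> (1 / (real M - real j + real i))\<^sup>2 + (1 / (real M - real i + real j))\<^sup>2"
     unfolding tau_weight_max[OF i j] by (simp add: max_def)
    moreover have "tau_weight M j i = tau_weight M i j" by (simp add: tau_weight_def abs_minus_commute)
    ultimately show "(cmod (tau M \<theta> j i))\<^sup>2 \<le> 1 / (real (M - j) + real i)\<^sup>2 + 1 / (real (Suc j) + real (M - Suc i))\<^sup>2"
     unfolding cmod_tau[OF j i] e by (simp add: power_divide)
   qed
   also have "... = (\<Sum>i<M. 1 / (real (M - j) + real i)\<^sup>2) + (\<Sum>i<M. 1 / (real (Suc j) + real i)\<^sup>2)"
    unfolding sum.distrib by (simp only: sum.nat_diff_reindex[of "\<lambda>i. 1 / (real (Suc j) + real i)\<^sup>2"])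
   also have "... \<le> 2 / real (M - j) + 2 / real (Suc j)"
    using j by (intro add_mono sum_inverse_squares) auto
   finally show ?thesis using j by (simp add: of_nat_diff add.commute)
  qed
  then have "(\<Sum>j<M. \<Sum>i<M. (cmod (tau M \<theta> j i))\<^sup>2) \<le> (\<Sum>j<M. 2 * (1 / (real M - real j)) + 2 * (1 / (real j + 1)))"
   by (intro sum_mono) auto
  also have "... = 4 * harm M"
   unfolding sum.distrib sum_distrib_left[symmetric] sum_inverse_harm by simp
  finally show ?thesis .
qed

text \<open>Multiplication by \<open>1 - w\<close> turns the sum into one over the differences of consecutive weights, so that only their
  total variation counts.\<close>

lemma abel_sum_le:
  fixes a :: "nat \<Rightarrow> real" and z :: complex
  assumes z: "cmod z = 1"
  shows "cmod (1 - z) * cmod (\<Sum>i<Suc n. of_real (a i) * z ^ i) \<le> \<bar>a 0\<bar> + \<bar>a n\<bar> + (\<Sum>i<n. \<bar>a (Suc i) - a i\<bar>)"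
proof -
  have "(1 - z) * (\<Sum>i<Suc n. of_real (a i) * z ^ i)
    = of_real (a 0) - of_real (a n) * z ^ Suc n + (\<Sum>i<n. of_real (a (Suc i) - a i) * z ^ Suc i)"
  proof (induction n)
   case 0
   show ?case by (simp add: algebra_simps)
  next
   case (Suc n)
   have "(1 - z) * (\<Sum>i<Suc (Suc n). of_real (a i) * z ^ i)
    = (1 - z) * (\<Sum>i<Suc n. of_real (a i) * z ^ i) + (1 - z) * (of_real (a (Suc n)) * z ^ Suc n)"
    by (simp only: sum.lessThan_Suc[of _ "Suc n"] distrib_left)
   also have "... = of_real (a 0) - of_real (a n) * z ^ Suc n + (\<Sum>i<n. of_real (a (Suc i) - a i) * z ^ Suc i)
    + (1 - z) * (of_real (a (Suc n)) * z ^ Suc n)"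
    by (simp only: Suc.IH)
   also have "... = of_real (a 0) - of_real (a (Suc n)) * z ^ Suc (Suc n) + (\<Sum>i<Suc n. of_real (a (Suc i) - a i) * z ^ Suc i)"
    by (simp add: left_diff_distrib)
   finally show ?case .
  qed
  then have "cmod (1 - z) * cmod (\<Sum>i<Suc n. of_real (a i) * z ^ i)
    = cmod (of_real (a 0) - of_real (a n) * z ^ Suc n + (\<Sum>i<n. of_real (a (Suc i) - a i) * z ^ Suc i))"
   by (metis norm_mult)
  also have "... \<le> cmod (of_real (a 0) - of_real (a n) * z ^ Suc n) + (\<Sum>i<n. cmod (of_real (a (Suc i) - a i) * z ^ Suc i))"
   by (intro order_trans[OF norm_triangle_ineq] add_left_mono norm_sum)
  also have "... \<le> (cmod (of_real (a 0)) + cmod (of_real (a n) * z ^ Suc n)) + (\<Sum>i<n. cmod (of_real (a (Suc i) - a i) * z ^ Suc i))"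
   by (intro add_right_mono norm_triangle_ineq4)
  also have "... = \<bar>a 0\<bar> + \<bar>a n\<bar> + (\<Sum>i<n. \<bar>a (Suc i) - a i\<bar>)"
   by (simp add: norm_mult norm_power z del: power_Suc of_real_diff)
  finally show ?thesis .
qed

lemma tau_vec_eq:
  "cmod (tau_vec M \<theta> \<phi> j) = cmod (\<Sum>i<M. of_real (tau_weight M i j) * cis (\<theta> - \<phi>) ^ i)"
proof -
  have "tau_vec M \<theta> \<phi> j = cis (- (real j * \<theta>)) * (\<Sum>i<M. of_real (tau_weight M i j) * cis (\<theta> - \<phi>) ^ i)"
   unfolding tau_vec_def sum_distrib_left
  proof (intro sum.cong refl)
   fix i
   have "cis ((real i - real j) * \<theta>) * cis (- (real i * \<phi>)) = cis (- (real j * \<theta>)) * cis (\<theta> - \<phi>) ^ i"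
    by (simp add: cis_mult Complex.DeMoivre algebra_simps)
   then show "tau M \<theta> i j * cis (- (real i * \<phi>)) = cis (- (real j * \<theta>)) * (of_real (tau_weight M i j) * cis (\<theta> - \<phi>) ^ i)"
    by (simp add: tau_def tau_weight_def mult_ac)
  qed
  then show ?thesis by (simp add: norm_mult)
qed

text \<open>The weights \<open>1 / (M - \<bar>i - j\<bar>)\<close> fall and then rise again, so their total variation is bounded by the values at the
  two ends of the row.\<close>

lemma tau_vec_decay:
  assumes j: "j < M" and e: "0 < e" "e \<le> cmod (1 - cis (\<theta> - \<phi>))"
  shows "cmod (tau_vec M \<theta> \<phi> j) \<le> 2 / e * (1 / (real M - real j) + 1 / (real j + 1))"
proof -
  obtain n where n: "M = Suc n" using j by (cases M) auto
  define a where "a i = tau_weight M i j" for i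
  define b where "b i = 1 / (real M - real j + real i)" for i
  define c where "c i = 1 / (real M - real i + real j)" for i
  have a_max: "a i = max (b i) (c i)" if "i < M" for i unfolding a_def b_def c_def by (rule tau_weight_max[OF that j])
  have "(\<Sum>i<n. \<bar>a (Suc i) - a i\<bar>) \<le> (\<Sum>i<n. (b i - b (Suc i)) + (c (Suc i) - c i))"
  proof (rule sum_mono)
   fix i assume "i \<in> {..<n}"
   then have i: "i < M" "Suc i < M" using n by auto
   have "b (Suc i) \<le> b i" unfolding b_def using j i by (intro divide_left_mono) auto
   moreover have "c i \<le> c (Suc i)" unfolding c_def using j i by (intro divide_left_mono) auto
   ultimately show "\<bar>a (Suc i) - a i\<bar> \<le> (b i - b (Suc i)) + (c (Suc i) - c i)"
    unfolding a_max[OF i(1)] a_max[OF i(2)] by (simp add: max_def abs_if)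
  qed
  also have "... = (b 0 - b n) + (c n - c 0)"
   unfolding sum.distrib by (simp add: sum_lessThan_telescope sum_lessThan_telescope')
  also have "... \<le> 1 / (real M - real j) + 1 / (real j + 1)"
  proof -
   have "b 0 = 1 / (real M - real j)" "c n = 1 / (real j + 1)" "0 \<le> b n" "0 \<le> c 0"
    using j n by (simp_all add: b_def c_def)
   then show ?thesis by linarith
  qed
  finally have tv: "(\<Sum>i<n. \<bar>a (Suc i) - a i\<bar>) \<le> 1 / (real M - real j) + 1 / (real j + 1)" .
  have "a 0 = 1 / (real M - real j)" "a n = 1 / (real j + 1)"
   using j n by (auto simp: a_def tau_weight_def)
  then have ends: "\<bar>a 0\<bar> + \<bar>a n\<bar> = 1 / (real M - real j) + 1 / (real j + 1)" using j by simp
  have "e * cmod (tau_vec M \<theta> \<phi> j) \<le> cmod (1 - cis (\<theta> - \<phi>)) * cmod (tau_vec M \<theta> \<phi> j)"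
   using e by (intro mult_right_mono) auto
  also have "... \<le> \<bar>a 0\<bar> + \<bar>a n\<bar> + (\<Sum>i<n. \<bar>a (Suc i) - a i\<bar>)"
   unfolding tau_vec_eq n using abel_sum_le[of "cis (\<theta> - \<phi>)" a n] by (simp add: a_def n)
  also have "... \<le> 2 * (1 / (real M - real j) + 1 / (real j + 1))" by (rule order_trans[OF add_mono[OF eq_refl[OF ends] tv]]) (simp only: mult_2 order_refl)
  finally have "cmod (tau_vec M \<theta> \<phi> j) \<le> 2 * (1 / (real M - real j) + 1 / (real j + 1)) / e"
   using e(1) by (subst pos_le_divide_eq) (simp_all add: mult.commute[of e])
  then show ?thesis by simp
qed

lemma tau_vec_bounded:
  assumes j: "j < M"
  shows "cmod (tau_vec M \<theta> \<phi> j) \<le> 2 * harm M"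
proof -
  have "cmod (tau_vec M \<theta> \<phi> j) \<le> (\<Sum>i<M. tau_weight M i j)"
   unfolding tau_vec_def by (rule order_trans[OF norm_sum]) (auto intro!: sum_mono simp: norm_mult cmod_tau j)
  also have "... \<le> (\<Sum>i<M. 1 / (real i + 1) + 1 / (real M - real i))"
  proof (rule sum_mono)
   fix i assume "i \<in> {..<M}"
   then have i: "i < M" by simp
   have "1 / (real M - real j + real i) \<le> 1 / (real i + 1)" "1 / (real M - real i + real j) \<le> 1 / (real M - real i)"
    using i j by (auto intro!: divide_left_mono mult_pos_pos)
   moreover have "0 \<le> 1 / (real i + 1)" "0 \<le> 1 / (real M - real i)" using i by auto
   ultimately show "tau_weight M i j \<le> 1 / (real i + 1) + 1 / (real M - real i)"
    unfolding tau_weight_max[OF i j] by linarith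
  qed
  also have "... = 2 * harm M" unfolding sum.distrib sum_inverse_harm by simp
  finally show ?thesis .
qed

lemma tau_vec_sums:
  assumes e: "0 < e" "e \<le> cmod (1 - cis (\<theta> - \<phi>))"
  shows "(\<Sum>j<M. cmod (tau_vec M \<theta> \<phi> j)) \<le> 4 / e * harm M"
   "(\<Sum>j<M. (cmod (tau_vec M \<theta> \<phi> j))\<^sup>2) \<le> 8 / e * (harm M)\<^sup>2"
proof -
  have "(\<Sum>j<M. cmod (tau_vec M \<theta> \<phi> j)) \<le> (\<Sum>j<M. 2 / e * (1 / (real M - real j) + 1 / (real j + 1)))"
   using e by (intro sum_mono tau_vec_decay) auto
  also have "... = 4 / e * harm M"
   unfolding sum_distrib_left[symmetric] sum.distrib sum_inverse_harm by simp
  finally show 1: "(\<Sum>j<M. cmod (tau_vec M \<theta> \<phi> j)) \<le> 4 / e * harm M" .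
  have h: "0 \<le> (harm M :: real)" by (rule harm_nonneg)
  have "(\<Sum>j<M. (cmod (tau_vec M \<theta> \<phi> j))\<^sup>2) \<le> (\<Sum>j<M. 2 * harm M * cmod (tau_vec M \<theta> \<phi> j))"
   unfolding power2_eq_square by (intro sum_mono mult_right_mono tau_vec_bounded) auto
  also have "... = 2 * harm M * (\<Sum>j<M. cmod (tau_vec M \<theta> \<phi> j))" by (simp only: sum_distrib_left)
  also have "... \<le> 2 * harm M * (4 / e * harm M)" using 1 h by (intro mult_left_mono) auto
  finally show "(\<Sum>j<M. (cmod (tau_vec M \<theta> \<phi> j))\<^sup>2) \<le> 8 / e * (harm M)\<^sup>2" by (simp add: power2_eq_square)
qed

lemma gram_int_le_bounded:
  assumes f: "integrable circ f" "AE x in circ. 0 \<le> f x" and g: "integrable circ g"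
   and F: "\<And>v. toeplitz_qf f M v \<le> F * (\<Sum>j<M. (cmod (v j))\<^sup>2)" and F0: "0 \<le> F"
   and G: "\<And>v. toeplitz_qf g M v \<le> G * (\<Sum>j<M. (cmod (v j))\<^sup>2)" and G0: "0 \<le> G"
  shows "gram_int M \<theta> f g \<le> G * F * (4 * harm M)"
proof -
  have ci: "integrable circ (\<lambda>\<phi>. f \<phi> * (cmod (tau_vec M \<theta> \<phi> j))\<^sup>2)" for j
   unfolding cmod_tau_vec by (rule integrable_qf[OF f(1)])
  have "gram_int M \<theta> f g \<le> (LINT \<phi>|circ. G * (\<Sum>j<M. f \<phi> * (cmod (tau_vec M \<theta> \<phi> j))\<^sup>2)) / (2 * pi)"
   unfolding gram_int_def
  proof (intro divide_right_mono integral_mono_AE)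
   show "AE \<phi> in circ. f \<phi> * toeplitz_qf g M (tau_vec M \<theta> \<phi>) \<le> G * (\<Sum>j<M. f \<phi> * (cmod (tau_vec M \<theta> \<phi> j))\<^sup>2)"
    using f(2)
   proof eventually_elim
    case (elim \<phi>)
    from mult_left_mono[OF G this, of "tau_vec M \<theta> \<phi>"] show ?case
     by (simp add: sum_distrib_left mult_ac)
   qed
  qed (use ci integrable_times_continuous_real[OF f(1) continuous_qf_tau_vec[OF g]] in auto)
  also have "... = G * (\<Sum>j<M. toeplitz_qf f M (\<lambda>i. tau M \<theta> j i))"
   using ci by (simp add: toeplitz_qf_def cmod_tau_vec flip: sum_divide_distrib)
  also have "... \<le> G * (\<Sum>j<M. F * (\<Sum>i<M. (cmod (tau M \<theta> j i))\<^sup>2))"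
   by (intro mult_left_mono sum_mono F G0)
  also have "... = G * (F * (\<Sum>j<M. \<Sum>i<M. (cmod (tau M \<theta> j i))\<^sup>2))" by (simp only: sum_distrib_left)
  also have "... \<le> G * (F * (4 * harm M))" by (intro mult_left_mono tau_frobenius F0 G0)
  finally show ?thesis by simp
qed

lemma gram_int_le_support:
  assumes f: "integrable circ f" "AE x in circ. 0 \<le> f x" and g: "integrable circ g"
   and B: "\<And>x. f x \<noteq> 0 \<Longrightarrow> toeplitz_qf g M (tau_vec M \<theta> x) \<le> B"
  shows "gram_int M \<theta> f g \<le> B * ((LINT x|circ. f x) / (2 * pi))"
proof -
  have "gram_int M \<theta> f g \<le> (LINT x|circ. B * f x) / (2 * pi)"
   unfolding gram_int_def
  proof (intro divide_right_mono integral_mono_AE)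
   show "AE \<phi> in circ. f \<phi> * toeplitz_qf g M (tau_vec M \<theta> \<phi>) \<le> B * f \<phi>"
    using f(2)
   proof eventually_elim
    case (elim \<phi>)
    then show ?case using B[of \<phi>] by (cases "f \<phi> = 0") (auto simp: mult.commute[of B] intro: mult_left_mono)
   qed
  qed (use f integrable_times_continuous_real[OF f(1) continuous_qf_tau_vec[OF g]] in auto)
  then show ?thesis by simp
qed

lemma toeplitz_qf_le_l1:
  assumes f: "integrable circ f" "AE x in circ. 0 \<le> f x"
  shows "toeplitz_qf f M v \<le> (\<Sum>j<M. cmod (v j))\<^sup>2 * ((LINT x|circ. f x) / (2 * pi))"
proof -
  have t: "cmod (trig M v x) \<le> (\<Sum>j<M. cmod (v j))" for x
   unfolding trig_def by (rule order_trans[OF norm_sum]) (simp add: norm_mult)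
  have "toeplitz_qf f M v \<le> (LINT x|circ. (\<Sum>j<M. cmod (v j))\<^sup>2 * f x) / (2 * pi)"
   unfolding toeplitz_qf_def
  proof (intro divide_right_mono integral_mono_AE integrable_qf f)
   show "AE x in circ. f x * (cmod (trig M v x))\<^sup>2 \<le> (\<Sum>j<M. cmod (v j))\<^sup>2 * f x"
    using f(2)
   proof eventually_elim
    case (elim x)
    from mult_left_mono[OF power_mono[OF t, of _ 2] this, of x] show ?case by (simp add: mult.commute)
   qed
  qed (use f in auto)
  then show ?thesis by simp
qed

text \<open>The symbol splits into a part bounded by \<open>B\<close> and a part of mass \<open>S\<close> living on \<open>\<bar>x\<bar> \<le> \<eta> / 2\<close>. The bounded parts are
  compared with the Frobenius norm of \<open>\<tau>\<close>; wherever the concentrated part occurs, \<open>\<theta>\<close> is at a distance of order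
  \<open>\<eta>\<close> from its support and the vectors \<open>tau_vec\<close> have decayed. The three terms are the pairs bounded-bounded, mixed and
  concentrated-concentrated.\<close>

theorem gram_int_far:
  assumes f: "integrable circ f" "AE x in circ. 0 \<le> f x" and \<eta>: "0 < \<eta>"
   and B: "0 \<le> B" "AE x in circ. \<eta> / 2 < \<bar>x\<bar> \<longrightarrow> f x \<le> B"
   and S: "S = (LINT x|circ. (if \<bar>x\<bar> \<le> \<eta> / 2 then f x else 0)) / (2 * pi)"
   and \<theta>: "\<eta> \<le> cmod (1 - cis \<theta>)"
  shows "gram_int M \<theta> f f \<le> 4 * B\<^sup>2 * harm M + 32 / \<eta> * B * S * (harm M)\<^sup>2 + (8 / \<eta> * S * harm M)\<^sup>2"
proof -
  define f1 where "f1 x = (if \<bar>x\<bar> \<le> \<eta> / 2 then f x else 0)" for x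
  define f2 where "f2 x = (if \<bar>x\<bar> \<le> \<eta> / 2 then 0 else f x)" for x
  have fm: "f \<in> borel_measurable circ" using f(1) by (rule borel_measurable_integrable)
  have set: "{x \<in> space circ. \<bar>x\<bar> \<le> \<eta> / 2} \<in> sets circ"
  proof -
   have "(\<lambda>x::real. \<bar>x\<bar>) \<in> borel_measurable circ"
    by (intro continuous_measurable_circ continuous_intros)
   then show ?thesis by measurable
  qed
  have f12m: "f1 \<in> borel_measurable circ" "f2 \<in> borel_measurable circ"
   unfolding f1_def f2_def using set fm by (auto intro!: measurable_If)
  have i1: "integrable circ f1" and i2: "integrable circ f2"
   using f(1) f12m by (auto intro: Bochner_Integration.integrable_bound simp: f1_def f2_def)
  have p1: "AE x in circ. 0 \<le> f1 x" and p2: "AE x in circ. 0 \<le> f2 x"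
   using f(2) by (auto simp: f1_def f2_def elim!: eventually_mono)
  have b2: "AE x in circ. f2 x \<le> B" using B by (auto simp: f2_def elim!: eventually_mono)
  have S': "S = (LINT x|circ. f1 x) / (2 * pi)" by (simp add: S f1_def)
  have S0: "0 \<le> S" unfolding S' by (intro divide_nonneg_nonneg integral_nonneg_AE p1) auto
  have h: "0 \<le> (harm M :: real)" by (rule harm_nonneg)
  have far: "\<eta> / 2 \<le> cmod (1 - cis (\<theta> - x))" if "f1 x \<noteq> 0" for x
  proof -
   have "\<bar>x\<bar> \<le> \<eta> / 2" using that by (auto simp: f1_def split: if_splits)
   moreover have "cmod (cis x - 1) \<le> \<bar>x\<bar>"
    using iexp_approx1[of x 0] by (simp add: cis_conv_exp)
   moreover have "cmod (1 - cis \<theta>) \<le> cmod (cis x - cis \<theta>) + cmod (cis x - 1)"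
    using norm_triangle_ineq4[of "cis x - cis \<theta>" "cis x - 1"] by simp
   moreover have "cis x - cis \<theta> = cis x * (1 - cis (\<theta> - x))"
    by (simp add: right_diff_distrib cis_mult)
   then have "cmod (cis x - cis \<theta>) = cmod (1 - cis (\<theta> - x))" by (simp add: norm_mult)
   ultimately show ?thesis using \<theta> by linarith
  qed
  have e: "0 < \<eta> / 2" using \<eta> by simp
  have g22: "gram_int M \<theta> f2 f2 \<le> B * B * (4 * harm M)"
   by (intro gram_int_le_bounded toeplitz_qf_le_const i2 p2 b2 B)
  have g12: "gram_int M \<theta> f1 f2 \<le> (B * (16 / \<eta> * (harm M)\<^sup>2)) * S"
   unfolding S'
  proof (rule gram_int_le_support[OF i1 p1 i2])
   fix x assume x: "f1 x \<noteq> 0"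
   have "toeplitz_qf f2 M (tau_vec M \<theta> x) \<le> B * (\<Sum>j<M. (cmod (tau_vec M \<theta> x j))\<^sup>2)"
    by (rule toeplitz_qf_le_const[OF i2 b2])
   also have "... \<le> B * (8 / (\<eta> / 2) * (harm M)\<^sup>2)" by (intro mult_left_mono tau_vec_sums(2) e far x B)
   finally show "toeplitz_qf f2 M (tau_vec M \<theta> x) \<le> B * (16 / \<eta> * (harm M)\<^sup>2)" by simp
  qed
  have g11: "gram_int M \<theta> f1 f1 \<le> ((8 / \<eta> * harm M)\<^sup>2 * S) * S"
   unfolding S'
  proof (rule gram_int_le_support[OF i1 p1 i1])
   fix x assume x: "f1 x \<noteq> 0"
   have "toeplitz_qf f1 M (tau_vec M \<theta> x) \<le> (\<Sum>j<M. cmod (tau_vec M \<theta> x j))\<^sup>2 * S"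
    unfolding S' by (rule toeplitz_qf_le_l1[OF i1 p1])
   also have "... \<le> (4 / (\<eta> / 2) * harm M)\<^sup>2 * S"
    by (intro mult_right_mono power_mono tau_vec_sums(1) e far x S0 sum_nonneg) auto
   finally show "toeplitz_qf f1 M (tau_vec M \<theta> x) \<le> (8 / \<eta> * harm M)\<^sup>2 * ((LINT x|circ. f1 x) / (2 * pi))" by (simp add: S')
  qed
  have f_eq: "f = (\<lambda>x. f1 x + f2 x)" by (auto simp: f1_def f2_def)
  have split: "gram_int M \<theta> f f = gram_int M \<theta> f1 f1 + gram_int M \<theta> f1 f2 + (gram_int M \<theta> f2 f1 + gram_int M \<theta> f2 f2)"
  proof -
   note ic = integrable_times_continuous_real[OF _ continuous_qf_tau_vec]
   have "gram_int M \<theta> f f = (LINT \<phi>|circ. (f1 \<phi> * toeplitz_qf f1 M (tau_vec M \<theta> \<phi>) + f1 \<phi> * toeplitz_qf f2 M (tau_vec M \<theta> \<phi>))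
    + (f2 \<phi> * toeplitz_qf f1 M (tau_vec M \<theta> \<phi>) + f2 \<phi> * toeplitz_qf f2 M (tau_vec M \<theta> \<phi>))) / (2 * pi)"
    unfolding gram_int_def f_eq toeplitz_qf_add[OF i1 i2] by (simp add: algebra_simps)
   then show ?thesis
    using ic[OF i1 i1] ic[OF i1 i2] ic[OF i2 i1] ic[OF i2 i2]
    by (simp add: gram_int_def add_divide_distrib)
  qed
  have "gram_int M \<theta> f f \<le> ((8 / \<eta> * harm M)\<^sup>2 * S) * S + (B * (16 / \<eta> * (harm M)\<^sup>2)) * S
    + ((B * (16 / \<eta> * (harm M)\<^sup>2)) * S + B * B * (4 * harm M))"
   unfolding split gram_int_commute[OF i2 i1] by (intro add_mono g11 g12 g22)
  also have "... = 4 * B\<^sup>2 * harm M + 32 / \<eta> * B * S * (harm M)\<^sup>2 + (8 / \<eta> * S * harm M)\<^sup>2"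
   by (simp add: power2_eq_square algebra_simps)
  finally show ?thesis .
qed

section \<open>Diagonal means and quadrature\<close>

lemma roots_of_unity_mean:
  assumes "0 < n" "\<bar>k\<bar> < int n"
  shows "(\<Sum>g<n. cis (of_int k * (2 * pi * real g / real n))) / of_nat n = (if k = 0 then 1 else 0)"
proof (cases "k = 0")
  case True
  then show ?thesis using assms by simp
next
  case False
  define z where "z = cis (2 * pi * of_int k / real n)"
  have "z \<noteq> 1"
  proof
   assume "z = 1"
   then have "cos (2 * pi * of_int k / real n) = 1" by (simp add: z_def complex_eq_iff)
   then obtain m :: int where "2 * pi * of_int k / real n = of_int m * (2 * pi)"
    by (auto simp: cos_one_2pi_int mult_ac)
   then have "of_int k = (of_int m * real n :: real)" using assms(1) by (simp add: field_simps)
   then have "k = m * int n" by (metis of_int_eq_iff of_int_mult of_int_of_nat_eq)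
   moreover have "1 \<le> \<bar>m\<bar>" using False calculation by auto
   ultimately have "int n \<le> \<bar>k\<bar>" using mult_right_mono[of 1 "\<bar>m\<bar>" "int n"] by (simp add: abs_mult)
   then show False using assms by simp
  qed
  moreover have "z ^ n = 1"
  proof -
   have "z ^ n = cis (2 * pi * of_int k)" using assms(1) by (simp add: z_def Complex.DeMoivre)
   also have "... = 1" by (rule cis_multiple_2pi) simp
   finally show ?thesis .
  qed
  moreover have "(\<Sum>g<n. cis (of_int k * (2 * pi * real g / real n))) = (\<Sum>g<n. z ^ g)"
   by (intro sum.cong refl) (simp add: z_def Complex.DeMoivre mult_ac)
  ultimately show ?thesis using False by (simp add: sum_gp_strict)
qed

definition grid :: "nat \<Rightarrow> nat \<Rightarrow> real" where
  "grid n g = 2 * pi * real g / real n"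

lemma grid_mean: "0 < n \<Longrightarrow> \<bar>k\<bar> < int n \<Longrightarrow>
   (\<Sum>g<n. cis (of_int k * grid n g)) / of_nat n = (if k = 0 then 1 else 0)"
  unfolding grid_def by (rule roots_of_unity_mean)

lemma grid_parseval:
  assumes "M \<le> n" "0 < n"
  shows "(\<Sum>g<n. (cmod (trig M w (grid n g)))\<^sup>2) / real n = (\<Sum>j<M. (cmod (w j))\<^sup>2)"
proof -
  have "complex_of_real ((\<Sum>g<n. (cmod (trig M w (grid n g)))\<^sup>2) / real n)
    = (\<Sum>g<n. \<Sum>i<M. \<Sum>j<M. cnj (w i) * w j * cis (- (of_int (int i - int j) * grid n g))) / of_nat n"
   by (simp only: of_real_divide of_real_sum cmod_trig_sq of_real_of_nat_eq)
  also have "... = (\<Sum>i<M. \<Sum>j<M. \<Sum>g<n. cnj (w i) * w j * cis (- (of_int (int i - int j) * grid n g))) / of_nat n"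
   by (subst sum.swap, subst (2) sum.swap) simp
  also have "... = (\<Sum>i<M. \<Sum>j<M. cnj (w i) * w j * ((\<Sum>g<n. cis (of_int (int j - int i) * grid n g)) / of_nat n))"
  proof -
   have "- (of_int (int i - int j) * x) = of_int (int j - int i) * x" for i j and x :: real
    by (simp add: algebra_simps)
   then show ?thesis by (simp only: sum_divide_distrib sum_distrib_left times_divide_eq_right)
  qed
  also have "... = (\<Sum>i<M. \<Sum>j<M. if i = j then cnj (w i) * w j else 0)"
  proof (intro sum.cong refl)
   fix i j assume ij: "i \<in> {..<M}" "j \<in> {..<M}"
   then have "\<bar>int j - int i\<bar> < int n" using assms by auto
   from grid_mean[OF assms(2) this]
   show "cnj (w i) * w j * ((\<Sum>g<n. cis (of_int (int j - int i) * grid n g)) / of_nat n) = (if i = j then cnj (w i) * w j else 0)"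
    by auto
  qed
  also have "... = of_real (\<Sum>j<M. (cmod (w j))\<^sup>2)"
   by (simp add: complex_norm_square mult.commute del: of_real_power)
  finally show ?thesis by (simp only: of_real_eq_iff)
qed

lemma trig_mult: "\<exists>w. \<forall>x. trig M v x * trig m u x = trig (M + m) w x"
proof -
  define w where "w l = (\<Sum>j<M. \<Sum>k<m. if j + k = l then v j * u k else 0)" for l
  have "trig M v x * trig m u x = trig (M + m) w x" for x
  proof -
   have "trig (M + m) w x = (\<Sum>l<M + m. \<Sum>j<M. \<Sum>k<m. if l = j + k then v j * u k * cis (real l * x) else 0)"
    unfolding trig_def w_def sum_distrib_right by (intro sum.cong refl) auto
   also have "... = (\<Sum>j<M. \<Sum>k<m. \<Sum>l<M + m. if l = j + k then v j * u k * cis (real l * x) else 0)"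
    by (subst sum.swap, subst (2) sum.swap) simp
   also have "... = (\<Sum>j<M. \<Sum>k<m. v j * u k * cis (real (j + k) * x))"
    by (intro sum.cong refl) (auto simp: sum.delta)
   also have "... = trig M v x * trig m u x"
   proof -
    have "v j * u k * cis (real (j + k) * x) = (v j * cis (real j * x)) * (u k * cis (real k * x))" for j k
     by (simp add: distrib_right flip: cis_mult)
    then show ?thesis unfolding trig_def sum_product by (simp only:)
   qed
   finally show ?thesis by simp
  qed
  then show ?thesis by blast
qed

text \<open>A product of trigonometric polynomials of \<open>M\<close> and \<open>m\<close> terms has at most \<open>M + m\<close> terms, for which the average over
  that many equidistant points equals the integral.\<close>

lemma grid_quadrature:
  assumes "M + m \<le> n" "0 < n"
  shows "(\<Sum>g<n. (cmod (trig M v (grid n g)))\<^sup>2 * (cmod (trig m u (grid n g)))\<^sup>2) / real n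
    = toeplitz_qf (\<lambda>x. (cmod (trig m u x))\<^sup>2) M v"
proof -
  obtain w where w: "\<And>x. trig M v x * trig m u x = trig (M + m) w x" using trig_mult by blast
  have e: "(cmod (trig M v x))\<^sup>2 * (cmod (trig m u x))\<^sup>2 = (cmod (trig (M + m) w x))\<^sup>2" for x
   unfolding w[symmetric] norm_mult power_mult_distrib ..
  have "toeplitz_qf (\<lambda>x. (cmod (trig m u x))\<^sup>2) M v = toeplitz_qf (\<lambda>_. 1) (M + m) w"
   unfolding toeplitz_qf_def e[symmetric] by (simp add: mult.commute)
  then show ?thesis unfolding e toeplitz_qf_one grid_parseval[OF assms] by simp
qed

text \<open>The normalised Dirichlet kernel, squared: a bump of width \<open>1/m\<close> at the origin.\<close>

definition bump :: "nat \<Rightarrow> real \<Rightarrow> real" where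
  "bump m x = (cmod (trig m (\<lambda>_. 1 / of_nat m) x))\<^sup>2"

text \<open>Near the origin all the terms of the kernel still point in the direction of 1.\<close>

lemma bump_near:
  assumes m: "0 < m" and x: "cmod (1 - cis x) \<le> 1 / (2 * real m)"
  shows "1 / 4 \<le> bump m x"
proof -
  have "cmod (trig m (\<lambda>_. 1 / of_nat m) x - 1) = cmod ((\<Sum>k<m. cis x ^ k - 1) / of_nat m)"
   using m by (simp add: trig_def sum_subtractf diff_divide_distrib sum_divide_distrib Complex.DeMoivre)
  also have "... \<le> (\<Sum>k<m. 1 / 2) / real m"
   unfolding norm_divide norm_of_nat
  proof (intro divide_right_mono order_trans[OF norm_sum] sum_mono)
   fix k assume "k \<in> {..<m}"
   then have k: "k < m" by simp
   have "cmod (cis x ^ k - 1 ^ k) \<le> real k * cmod (cis x - 1)" by (rule norm_power_diff) auto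
   also have "... \<le> real m * (1 / (2 * real m))"
    using x k by (intro mult_mono) (auto simp: norm_minus_commute)
   finally show "cmod (cis x ^ k - 1) \<le> 1 / 2" using m by simp
  qed simp
  finally have "cmod (trig m (\<lambda>_. 1 / of_nat m) x - 1) \<le> 1 / 2" using m by simp
  then have "1 / 2 \<le> cmod (trig m (\<lambda>_. 1 / of_nat m) x)"
   using norm_triangle_ineq2[of 1 "1 - trig m (\<lambda>_. 1 / of_nat m) x"] by (simp add: norm_minus_commute)
  from power_mono[OF this, of 2] show ?thesis by (simp add: bump_def power2_eq_square)
qed

lemma jordan_sin:
  assumes "0 \<le> x" "x \<le> pi / 2"
  shows "2 * x / pi \<le> sin x"
proof -
  have "convex_on {0..pi / 2} (\<lambda>x. - sin x)"
   by (rule f''_ge0_imp_convex[where f' = "\<lambda>x. - cos x" and f'' = sin])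
    (auto intro!: derivative_eq_intros sin_ge_zero)
  from convex_onD[OF this, of "2 * x / pi" 0 "pi / 2"] show ?thesis
   using assms by (simp add: field_simps)
qed

lemma cis_distance_ge: "\<bar>x\<bar> \<le> pi \<Longrightarrow> 2 * \<bar>x\<bar> / pi \<le> cmod (1 - cis x)"
proof -
  assume x: "\<bar>x\<bar> \<le> pi"
  have "(cmod (1 - cis x))\<^sup>2 = (1 - cos x)\<^sup>2 + (sin x)\<^sup>2" by (simp add: cmod_power2)
  also have "... = (cos x)\<^sup>2 + (sin x)\<^sup>2 + 1 - 2 * cos x" by (simp add: power2_eq_square algebra_simps)
  also have "... = 2 - 2 * cos (2 * (\<bar>x\<bar> / 2))" by simp
  also have "... = (2 * sin (\<bar>x\<bar> / 2))\<^sup>2" unfolding cos_double_sin by (simp add: power_mult_distrib)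
  finally have "cmod (1 - cis x) = \<bar>2 * sin (\<bar>x\<bar> / 2)\<bar>" by (metis norm_ge_zero power2_eq_iff_nonneg abs_ge_zero power2_abs)
  moreover have "2 * (\<bar>x\<bar> / 2) / pi \<le> sin (\<bar>x\<bar> / 2)" using x by (intro jordan_sin) auto
  ultimately show ?thesis by simp
qed

lemma bump_le:
  assumes m: "0 < m" and x: "\<bar>x\<bar> \<le> pi" "x \<noteq> 0" and b: "0 < b" "b \<le> 2"
  shows "bump m x \<le> (pi / (real m * \<bar>x\<bar>)) powr b"
proof -
  define t where "t = pi / (real m * \<bar>x\<bar>)"
  have t: "0 < t" using m x by (simp add: t_def)
  define y where "y = cmod (trig m (\<lambda>_. 1 / of_nat m) x)"
  have y0: "0 \<le> y" by (simp add: y_def)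
  have "y \<le> (\<Sum>k<m. 1 / real m)"
   unfolding y_def trig_def by (rule order_trans[OF norm_sum]) (simp add: norm_mult norm_divide)
  then have y1: "y \<le> 1" using m by simp
  have "(1 - cis x) * (\<Sum>k<m. cis x ^ k) = 1 - cis x ^ m" by (rule one_diff_power_eq[symmetric])
  then have "cmod (1 - cis x) * cmod (\<Sum>k<m. cis x ^ k) = cmod (1 - cis x ^ m)" by (metis norm_mult)
  also have "... \<le> 2" using norm_triangle_ineq4[of 1 "cis x ^ m"] by (simp add: norm_power)
  finally have "cmod (1 - cis x) * cmod (\<Sum>k<m. cis x ^ k) \<le> 2" .
  moreover have "(\<Sum>k<m. cis x ^ k) = of_nat m * trig m (\<lambda>_. 1 / of_nat m) x"
   using m by (simp add: trig_def sum_distrib_left Complex.DeMoivre)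
  ultimately have "cmod (1 - cis x) * (real m * y) \<le> 2" by (simp add: norm_mult y_def)
  moreover have "2 * \<bar>x\<bar> / pi * (real m * y) \<le> cmod (1 - cis x) * (real m * y)"
   using cis_distance_ge[OF x(1)] y0 by (intro mult_right_mono) auto
  ultimately have "2 * \<bar>x\<bar> / pi * (real m * y) \<le> 2" by linarith
  then have yt: "y \<le> t" using m x by (simp add: t_def field_simps)
  show ?thesis
  proof (cases "t \<le> 1")
   case True
   have "y\<^sup>2 \<le> t\<^sup>2" using yt y0 by (intro power_mono)
   also have "t\<^sup>2 = t powr 2" using t by simp
   also have "... \<le> t powr b" using True t b by (intro powr_mono') auto
   finally show ?thesis by (simp add: bump_def y_def t_def)
  next
   case False
   have "y\<^sup>2 \<le> 1" using y0 y1 by (simp add: power_le_one)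
   also have "1 \<le> t powr b" using False b by (intro ge_one_powr_ge_zero) auto
   finally show ?thesis by (simp add: bump_def y_def t_def)
  qed
qed

text \<open>The bump decays away from the origin while the density grows towards it at least like \<open>\<bar>x\<bar>\<close> to the power \<open>- b\<close>: so on the
  scale \<open>1 / m\<close> the density exceeds the bump by the factor \<open>m powr b\<close>.\<close>

lemma qf_bump_le:
  assumes f: "integrable circ f" and m: "0 < m" and b: "0 < b" "b \<le> 2" and c: "0 < c"
   and low: "AE x in circ. x \<noteq> 0 \<longrightarrow> c * \<bar>x\<bar> powr (- b) \<le> f x"
  shows "toeplitz_qf (bump m) M v \<le> (pi / real m) powr b / c * toeplitz_qf f M v"
proof -
  have bi: "integrable circ (bump m)"
   using integrable_qf[OF integrable_const_circ[of 1], of m "\<lambda>_. 1 / of_nat m"] by (simp add: bump_def[abs_def])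
  have "{0} \<in> null_sets lebesgue" by simp
  from AE_not_in[OF this] have "AE x in lebesgue. x \<noteq> (0::real)" by simp
  then have nz: "AE x in circ. x \<noteq> 0" by (auto simp: AE_restrict_space_iff elim!: eventually_mono)
  have "toeplitz_qf (bump m) M v \<le> toeplitz_qf (\<lambda>x. (pi / real m) powr b / c * f x) M v"
  proof (rule toeplitz_qf_mono[OF bi])
   have sp: "AE x in circ. x \<in> {-pi..pi}" by (rule AE_I2) simp
   show "AE x in circ. bump m x \<le> (pi / real m) powr b / c * f x"
    using low nz sp
   proof eventually_elim
    case (elim x)
    then have x: "\<bar>x\<bar> \<le> pi" "x \<noteq> 0" by auto
    have "bump m x \<le> (pi / real m / \<bar>x\<bar>) powr b" using bump_le[OF m x b] by simp
    also have "... = (pi / real m) powr b / c * (c * \<bar>x\<bar> powr (- b))"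
     using m x c by (simp add: powr_divide powr_mult powr_minus field_simps)
    also have "... \<le> (pi / real m) powr b / c * f x" using elim c by (intro mult_left_mono) auto
    finally show ?case .
   qed
  qed (use f in simp)
  then show ?thesis unfolding toeplitz_qf_cmult .
qed

text \<open>The average of a matrix along its \<open>k\<close>-th diagonal as a double sum, which makes it visibly linear in the matrix.\<close>

definition diag_mean :: "nat \<Rightarrow> (nat \<Rightarrow> nat \<Rightarrow> complex) \<Rightarrow> int \<Rightarrow> complex" where
  "diag_mean M D k = (\<Sum>i<M. \<Sum>j<M. if int i - int j = k then D i j / of_real (real M - \<bar>real i - real j\<bar>) else 0)"

definition tau_sum :: "nat \<Rightarrow> (nat \<Rightarrow> nat \<Rightarrow> complex) \<Rightarrow> real \<Rightarrow> complex" where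
  "tau_sum M D \<theta> = (\<Sum>i<M. \<Sum>j<M. D i j * tau M \<theta> i j)"

text \<open>The form of the Toeplitz matrix of diagonal means is the average of the real weights \<open>tau_sum\<close> against the squared
  modulus of the trigonometric polynomial of \<open>v\<close>: all frequencies involved are below \<open>2 * M\<close>, so the grid is exact.\<close>

lemma diag_mean_form:
  assumes n: "2 * M \<le> n" "0 < n"
  shows "(\<Sum>a<M. \<Sum>b<M. cnj (v a) * v b * diag_mean M D (int a - int b))
    = (\<Sum>g<n. tau_sum M D (grid n g) * of_real ((cmod (trig M v (grid n g)))\<^sup>2)) / of_nat n"
proof -
  define e where "e i j = D i j / of_real (real M - \<bar>real i - real j\<bar>)" for i j
  have "(\<Sum>g<n. tau_sum M D (grid n g) * of_real ((cmod (trig M v (grid n g)))\<^sup>2)) / of_nat n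
   = (\<Sum>g<n. \<Sum>i<M. \<Sum>j<M. \<Sum>a<M. \<Sum>b<M. cnj (v a) * v b * e i j * cis (of_int (int i - int j - (int a - int b)) * grid n g)) / of_nat n"
  proof (intro arg_cong2[where f = "(/)"] sum.cong refl)
   fix g
   have "tau_sum M D (grid n g) * of_real ((cmod (trig M v (grid n g)))\<^sup>2)
    = (\<Sum>i<M. \<Sum>j<M. \<Sum>a<M. \<Sum>b<M. D i j * tau M (grid n g) i j * (cnj (v a) * v b * cis (- (of_int (int a - int b) * grid n g))))"
    unfolding tau_sum_def cmod_trig_sq sum_distrib_right by (simp only: sum_distrib_left)
   also have "... = (\<Sum>i<M. \<Sum>j<M. \<Sum>a<M. \<Sum>b<M. cnj (v a) * v b * e i j * cis (of_int (int i - int j - (int a - int b)) * grid n g))"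
   proof (intro sum.cong refl)
    fix i j a b
    have "cis ((real i - real j) * grid n g) * cis (- (of_int (int a - int b) * grid n g)) = cis (of_int (int i - int j - (int a - int b)) * grid n g)"
     unfolding cis_mult by (simp add: algebra_simps)
    then show "D i j * tau M (grid n g) i j * (cnj (v a) * v b * cis (- (of_int (int a - int b) * grid n g)))
     = cnj (v a) * v b * e i j * cis (of_int (int i - int j - (int a - int b)) * grid n g)"
     unfolding tau_def e_def by (simp add: mult_ac del: of_int_diff)
   qed
   finally show "tau_sum M D (grid n g) * of_real ((cmod (trig M v (grid n g)))\<^sup>2)
    = (\<Sum>i<M. \<Sum>j<M. \<Sum>a<M. \<Sum>b<M. cnj (v a) * v b * e i j * cis (of_int (int i - int j - (int a - int b)) * grid n g))" .
  qed
  also have "... = (\<Sum>i<M. \<Sum>j<M. \<Sum>a<M. \<Sum>b<M. \<Sum>g<n. cnj (v a) * v b * e i j * cis (of_int (int i - int j - (int a - int b)) * grid n g)) / of_nat n"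
  proof -
   have "(\<Sum>g<n. \<Sum>i<M. \<Sum>j<M. \<Sum>a<M. \<Sum>b<M. F g i j a b) = (\<Sum>i<M. \<Sum>j<M. \<Sum>a<M. \<Sum>b<M. \<Sum>g<n. F g i j a b)"
    for F :: "nat \<Rightarrow> nat \<Rightarrow> nat \<Rightarrow> nat \<Rightarrow> nat \<Rightarrow> complex"
   proof -
    have "(\<Sum>g<n. \<Sum>i<M. \<Sum>j<M. \<Sum>a<M. \<Sum>b<M. F g i j a b) = (\<Sum>i<M. \<Sum>g<n. \<Sum>j<M. \<Sum>a<M. \<Sum>b<M. F g i j a b)"
     by (rule sum.swap)
    also have "... = (\<Sum>i<M. \<Sum>j<M. \<Sum>g<n. \<Sum>a<M. \<Sum>b<M. F g i j a b)"
     by (rule sum.cong[OF refl], rule sum.swap)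
    also have "... = (\<Sum>i<M. \<Sum>j<M. \<Sum>a<M. \<Sum>g<n. \<Sum>b<M. F g i j a b)"
     by (rule sum.cong[OF refl], rule sum.cong[OF refl], rule sum.swap)
    also have "... = (\<Sum>i<M. \<Sum>j<M. \<Sum>a<M. \<Sum>b<M. \<Sum>g<n. F g i j a b)"
     by (rule sum.cong[OF refl], rule sum.cong[OF refl], rule sum.cong[OF refl], rule sum.swap)
    finally show ?thesis .
   qed
   then show ?thesis by simp
  qed
  also have "... = (\<Sum>i<M. \<Sum>j<M. \<Sum>a<M. \<Sum>b<M. cnj (v a) * v b * (if int i - int j = int a - int b then e i j else 0))"
  proof -
   have "(\<Sum>g<n. cnj (v a) * v b * e i j * cis (of_int (int i - int j - (int a - int b)) * grid n g)) / of_nat n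
    = cnj (v a) * v b * (if int i - int j = int a - int b then e i j else 0)"
    if "i < M" "j < M" "a < M" "b < M" for i j a b
   proof -
    have "\<bar>int i - int j - (int a - int b)\<bar> < int n" using that n by auto
    note gm = grid_mean[OF n(2) this]
    have "(\<Sum>g<n. cnj (v a) * v b * e i j * cis (of_int (int i - int j - (int a - int b)) * grid n g)) / of_nat n
     = cnj (v a) * v b * e i j * ((\<Sum>g<n. cis (of_int (int i - int j - (int a - int b)) * grid n g)) / of_nat n)"
     by (simp only: sum_distrib_left times_divide_eq_right)
    then show ?thesis unfolding gm by auto
   qed
   then show ?thesis unfolding sum_divide_distrib by (intro sum.cong refl) auto
  qed
  also have "... = (\<Sum>a<M. \<Sum>b<M. \<Sum>i<M. \<Sum>j<M. cnj (v a) * v b * (if int i - int j = int a - int b then e i j else 0))"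
   by (rule sum_swap_pairs)
  also have "... = (\<Sum>a<M. \<Sum>b<M. cnj (v a) * v b * diag_mean M D (int a - int b))"
   unfolding diag_mean_def e_def by (simp only: sum_distrib_left)
  finally show ?thesis by simp
qed

lemma diag_count: "\<bar>k\<bar> < int M \<Longrightarrow> card {j. j < M \<and> 0 \<le> int j + k \<and> int j + k < int M} = nat (int M - \<bar>k\<bar>)"
proof -
  assume k: "\<bar>k\<bar> < int M"
  have "{j. j < M \<and> 0 \<le> int j + k \<and> int j + k < int M} = {nat (max 0 (- k))..<nat (min (int M) (int M - k))}" by auto
  then have "card {j. j < M \<and> 0 \<le> int j + k \<and> int j + k < int M} = nat (min (int M) (int M - k)) - nat (max 0 (- k))"
   by (simp only: card_atLeastLessThan)
  also have "... = nat (int M - \<bar>k\<bar>)" using k by (cases "0 \<le> k") (simp_all add: nat_diff_distrib)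
  finally show ?thesis .
qed

lemma diag_mean_single_sum:
  assumes k: "\<bar>k\<bar> < int M"
  shows "diag_mean M D k = (\<Sum>j | j < M \<and> 0 \<le> int j + k \<and> int j + k < int M. D (nat (int j + k)) j) / of_int (int M - \<bar>k\<bar>)"
proof -
  have "diag_mean M D k = (\<Sum>j<M. \<Sum>i<M. if int i - int j = k then D i j / of_real (real M - \<bar>real i - real j\<bar>) else 0)"
   unfolding diag_mean_def by (rule sum.swap)
  also have "... = (\<Sum>j<M. if 0 \<le> int j + k \<and> int j + k < int M then D (nat (int j + k)) j / of_int (int M - \<bar>k\<bar>) else 0)"
  proof (intro sum.cong refl)
   fix j
   have "(\<Sum>i<M. if int i - int j = k then D i j / of_real (real M - \<bar>real i - real j\<bar>) else 0)
    = (\<Sum>i<M. if i = nat (int j + k) \<and> 0 \<le> int j + k then D i j / of_int (int M - \<bar>k\<bar>) else 0)"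
   proof (intro sum.cong refl)
    fix i
    have iff: "(int i - int j = k) = (i = nat (int j + k) \<and> 0 \<le> int j + k)" by auto
    have den: "complex_of_real (real M - \<bar>real i - real j\<bar>) = of_int (int M - \<bar>k\<bar>)" if "int i - int j = k"
    proof -
     have "real i - real j = of_int k" using that by (metis of_int_diff of_int_of_nat_eq)
     then have "real M - \<bar>real i - real j\<bar> = real_of_int (int M - \<bar>k\<bar>)" by simp
     then show ?thesis by (simp only: of_real_of_int_eq)
    qed
    show "(if int i - int j = k then D i j / of_real (real M - \<bar>real i - real j\<bar>) else 0)
      = (if i = nat (int j + k) \<and> 0 \<le> int j + k then D i j / of_int (int M - \<bar>k\<bar>) else 0)"
    proof (cases "int i - int j = k")
     case True
     show ?thesis unfolding if_P[OF True] if_P[OF True[unfolded iff]] den[OF True] ..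
    next
     case False
     show ?thesis unfolding if_not_P[OF False] if_not_P[OF False[unfolded iff]] ..
    qed
   qed
   also have "... = (if 0 \<le> int j + k \<and> int j + k < int M then D (nat (int j + k)) j / of_int (int M - \<bar>k\<bar>) else 0)"
   proof (cases "0 \<le> int j + k")
    case True
    have "nat (int j + k) \<in> {..<M} \<longleftrightarrow> 0 \<le> int j + k \<and> int j + k < int M" using True by (simp add: nat_less_iff)
    moreover have "(i = nat (int j + k) \<and> 0 \<le> int j + k) = (i = nat (int j + k))" for i using True by simp
    ultimately show ?thesis by (simp only: sum.delta'[OF finite_lessThan] sum.delta[OF finite_lessThan])
   next
    case False
    then have "(i = nat (int j + k) \<and> 0 \<le> int j + k) = False" "(0 \<le> int j + k \<and> int j + k < int M) = False" for i by simp_all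
    then show ?thesis by (simp only: if_False sum.neutral_const)
   qed
   finally show "(\<Sum>i<M. if int i - int j = k then D i j / of_real (real M - \<bar>real i - real j\<bar>) else 0)
    = (if 0 \<le> int j + k \<and> int j + k < int M then D (nat (int j + k)) j / of_int (int M - \<bar>k\<bar>) else 0)" .
  qed
  also have "... = (\<Sum>j | j < M \<and> 0 \<le> int j + k \<and> int j + k < int M. D (nat (int j + k)) j / of_int (int M - \<bar>k\<bar>))"
   by (subst sum.inter_filter[symmetric]) (auto intro!: sum.cong)
  finally show ?thesis by (simp add: sum_divide_distrib)
qed

lemma diag_mean_toeplitz:
  assumes k: "\<bar>k\<bar> < int M"
  shows "diag_mean M (\<lambda>i j. r (int i - int j)) k = r k"
proof -
  have "(\<Sum>j | j < M \<and> 0 \<le> int j + k \<and> int j + k < int M. r (int (nat (int j + k)) - int j))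
    = (\<Sum>j | j < M \<and> 0 \<le> int j + k \<and> int j + k < int M. r k)"
   by (intro sum.cong) auto
  moreover have "of_int (int M - \<bar>k\<bar>) \<noteq> (0 :: complex)" using k unfolding of_int_eq_0_iff by simp
  moreover have "complex_of_nat (nat (int M - \<bar>k\<bar>)) = of_int (int M - \<bar>k\<bar>)" using k by (simp only: of_nat_nat)
  ultimately show ?thesis unfolding diag_mean_single_sum[OF k] sum_constant diag_count[OF k]
   by (simp add: diag_count[OF k] del: of_int_diff)
qed

lemma diag_average_eq:
  assumes S: "S \<in> carrier_mat M M" and k: "\<bar>k\<bar> < int M"
  shows "diag_average S k = diag_mean M (\<lambda>i j. S $$ (i, j)) k"
proof -
  have "(\<Sum>i | 0 \<le> i \<and> i < int M \<and> 0 \<le> i + k \<and> i + k < int M. S $$ (nat (i + k), nat i))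
    = (\<Sum>j | j < M \<and> 0 \<le> int j + k \<and> int j + k < int M. S $$ (nat (int j + k), j))"
   by (rule sum.reindex_bij_witness[where i = int and j = nat]) auto
  then show ?thesis unfolding diag_mean_single_sum[OF k] diag_average_def using S by simp
qed

text \<open>At grid points near the singularity the squared modulus of the trigonometric polynomial of \<open>v\<close> is at most four times its
  product with the bump, and the quadrature formula sums these products to a Toeplitz form. The large error \<open>e2\<close> thus only
  multiplies the form of the bump, which is small relative to the covariance.\<close>

theorem diag_mean_form_bound:
  assumes M: "0 < M" and m: "0 < m" "m \<le> M" and e: "0 \<le> e1" "0 \<le> e2"
   and far: "\<And>g. g < 2 * M \<Longrightarrow> 1 / (2 * real m) \<le> cmod (1 - cis (grid (2 * M) g)) \<Longrightarrow> \<bar>Re (tau_sum M D (grid (2 * M) g))\<bar> \<le> e1"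
   and near: "\<And>g. g < 2 * M \<Longrightarrow> \<bar>Re (tau_sum M D (grid (2 * M) g))\<bar> \<le> e2"
  shows "\<bar>Re (\<Sum>a<M. \<Sum>b<M. cnj (v a) * v b * diag_mean M D (int a - int b))\<bar>
    \<le> e1 * (\<Sum>j<M. (cmod (v j))\<^sup>2) + 4 * e2 * toeplitz_qf (bump m) M v"
proof -
  define n where "n = 2 * M"
  define t where "t g = (cmod (trig M v (grid n g)))\<^sup>2" for g
  have n2: "2 * M \<le> n" by (simp add: n_def)
  have n: "0 < n" "M \<le> n" "M + m \<le> n" using M m by (auto simp: n_def)
  have "Re (\<Sum>a<M. \<Sum>b<M. cnj (v a) * v b * diag_mean M D (int a - int b))
    = (\<Sum>g<n. Re (tau_sum M D (grid n g)) * t g) / real n"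
   unfolding diag_mean_form[OF n2 n(1)] t_def
   by (simp add: Re_divide_of_nat Re_sum del: of_real_power)
  then have "\<bar>Re (\<Sum>a<M. \<Sum>b<M. cnj (v a) * v b * diag_mean M D (int a - int b))\<bar>
    \<le> (\<Sum>g<n. \<bar>Re (tau_sum M D (grid n g))\<bar> * t g) / real n"
   using sum_abs[of "\<lambda>g. Re (tau_sum M D (grid n g)) * t g" "{..<n}"] by (simp add: abs_mult t_def divide_right_mono)
  also have "... \<le> (\<Sum>g<n. e1 * t g + 4 * e2 * (t g * bump m (grid n g))) / real n"
  proof (intro divide_right_mono sum_mono)
   fix g assume "g \<in> {..<n}"
   then have g: "g < 2 * M" by (simp add: n_def)
   have t0: "0 \<le> t g" "0 \<le> bump m (grid n g)" by (auto simp: t_def bump_def)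
   show "\<bar>Re (tau_sum M D (grid n g))\<bar> * t g \<le> e1 * t g + 4 * e2 * (t g * bump m (grid n g))"
   proof (cases "1 / (2 * real m) \<le> cmod (1 - cis (grid n g))")
    case True
    then have "\<bar>Re (tau_sum M D (grid n g))\<bar> * t g \<le> e1 * t g"
     using far[OF g] t0 by (intro mult_right_mono) (auto simp: n_def)
    moreover have "0 \<le> 4 * e2 * (t g * bump m (grid n g))" using e t0 by simp
    ultimately show ?thesis by simp
   next
    case False
    then have "1 / 4 \<le> bump m (grid n g)" by (intro bump_near m) auto
    then have "e2 * t g * (1 / 4) \<le> e2 * t g * bump m (grid n g)" using e t0 by (intro mult_left_mono) auto
    moreover have "\<bar>Re (tau_sum M D (grid n g))\<bar> * t g \<le> e2 * t g"
     using near[OF g] t0 by (intro mult_right_mono) (auto simp: n_def)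
    moreover have "0 \<le> e1 * t g" using e t0 by simp
    ultimately show ?thesis by (simp add: mult_ac)
   qed
  qed simp
  also have "... = e1 * ((\<Sum>g<n. t g) / real n) + 4 * e2 * ((\<Sum>g<n. t g * bump m (grid n g)) / real n)"
   by (simp add: sum.distrib add_divide_distrib sum_distrib_left[symmetric])
  also have "(\<Sum>g<n. t g) / real n = (\<Sum>j<M. (cmod (v j))\<^sup>2)"
   unfolding t_def by (rule grid_parseval[OF n(2,1)])
  also have "(\<Sum>g<n. t g * bump m (grid n g)) / real n = toeplitz_qf (bump m) M v"
   unfolding t_def bump_def[abs_def] by (rule grid_quadrature[OF n(3,1)])
  finally show ?thesis .
qed

section \<open>The estimator as a family of row sums\<close>

text \<open>The matrix of the quadratic form through which one row enters \<open>tau_sum\<close>. For \<open>h\<close> a square root of the covariance it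
  is \<open>R\<^sup>1\<^sup>/\<^sup>2 \<tau> R\<^sup>1\<^sup>/\<^sup>2\<close>, with the conjugations due to the sample covariance being \<open>X\<^sup>* X\<close>.\<close>

definition sandwich :: "nat \<Rightarrow> (nat \<Rightarrow> nat \<Rightarrow> complex) \<Rightarrow> real \<Rightarrow> nat \<Rightarrow> nat \<Rightarrow> complex" where
  "sandwich M h \<theta> k l = (\<Sum>i<M. \<Sum>j<M. cnj (h k i) * tau M \<theta> i j * h l j)"

lemma sandwich_hermitian: "sandwich M h \<theta> l k = cnj (sandwich M h \<theta> k l)"
proof -
  have "cnj (sandwich M h \<theta> k l) = (\<Sum>i<M. \<Sum>j<M. h k i * tau M \<theta> j i * cnj (h l j))"
   by (simp add: sandwich_def cnj_sum tau_cnj)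
  also have "... = (\<Sum>j<M. \<Sum>i<M. cnj (h l j) * tau M \<theta> j i * h k i)"
   by (subst sum.swap) (simp add: mult_ac)
  finally show ?thesis by (simp add: sandwich_def)
qed

lemma sandwich_trace:
  assumes h: "\<And>i j. i < M \<Longrightarrow> j < M \<Longrightarrow> (\<Sum>k<M. cnj (h k i) * h k j) = R i j"
  shows "(\<Sum>k<M. sandwich M h \<theta> k k) = tau_sum M R \<theta>"
proof -
  have "(\<Sum>k<M. sandwich M h \<theta> k k) = (\<Sum>i<M. \<Sum>k<M. \<Sum>j<M. cnj (h k i) * tau M \<theta> i j * h k j)"
   unfolding sandwich_def by (rule sum.swap)
  also have "... = (\<Sum>i<M. \<Sum>j<M. \<Sum>k<M. cnj (h k i) * tau M \<theta> i j * h k j)"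
   by (rule sum.cong[OF refl], rule sum.swap)
  also have "... = (\<Sum>i<M. \<Sum>j<M. (\<Sum>k<M. cnj (h k i) * h k j) * tau M \<theta> i j)"
   unfolding sum_distrib_right by (intro sum.cong refl) (simp only: mult_ac)
  also have "... = tau_sum M R \<theta>" unfolding tau_sum_def by (intro sum.cong refl) (simp add: h)
  finally show ?thesis .
qed

lemma sandwich_frobenius:
  assumes f: "integrable circ f"
   and h: "\<And>i j. i < M \<Longrightarrow> j < M \<Longrightarrow> (\<Sum>k<M. cnj (h k i) * h k j) = fourier_coeff f (int i - int j)"
  shows "(\<Sum>k<M. \<Sum>l<M. (cmod (sandwich M h \<theta> k l))\<^sup>2) = gram_int M \<theta> f f"
proof -
  define G where "G i j i' j' k l = cnj (h k i) * tau M \<theta> i j * h l j * (h k i' * cnj (tau M \<theta> i' j') * cnj (h l j'))" for i j i' j' k l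
  have "complex_of_real (\<Sum>k<M. \<Sum>l<M. (cmod (sandwich M h \<theta> k l))\<^sup>2)
    = (\<Sum>k<M. \<Sum>l<M. sandwich M h \<theta> k l * cnj (sandwich M h \<theta> k l))"
   by (simp only: of_real_sum complex_norm_square)
  also have "... = (\<Sum>k<M. \<Sum>l<M. \<Sum>i<M. \<Sum>j<M. \<Sum>i'<M. \<Sum>j'<M. G i j i' j' k l)"
   unfolding sandwich_def cnj_sum sum_distrib_right G_def
   by (intro sum.cong refl) (simp add: sum_distrib_left)
  also have "... = (\<Sum>i<M. \<Sum>j<M. \<Sum>k<M. \<Sum>l<M. \<Sum>i'<M. \<Sum>j'<M. G i j i' j' k l)"
   by (rule sum_swap_pairs)
  also have "... = (\<Sum>i<M. \<Sum>j<M. \<Sum>i'<M. \<Sum>j'<M. \<Sum>k<M. \<Sum>l<M. G i j i' j' k l)"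
   by (intro sum.cong[OF refl] sum_swap_pairs)
  also have "... = (\<Sum>i<M. \<Sum>j<M. \<Sum>i'<M. \<Sum>j'<M.
    fourier_coeff f (int j' - int j) * tau M \<theta> i j * cnj (tau M \<theta> i' j') * fourier_coeff f (int i - int i'))"
  proof (intro sum.cong refl)
   fix i j i' j' assume b: "i \<in> {..<M}" "j \<in> {..<M}" "i' \<in> {..<M}" "j' \<in> {..<M}"
   have "(\<Sum>k<M. \<Sum>l<M. G i j i' j' k l) = (\<Sum>k<M. \<Sum>l<M. (tau M \<theta> i j * cnj (tau M \<theta> i' j') * (cnj (h k i) * h k i')) * (cnj (h l j') * h l j))"
    unfolding G_def by (intro sum.cong refl) (simp only: mult_ac)
   also have "... = tau M \<theta> i j * cnj (tau M \<theta> i' j') * (\<Sum>k<M. cnj (h k i) * h k i') * (\<Sum>l<M. cnj (h l j') * h l j)"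
    by (simp only: sum_product[symmetric] sum_distrib_left[symmetric] sum_distrib_right[symmetric])
   finally have "(\<Sum>k<M. \<Sum>l<M. G i j i' j' k l) = tau M \<theta> i j * cnj (tau M \<theta> i' j') * fourier_coeff f (int i - int i') * fourier_coeff f (int j' - int j)"
    using b by (simp only: h lessThan_iff)
   then show "(\<Sum>k<M. \<Sum>l<M. G i j i' j' k l)
     = fourier_coeff f (int j' - int j) * tau M \<theta> i j * cnj (tau M \<theta> i' j') * fourier_coeff f (int i - int i')"
    by (simp only: mult_ac)
  qed
  also have "... = (\<Sum>i<M. \<Sum>i'<M. \<Sum>j<M. \<Sum>j'<M.
    fourier_coeff f (int j' - int j) * tau M \<theta> i j * cnj (tau M \<theta> i' j') * fourier_coeff f (int i - int i'))"
   by (rule sum.cong[OF refl], rule sum.swap)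
  also have "... = (\<Sum>i<M. \<Sum>i'<M. \<Sum>j'<M. \<Sum>j<M.
    fourier_coeff f (int j' - int j) * tau M \<theta> i j * cnj (tau M \<theta> i' j') * fourier_coeff f (int i - int i'))"
   by (intro sum.cong[OF refl] sum.swap)
  also have "... = gram_sum M \<theta> f f" unfolding gram_sum_def by (simp only: sum_distrib_right)
  also have "... = of_real (gram_int M \<theta> f f)" by (rule gram_sum_eq[OF f f])
  finally show ?thesis by (simp only: of_real_eq_iff)
qed

lemma tau_sum_rank_one:
  "tau_sum M (\<lambda>i j. cnj (\<Sum>k<M. z k * h k i) * (\<Sum>l<M. z l * h l j)) \<theta>
    = (\<Sum>k<M. \<Sum>l<M. cnj (z k) * z l * sandwich M h \<theta> k l)"
proof -
  have "tau_sum M (\<lambda>i j. cnj (\<Sum>k<M. z k * h k i) * (\<Sum>l<M. z l * h l j)) \<theta>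
    = (\<Sum>i<M. \<Sum>j<M. \<Sum>k<M. \<Sum>l<M. cnj (z k) * z l * (cnj (h k i) * tau M \<theta> i j * h l j))"
   unfolding tau_sum_def
  proof (intro sum.cong refl)
   fix i j
   have p: "cnj (\<Sum>k<M. z k * h k i) * (\<Sum>l<M. z l * h l j) = (\<Sum>k<M. \<Sum>l<M. (cnj (z k) * cnj (h k i)) * (z l * h l j))"
    by (simp only: cnj_sum complex_cnj_mult sum_product)
   have "cnj (\<Sum>k<M. z k * h k i) * (\<Sum>l<M. z l * h l j) * tau M \<theta> i j
     = (\<Sum>k<M. \<Sum>l<M. (cnj (z k) * cnj (h k i)) * (z l * h l j) * tau M \<theta> i j)"
    unfolding p sum_distrib_right ..
   then show "cnj (\<Sum>k<M. z k * h k i) * (\<Sum>l<M. z l * h l j) * tau M \<theta> i j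
     = (\<Sum>k<M. \<Sum>l<M. cnj (z k) * z l * (cnj (h k i) * tau M \<theta> i j * h l j))"
    by (simp only: mult_ac)
  qed
  also have "... = (\<Sum>k<M. \<Sum>l<M. \<Sum>i<M. \<Sum>j<M. cnj (z k) * z l * (cnj (h k i) * tau M \<theta> i j * h l j))"
   by (rule sum_swap_pairs)
  finally show ?thesis unfolding sandwich_def by (simp only: sum_distrib_left)
qed

definition gram_row :: "nat \<Rightarrow> (nat \<Rightarrow> nat \<Rightarrow> complex) \<Rightarrow> (nat \<Rightarrow> complex) \<Rightarrow> nat \<Rightarrow> nat \<Rightarrow> complex" where
  "gram_row M h z i j = cnj (\<Sum>k<M. z k * h k i) * (\<Sum>l<M. z l * h l j)"

definition sample_deviation ::
   "nat \<Rightarrow> nat \<Rightarrow> (nat \<Rightarrow> real) \<Rightarrow> (nat \<Rightarrow> nat \<Rightarrow> complex) \<Rightarrow> (nat \<Rightarrow> nat \<Rightarrow> complex) \<Rightarrow> (nat \<Rightarrow> nat \<Rightarrow> complex) \<Rightarrow> nat \<Rightarrow> nat \<Rightarrow> complex" where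
  "sample_deviation M N c h z R i j = (\<Sum>n<N. of_real (c n) * (gram_row M h (z n) i j - R i j)) / of_nat N"

text \<open>The reason for passing to \<open>tau_sum\<close>: at each grid point the deviation is a sum of independent centred quadratic
  forms, all with the same matrix.\<close>

lemma tau_sum_sample_deviation:
  assumes h: "\<And>i j. i < M \<Longrightarrow> j < M \<Longrightarrow> (\<Sum>k<M. cnj (h k i) * h k j) = R i j"
  shows "Re (tau_sum M (sample_deviation M N c h z R) \<theta>) = (\<Sum>n<N. c n * centred_form M (sandwich M h \<theta>) (z n)) / real N"
proof -
  have "tau_sum M (sample_deviation M N c h z R) \<theta>
    = (\<Sum>i<M. \<Sum>j<M. \<Sum>n<N. of_real (c n) * (gram_row M h (z n) i j * tau M \<theta> i j - R i j * tau M \<theta> i j)) / of_nat N"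
   unfolding tau_sum_def sample_deviation_def sum_divide_distrib sum_distrib_right
   by (intro sum.cong refl) (simp add: field_simps)
  also have "(\<Sum>i<M. \<Sum>j<M. \<Sum>n<N. of_real (c n) * (gram_row M h (z n) i j * tau M \<theta> i j - R i j * tau M \<theta> i j))
    = (\<Sum>i<M. \<Sum>n<N. \<Sum>j<M. of_real (c n) * (gram_row M h (z n) i j * tau M \<theta> i j - R i j * tau M \<theta> i j))"
   by (rule sum.cong[OF refl], rule sum.swap)
  also have "... = (\<Sum>n<N. \<Sum>i<M. \<Sum>j<M. of_real (c n) * (gram_row M h (z n) i j * tau M \<theta> i j - R i j * tau M \<theta> i j))"
   by (rule sum.swap)
  also have "... = (\<Sum>n<N. of_real (c n) * (tau_sum M (gram_row M h (z n)) \<theta> - tau_sum M R \<theta>))"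
   unfolding tau_sum_def by (simp only: sum_distrib_left[symmetric] sum_subtractf)
  finally have "tau_sum M (sample_deviation M N c h z R) \<theta>
    = (\<Sum>n<N. of_real (c n) * (tau_sum M (gram_row M h (z n)) \<theta> - tau_sum M R \<theta>)) / of_nat N" .
  moreover have "(\<Sum>k<M. sandwich M h \<theta> k k) = tau_sum M R \<theta>" by (rule sandwich_trace) (rule h)
  then have "Re (tau_sum M (gram_row M h (z n)) \<theta>) - Re (tau_sum M R \<theta>) = centred_form M (sandwich M h \<theta>) (z n)" for n
   unfolding centred_form_def gram_row_def[abs_def] tau_sum_rank_one by simp
  ultimately show ?thesis by (simp add: Re_divide_of_nat)
qed

lemma fourier_coeff_cnj:
  assumes f: "integrable circ f"
  shows "fourier_coeff f (- k) = cnj (fourier_coeff f k)"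
proof -
  have "integrable circ (\<lambda>x. f x *\<^sub>R cis (- (of_int k * x)))"
   using integrable_times_continuous[OF f continuous_cis_lin[of "- of_int k"]] by simp
  then show ?thesis unfolding fourier_coeff_circ
   using Bochner_Integration.integral_cnj[of circ "\<lambda>x. f x *\<^sub>R cis (- (of_int k * x))"] by (simp add: cis_cnj)
qed

lemma toeplitz_carrier: "toeplitz_mat M r \<in> carrier_mat M M" by (simp add: toeplitz_mat_def)

lemma toeplitz_adjoint:
  assumes "\<And>k. \<bar>k\<bar> < int M \<Longrightarrow> r (- k) = cnj (r k)"
  shows "mat_adjoint (toeplitz_mat M r) = toeplitz_mat M r"
proof (rule eq_matI)
  fix i j assume "i < dim_row (toeplitz_mat M r)" "j < dim_col (toeplitz_mat M r)"
  then have ij: "i < M" "j < M" by (auto simp: toeplitz_mat_def)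
  then have "\<bar>int j - int i\<bar> < int M" by auto
  from assms[OF this] have "cnj (r (int j - int i)) = r (int i - int j)" by simp
  then show "mat_adjoint (toeplitz_mat M r) $$ (i, j) = toeplitz_mat M r $$ (i, j)"
   using ij unfolding adjoint_index[OF toeplitz_carrier ij] by (simp add: toeplitz_mat_def)
qed (use adjoint_carrier[OF toeplitz_carrier[of M r]] toeplitz_carrier[of M r] in auto)

lemma toeplitz_mat_form:
  assumes v: "v \<in> carrier_vec M"
  shows "(toeplitz_mat M r *\<^sub>v v) \<bullet>c v = (\<Sum>a<M. \<Sum>b<M. cnj (vec_index v a) * vec_index v b * r (int a - int b))"
proof -
  have "(toeplitz_mat M r *\<^sub>v v) \<bullet>c v = (\<Sum>a<M. vec_index (toeplitz_mat M r *\<^sub>v v) a * cnj (vec_index v a))"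
   by (rule cscalar_sum[OF mult_mat_vec_carrier[OF toeplitz_carrier v] v])
  also have "... = (\<Sum>a<M. \<Sum>b<M. cnj (vec_index v a) * vec_index v b * r (int a - int b))"
  proof (intro sum.cong refl)
   fix a assume "a \<in> {..<M}"
   then have "vec_index (toeplitz_mat M r *\<^sub>v v) a = (\<Sum>b<M. r (int a - int b) * vec_index v b)"
    by (subst mat_vec_index[OF toeplitz_carrier v]) (auto simp: toeplitz_mat_def intro!: sum.cong)
   then show "vec_index (toeplitz_mat M r *\<^sub>v v) a * cnj (vec_index v a) = (\<Sum>b<M. cnj (vec_index v a) * vec_index v b * r (int a - int b))"
    by (simp only: sum_distrib_right) (simp only: mult_ac)
  qed
  finally show ?thesis .
qed

lemma toeplitz_cov_form:
  assumes f: "integrable circ f" and v: "v \<in> carrier_vec M"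
  shows "(toeplitz_cov f M *\<^sub>v v) \<bullet>c v = of_real (toeplitz_qf f M (vec_index v))"
  unfolding toeplitz_cov_def toeplitz_mat_form[OF v] by (rule toeplitz_form[OF f])

lemma toeplitz_cov_psd:
  assumes f: "integrable circ f" "AE x in circ. 0 \<le> f x"
  shows "psd (toeplitz_cov f M)"
proof -
  have "mat_adjoint (toeplitz_cov f M) = toeplitz_cov f M"
   unfolding toeplitz_cov_def by (rule toeplitz_adjoint) (rule fourier_coeff_cnj[OF f(1)])
  moreover have "0 \<le> qform (toeplitz_cov f M) v" if "v \<in> carrier_vec M" for v
   unfolding toeplitz_cov_form[OF f(1) that] using toeplitz_qf_nonneg[OF f(2)] by simp
  ultimately show ?thesis using toeplitz_carrier[of M "fourier_coeff f"] unfolding psd_def toeplitz_cov_def by auto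
qed

lemma root_gram:
  assumes f: "integrable circ f" "AE x in circ. 0 \<le> f x" and ij: "i < M" "j < M"
  shows "(\<Sum>k<M. cnj (psd_sqrt (toeplitz_cov f M) $$ (k, i)) * psd_sqrt (toeplitz_cov f M) $$ (k, j)) = fourier_coeff f (int i - int j)"
proof -
  let ?R = "toeplitz_cov f M" and ?H = "psd_sqrt (toeplitz_cov f M)"
  have R: "?R \<in> carrier_mat M M" unfolding toeplitz_cov_def by (rule toeplitz_carrier)
  note H = psd_sqrt_props[OF toeplitz_cov_psd[OF f] R]
  have "mat_adjoint ?H = ?H" using psdD(1)[OF H(2,1)] .
  then have "cnj (?H $$ (k, i)) = ?H $$ (i, k)" if "k < M" for k
   using adjoint_index[OF H(1) ij(1) that] by simp
  then have "(\<Sum>k<M. cnj (?H $$ (k, i)) * ?H $$ (k, j)) = (\<Sum>k<M. ?H $$ (i, k) * ?H $$ (k, j))" by simp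
  also have "... = (?H * ?H) $$ (i, j)" by (rule mat_mult_index[OF H(1) H(1) ij, symmetric])
  also have "... = fourier_coeff f (int i - int j)" unfolding H(3) using ij by (simp add: toeplitz_cov_def toeplitz_mat_def)
  finally show ?thesis .
qed

lemma data_mat_sample_cov:
  assumes Z: "Z \<in> carrier_mat N M" and c: "\<And>n. n < N \<Longrightarrow> 0 \<le> c n" and R: "R \<in> carrier_mat M M" "psd R"
  shows "data_mat (real_diag N c) Z R \<in> carrier_mat N M" "sample_cov (data_mat (real_diag N c) Z R) \<in> carrier_mat M M"
   and "\<And>i j. i < M \<Longrightarrow> j < M \<Longrightarrow> sample_cov (data_mat (real_diag N c) Z R) $$ (i, j)
     = (\<Sum>n<N. of_real (c n) * gram_row M (\<lambda>k l. psd_sqrt R $$ (k, l)) (\<lambda>k. Z $$ (n, k)) i j) / of_nat N"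
proof -
  let ?X = "data_mat (real_diag N c) Z R" and ?H = "psd_sqrt R"
  note H = psd_sqrt_props[OF R(2,1)]
  have D: "psd_sqrt (real_diag N c) = real_diag N (\<lambda>n. sqrt (c n))" by (rule psd_sqrt_real_diag[OF c])
  have DZ: "real_diag N (\<lambda>n. sqrt (c n)) * Z \<in> carrier_mat N M" by (rule mult_carrier_mat[OF real_diag_carrier Z])
  show X: "?X \<in> carrier_mat N M" unfolding data_mat_def D by (rule mult_carrier_mat[OF DZ H(1)])
  note aX = adjoint_carrier[OF X]
  show "sample_cov ?X \<in> carrier_mat M M" unfolding sample_cov_def using mult_carrier_mat[OF aX X] by simp
  have Xe: "?X $$ (n, i) = of_real (sqrt (c n)) * (\<Sum>k<M. Z $$ (n, k) * ?H $$ (k, i))" if "n < N" "i < M" for n i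
  proof -
   have "?X $$ (n, i) = (\<Sum>k<M. (real_diag N (\<lambda>n. sqrt (c n)) * Z) $$ (n, k) * ?H $$ (k, i))"
    unfolding data_mat_def D by (rule mat_mult_index[OF DZ H(1) that])
   also have "... = (\<Sum>k<M. of_real (sqrt (c n)) * Z $$ (n, k) * ?H $$ (k, i))"
   proof (intro sum.cong refl)
    fix k assume "k \<in> {..<M}"
    then have "(real_diag N (\<lambda>n. sqrt (c n)) * Z) $$ (n, k) = (\<Sum>l<N. real_diag N (\<lambda>n. sqrt (c n)) $$ (n, l) * Z $$ (l, k))"
     using that by (intro mat_mult_index[OF real_diag_carrier Z]) auto
    also have "... = (\<Sum>l<N. if l = n then of_real (sqrt (c n)) * Z $$ (n, k) else 0)"
     using that by (intro sum.cong refl) (auto simp: real_diag_index)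
    finally show "(real_diag N (\<lambda>n. sqrt (c n)) * Z) $$ (n, k) * ?H $$ (k, i) = of_real (sqrt (c n)) * Z $$ (n, k) * ?H $$ (k, i)"
     using that by (simp add: sum.delta)
   qed
   finally show ?thesis by (simp add: sum_distrib_left mult.assoc)
  qed
  show "sample_cov ?X $$ (i, j) = (\<Sum>n<N. of_real (c n) * gram_row M (\<lambda>k l. ?H $$ (k, l)) (\<lambda>k. Z $$ (n, k)) i j) / of_nat N"
   if ij: "i < M" "j < M" for i j
  proof -
   have "(mat_adjoint ?X * ?X) $$ (i, j) = (\<Sum>n<N. mat_adjoint ?X $$ (i, n) * ?X $$ (n, j))"
    by (rule mat_mult_index[OF aX X ij])
   also have "... = (\<Sum>n<N. of_real (c n) * gram_row M (\<lambda>k l. ?H $$ (k, l)) (\<lambda>k. Z $$ (n, k)) i j)"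
   proof (intro sum.cong refl)
    fix n assume "n \<in> {..<N}"
    then have n: "n < N" by simp
    have s: "complex_of_real (sqrt (c n)) * of_real (sqrt (c n)) = of_real (c n)"
     using c[OF n] by (simp flip: of_real_mult)
    define p q where "p = (\<Sum>k<M. Z $$ (n, k) * ?H $$ (k, i))" and "q = (\<Sum>k<M. Z $$ (n, k) * ?H $$ (k, j))"
    have "mat_adjoint ?X $$ (i, n) * ?X $$ (n, j) = cnj (of_real (sqrt (c n)) * p) * (of_real (sqrt (c n)) * q)"
     unfolding adjoint_index[OF X ij(1) n] Xe[OF n ij(1)] Xe[OF n ij(2)] p_def q_def ..
    also have "... = (complex_of_real (sqrt (c n)) * of_real (sqrt (c n))) * (cnj p * q)"
     by (simp only: complex_cnj_mult complex_cnj_complex_of_real mult_ac)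
    finally show "mat_adjoint ?X $$ (i, n) * ?X $$ (n, j) = of_real (c n) * gram_row M (\<lambda>k l. ?H $$ (k, l)) (\<lambda>k. Z $$ (n, k)) i j"
     unfolding s gram_row_def p_def q_def .
   qed
   moreover have "sample_cov ?X $$ (i, j) = 1 / of_nat N * (mat_adjoint ?X * ?X) $$ (i, j)"
    unfolding sample_cov_def using carrier_matD[OF X] carrier_matD[OF aX] ij
    by (subst index_smult_mat(1)) auto
   ultimately show ?thesis by simp
  qed
qed

lemma mean_trace_real_diag: "mean_trace (real_diag N c) = (\<Sum>n<N. c n) / real N"
proof -
  have "mtrace (real_diag N c) = (\<Sum>n<N. of_real (c n))"
   unfolding mtrace_def using carrier_matD(1)[OF real_diag_carrier[of N c]] by (auto simp: real_diag_index intro!: sum.cong)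
  then show ?thesis unfolding mean_trace_def using carrier_matD(1)[OF real_diag_carrier[of N c]] by simp
qed

lemma diag_mean_cnj: "(\<And>i j. i < M \<Longrightarrow> j < M \<Longrightarrow> D j i = cnj (D i j)) \<Longrightarrow> diag_mean M D (- k) = cnj (diag_mean M D k)"
proof -
  assume D: "\<And>i j. i < M \<Longrightarrow> j < M \<Longrightarrow> D j i = cnj (D i j)"
  have "cnj (diag_mean M D k) = (\<Sum>i<M. \<Sum>j<M. if int j - int i = - k then D j i / of_real (real M - \<bar>real j - real i\<bar>) else 0)"
   unfolding diag_mean_def cnj_sum
  proof (intro sum.cong refl)
   fix i j assume "i \<in> {..<M}" "j \<in> {..<M}"
   then have Dji: "D j i = cnj (D i j)" by (intro D) simp_all
   have iff: "(int j - int i = - k) = (int i - int j = k)" by auto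
   show "cnj (if int i - int j = k then D i j / of_real (real M - \<bar>real i - real j\<bar>) else 0)
    = (if int j - int i = - k then D j i / of_real (real M - \<bar>real j - real i\<bar>) else 0)"
    unfolding iff Dji abs_minus_commute[of "real j"]
    by (cases "int i - int j = k") (simp_all only: simp_thms if_True if_False complex_cnj_divide complex_cnj_complex_of_real complex_cnj_zero)
  qed
  also have "... = diag_mean M D (- k)" unfolding diag_mean_def by (rule sum.swap)
  finally show ?thesis by simp
qed

lemma diag_mean_diff: "diag_mean M (\<lambda>i j. A i j - x * B i j) k = diag_mean M A k - x * diag_mean M B k"
proof -
  have "diag_mean M (\<lambda>i j. A i j - x * B i j) k = (\<Sum>i<M. \<Sum>j<M. (if int i - int j = k then A i j / of_real (real M - \<bar>real i - real j\<bar>) else 0)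
    - x * (if int i - int j = k then B i j / of_real (real M - \<bar>real i - real j\<bar>) else 0))"
   unfolding diag_mean_def by (intro sum.cong refl) (simp add: diff_divide_distrib)
  then show ?thesis unfolding diag_mean_def by (simp add: sum_subtractf sum_distrib_left)
qed

lemma diag_mean_cong: "(\<And>i j. i < M \<Longrightarrow> j < M \<Longrightarrow> A i j = B i j) \<Longrightarrow> diag_mean M A k = diag_mean M B k"
  unfolding diag_mean_def by (intro sum.cong refl) auto

text \<open>Taking diagonal means reproduces a Toeplitz matrix, so the error of the estimator is the matrix of diagonal means of the
  error of the sample covariance.\<close>

theorem toeplitz_est_form:
  assumes Z: "Z \<in> carrier_mat N M" and c: "\<And>n. n < N \<Longrightarrow> 0 \<le> c n"
   and f: "integrable circ f" "AE x in circ. 0 \<le> f x"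
  defines "E \<equiv> toeplitz_est (data_mat (real_diag N c) Z (toeplitz_cov f M))"
   and "h \<equiv> \<lambda>k l. psd_sqrt (toeplitz_cov f M) $$ (k, l)"
  shows "E \<in> carrier_mat M M" "mat_adjoint E = E"
   and "\<And>v. v \<in> carrier_vec M \<Longrightarrow> qform E v - mean_trace (real_diag N c) * qform (toeplitz_cov f M) v
     = Re (\<Sum>a<M. \<Sum>b<M. cnj (vec_index v a) * vec_index v b *
       diag_mean M (sample_deviation M N c h (\<lambda>n k. Z $$ (n, k)) (\<lambda>i j. fourier_coeff f (int i - int j))) (int a - int b))"
proof -
  let ?R = "toeplitz_cov f M" and ?X = "data_mat (real_diag N c) Z (toeplitz_cov f M)"
  define r where "r i j = fourier_coeff f (int i - int j)" for i j
  define z where "z n k = Z $$ (n, k)" for n k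
  define S where "S i j = (\<Sum>n<N. complex_of_real (c n) * gram_row M h (z n) i j) / of_nat N" for i j
  define x where "x = mean_trace (real_diag N c)"
  have R: "?R \<in> carrier_mat M M" unfolding toeplitz_cov_def by (rule toeplitz_carrier)
  have X: "?X \<in> carrier_mat N M" "sample_cov ?X \<in> carrier_mat M M"
   "\<And>i j. i < M \<Longrightarrow> j < M \<Longrightarrow> sample_cov ?X $$ (i, j) = (\<Sum>n<N. of_real (c n) * gram_row M (\<lambda>k l. psd_sqrt ?R $$ (k, l)) (\<lambda>k. Z $$ (n, k)) i j) / of_nat N"
   using data_mat_sample_cov[of Z N M c ?R] Z c R toeplitz_cov_psd[OF f] by simp_all
  have E: "E = toeplitz_mat M (diag_average (sample_cov ?X))" unfolding E_def toeplitz_est_def using carrier_matD(2)[OF X(1)] by simp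
  have dm: "diag_average (sample_cov ?X) k = diag_mean M S k" if "\<bar>k\<bar> < int M" for k
   unfolding diag_average_eq[OF X(2) that] S_def z_def[abs_def] h_def by (intro diag_mean_cong X(3))
  show "E \<in> carrier_mat M M" unfolding E by (rule toeplitz_carrier)
  have Sc: "S j i = cnj (S i j)" for i j
   unfolding S_def gram_row_def by (simp add: cnj_sum mult.commute)
  show "mat_adjoint E = E" unfolding E
  proof (rule toeplitz_adjoint)
   fix k assume k: "\<bar>k\<bar> < int M"
   then have "\<bar>- k\<bar> < int M" by simp
   from dm[OF this] dm[OF k] diag_mean_cnj[of M S k, OF Sc]
   show "diag_average (sample_cov ?X) (- k) = cnj (diag_average (sample_cov ?X) k)" by simp
  qed
  show "qform E v - mean_trace (real_diag N c) * qform ?R v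
     = Re (\<Sum>a<M. \<Sum>b<M. cnj (vec_index v a) * vec_index v b *
       diag_mean M (sample_deviation M N c h (\<lambda>n k. Z $$ (n, k)) (\<lambda>i j. fourier_coeff f (int i - int j))) (int a - int b))"
   if v: "v \<in> carrier_vec M" for v
  proof -
   have sd: "sample_deviation M N c h z r i j = S i j - of_real x * r i j" for i j
    unfolding sample_deviation_def S_def x_def mean_trace_real_diag
    by (simp add: right_diff_distrib sum_subtractf diff_divide_distrib sum_distrib_right[symmetric] of_real_sum)
   have "diag_mean M (sample_deviation M N c h z r) k = diag_average (sample_cov ?X) k - of_real x * fourier_coeff f k" if k: "\<bar>k\<bar> < int M" for k
   proof -
    have "diag_mean M r k = fourier_coeff f k" unfolding r_def[abs_def] by (rule diag_mean_toeplitz[OF k])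
    then show ?thesis unfolding sd diag_mean_diff dm[OF k] by simp
   qed
   then have "(\<Sum>a<M. \<Sum>b<M. cnj (vec_index v a) * vec_index v b * diag_mean M (sample_deviation M N c h z r) (int a - int b))
     = (\<Sum>a<M. \<Sum>b<M. cnj (vec_index v a) * vec_index v b * (diag_average (sample_cov ?X) (int a - int b) - of_real x * fourier_coeff f (int a - int b)))"
    by (intro sum.cong refl) auto
   also have "... = (E *\<^sub>v v) \<bullet>c v - of_real x * ((?R *\<^sub>v v) \<bullet>c v)"
    unfolding E toeplitz_cov_def toeplitz_mat_form[OF v] by (simp add: right_diff_distrib sum_subtractf sum_distrib_left mult_ac)
   finally show ?thesis unfolding x_def[symmetric] z_def[abs_def] r_def[abs_def] by simp
  qed
qed

section \<open>The spectral density near its singularity\<close>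

lemma essinf_pos_AE:
  assumes "0 < essinf M (\<lambda>x. ereal (g x))"
  shows "\<exists>c>0. AE x in M. c \<le> g x"
proof -
  obtain c where c: "0 < ereal c" "ereal c < essinf M (\<lambda>x. ereal (g x))"
   using ereal_dense2[OF assms] by (metis ereal_dense2 assms)
  have "AE x in M. - ereal (g x) \<le> esssup M (\<lambda>x. - ereal (g x))" by (rule esssup_AE)
  then have "AE x in M. c \<le> g x"
  proof (eventually_elim)
   case (elim x)
   have "esssup M (\<lambda>x. - ereal (g x)) < - ereal c"
    using c(2) unfolding essinf_def by (metis ereal_less_uminus_reorder)
   with elim have "- ereal (g x) < - ereal c" by (rule le_less_trans)
   then show ?case by simp
  qed
  then show ?thesis using c(1) by auto
qed

lemma circ_AE_iff_open: "(AE x in lebesgue_on {-pi<..<pi}. Q x) \<longleftrightarrow> (AE x in circ. Q x)"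
proof -
  have "{-pi, pi} \<in> null_sets lebesgue" by (simp add: finite_imp_null_set_lborel)
  then have "AE x in lebesgue. x \<notin> {-pi, pi}" by (rule AE_not_in)
  then have "(AE x in lebesgue. x \<in> {-pi<..<pi} \<longrightarrow> Q x) \<longleftrightarrow> (AE x in lebesgue. x \<in> {-pi..pi} \<longrightarrow> Q x)"
   by (intro AE_cong_simp[OF refl] iffI) (auto elim!: eventually_elim2)
  then show ?thesis by (simp add: AE_restrict_space_iff)
qed

lemma circ_integrable_iff_open: "f absolutely_integrable_on {-pi<..<pi} \<Longrightarrow> integrable circ f" for f :: "real \<Rightarrow> real"
proof -
  assume "f absolutely_integrable_on {-pi<..<pi}"
  then have "f absolutely_integrable_on {-pi..pi}"
   using absolutely_integrable_on_open_interval[where f = f and a = "-pi" and b = pi] by (simp add: box_real)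
  then show ?thesis by (simp add: set_integrable_def integrable_restrict_space mult.commute)
qed

text \<open>Near the origin this is the bound on \<open>L\<close>. Away from it the density lies between positive constants, from below only almost
  everywhere, and there powers of \<open>\<bar>x\<bar>\<close> are comparable to constants.\<close>

lemma spectral_density_bounds:
  assumes f_L1: "f absolutely_integrable_on {-pi<..<pi}"
   and bdd: "\<And>\<delta>. 0 < \<delta> \<Longrightarrow> bounded (f ` ({-pi..pi} - {-\<delta><..<\<delta>}))"
   and inf: "0 < essinf (lebesgue_on {-pi<..<pi}) (\<lambda>\<theta>. ereal (f \<theta>))"
   and L: "slowly_varying_on (1 / pi) L"
   and f_L: "\<And>x. x \<in> {-pi..pi} - {0} \<Longrightarrow> f x = L (1 / \<bar>x\<bar>) / \<bar>x\<bar> powr a"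
   and d: "0 < d" "d < a"
  shows "\<exists>c>0. \<exists>C>0. integrable circ f \<and> (AE x in circ. c \<le> f x) \<and>
    (AE x in circ. x \<noteq> 0 \<longrightarrow> c * \<bar>x\<bar> powr (- (a - d)) \<le> f x) \<and>
    (\<forall>x \<in> {-pi..pi} - {0}. f x \<le> C * \<bar>x\<bar> powr (- (a + d)))"
proof -
  obtain cL CL X where X: "0 < cL" "0 < CL" "max (1 / pi) 1 \<le> X"
   and LX: "\<And>x. X \<le> x \<Longrightarrow> cL * x powr (- d) \<le> L x \<and> L x \<le> CL * x powr d"
   using slowly_varying_power_bounds[OF L _ d(1)] by auto
  have X1: "1 \<le> X" using X(3) by simp
  obtain c0 where c0: "0 < c0" "AE x in circ. c0 \<le> f x"
   using essinf_pos_AE[OF inf] unfolding circ_AE_iff_open by blast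
  obtain B where B: "0 < B" "\<And>x. x \<in> {-pi..pi} - {-(1/X)<..<1/X} \<Longrightarrow> \<bar>f x\<bar> \<le> B"
   using bdd[of "1 / X"] X1 unfolding bounded_pos by (auto simp: image_iff)
  define c where "c = min (min c0 cL) (c0 * X powr (- (a - d)))"
  define C where "C = max CL (B * pi powr (a + d))"
  have cp: "0 < c" using c0 X X1 by (simp add: c_def)
  have Cp: "0 < C" using X by (simp add: C_def)
  have near: "cL * \<bar>x\<bar> powr (- (a - d)) \<le> f x \<and> f x \<le> CL * \<bar>x\<bar> powr (- (a + d))"
   if x: "x \<in> {-pi..pi} - {0}" "\<bar>x\<bar> < 1 / X" for x
  proof -
   have xp: "0 < \<bar>x\<bar>" using x by simp
   have "X \<le> 1 / \<bar>x\<bar>" using x xp X1 by (simp add: field_simps)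
   from LX[OF this] have l: "cL * (1 / \<bar>x\<bar>) powr (- d) \<le> L (1 / \<bar>x\<bar>)" "L (1 / \<bar>x\<bar>) \<le> CL * (1 / \<bar>x\<bar>) powr d" by auto
   have e: "(1 / \<bar>x\<bar>) powr (- d) = \<bar>x\<bar> powr d" "(1 / \<bar>x\<bar>) powr d = \<bar>x\<bar> powr (- d)"
    using xp by (simp_all add: powr_minus_divide powr_divide)
   have "f x = L (1 / \<bar>x\<bar>) * \<bar>x\<bar> powr (- a)" using f_L[OF x(1)] by (simp add: powr_minus divide_inverse)
   moreover have "cL * \<bar>x\<bar> powr d * \<bar>x\<bar> powr (- a) \<le> L (1 / \<bar>x\<bar>) * \<bar>x\<bar> powr (- a)"
    using l(1) unfolding e by (intro mult_right_mono) auto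
   moreover have "L (1 / \<bar>x\<bar>) * \<bar>x\<bar> powr (- a) \<le> CL * \<bar>x\<bar> powr (- d) * \<bar>x\<bar> powr (- a)"
    using l(2) unfolding e by (intro mult_right_mono) auto
   moreover have "\<bar>x\<bar> powr d * \<bar>x\<bar> powr (- a) = \<bar>x\<bar> powr (- (a - d))" "\<bar>x\<bar> powr (- d) * \<bar>x\<bar> powr (- a) = \<bar>x\<bar> powr (- (a + d))"
    by (simp_all add: algebra_simps flip: powr_add)
   ultimately show ?thesis by (simp add: mult.assoc)
  qed
  have sp: "AE x in circ. x \<in> {-pi..pi}" by (rule AE_I2) simp
  have "AE x in circ. x \<noteq> 0 \<longrightarrow> c * \<bar>x\<bar> powr (- (a - d)) \<le> f x"
   using sp c0(2)
  proof eventually_elim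
   case (elim x)
   show ?case
   proof
    assume "x \<noteq> 0"
    then have x: "x \<in> {-pi..pi} - {0}" using elim by simp
    show "c * \<bar>x\<bar> powr (- (a - d)) \<le> f x"
    proof (cases "\<bar>x\<bar> < 1 / X")
     case True
     have "c * \<bar>x\<bar> powr (- (a - d)) \<le> cL * \<bar>x\<bar> powr (- (a - d))" by (intro mult_right_mono) (auto simp: c_def)
     then show ?thesis using near[OF x True] by linarith
    next
     case False
     then have "1 / X \<le> \<bar>x\<bar>" by simp
     then have "\<bar>x\<bar> powr (- (a - d)) \<le> (1 / X) powr (- (a - d))" using X1 d by (intro powr_mono2') auto
     also have "... = X powr (a - d)"
     proof -
      have "(1 / X) powr (- p) = X powr p" for p using X1 by (simp add: powr_divide powr_minus_divide)
      then show ?thesis .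
     qed
     finally have "c * \<bar>x\<bar> powr (- (a - d)) \<le> (c0 * X powr (- (a - d))) * X powr (a - d)"
      using c0 cp by (intro mult_mono) (auto simp: c_def)
     also have "... = c0" using X1 by (simp add: mult.assoc flip: powr_add)
     finally show ?thesis using elim by linarith
    qed
   qed
  qed
  moreover have "AE x in circ. c \<le> f x"
   using c0(2) by (rule eventually_mono) (auto simp: c_def)
  moreover have "f x \<le> C * \<bar>x\<bar> powr (- (a + d))" if x: "x \<in> {-pi..pi} - {0}" for x
  proof (cases "\<bar>x\<bar> < 1 / X")
   case True
   have "CL * \<bar>x\<bar> powr (- (a + d)) \<le> C * \<bar>x\<bar> powr (- (a + d))" by (intro mult_right_mono) (auto simp: C_def)
   then show ?thesis using near[OF x True] by linarith
  next
   case False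
   then have "x \<in> {-pi..pi} - {-(1/X)<..<1/X}" using x by auto
   from B(2)[OF this] have "f x \<le> B" by simp
   also have "B = B * pi powr (a + d) * pi powr (- (a + d))" by (simp add: mult.assoc flip: powr_add)
   also have "... \<le> C * \<bar>x\<bar> powr (- (a + d))"
    using x d Cp by (intro mult_mono powr_mono2') (auto simp: C_def)
   finally show ?thesis .
  qed
  ultimately show ?thesis using cp Cp circ_integrable_iff_open[OF f_L1] by blast
qed

lemma integral_power_near_zero:
  assumes f: "integrable circ f" "AE x in circ. 0 \<le> f x" and C: "0 \<le> C"
   and up: "\<And>x. x \<in> {-pi..pi} - {0} \<Longrightarrow> f x \<le> C * \<bar>x\<bar> powr (- b)"
   and b: "0 \<le> b" "b < 1" and y: "0 < y"
  shows "(LINT x|circ. (if \<bar>x\<bar> \<le> y then f x else 0)) \<le> 2 * C / (1 - b) * y powr (1 - b)"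
proof -
  have "((\<lambda>x. x powr (- b)) has_integral (y powr (- b + 1) / (- b + 1))) {0..y}"
   using b y by (intro has_integral_powr_from_0) auto
  then have r: "((\<lambda>x. \<bar>x\<bar> powr (- b)) has_integral (y powr (1 - b) / (1 - b))) {0..y}"
   by (rule has_integral_eq_rhs[OF has_integral_eq[rotated]]) (auto simp: add.commute)
  have l: "((\<lambda>x. \<bar>x\<bar> powr (- b)) has_integral (y powr (1 - b) / (1 - b))) {-y..0}"
   using r has_integral_reflect_real[of "\<lambda>x. \<bar>x\<bar> powr (- b)" _ y 0] by simp
  have "((\<lambda>x. \<bar>x\<bar> powr (- b)) has_integral (y powr (1 - b) / (1 - b) + y powr (1 - b) / (1 - b))) {-y..y}"
   by (rule has_integral_combine[OF _ _ l r]) (use y in auto)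
  then have hi: "((\<lambda>x. C * \<bar>x\<bar> powr (- b)) has_integral (C * (y powr (1 - b) / (1 - b) + y powr (1 - b) / (1 - b)))) {-y..y}"
   by (rule has_integral_mult_right)
  have ai: "(\<lambda>x. C * \<bar>x\<bar> powr (- b)) absolutely_integrable_on {-y..y}"
   by (rule nonnegative_absolutely_integrable_1[OF has_integral_integrable[OF hi]]) (use C in auto)
  have val: "(LINT x:{-y..y}|lebesgue. C * \<bar>x\<bar> powr (- b)) = 2 * C / (1 - b) * y powr (1 - b)"
   by (subst set_lebesgue_integral_eq_integral(2)[OF ai], subst integral_unique[OF hi]) simp
  have fi: "integrable lebesgue (\<lambda>x. indicator {-pi..pi} x * f x)"
   using f(1) by (simp add: integrable_restrict_space)
  have "(LINT x|circ. (if \<bar>x\<bar> \<le> y then f x else 0)) = (LINT x|lebesgue. indicator {-y..y} x * (indicator {-pi..pi} x * f x))"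
   by (subst integral_restrict_space) (auto intro!: Bochner_Integration.integral_cong simp: indicator_def)
  also have "... \<le> (LINT x|lebesgue. indicator {-y..y} x * (C * \<bar>x\<bar> powr (- b)))"
  proof (rule integral_mono_AE)
   show "integrable lebesgue (\<lambda>x. indicator {-y..y} x * (indicator {-pi..pi} x * f x))"
    using integrable_mult_indicator[OF _ fi, of "{-y..y}"] by simp
   show "integrable lebesgue (\<lambda>x. indicator {-y..y} x * (C * \<bar>x\<bar> powr (- b)))"
    using ai by (simp add: set_integrable_def)
   have "{0} \<in> null_sets lebesgue" by simp
   from AE_not_in[OF this] have nz: "AE x in lebesgue. x \<noteq> (0::real)" by simp
   show "AE x in lebesgue. indicator {-y..y} x * (indicator {-pi..pi} x * f x) \<le> indicator {-y..y} x * (C * \<bar>x\<bar> powr (- b))"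
    using nz
   proof eventually_elim
    case (elim x)
    then show ?case using up[of x] C by (auto simp: indicator_def)
   qed
  qed
  also have "... = 2 * C / (1 - b) * y powr (1 - b)" using val unfolding set_lebesgue_integral_def real_scaleR_def .
  finally show ?thesis .
qed

text \<open>The density is cut at \<open>1 / M\<close>: the outer part is at most \<open>C * M powr b\<close>, the inner part has mass of order
  \<open>M powr (b - 1)\<close>, and a trigonometric polynomial of \<open>M\<close> terms is at most \<open>sqrt M\<close> times the Euclidean norm.\<close>

lemma toeplitz_qf_power_bound:
  assumes f: "integrable circ f" "AE x in circ. 0 \<le> f x" and C: "0 < C"
   and up: "\<And>x. x \<in> {-pi..pi} - {0} \<Longrightarrow> f x \<le> C * \<bar>x\<bar> powr (- b)"
   and b: "0 < b" "b < 1" and M: "0 < M"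
  shows "toeplitz_qf f M v \<le> 2 * C / (1 - b) * real M powr b * (\<Sum>j<M. (cmod (v j))\<^sup>2)"
proof -
  define y where "y = 1 / real M"
  have y: "0 < y" using M by (simp add: y_def)
  define f1 where "f1 x = (if \<bar>x\<bar> \<le> y then f x else 0)" for x
  define f2 where "f2 x = (if \<bar>x\<bar> \<le> y then 0 else f x)" for x
  define W where "W = (\<Sum>j<M. (cmod (v j))\<^sup>2)"
  have W0: "0 \<le> W" by (simp add: W_def sum_nonneg)
  have "{x \<in> space circ. \<bar>x\<bar> \<le> y} \<in> sets circ"
   by (intro borel_measurable_le continuous_measurable_circ continuous_intros)
  note ms = this
  have i1: "integrable circ f1" "integrable circ f2"
  proof -
   have "integrable circ (\<lambda>x. indicator {x \<in> space circ. \<bar>x\<bar> \<le> y} x *\<^sub>R f x)" by (rule integrable_mult_indicator[OF ms f(1)])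
   then show "integrable circ f1"
    by (rule Bochner_Integration.integrable_cong[THEN iffD1, rotated -1]) (auto simp: f1_def indicator_def)
   from Bochner_Integration.integrable_diff[OF f(1) this] show "integrable circ f2"
    by (rule Bochner_Integration.integrable_cong[THEN iffD1, rotated -1]) (auto simp: f1_def f2_def)
  qed
  have f1p: "AE x in circ. 0 \<le> f1 x" using f(2) by (rule eventually_mono) (auto simp: f1_def)
  have "toeplitz_qf f M v = toeplitz_qf (\<lambda>x. f1 x + f2 x) M v"
   unfolding toeplitz_qf_def by (intro arg_cong2[where f = "(/)"] Bochner_Integration.integral_cong refl) (auto simp: f1_def f2_def)
  also have "... = toeplitz_qf f1 M v + toeplitz_qf f2 M v" by (rule toeplitz_qf_add[OF i1])
  also have "toeplitz_qf f2 M v \<le> C * y powr (- b) * W"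
   unfolding W_def
  proof (rule toeplitz_qf_le_const[OF i1(2)], rule AE_I2)
   fix x assume "x \<in> space circ"
   then have x: "x \<in> {-pi..pi}" by simp
   show "f2 x \<le> C * y powr (- b)"
   proof (cases "\<bar>x\<bar> \<le> y")
    case False
    then have "f x \<le> C * \<bar>x\<bar> powr (- b)" using x y by (intro up) auto
    also have "... \<le> C * y powr (- b)" using False y C b by (intro mult_left_mono powr_mono2') auto
    finally show ?thesis using False by (simp add: f2_def)
   qed (use C in \<open>simp add: f2_def\<close>)
  qed
  also have "toeplitz_qf f1 M v \<le> (real M * W) * ((2 * C / (1 - b) * y powr (1 - b)) / (2 * pi))"
  proof -
   have "(\<Sum>j<M. 1 * cmod (v j))\<^sup>2 \<le> (\<Sum>j<M. 1\<^sup>2) * W"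
    unfolding W_def by (rule Cauchy_Schwarz_ineq_sum)
   then have cs: "(\<Sum>j<M. cmod (v j))\<^sup>2 \<le> real M * W" by simp
   have "(LINT x|circ. f1 x) \<le> 2 * C / (1 - b) * y powr (1 - b)"
    unfolding f1_def using integral_power_near_zero[OF f _ up _ b(2) y] C b by simp
   then have "(LINT x|circ. f1 x) / (2 * pi) \<le> 2 * C / (1 - b) * y powr (1 - b) / (2 * pi)" by (intro divide_right_mono) auto
   moreover have "0 \<le> (LINT x|circ. f1 x) / (2 * pi)"
    using Bochner_Integration.integral_nonneg_AE[OF f1p] by (intro divide_nonneg_nonneg) auto
   ultimately show ?thesis
    using W0 cs by (intro order_trans[OF toeplitz_qf_le_l1[OF i1(1) f1p]] mult_mono) auto
  qed
  finally have "toeplitz_qf f M v \<le> (real M * W) * ((2 * C / (1 - b) * y powr (1 - b)) / (2 * pi)) + C * y powr (- b) * W" by simp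
  also have "y powr (1 - b) = y * y powr (- b)" using y by (simp add: powr_diff powr_minus divide_inverse)
  also have "(real M * W) * ((2 * C / (1 - b) * (y * y powr (- b))) / (2 * pi)) + C * y powr (- b) * W
    = (C / ((1 - b) * pi) + C) * (y powr (- b) * W)"
  proof -
   have My: "real M * y = 1" using M by (simp add: y_def)
   have E: "(real M * W) * ((2 * C / (1 - b) * (y * Y)) / (2 * pi)) = (real M * y) * (C / ((1 - b) * pi) * (Y * W))" for Y
    using b by (simp add: field_simps)
   show ?thesis unfolding E My by (simp only: mult_1_left distrib_right mult.assoc)
  qed
  also have "... \<le> 2 * C / (1 - b) * (y powr (- b) * W)"
  proof (rule mult_right_mono)
   have "1 - b \<le> (1 - b) * pi" using b pi_gt3 by simp
   then have "C / ((1 - b) * pi) \<le> C / (1 - b)" using C b by (intro divide_left_mono) auto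
   moreover have "C \<le> C / (1 - b)" using C b by (simp add: field_simps)
   ultimately show "C / ((1 - b) * pi) + C \<le> 2 * C / (1 - b)" by simp
  qed (use W0 y in auto)
  also have "y powr (- b) = real M powr b" using M by (simp add: y_def powr_divide powr_minus)
  finally show ?thesis by (simp add: W_def mult_ac)
qed

lemma harm_le_powr:
  assumes d: "0 < d" "d \<le> 1" and M: "0 < M"
  shows "harm M \<le> 2 / d * real M powr d"
proof -
  have "harm M \<le> ln (real M) + 1" using decseqD[OF decseq_harm_diff_ln, of 0 "M - 1"] M by (simp add: harm_Suc harm_altdef[of 0])
  also have "ln (real M) \<le> real M powr d / d" using M d by (intro ln_powr_bound) auto
  also have "1 \<le> real M powr d / d"
  proof -
   have "1 \<le> real M powr d" using M d by (intro ge_one_powr_ge_zero) auto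
   then show ?thesis using d by (simp add: field_simps)
  qed
  finally show ?thesis by (simp add: field_simps)
qed

text \<open>The scale separating grid points near the singularity from the others is \<open>M\<^sup>-\<^sup>1\<^sup>/\<^sup>2\<close>.\<close>

definition half_scale :: "nat \<Rightarrow> nat" where
  "half_scale M = nat \<lceil>sqrt (real M)\<rceil>"

lemma half_scale:
  assumes "0 < M"
  shows "0 < half_scale M" "half_scale M \<le> M" "sqrt (real M) \<le> real (half_scale M)" "real (half_scale M) \<le> 2 * sqrt (real M)"
proof -
  have s: "1 \<le> sqrt (real M)" using assms by simp
  show "sqrt (real M) \<le> real (half_scale M)" unfolding half_scale_def by (rule real_nat_ceiling_ge)
  then show "0 < half_scale M" using s by (cases "half_scale M = 0") auto
  have "real (half_scale M) < sqrt (real M) + 1" using s unfolding half_scale_def by linarith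
  then show "real (half_scale M) \<le> 2 * sqrt (real M)" using s by linarith
  have "real M * 1 \<le> real M * real M" using assms by (intro mult_left_mono) auto
  then have "sqrt (real M) \<le> real M" by (intro real_le_lsqrt) (auto simp: power2_eq_square)
  then have "\<lceil>sqrt (real M)\<rceil> \<le> int M" by (simp add: ceiling_le_iff)
  then show "half_scale M \<le> M" unfolding half_scale_def by (simp only: nat_le_iff)
qed

text \<open>Without separation of \<open>\<theta>\<close> from the singularity only the operator norm of the covariance, of order \<open>M powr b\<close>, is
  available for each of its two occurrences.\<close>

lemma gram_int_near_bound:
  assumes f: "integrable circ f" "AE x in circ. 0 \<le> f x" and C: "0 < C"
   and up: "\<And>x. x \<in> {-pi..pi} - {0} \<Longrightarrow> f x \<le> C * \<bar>x\<bar> powr (- b)"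
   and b: "0 < b" "b < 1" and d: "0 < d" "d \<le> 1" and M: "0 < M"
  shows "gram_int M \<theta> f f \<le> (2 * C / (1 - b))\<^sup>2 * (8 / d) * real M powr (2 * b + 2 * d)"
proof -
  define F where "F = 2 * C / (1 - b) * real M powr b"
  have F0: "0 \<le> F" using C b by (simp add: F_def)
  have "gram_int M \<theta> f f \<le> F * F * (4 * harm M)"
   by (rule gram_int_le_bounded[OF f f(1) _ F0 _ F0])
    (unfold F_def, (rule toeplitz_qf_power_bound[OF f C up b M]; assumption)+)
  also have "... \<le> F * F * (4 * (2 / d * real M powr d))"
   using F0 harm_le_powr[OF d M] by (intro mult_left_mono) auto
  also have "... = (2 * C / (1 - b))\<^sup>2 * (8 / d) * (real M powr b * real M powr b * real M powr d)"
   by (simp add: F_def power2_eq_square mult_ac)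
  also have "real M powr b * real M powr b * real M powr d = real M powr (2 * b + d)"
   by (simp flip: powr_add)
  also have "(2 * C / (1 - b))\<^sup>2 * (8 / d) * real M powr (2 * b + d) \<le> (2 * C / (1 - b))\<^sup>2 * (8 / d) * real M powr (2 * b + 2 * d)"
   using M d by (intro mult_left_mono powr_mono) auto
  finally show ?thesis .
qed

text \<open>At distance \<open>\<eta>\<close> of order \<open>M\<^sup>-\<^sup>1\<^sup>/\<^sup>2\<close> the bound \<open>B\<close> of the outer part and \<open>S / \<eta>\<close> for the inner part are both of order
  \<open>\<eta> powr (- b) = M powr (b / 2)\<close>. All three contributions are products of two of them, which is half of the exponent
  that is lost near the singularity.\<close>

lemma gram_int_far_bound:
  assumes f: "integrable circ f" "AE x in circ. 0 \<le> f x" and C: "0 < C"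
   and up: "\<And>x. x \<in> {-pi..pi} - {0} \<Longrightarrow> f x \<le> C * \<bar>x\<bar> powr (- b)"
   and b: "0 < b" "b < 1" and d: "0 < d" "d \<le> 1"
  shows "\<exists>B>0. \<forall>M>0. \<forall>\<theta>. 1 / (2 * real (half_scale M)) \<le> cmod (1 - cis \<theta>) \<longrightarrow>
    gram_int M \<theta> f f \<le> B * real M powr (b + 2 * d)"
proof -
  define P where "P = C / (1 - b)"
  have P0: "0 < P" "C \<le> P" using C b by (auto simp: P_def field_simps)
  define Q where "Q = 8 powr (2 * b) * P\<^sup>2"
  have Q0: "0 < Q" using P0 by (simp add: Q_def)
  define B where "B = (4 * Q + 32 * Q + 64 * Q) * (2 / d)\<^sup>2"
  have B0: "0 < B" using Q0 d by (simp add: B_def)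
  have "gram_int M \<theta> f f \<le> B * real M powr (b + 2 * d)"
   if M: "0 < M" and \<theta>: "1 / (2 * real (half_scale M)) \<le> cmod (1 - cis \<theta>)" for M \<theta>
  proof -
   define \<eta> where "\<eta> = 1 / (2 * real (half_scale M))"
   define y where "y = \<eta> / 2"
   define S where "S = (LINT x|circ. (if \<bar>x\<bar> \<le> \<eta> / 2 then f x else 0)) / (2 * pi)"
   define T where "T = P * y powr (- b)"
   define h where "h = (harm M :: real)"
   note m = half_scale[OF M]
   have \<eta>0: "0 < \<eta>" and y0: "0 < y" using m by (auto simp: \<eta>_def y_def)
   have T0: "0 \<le> T" using P0 by (simp add: T_def)
   have h1: "1 \<le> h"
   proof -
    have "harm 1 \<le> (harm M :: real)" using M by (intro harm_mono) auto
    then show ?thesis by (simp add: h_def harm_Suc harm_altdef[of 0])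
   qed
   have BT: "AE x in circ. \<eta> / 2 < \<bar>x\<bar> \<longrightarrow> f x \<le> T"
   proof (rule AE_I2, rule impI)
    fix x assume x: "x \<in> space circ" "\<eta> / 2 < \<bar>x\<bar>"
    then have "f x \<le> C * \<bar>x\<bar> powr (- b)" using \<eta>0 by (intro up) auto
    also have "... \<le> P * y powr (- b)"
     using x P0 C b y0 by (intro mult_mono powr_mono2') (auto simp: y_def)
    finally show "f x \<le> T" by (simp add: T_def)
   qed
   have S1: "S \<le> T * y"
   proof -
    have "(LINT x|circ. (if \<bar>x\<bar> \<le> y then f x else 0)) \<le> 2 * C / (1 - b) * y powr (1 - b)"
     using integral_power_near_zero[OF f _ up _ b(2) y0] C b by simp
    also have "y powr (1 - b) = y * y powr (- b)" using y0 by (simp add: powr_diff powr_minus divide_inverse)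
    also have "2 * C / (1 - b) * (y * y powr (- b)) = 2 * (T * y)" by (simp add: T_def P_def)
    finally have "S \<le> 2 * (T * y) / (2 * pi)" unfolding S_def y_def by (intro divide_right_mono) auto
    also have "... = T * y / pi" by simp
    also have "... \<le> T * y / 1" using T0 y0 pi_gt3 by (intro divide_left_mono) auto
    finally show ?thesis by simp
   qed
   have S0: "0 \<le> S" unfolding S_def
    by (intro divide_nonneg_nonneg Bochner_Integration.integral_nonneg_AE)
     (use f(2) in \<open>auto elim!: eventually_mono\<close>)
   have Sy: "S / \<eta> \<le> T"
   proof -
    have "S / \<eta> \<le> T * y / \<eta>" using S1 \<eta>0 by (intro divide_right_mono) auto
    also have "... = T / 2" using \<eta>0 by (simp add: y_def)
    finally show ?thesis using T0 by linarith
   qed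
   have "gram_int M \<theta> f f \<le> 4 * T\<^sup>2 * h + 32 / \<eta> * T * S * h\<^sup>2 + (8 / \<eta> * S * h)\<^sup>2"
    unfolding h_def using \<theta> by (intro gram_int_far[OF f \<eta>0 T0 BT S_def]) (simp add: \<eta>_def)
   also have "... = 4 * T\<^sup>2 * h + 32 * (T * (S / \<eta>)) * h\<^sup>2 + 64 * (S / \<eta>)\<^sup>2 * h\<^sup>2"
    by (simp add: power2_eq_square mult_ac)
   also have "... \<le> 4 * T\<^sup>2 * h\<^sup>2 + 32 * (T * T) * h\<^sup>2 + 64 * T\<^sup>2 * h\<^sup>2"
   proof (intro add_mono mult_right_mono mult_left_mono power_mono)
    show "h \<le> h\<^sup>2" using h1 by (simp add: power2_eq_square)
   qed (use T0 Sy S0 \<eta>0 in auto)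
   also have "... = (4 + 32 + 64) * (T\<^sup>2 * h\<^sup>2)" by (simp add: power2_eq_square algebra_simps)
   finally have gT: "gram_int M \<theta> f f \<le> (4 + 32 + 64) * (T\<^sup>2 * h\<^sup>2)" .
   have T2: "T\<^sup>2 \<le> Q * real M powr b"
   proof -
    have "y powr (- b) = (4 * real (half_scale M)) powr b"
     using m by (simp add: y_def \<eta>_def powr_minus powr_divide)
    also have "... \<le> (4 * (2 * sqrt (real M))) powr b" using m b by (intro powr_mono2) auto
    finally have "y powr (- b) \<le> (8 * sqrt (real M)) powr b" by simp
    then have "(y powr (- b))\<^sup>2 \<le> ((8 * sqrt (real M)) powr b)\<^sup>2" by (intro power_mono) auto
    also have "... = 8 powr (2 * b) * real M powr b"
    proof -
     have "((8 * sqrt (real M)) powr b)\<^sup>2 = (8 powr b)\<^sup>2 * ((sqrt (real M)) powr b)\<^sup>2"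
      by (simp add: powr_mult power_mult_distrib)
     also have "(8 powr b)\<^sup>2 = 8 powr (2 * b)" by (simp add: power2_eq_square flip: powr_add)
     also have "((sqrt (real M)) powr b)\<^sup>2 = real M powr b"
      using M by (simp add: power2_eq_square flip: powr_mult)
     finally show ?thesis .
    qed
    finally have "P\<^sup>2 * (y powr (- b))\<^sup>2 \<le> P\<^sup>2 * (8 powr (2 * b) * real M powr b)" by (intro mult_left_mono) auto
    then show ?thesis by (simp add: T_def Q_def power_mult_distrib mult_ac)
   qed
   have "h\<^sup>2 \<le> (2 / d * real M powr d)\<^sup>2"
    using h1 harm_le_powr[OF d M] by (intro power_mono) (auto simp: h_def)
   also have "(2 / d * real M powr d)\<^sup>2 = (2 / d)\<^sup>2 * real M powr (2 * d)"
    by (simp add: power_mult_distrib power2_eq_square flip: powr_add)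
   finally have h2: "h\<^sup>2 \<le> (2 / d)\<^sup>2 * real M powr (2 * d)" .
   have "T\<^sup>2 * h\<^sup>2 \<le> Q * real M powr b * ((2 / d)\<^sup>2 * real M powr (2 * d))"
    using T2 h2 Q0 by (intro mult_mono) auto
   from mult_left_mono[OF this] have "gram_int M \<theta> f f \<le> (4 + 32 + 64) * (Q * real M powr b * ((2 / d)\<^sup>2 * real M powr (2 * d)))"
    by (rule order_trans[OF gT]) simp
   also have "... = B * (real M powr b * real M powr (2 * d))" by (simp add: B_def algebra_simps)
   also have "real M powr b * real M powr (2 * d) = real M powr (b + 2 * d)" by (simp flip: powr_add)
   finally show ?thesis .
  qed
  then show ?thesis using B0 by blast
qed

section \<open>Almost sure control of the row sums\<close>

lemma centred_form_measurable: "centred_form M A \<in> borel_measurable (vec_space M)"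
proof -
  have c: "(\<lambda>z. z k) \<in> borel_measurable (vec_space M)" if "k < M" for k
   using that by (intro measurable_component_singleton) auto
  have "(\<lambda>z. \<Sum>k<M. \<Sum>l<M. cnj (z k) * z l * A k l) \<in> borel_measurable (vec_space M)"
   by (intro borel_measurable_sum borel_measurable_times borel_measurable_const measurable_compose[OF c cnj_measurable] c) auto
  from measurable_compose[OF this borel_measurable_Re]
  show ?thesis unfolding centred_form_def[abs_def] by (intro borel_measurable_diff borel_measurable_const)
qed

text \<open>The rows are independent with centred forms, so every increment is orthogonal to powers of the preceding partial sum.\<close>

lemma iid_row_forms_moment:
  fixes c :: "nat \<Rightarrow> real"
  assumes \<Omega>: "prob_space \<Omega>" and q: "1 \<le> q" and rows: "iid_rows \<Omega> N M Z \<mu>"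
   and conc: "concentrated_forms q K M \<mu>" and K: "0 \<le> K"
   and A: "\<And>k l. k < M \<Longrightarrow> l < M \<Longrightarrow> A l k = cnj (A k l)"
  defines "S \<equiv> \<lambda>\<omega>. \<Sum>n<N. c n * centred_form M A (\<lambda>k. Z \<omega> $$ (n, k))"
  shows "S \<in> borel_measurable \<Omega>" "integrable \<Omega> (\<lambda>\<omega>. S \<omega> ^ (2 * q))"
   and "(LINT \<omega>|\<Omega>. S \<omega> ^ (2 * q)) \<le>
    2 * exp (4 ^ q) * K * ((\<Sum>n<N. (c n)\<^sup>2) * (\<Sum>k<M. \<Sum>l<M. (cmod (A k l))\<^sup>2)) ^ q"
proof -
  interpret prob_space \<Omega> by (rule \<Omega>)
  define G where "G = (\<Sum>k<M. \<Sum>l<M. (cmod (A k l))\<^sup>2)"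
  define X where "X n \<omega> = (\<lambda>j\<in>{..<M}. Z \<omega> $$ (n, j))" for n \<omega>
  define Q where "Q = centred_form M A"
  define D where "D n \<omega> = c n * Q (X n \<omega>)" for n \<omega>
  have "Q (X n \<omega>) = centred_form M A (\<lambda>k. Z \<omega> $$ (n, k))" for n \<omega>
   unfolding Q_def centred_form_def X_def
   by (intro arg_cong2[where f = "(-)"] arg_cong[where f = Re] sum.cong refl) auto
  then have S: "S = (\<lambda>\<omega>. \<Sum>n<N. D n \<omega>)" unfolding S_def D_def by simp
  have Qm: "Q \<in> borel_measurable (vec_space M)" unfolding Q_def by (rule centred_form_measurable)
  have ind: "indep_vars (\<lambda>_. vec_space M) X {..<N}"
   using rows unfolding iid_rows_def X_def[abs_def] by simp
  have Xm: "X n \<in> measurable \<Omega> (vec_space M)" if "n < N" for n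
   using ind that unfolding indep_vars_def by auto
  have law: "distr \<Omega> (vec_space M) (X n) = \<mu>" if "n < N" for n
   using rows that unfolding iid_rows_def X_def[abs_def] by simp
  have cf: "integrable \<mu> (\<lambda>z. Q z ^ (2 * q))" "(LINT z|\<mu>. Q z ^ (2 * q)) \<le> K * G ^ q" "(LINT z|\<mu>. Q z) = 0"
   using conc A unfolding concentrated_forms_def Q_def G_def by blast+
  have Qp: "(\<lambda>z. Q z ^ p) \<in> borel_measurable (vec_space M)" for p by (rule borel_measurable_power[OF Qm])
  have QX: "integrable \<Omega> (\<lambda>\<omega>. Q (X n \<omega>) ^ (2 * q))" "expectation (\<lambda>\<omega>. Q (X n \<omega>) ^ (2 * q)) \<le> K * G ^ q" "expectation (\<lambda>\<omega>. Q (X n \<omega>)) = 0"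
   if n: "n < N" for n
  proof -
   show "integrable \<Omega> (\<lambda>\<omega>. Q (X n \<omega>) ^ (2 * q))"
    using cf(1) unfolding law[OF n, symmetric] by (subst (asm) integrable_distr_eq[OF Xm[OF n] Qp])
   show "expectation (\<lambda>\<omega>. Q (X n \<omega>) ^ (2 * q)) \<le> K * G ^ q"
    using cf(2) unfolding law[OF n, symmetric] by (subst (asm) integral_distr[OF Xm[OF n] Qp])
   show "expectation (\<lambda>\<omega>. Q (X n \<omega>)) = 0"
    using cf(3) unfolding law[OF n, symmetric] by (subst (asm) integral_distr[OF Xm[OF n] Qm])
  qed
  have QXm: "(\<lambda>\<omega>. Q (X n \<omega>)) \<in> borel_measurable \<Omega>" if "n < N" for n
   by (rule measurable_compose[OF Xm[OF that] Qm])
  have Dm: "D n \<in> borel_measurable \<Omega>" if "n < N" for n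
   unfolding D_def[abs_def] by (intro borel_measurable_times borel_measurable_const QXm that)
  have Di: "integrable \<Omega> (\<lambda>\<omega>. D n \<omega> ^ (2 * q))" if "n < N" for n
   unfolding D_def power_mult_distrib using QX(1)[OF that] by simp
  show "S \<in> borel_measurable \<Omega>" unfolding S by (intro borel_measurable_sum Dm) simp
  show "integrable \<Omega> (\<lambda>\<omega>. S \<omega> ^ (2 * q))" unfolding S by (rule even_power_of_sum_integrable[OF Dm Di])
  have "expectation (\<lambda>\<omega>. (\<Sum>n<N. D n \<omega>) ^ (2 * q)) \<le> 2 * exp (4 ^ q) * K * (\<Sum>n<N. (c n)\<^sup>2 * G) ^ q"
  proof (rule even_moment_of_sum_le[OF q K Dm Di])
   fix n assume n: "n < N"
   have "expectation (\<lambda>\<omega>. D n \<omega> ^ (2 * q)) = c n ^ (2 * q) * expectation (\<lambda>\<omega>. Q (X n \<omega>) ^ (2 * q))"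
    unfolding D_def power_mult_distrib by simp
   also have "... \<le> c n ^ (2 * q) * (K * G ^ q)" using QX(2)[OF n] by (intro mult_left_mono) auto
   also have "... = K * ((c n)\<^sup>2 * G) ^ q" by (simp add: power_mult power_mult_distrib)
   finally show "expectation (\<lambda>\<omega>. D n \<omega> ^ (2 * q)) \<le> K * ((c n)\<^sup>2 * G) ^ q" .
   show "0 \<le> (c n)\<^sup>2 * G" by (simp add: G_def sum_nonneg)
   define g where "g x = (\<Sum>j<n. c j * Q (x j)) ^ (2 * q - 1)" for x :: "nat \<Rightarrow> nat \<Rightarrow> complex"
   have gX: "g (\<lambda>i\<in>{..<n}. X i \<omega>) = (\<Sum>j<n. D j \<omega>) ^ (2 * q - 1)" for \<omega>
    unfolding g_def D_def by (intro arg_cong[where f = "\<lambda>t. t ^ (2 * q - 1)"] sum.cong refl) auto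
   have gm: "g \<in> borel_measurable (PiM {..<n} (\<lambda>_. vec_space M))"
    unfolding g_def[abs_def]
    by (intro borel_measurable_power borel_measurable_sum borel_measurable_times borel_measurable_const
       measurable_compose[OF _ Qm] measurable_component_singleton)
   have "integrable \<Omega> (\<lambda>\<omega>. (\<Sum>j<n. D j \<omega>) ^ (2 * q))"
    using n by (intro even_power_of_sum_integrable Dm Di) auto
   then have gi: "integrable \<Omega> (\<lambda>\<omega>. g (\<lambda>i\<in>{..<n}. X i \<omega>))"
    unfolding gX by (rule integrable_lower_power(2)[rotated]) (use n in \<open>auto intro!: borel_measurable_sum Dm\<close>)
   have hi: "integrable \<Omega> (\<lambda>\<omega>. c n * Q (X n \<omega>))"
    using integrable_lower_power(2)[OF QXm[OF n] QX(1)[OF n], of 1] q by simp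
   have hm: "(\<lambda>z. c n * Q z) \<in> borel_measurable (vec_space M)" using Qm by simp
   have "expectation (\<lambda>\<omega>. g (\<lambda>i\<in>{..<n}. X i \<omega>) * (c n * Q (X n \<omega>)))
     = expectation (\<lambda>\<omega>. g (\<lambda>i\<in>{..<n}. X i \<omega>)) * expectation (\<lambda>\<omega>. c n * Q (X n \<omega>))"
    by (rule indep_past_present(2)[where X = X and A = "{..<n}" and n = n and g = g and h = "\<lambda>z. c n * Q z", OF ind])
     (use n gm hm gi hi in auto)
   then show "expectation (\<lambda>\<omega>. (\<Sum>j<n. D j \<omega>) ^ (2 * q - 1) * D n \<omega>) = 0"
    unfolding gX D_def[of n] using QX(3)[OF n] by simp
  qed
  then show "(LINT \<omega>|\<Omega>. S \<omega> ^ (2 * q)) \<le> 2 * exp (4 ^ q) * K * ((\<Sum>n<N. (c n)\<^sup>2) * (\<Sum>k<M. \<Sum>l<M. (cmod (A k l))\<^sup>2)) ^ q"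
   unfolding S G_def[symmetric] sum_distrib_right .
qed

lemma even_moment_tail:
  assumes \<Omega>: "prob_space \<Omega>" and S: "integrable \<Omega> (\<lambda>\<omega>. S \<omega> ^ (2 * q))" and e: "0 < e"
  shows "measure \<Omega> {\<omega> \<in> space \<Omega>. e \<le> \<bar>S \<omega>\<bar>} \<le> (LINT \<omega>|\<Omega>. S \<omega> ^ (2 * q)) / e ^ (2 * q)"
proof -
  interpret prob_space \<Omega> by (rule \<Omega>)
  have m: "{\<omega> \<in> space \<Omega>. e ^ (2 * q) \<le> S \<omega> ^ (2 * q)} \<in> sets \<Omega>"
   by (intro borel_measurable_le borel_measurable_const borel_measurable_integrable[OF S])
  have "measure \<Omega> {\<omega> \<in> space \<Omega>. e \<le> \<bar>S \<omega>\<bar>} \<le> measure \<Omega> {\<omega> \<in> space \<Omega>. e ^ (2 * q) \<le> S \<omega> ^ (2 * q)}"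
  proof (rule finite_measure_mono[OF _ m], safe)
   fix \<omega> assume "e \<le> \<bar>S \<omega>\<bar>"
   from power_mono[OF this, of "2 * q"] e show "e ^ (2 * q) \<le> S \<omega> ^ (2 * q)" by (simp add: power_even_abs)
  qed
  also have "... \<le> (LINT \<omega>|\<Omega>. S \<omega> ^ (2 * q)) / e ^ (2 * q)"
   by (rule integral_Markov_inequality_measure[OF S sets.empty_sets]) (use e in \<open>auto simp: zero_le_even_power\<close>)
  finally show ?thesis .
qed

text \<open>The thresholds are allowed to exceed the standard deviation by a fixed power of \<open>M\<close> only. As all moments are available, \<open>q\<close>
  can be taken so large that Markov's inequality beats the number of grid points and of admissible \<open>N\<close>, which are of order
  \<open>M\<close> each, and Borel--Cantelli applies.\<close>

theorem row_forms_eventually_small: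
  fixes Z :: "nat \<Rightarrow> nat \<Rightarrow> 'w \<Rightarrow> complex Matrix.mat" and c :: "nat \<Rightarrow> nat \<Rightarrow> real"
   and A :: "nat \<Rightarrow> nat \<Rightarrow> nat \<Rightarrow> nat \<Rightarrow> complex"
  assumes \<Omega>: "prob_space \<Omega>"
   and pos: "\<And>M N. (M, N) \<in> P \<Longrightarrow> 1 \<le> M \<and> 1 \<le> N" and K1: "0 < K1"
   and asymp: "\<And>M N. (M, N) \<in> P \<Longrightarrow> K1 * real M \<le> real N \<and> real N \<le> K2 * real M"
   and law: "row_law \<in> {normal_law real_std_normal, normal_law complex_std_normal, sphere_law \<real>, sphere_law UNIV}"
   and rows: "\<And>M N. (M, N) \<in> P \<Longrightarrow> \<exists>\<mu>. row_law M \<mu> \<and> iid_rows \<Omega> N M (Z M N) \<mu>"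
   and C: "0 < C" "\<And>M N. (M, N) \<in> P \<Longrightarrow> (\<Sum>n<N. (c N n)\<^sup>2) \<le> real N * C"
   and A: "\<And>M g k l. A M g l k = cnj (A M g k l)"
   and e: "\<And>M g. 0 < M \<Longrightarrow> 0 < e M g"
   and B: "0 \<le> B" "0 < d"
    "\<And>M g. 0 < M \<Longrightarrow> (\<Sum>k<M. \<Sum>l<M. (cmod (A M g k l))\<^sup>2) \<le> B * real M * (e M g)\<^sup>2 * real M powr (- d)"
  shows "AE \<omega> in \<Omega>. \<forall>\<^sub>F M in sequentially. \<forall>N. (M, N) \<in> P \<longrightarrow>
    (\<forall>g<2 * M. \<bar>(\<Sum>n<N. c N n * centred_form M (A M g) (\<lambda>k. Z M N \<omega> $$ (n, k))) / real N\<bar> < e M g)"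
proof -
  interpret prob_space \<Omega> by (rule \<Omega>)
  define S where "S M N g \<omega> = (\<Sum>n<N. c N n * centred_form M (A M g) (\<lambda>k. Z M N \<omega> $$ (n, k)))" for M N g \<omega>
  define q where "q = nat \<lceil>4 / d\<rceil>"
  have "4 / d \<le> real q" unfolding q_def by (rule real_nat_ceiling_ge)
  then have qd: "4 \<le> d * real q" using B(2) by (simp add: field_simps)
  have q: "1 \<le> q" using qd B(2) by (cases q) auto
  obtain K where K: "0 \<le> K" "\<And>M \<mu>. 4 \<le> M \<Longrightarrow> row_law M \<mu> \<Longrightarrow> concentrated_forms q K M \<mu>"
   using row_law_concentrated[OF q law] by blast
  define H where "H = 2 * exp (4 ^ q) * K"
  define T where "T = C * B / K1"
  have H0: "0 \<le> H" and T0: "0 \<le> T" using K B C K1 by (auto simp: H_def T_def)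
  have Sm: "{\<omega> \<in> space \<Omega>. e M g * real N \<le> \<bar>S M N g \<omega>\<bar>} \<in> sets \<Omega>"
   and tail: "measure \<Omega> {\<omega> \<in> space \<Omega>. e M g * real N \<le> \<bar>S M N g \<omega>\<bar>} \<le> H * T ^ q * real M powr (- 4)"
   if MN: "(M, N) \<in> P" "4 \<le> M" for M N g
  proof -
   obtain \<mu> where \<mu>: "row_law M \<mu>" "iid_rows \<Omega> N M (Z M N) \<mu>" using rows[OF MN(1)] by blast
   define G where "G = (\<Sum>k<M. \<Sum>l<M. (cmod (A M g k l))\<^sup>2)"
   have mom: "S M N g \<in> borel_measurable \<Omega>" "integrable \<Omega> (\<lambda>\<omega>. S M N g \<omega> ^ (2 * q))"
    "(LINT \<omega>|\<Omega>. S M N g \<omega> ^ (2 * q)) \<le> H * ((\<Sum>n<N. (c N n)\<^sup>2) * G) ^ q"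
    unfolding S_def[abs_def] H_def G_def
    by (rule iid_row_forms_moment[OF \<Omega> q \<mu>(2) K(2)[OF MN(2) \<mu>(1)] K(1)]; rule A)+
   show "{\<omega> \<in> space \<Omega>. e M g * real N \<le> \<bar>S M N g \<omega>\<bar>} \<in> sets \<Omega>"
    by (intro borel_measurable_le borel_measurable_const borel_measurable_abs mom(1))
   have M: "0 < M" "0 < real M" and N: "0 < real N" using MN pos[OF MN(1)] by auto
   have eN: "0 < e M g * real N" using e[OF M(1)] N by simp
   have G0: "0 \<le> G" by (simp add: G_def sum_nonneg)
   have "measure \<Omega> {\<omega> \<in> space \<Omega>. e M g * real N \<le> \<bar>S M N g \<omega>\<bar>} \<le> (LINT \<omega>|\<Omega>. S M N g \<omega> ^ (2 * q)) / (e M g * real N) ^ (2 * q)"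
    by (rule even_moment_tail[OF \<Omega> mom(2) eN])
   also have "... \<le> H * ((\<Sum>n<N. (c N n)\<^sup>2) * G) ^ q / (e M g * real N) ^ (2 * q)"
    using mom(3) eN by (intro divide_right_mono) auto
   also have "... = H * (((\<Sum>n<N. (c N n)\<^sup>2) * G) / (e M g * real N)\<^sup>2) ^ q"
    by (simp add: power_divide power_mult)
   also have "... \<le> H * (T * real M powr (- d)) ^ q"
   proof (intro mult_left_mono power_mono)
    have "(\<Sum>n<N. (c N n)\<^sup>2) * G \<le> (real N * C) * (B * real M * (e M g)\<^sup>2 * real M powr (- d))"
     using C(2)[OF MN(1)] B(3)[OF M(1), of g] G0 C(1) N by (intro mult_mono) (auto simp: G_def)
    also have "... = (C * B * (e M g)\<^sup>2 * real M powr (- d) * real N) * real M" by (simp add: mult_ac)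
    also have "... \<le> (C * B * (e M g)\<^sup>2 * real M powr (- d) * real N) * (real N / K1)"
     using asymp[OF MN(1)] K1 C B N by (intro mult_left_mono) (auto simp: field_simps)
    also have "... = T * real M powr (- d) * (e M g * real N)\<^sup>2" by (simp add: T_def power2_eq_square)
    finally show "((\<Sum>n<N. (c N n)\<^sup>2) * G) / (e M g * real N)\<^sup>2 \<le> T * real M powr (- d)"
     by (simp only: pos_divide_le_eq[OF zero_less_power[OF eN]])
    show "0 \<le> ((\<Sum>n<N. (c N n)\<^sup>2) * G) / (e M g * real N)\<^sup>2" using G0 by (intro divide_nonneg_nonneg mult_nonneg_nonneg sum_nonneg) auto
   qed (rule H0)
   also have "... = H * T ^ q * real M powr (- (d * real q))"
    using M by (simp add: power_mult_distrib powr_powr flip: powr_realpow)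
   also have "... \<le> H * T ^ q * real M powr (- 4)"
    using H0 T0 M qd by (intro mult_left_mono powr_mono) auto
   finally show "measure \<Omega> {\<omega> \<in> space \<Omega>. e M g * real N \<le> \<bar>S M N g \<omega>\<bar>} \<le> H * T ^ q * real M powr (- 4)" .
  qed
  define NN where "NN M = {N. (M, N) \<in> P}" for M
  have NN: "NN M \<subseteq> {1..nat \<lfloor>K2 * real M\<rfloor>}" for M
  proof
   fix N assume "N \<in> NN M"
   then have "(M, N) \<in> P" by (simp add: NN_def)
   from pos[OF this] asymp[OF this] show "N \<in> {1..nat \<lfloor>K2 * real M\<rfloor>}" by (auto simp: le_nat_iff le_floor_iff)
  qed
  then have NNf: "finite (NN M)" for M by (rule finite_subset) simp
  have NNc: "real (card (NN M)) \<le> \<bar>K2\<bar> * real M" for M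
  proof -
   have "card (NN M) \<le> nat \<lfloor>K2 * real M\<rfloor>" using card_mono[OF _ NN[of M]] by simp
   then have "real (card (NN M)) \<le> real (nat \<lfloor>K2 * real M\<rfloor>)" by simp
   also have "... \<le> \<bar>K2 * real M\<bar>" by linarith
   finally show ?thesis by (simp add: abs_mult)
  qed
  define bad where "bad M = (if 4 \<le> M then \<Union>N\<in>NN M. \<Union>g<2 * M. {\<omega> \<in> space \<Omega>. e M g * real N \<le> \<bar>S M N g \<omega>\<bar>} else {})" for M
  have badm: "bad M \<in> sets \<Omega>" for M
   unfolding bad_def using Sm NNf by (auto simp: NN_def intro!: sets.finite_UN)
  have bad_le: "measure \<Omega> (bad M) \<le> 2 * \<bar>K2\<bar> * H * T ^ q * (1 / real M ^ 2)" for M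
  proof (cases "4 \<le> M")
   case True
   have "measure \<Omega> (bad M) \<le> (\<Sum>N\<in>NN M. measure \<Omega> (\<Union>g<2 * M. {\<omega> \<in> space \<Omega>. e M g * real N \<le> \<bar>S M N g \<omega>\<bar>}))"
    unfolding bad_def if_P[OF True] using Sm True
    by (intro finite_measure_subadditive_finite NNf) (auto simp: NN_def intro!: sets.finite_UN)
   also have "... \<le> (\<Sum>N\<in>NN M. \<Sum>g<2 * M. measure \<Omega> {\<omega> \<in> space \<Omega>. e M g * real N \<le> \<bar>S M N g \<omega>\<bar>})"
    using Sm True by (intro sum_mono finite_measure_subadditive_finite) (auto simp: NN_def)
   also have "... \<le> (\<Sum>N\<in>NN M. \<Sum>g<2 * M. H * T ^ q * real M powr (- 4))"
    using tail True by (intro sum_mono) (auto simp: NN_def)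
   also have "... = real (card (NN M)) * (2 * real M * (H * T ^ q * real M powr (- 4)))" by simp
   also have "... \<le> (\<bar>K2\<bar> * real M) * (2 * real M * (H * T ^ q * real M powr (- 4)))"
    using NNc H0 T0 by (intro mult_right_mono) auto
   also have "real M powr (- 4) = 1 / real M ^ 4" using True by (simp add: powr_minus_divide)
   also have "(\<bar>K2\<bar> * real M) * (2 * real M * (H * T ^ q * (1 / real M ^ 4))) = 2 * \<bar>K2\<bar> * H * T ^ q * (1 / real M ^ 2)"
    using True by (simp add: power2_eq_square power4_eq_xxxx field_simps)
   finally show ?thesis .
  next
   case False
   then show ?thesis using H0 T0 by (simp add: bad_def)
  qed
  have "summable (\<lambda>M. 2 * \<bar>K2\<bar> * H * T ^ q * (1 / real M ^ 2))"
   using inverse_power_summable[of 2, where 'a = real] by (intro summable_mult) (simp add: divide_inverse)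
  then have "summable (\<lambda>M. measure \<Omega> (bad M))"
   by (rule summable_comparison_test'[where N = 0]) (use bad_le in simp)
  then have "AE \<omega> in \<Omega>. \<forall>\<^sub>F M in sequentially. \<omega> \<in> space \<Omega> - bad M"
   using badm by (intro borel_cantelli_AE1) (auto simp: emeasure_eq_measure)
  then show ?thesis
  proof eventually_elim
   case (elim \<omega>)
   show ?case using elim eventually_ge_at_top[of 4]
   proof eventually_elim
    case (elim M)
    show ?case
    proof (intro allI impI)
     fix N g assume N: "(M, N) \<in> P" and g: "g < 2 * M"
     then have "\<not> e M g * real N \<le> \<bar>S M N g \<omega>\<bar>" using elim by (auto simp: bad_def NN_def)
     moreover have "0 < real N" using pos[OF N] by simp
     ultimately show "\<bar>(\<Sum>n<N. c N n * centred_form M (A M g) (\<lambda>k. Z M N \<omega> $$ (n, k))) / real N\<bar> < e M g"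
      unfolding S_def[symmetric] by (simp add: field_simps)
    qed
   qed
  qed
qed

section \<open>The estimator relative to the covariance\<close>

text \<open>The far error is compared with the lower bound of the density, the near error with its growth at the origin.\<close>

lemma estimator_relative_error:
  assumes f: "integrable circ f" and b: "0 < b" "b \<le> 2" and k: "0 < k"
   and low: "AE x in circ. k \<le> f x" "AE x in circ. x \<noteq> 0 \<longrightarrow> k * \<bar>x\<bar> powr (- b) \<le> f x"
   and M: "0 < M" and Z: "Z \<in> carrier_mat N M" and c: "\<And>n. n < N \<Longrightarrow> 0 \<le> c n"
   and e: "0 \<le> e1" "e1 \<le> e2"
   and dev: "\<And>g. g < 2 * M \<Longrightarrow>
    \<bar>(\<Sum>n<N. c n * centred_form M (sandwich M (\<lambda>k l. psd_sqrt (toeplitz_cov f M) $$ (k, l)) (grid (2 * M) g)) (\<lambda>k. Z $$ (n, k))) / real N\<bar>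
     \<le> (if 1 / (2 * real (half_scale M)) \<le> cmod (1 - cis (grid (2 * M) g)) then e1 else e2)"
   and v: "v \<in> carrier_vec M"
  shows "\<bar>qform (toeplitz_est (data_mat (real_diag N c) Z (toeplitz_cov f M))) v
    - mean_trace (real_diag N c) * qform (toeplitz_cov f M) v\<bar>
   \<le> (e1 + 4 * e2 * (pi / real (half_scale M)) powr b) / k * qform (toeplitz_cov f M) v"
proof -
  define h where "h k l = psd_sqrt (toeplitz_cov f M) $$ (k, l)" for k l
  define r where "r i j = fourier_coeff f (int i - int j)" for i j
  define D where "D = sample_deviation M N c h (\<lambda>n k. Z $$ (n, k)) r"
  define w where "w = vec_index v"
  have nn: "AE x in circ. 0 \<le> f x" using low(1) by (rule eventually_mono) (use k in auto)
  have gram: "(\<Sum>k<M. cnj (h k i) * h k j) = r i j" if "i < M" "j < M" for i j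
   unfolding h_def r_def by (rule root_gram[OF f nn that])
  have ts: "Re (tau_sum M D \<theta>) = (\<Sum>n<N. c n * centred_form M (sandwich M h \<theta>) (\<lambda>k. Z $$ (n, k))) / real N" for \<theta>
   unfolding D_def by (rule tau_sum_sample_deviation) (rule gram)
  note m = half_scale[OF M]
  have "\<bar>Re (\<Sum>a<M. \<Sum>b<M. cnj (w a) * w b * diag_mean M D (int a - int b))\<bar>
    \<le> e1 * (\<Sum>j<M. (cmod (w j))\<^sup>2) + 4 * e2 * toeplitz_qf (bump (half_scale M)) M w"
  proof (rule diag_mean_form_bound[OF M m(1,2)])
   show "0 \<le> e1" "0 \<le> e2" using e by auto
   fix g assume g: "g < 2 * M"
   have "\<bar>Re (tau_sum M D (grid (2 * M) g))\<bar> \<le> (if 1 / (2 * real (half_scale M)) \<le> cmod (1 - cis (grid (2 * M) g)) then e1 else e2)"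
    using dev[OF g] unfolding ts h_def[abs_def] .
   then show "1 / (2 * real (half_scale M)) \<le> cmod (1 - cis (grid (2 * M) g)) \<Longrightarrow> \<bar>Re (tau_sum M D (grid (2 * M) g))\<bar> \<le> e1"
    and "\<bar>Re (tau_sum M D (grid (2 * M) g))\<bar> \<le> e2"
    using e by (auto split: if_splits)
  qed
  also have "e1 * (\<Sum>j<M. (cmod (w j))\<^sup>2) \<le> e1 / k * toeplitz_qf f M w"
   using mult_left_mono[OF toeplitz_qf_ge_const[OF f low(1), where M = M and v = w], of "e1 / k"] e k by simp
  also have "4 * e2 * toeplitz_qf (bump (half_scale M)) M w \<le> 4 * e2 * ((pi / real (half_scale M)) powr b / k * toeplitz_qf f M w)"
   using qf_bump_le[OF f m(1) b k low(2), where M = M and v = w] e by (intro mult_left_mono) auto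
  also have "e1 / k * toeplitz_qf f M w + 4 * e2 * ((pi / real (half_scale M)) powr b / k * toeplitz_qf f M w)
    = (e1 + 4 * e2 * (pi / real (half_scale M)) powr b) / k * toeplitz_qf f M w"
   by (simp add: add_divide_distrib distrib_right)
  also have "toeplitz_qf f M w = qform (toeplitz_cov f M) v"
   unfolding toeplitz_cov_form[OF f v] w_def by simp
  also have "Re (\<Sum>a<M. \<Sum>b<M. cnj (w a) * w b * diag_mean M D (int a - int b))
    = qform (toeplitz_est (data_mat (real_diag N c) Z (toeplitz_cov f M))) v
     - mean_trace (real_diag N c) * qform (toeplitz_cov f M) v"
   unfolding w_def D_def h_def[abs_def] r_def[abs_def] using toeplitz_est_form(3)[of Z N M c f v] Z c f nn v by simp
  finally show ?thesis by simp
qed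

lemma dyadic_exponent:
  assumes z: "1 \<le> z" and K: "K = nat \<lceil>log 2 z\<rceil> + 1"
  shows "z < 2 ^ K" "real K \<le> log 2 z + 2"
proof -
  have l: "0 \<le> log 2 z" using z by simp
  have "z = 2 powr log 2 z" using z by simp
  also have "... < 2 powr real K" using l unfolding K by (intro powr_less_mono) linarith+
  also have "... = 2 ^ K" by (simp add: powr_realpow)
  finally show "z < 2 ^ K" .
  show "real K \<le> log 2 z + 2" using l unfolding K by linarith
qed

lemma mean_trace_le_square:
  "mean_trace (real_diag N c) \<le> 1 + mean_trace (real_diag N c * real_diag N c)"
proof (cases "N = 0")
  case False
  have "(\<Sum>n<N. c n) \<le> (\<Sum>n<N. 1 + c n * c n)"
  proof (rule sum_mono)
   fix n
   have "0 \<le> (c n - 1)\<^sup>2 + (c n)\<^sup>2 + 1" by (intro add_nonneg_nonneg) auto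
   then show "c n \<le> 1 + c n * c n" by (simp add: power2_eq_square algebra_simps)
  qed
  also have "... = real N + (\<Sum>n<N. c n * c n)" by (simp add: sum.distrib)
  finally have "(\<Sum>n<N. c n) / real N \<le> (real N + (\<Sum>n<N. c n * c n)) / real N" by (intro divide_right_mono) auto
  then show ?thesis using False unfolding real_diag_mult mean_trace_real_diag by (simp add: add_divide_distrib)
qed (simp add: real_diag_mult mean_trace_real_diag)

theorem corollary2p3:
  fixes \<Omega> :: "'w measure"
    and P :: "(nat \<times> nat) set"
    and Z :: "nat \<Rightarrow> nat \<Rightarrow> 'w \<Rightarrow> complex Matrix.mat"
    and row_law :: "nat \<Rightarrow> (nat \<Rightarrow> complex) measure \<Rightarrow> bool"
    and c :: "nat \<Rightarrow> nat \<Rightarrow> real"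
    and f L :: "real \<Rightarrow> real"
    and K1 K2 C \<kappa> a \<xi>0 :: real
  assumes "prob_space \<Omega>"
    and pos: "\<And>M N. (M, N) \<in> P \<Longrightarrow> 1 \<le> M \<and> 1 \<le> N"
    and K: "0 < K1" "K1 < K2"
    and asymp: "\<And>M N. (M, N) \<in> P \<Longrightarrow> K1 * real M \<le> real N \<and> real N \<le> K2 * real M"
    and row_law: "row_law \<in> {normal_law real_std_normal, normal_law complex_std_normal,
                              sphere_law \<real>, sphere_law UNIV}"
    and rows: "\<And>M N. (M, N) \<in> P \<Longrightarrow> \<exists>\<mu>. row_law M \<mu> \<and> iid_rows \<Omega> N M (Z M N) \<mu>"
    and c_nonneg: "\<And>M N n. (M, N) \<in> P \<Longrightarrow> n < N \<Longrightarrow> 0 \<le> c N n"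
    and C: "0 < C" "\<And>M N. (M, N) \<in> P \<Longrightarrow>
              mean_trace (real_diag N (c N) * real_diag N (c N)) \<le> C"
    and \<kappa>: "0 < \<kappa>" "\<And>M N. (M, N) \<in> P \<Longrightarrow> 2 \<le> M \<Longrightarrow>
              op_norm (real_diag N (c N)) \<le> \<kappa> * ln (real M)"
    and f_L1: "f absolutely_integrable_on {-pi<..<pi}"
    and f_pos: "\<And>x. x \<in> {-pi..pi} - {0} \<Longrightarrow> 0 < f x"
    and f_bdd: "\<And>\<delta>. 0 < \<delta> \<Longrightarrow> bounded (f ` ({-pi..pi} - {-\<delta><..<\<delta>}))"
    and f_essinf: "0 < essinf (lebesgue_on {-pi<..<pi}) (\<lambda>\<theta>. ereal (f \<theta>))"
    and f_even: "\<And>x. x \<in> {-pi..pi} \<Longrightarrow> f (- x) = f x"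
    and a: "0 < a" "a < 1"
    and L: "slowly_varying_on (1 / pi) L"
    and f_L: "\<And>x. x \<in> {-pi..pi} - {0} \<Longrightarrow> f x = L (1 / \<bar>x\<bar>) / \<bar>x\<bar> powr a"
    and \<xi>: "0 < \<xi>0" "\<And>M N. (M, N) \<in> P \<Longrightarrow> \<xi>0 \<le> mean_trace (real_diag N (c N))"
  defines "Rhat \<equiv> \<lambda>M N \<omega>. toeplitz_est (data_mat (real_diag N (c N)) (Z M N \<omega>) (toeplitz_cov f M))"
    and "F \<equiv> inf (at_top \<times>\<^sub>F at_top) (principal P)"
  shows "AE \<omega> in \<Omega>.
           (\<forall>\<^sub>F (M, N) in F. psd (Rhat M N \<omega>)) \<and>
           ((\<lambda>(M, N). op_norm (psd_sqrt (Rhat M N \<omega>) * psd_inv_sqrt (toeplitz_cov f M)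
                - of_real (sqrt (mean_trace (real_diag N (c N)))) \<cdot>\<^sub>m 1\<^sub>m M)) \<longlongrightarrow> 0) F"
proof -
  \<comment> \<open>The exponent lost to slow variation, to logarithms and to the union bound. The relative error is of order
   \<open>M powr ((a + 6 * d - 1) / 2)\<close> in the end, which dictates the size of \<open>d\<close>.\<close>
  define d where "d = min ((1 - a) / 12) (a / 2)"
  have "d \<le> a / 2" "d \<le> (1 - a) / 12" unfolding d_def by (rule min.cobounded2) (rule min.cobounded1)
  moreover have "0 < d" using a by (simp add: d_def)
  ultimately have "0 < d" "d \<le> a / 2" "d \<le> (1 - a) / 12" by blast+
  moreover from this(3) have "12 * d \<le> 1 - a" by simp
  ultimately have d: "0 < d" "d < a" "d \<le> 1" "a + 6 * d < 1" using a by simp_all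
  define lo_exp up_exp where "lo_exp = a - d" and "up_exp = a + d"
  have le: "0 < lo_exp" "lo_exp \<le> 2" and ue: "0 < up_exp" "up_exp < 1"
   using a d by (auto simp: lo_exp_def up_exp_def)
  obtain k U where k: "0 < k" and U: "0 < U" and f: "integrable circ f"
   and low: "AE x in circ. k \<le> f x" "AE x in circ. x \<noteq> 0 \<longrightarrow> k * \<bar>x\<bar> powr (- lo_exp) \<le> f x"
   and up: "\<And>x. x \<in> {-pi..pi} - {0} \<Longrightarrow> f x \<le> U * \<bar>x\<bar> powr (- up_exp)"
   using spectral_density_bounds[OF f_L1 f_bdd f_essinf L f_L d(1,2)] unfolding lo_exp_def up_exp_def by blast
  have nn: "AE x in circ. 0 \<le> f x" using low(1) by (rule eventually_mono) (use k in auto)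
  obtain B1 where B1: "0 < B1" "\<And>M \<theta>. 0 < M \<Longrightarrow> 1 / (2 * real (half_scale M)) \<le> cmod (1 - cis \<theta>) \<Longrightarrow>
    gram_int M \<theta> f f \<le> B1 * real M powr (up_exp + 2 * d)"
   using gram_int_far_bound[OF f nn U up ue d(1,3)] by blast
  define B2 where "B2 = (2 * U / (1 - up_exp))\<^sup>2 * (8 / d)"
  define B where "B = max B1 B2"
  define far where "far M g \<longleftrightarrow> 1 / (2 * real (half_scale M)) \<le> cmod (1 - cis (grid (2 * M) g))" for M g
  \<comment> \<open>The standard deviations of the row sums, enlarged by \<open>M powr (d / 2)\<close>\<close>
  define e1 where "e1 M = real M powr ((up_exp + 3 * d - 1) / 2)" for M :: nat
  define e2 where "e2 M = real M powr ((2 * up_exp + 3 * d - 1) / 2)" for M :: nat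
  define h where "h M = (\<lambda>k l. psd_sqrt (toeplitz_cov f M) $$ (k, l))" for M
  define A where "A M g = sandwich M (h M) (grid (2 * M) g)" for M g
  have frob: "(\<Sum>k<M. \<Sum>l<M. (cmod (A M g k l))\<^sup>2) \<le> B * real M * (if far M g then e1 M else e2 M)\<^sup>2 * real M powr (- d)"
   if M: "0 < M" for M g
  proof -
   have sq: "real M * (real M powr (x / 2))\<^sup>2 * real M powr (- d) = real M powr (1 + x - d)" for x
   proof -
    have e: "(real M powr (x / 2))\<^sup>2 = real M powr x" by (simp add: power2_eq_square flip: powr_add)
    have "real M powr 1 = real M" using M by simp
    then have "real M * (real M powr (x / 2))\<^sup>2 * real M powr (- d) = real M powr 1 * real M powr x * real M powr (- d)"
     unfolding e by (simp only:)
    also have "... = real M powr (1 + x + - d)" by (simp only: powr_add)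
    finally show ?thesis by simp
   qed
   have "(\<Sum>k<M. \<Sum>l<M. (cmod (A M g k l))\<^sup>2) = gram_int M (grid (2 * M) g) f f"
    unfolding A_def h_def by (rule sandwich_frobenius[OF f]) (rule root_gram[OF f nn])
   also have "... \<le> B * (real M * (if far M g then e1 M else e2 M)\<^sup>2 * real M powr (- d))"
   proof (cases "far M g")
    case True
    have "gram_int M (grid (2 * M) g) f f \<le> B1 * real M powr (up_exp + 2 * d)"
     using B1(2)[OF M] True by (simp add: far_def)
    also have "... \<le> B * real M powr (up_exp + 2 * d)"
     by (rule mult_right_mono) (simp_all add: B_def)
    also have "up_exp + 2 * d = 1 + (up_exp + 3 * d - 1) - d" by simp
    finally show ?thesis unfolding e1_def if_P[OF True] sq .
   next
    case False
    have "gram_int M (grid (2 * M) g) f f \<le> B2 * real M powr (2 * up_exp + 2 * d)"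
     unfolding B2_def by (rule gram_int_near_bound[OF f nn U up ue d(1,3) M])
    also have "... \<le> B * real M powr (2 * up_exp + 2 * d)"
     by (rule mult_right_mono) (simp_all add: B_def)
    also have "2 * up_exp + 2 * d = 1 + (2 * up_exp + 3 * d - 1) - d" by simp
    finally show ?thesis unfolding e2_def if_not_P[OF False] sq .
   qed
   finally show ?thesis by (simp add: mult_ac)
  qed
  have squares: "(\<Sum>n<N. (c N n)\<^sup>2) \<le> real N * C" if MN: "(M, N) \<in> P" for M N
   using C(2)[OF MN] pos[OF MN] unfolding real_diag_mult mean_trace_real_diag
   by (simp add: field_simps power2_eq_square)
  have small: "AE \<omega> in \<Omega>. \<forall>\<^sub>F M in sequentially. \<forall>N. (M, N) \<in> P \<longrightarrow>
    (\<forall>g<2 * M. \<bar>(\<Sum>n<N. c N n * centred_form M (A M g) (\<lambda>k. Z M N \<omega> $$ (n, k))) / real N\<bar> < (if far M g then e1 M else e2 M))"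
  proof (rule row_forms_eventually_small[OF assms(1) _ K(1) _ row_law _ C(1)])
   fix M N assume MN: "(M, N) \<in> P"
   show "1 \<le> M \<and> 1 \<le> N" by (rule pos[OF MN])
   show "K1 * real M \<le> real N \<and> real N \<le> K2 * real M" by (rule asymp[OF MN])
   show "\<exists>\<mu>. row_law M \<mu> \<and> iid_rows \<Omega> N M (Z M N) \<mu>" by (rule rows[OF MN])
   show "(\<Sum>n<N. (c N n)\<^sup>2) \<le> real N * C" by (rule squares[OF MN])
  next
   show "A M g l k = cnj (A M g k l)" for M g k l unfolding A_def by (rule sandwich_hermitian)
   show "0 < (if far M g then e1 M else e2 M)" if "0 < M" for M g using that by (simp add: e1_def e2_def)
   show "0 \<le> B" "0 < d" using B1(1) d by (auto simp: B_def)
  qed (rule frob)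
  define \<rho> where "\<rho> = (1 - a - 6 * d) / 2"
  have \<rho>: "0 < \<rho>" using d by (simp add: \<rho>_def)
  define W where "W = (1 + 4 * pi powr lo_exp) / k / \<xi>0"
  have W0: "0 < W" using k \<xi>(1) by (simp add: W_def add_pos_nonneg)
  define \<epsilon> where "\<epsilon> M = W * real M powr (- \<rho>)" for M :: nat
  \<comment> \<open>Near the singularity the error is larger by \<open>M powr (up_exp / 2)\<close>, but the bump gains \<open>M powr (- lo_exp / 2)\<close>.\<close>
  have total: "(e1 M + 4 * e2 M * (pi / real (half_scale M)) powr lo_exp) / k \<le> \<epsilon> M * \<xi>0" if M: "0 < M" for M
  proof -
   note m = half_scale[OF M]
   have "(pi / real (half_scale M)) powr lo_exp \<le> (pi / sqrt (real M)) powr lo_exp"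
    using m M le by (intro powr_mono2 divide_left_mono) auto
   also have "... = pi powr lo_exp * real M powr (- lo_exp / 2)"
    using M by (simp add: powr_divide powr_minus_divide powr_half_sqrt[symmetric] powr_powr)
   finally have "e2 M * (pi / real (half_scale M)) powr lo_exp \<le> e2 M * (pi powr lo_exp * real M powr (- lo_exp / 2))"
    by (intro mult_left_mono) (auto simp: e2_def)
   also have "... = pi powr lo_exp * (real M powr ((2 * up_exp + 3 * d - 1) / 2) * real M powr (- lo_exp / 2))"
    by (simp add: e2_def)
   also have "real M powr ((2 * up_exp + 3 * d - 1) / 2) * real M powr (- lo_exp / 2) = real M powr (- \<rho>)"
    unfolding powr_add[symmetric] by (rule arg_cong[where f = "(powr) (real M)"]) (simp add: up_exp_def lo_exp_def \<rho>_def field_simps)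
   finally have 2: "e2 M * (pi / real (half_scale M)) powr lo_exp \<le> pi powr lo_exp * real M powr (- \<rho>)" .
   have 1: "e1 M \<le> real M powr (- \<rho>)"
    unfolding e1_def
   proof (rule powr_mono)
    have "- \<rho> = (a + 6 * d - 1) / 2" unfolding \<rho>_def by argo
    moreover have "up_exp + 3 * d - 1 \<le> a + 6 * d - 1" using d(1) by (simp add: up_exp_def)
    ultimately show "(up_exp + 3 * d - 1) / 2 \<le> - \<rho>" by simp
   qed (use M in simp)
   have "(e1 M + 4 * e2 M * (pi / real (half_scale M)) powr lo_exp) / k \<le> ((1 + 4 * pi powr lo_exp) * real M powr (- \<rho>)) / k"
    using 1 2 k by (intro divide_right_mono) (auto simp: algebra_simps)
   then show ?thesis using \<xi>(1) by (simp add: \<epsilon>_def W_def)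
  qed
  define z where "z M = (2 * U / (1 - up_exp) / k + 1) * real M" for M :: nat
  \<comment> \<open>The number of dyadic blocks of the spectrum of the root of the covariance\<close>
  define J where "J M = nat \<lceil>log 2 (z M)\<rceil> + 1" for M
  define bd where "bd M = 6 * sqrt (1 + C) * \<epsilon> M * (log 2 (z M) + 2)" for M
  define z0 where "z0 = 2 * U / (1 - up_exp) / k + 1"
  have z0: "1 \<le> z0" using U ue k by (simp add: z0_def)
  have bd0: "bd \<longlonglongrightarrow> 0"
  proof -
   have "(\<lambda>M. real M powr (- \<rho>) * (log 2 (z0 * real M) + 2)) \<longlonglongrightarrow> 0"
    using \<rho> z0 by real_asymp
   from tendsto_mult_right_zero[OF this, of "6 * sqrt (1 + C) * W"]
   show ?thesis unfolding bd_def[abs_def] \<epsilon>_def z_def z0_def by (simp only: mult.assoc)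
  qed
  have \<epsilon>0: "\<epsilon> \<longlonglongrightarrow> 0"
  proof -
   have "(\<lambda>M. real M powr (- \<rho>)) \<longlonglongrightarrow> 0" using \<rho> by real_asymp
   from tendsto_mult_right_zero[OF this, of W] show ?thesis by (simp add: \<epsilon>_def[abs_def])
  qed
  have \<epsilon>half: "\<forall>\<^sub>F M in sequentially. \<epsilon> M \<le> 1 / 2"
   by (rule eventually_mono[OF order_tendstoD(2)[OF \<epsilon>0, of "1 / 2"]]) simp_all
  have R: "toeplitz_cov f M \<in> carrier_mat M M" "psd (toeplitz_cov f M)" for M
   unfolding toeplitz_cov_def[of f M] by (rule toeplitz_carrier) (rule toeplitz_cov_psd[OF f nn, unfolded toeplitz_cov_def])
  have core: "psd (Rhat M N \<omega>) \<and> op_norm (psd_sqrt (Rhat M N \<omega>) * psd_inv_sqrt (toeplitz_cov f M)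
     - of_real (sqrt (mean_trace (real_diag N (c N)))) \<cdot>\<^sub>m 1\<^sub>m M) \<in> {0..bd M}"
   if \<omega>: "\<omega> \<in> space \<Omega>" and MN: "(M, N) \<in> P" and half: "\<epsilon> M \<le> 1 / 2"
    and dev: "\<And>g. g < 2 * M \<Longrightarrow> \<bar>(\<Sum>n<N. c N n * centred_form M (A M g) (\<lambda>k. Z M N \<omega> $$ (n, k))) / real N\<bar> < (if far M g then e1 M else e2 M)"
   for \<omega> M N
  proof -
   define x where "x = mean_trace (real_diag N (c N))"
   define E where "E = Rhat M N \<omega>"
   have M: "0 < M" "1 \<le> real M" using pos[OF MN] by auto
   have x: "\<xi>0 \<le> x" "0 < x" using \<xi>(1) \<xi>(2)[OF MN] by (auto simp: x_def)
   have \<epsilon>p: "0 \<le> \<epsilon> M" using W0 by (simp add: \<epsilon>_def)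
   have Zc: "Z M N \<omega> \<in> carrier_mat N M" using rows[OF MN] \<omega> unfolding iid_rows_def by blast
   have cn: "\<And>n. n < N \<Longrightarrow> 0 \<le> c N n" by (rule c_nonneg[OF MN])
   have Ec: "E \<in> carrier_mat M M" "mat_adjoint E = E"
    unfolding E_def Rhat_def using toeplitz_est_form(1,2)[of "Z M N \<omega>" N M "c N" f] Zc cn f nn by simp_all
   have e12: "0 \<le> e1 M" "e1 M \<le> e2 M"
    using M ue by (auto simp: e1_def e2_def intro!: powr_mono)
   have rel: "\<bar>qform E v - x * qform (toeplitz_cov f M) v\<bar> \<le> \<epsilon> M * (x * qform (toeplitz_cov f M) v)"
    if v: "v \<in> carrier_vec M" for v :: "complex Matrix.vec"
   proof -
    have q0: "0 \<le> qform (toeplitz_cov f M) v" by (rule psdD(2)[OF R(2,1) v])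
    have "\<bar>qform E v - x * qform (toeplitz_cov f M) v\<bar>
      \<le> (e1 M + 4 * e2 M * (pi / real (half_scale M)) powr lo_exp) / k * qform (toeplitz_cov f M) v"
     unfolding E_def Rhat_def x_def
    proof (rule estimator_relative_error[OF f le k low M(1) Zc cn e12 _ v])
     fix g assume "g < 2 * M"
     from dev[OF this] show "\<bar>(\<Sum>n<N. c N n * centred_form M (sandwich M (\<lambda>k l. psd_sqrt (toeplitz_cov f M) $$ (k, l)) (grid (2 * M) g)) (\<lambda>k. Z M N \<omega> $$ (n, k))) / real N\<bar>
      \<le> (if 1 / (2 * real (half_scale M)) \<le> cmod (1 - cis (grid (2 * M) g)) then e1 M else e2 M)"
      unfolding A_def h_def far_def by (rule less_imp_le)
    qed
    also have "... \<le> (\<epsilon> M * \<xi>0) * qform (toeplitz_cov f M) v"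
     by (rule mult_right_mono[OF total[OF M(1)] q0])
    also have "... \<le> (\<epsilon> M * x) * qform (toeplitz_cov f M) v"
     using x \<epsilon>p q0 by (intro mult_right_mono mult_left_mono) auto
    finally show ?thesis by (simp only: mult.assoc)
   qed
   have psdE: "psd E"
    unfolding psd_def
   proof (intro conjI ballI)
    show "square_mat E" "mat_adjoint E = E" using Ec by auto
    fix v :: "complex Matrix.vec" assume "v \<in> carrier_vec (dim_row E)"
    then have v: "v \<in> carrier_vec M" using carrier_matD(1)[OF Ec(1)] by simp
    have q0: "0 \<le> x * qform (toeplitz_cov f M) v" using psdD(2)[OF R(2,1) v] x by simp
    have "\<epsilon> M * (x * qform (toeplitz_cov f M) v) \<le> 1 / 2 * (x * qform (toeplitz_cov f M) v)"
     by (rule mult_right_mono[OF half q0])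
    then show "0 \<le> qform E v" using rel[OF v] q0 by linarith
   qed
   have zM: "1 \<le> z M" "2 * U / (1 - up_exp) * real M \<le> k * z M"
   proof -
    have "z M = z0 * real M" by (simp add: z_def z0_def)
    then show "1 \<le> z M" using mult_mono[of 1 z0 1 "real M"] z0 M by simp
    have "k * ((q / k + 1) * m) = q * m + k * m" for q m using k by (simp add: field_simps)
    then have "k * z M = 2 * U / (1 - up_exp) * real M + k * real M" unfolding z_def .
    then show "2 * U / (1 - up_exp) * real M \<le> k * z M" using k by simp
   qed
   note J = dyadic_exponent[OF zM(1) J_def]
   define hi where "hi = sqrt (2 * U / (1 - up_exp) * real M)"
   have U0: "0 \<le> 2 * U / (1 - up_exp) * real M" using U ue by simp
   have hi: "hi < 2 ^ J M * sqrt k"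
   proof -
    have "z M * 1 \<le> z M * z M" using zM(1) by (intro mult_left_mono) auto
    then have "k * z M \<le> k * (z M)\<^sup>2" using k by (intro mult_left_mono) (auto simp: power2_eq_square)
    then have "hi \<le> sqrt (k * (z M)\<^sup>2)" unfolding hi_def using zM(2) by (intro real_sqrt_le_mono) linarith
    also have "... = z M * sqrt k" using zM(1) by (simp add: real_sqrt_mult)
    also have "... < 2 ^ J M * sqrt k" using J(1) k by (intro mult_strict_right_mono) auto
    finally show ?thesis .
   qed
   have "op_norm (psd_sqrt E * psd_inv_sqrt (toeplitz_cov f M) - of_real (sqrt x) \<cdot>\<^sub>m 1\<^sub>m M) \<in> {0..6 * sqrt x * \<epsilon> M * real (J M)}"
   proof (rule relative_sqrt_perturbation[OF psdE Ec(1) R(2,1)])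
    show "0 < sqrt x" "0 < sqrt k" using x k by auto
    show "hi < 2 ^ J M * sqrt k" "0 \<le> hi" using hi U0 by (auto simp: hi_def)
    fix v :: "complex Matrix.vec" assume v: "v \<in> carrier_vec M"
    show "\<bar>qform E v - (sqrt x)\<^sup>2 * qform (toeplitz_cov f M) v\<bar> \<le> \<epsilon> M * ((sqrt x)\<^sup>2 * qform (toeplitz_cov f M) v)"
     using rel[OF v] x by simp
    show "(sqrt k)\<^sup>2 * (vec_l2 v)\<^sup>2 \<le> qform (toeplitz_cov f M) v"
     using toeplitz_qf_ge_const[OF f low(1), where M = M and v = "vec_index v"] k
     unfolding toeplitz_cov_form[OF f v] vec_l2_sq[OF v] by simp
    have "toeplitz_qf f M (vec_index v) \<le> 2 * U / (1 - up_exp) * real M powr up_exp * (\<Sum>j<M. (cmod (vec_index v j))\<^sup>2)"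
     by (rule toeplitz_qf_power_bound[OF f nn U up ue M(1)])
    also have "... \<le> 2 * U / (1 - up_exp) * real M powr 1 * (\<Sum>j<M. (cmod (vec_index v j))\<^sup>2)"
     using U ue M by (intro mult_right_mono mult_left_mono powr_mono sum_nonneg) auto
    finally show "qform (toeplitz_cov f M) v \<le> hi\<^sup>2 * (vec_l2 v)\<^sup>2"
     unfolding toeplitz_cov_form[OF f v] vec_l2_sq[OF v] hi_def real_sqrt_pow2[OF U0] using M by simp
   qed (use \<epsilon>p half in auto)
   moreover have "6 * sqrt x * \<epsilon> M * real (J M) \<le> bd M"
   proof -
    have "x \<le> 1 + C" using mean_trace_le_square[of N "c N"] C(2)[OF MN] by (simp add: x_def)
    then have "6 * sqrt x * \<epsilon> M \<le> 6 * sqrt (1 + C) * \<epsilon> M" using \<epsilon>p by (intro mult_right_mono) auto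
    then show ?thesis unfolding bd_def by (rule mult_mono[OF _ J(2)]) (use \<epsilon>p C(1) in simp_all)
   qed
   ultimately show ?thesis using psdE unfolding E_def x_def by auto
  qed
  show ?thesis
   using small AE_space
  proof eventually_elim
   case (elim \<omega>)
   define nrm where "nrm M N = op_norm (psd_sqrt (Rhat M N \<omega>) * psd_inv_sqrt (toeplitz_cov f M)
     - of_real (sqrt (mean_trace (real_diag N (c N)))) \<cdot>\<^sub>m 1\<^sub>m M)" for M N
   have "\<forall>\<^sub>F M in sequentially. \<forall>N. (M, N) \<in> P \<longrightarrow> psd (Rhat M N \<omega>) \<and> nrm M N \<in> {0..bd M}"
    using elim(1) \<epsilon>half
   proof eventually_elim
    case (elim M)
    then show ?case using core[OF \<open>\<omega> \<in> space \<Omega>\<close>] unfolding nrm_def by blast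
   qed
   from eventually_compose_filterlim[OF this filterlim_fst[of sequentially sequentially]]
   have ev: "\<forall>\<^sub>F p in F. psd (Rhat (fst p) (snd p) \<omega>) \<and> nrm (fst p) (snd p) \<in> {0..bd (fst p)}"
    unfolding F_def eventually_inf_principal by (rule eventually_mono) auto
   have "filterlim fst sequentially F"
    unfolding F_def by (rule filterlim_mono[OF filterlim_fst order_refl inf_le1])
   then have lim: "((\<lambda>p. bd (fst p)) \<longlongrightarrow> 0) F" by (rule filterlim_compose[OF bd0])
   have "((\<lambda>p. nrm (fst p) (snd p)) \<longlongrightarrow> 0) F"
    by (rule tendsto_sandwich[OF _ _ tendsto_const lim]; rule eventually_mono[OF ev]) auto
   moreover have "\<forall>\<^sub>F (M, N) in F. psd (Rhat M N \<omega>)"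
    using ev by (rule eventually_mono) auto
   ultimately show ?case unfolding nrm_def by (simp add: case_prod_beta')
  qed
qed

end
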